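(* Let $\mathcal L$ be a $k$-local Lindblad generator on $n$ qubits with bounded weighted interaction strength $\alpha$. Let $\tau>0$, $\varepsilon_\chi>0$, and let $\Omega\subseteq\mathcal I_k^\circ$ be a given set such that, for $(\mathbf P,\mathbf Q)\in\mathcal I_k^\circ$, $$|\chi_{\mathbf P,\mathbf Q}|>\tau\ \Longrightarrow\ (\mathbf P,\mathbf Q)\in\Omega ,\qquad\text{and}\qquad \tau+D_\Omega\rho_\Omega\le\varepsilon_\chi .$$ Run the supplied-support recursive inversion restricted to $\Omega$ on PTM estimates of accuracy $\varepsilon_L$, set $\widehat\chi_{\mathbf P,\mathbf Q}:=0$ for $(\mathbf P,\mathbf Q)\notin\Omega$, and use the returned estimates on $\Omega$. Then for all $(\mathbf P,\mathbf Q)\in\mathcal I_k^\circ$, $$|\widehat\chi_{\mathbf P,\mathbf Q}-\chi_{\mathbf P,\mathbf Q}|=\mathcal O(\varepsilon_\chi+D_\Omega\varepsilon_L).$$ Consequently, the estimators $\widehat G_{\mathbf P,\mathbf Q}:=\widehat\chi_{\mathbf P,\mathbf Q}$ ($\mathbf P,\mathbf Q\ne I$) and $\widehat h_{\mathbf P}:=\frac i2(\widehat\chi_{\mathbf P,I}-\widehat\chi_{I,\mathbf P})$ satisfy $$|\widehat G_{\mathbf P,\mathbf Q}-G_{\mathbf P,\mathbf Q}|=\mathcal O(\varepsilon_\chi+D_\Omega\varepsilon_L)\quad\text{and}\quad|\widehat h_{\mathbf P}-h_{\mathbf P}|=\mathcal O(\varepsilon_\chi+D_\Omega\varepsilon_L).$$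 The classical postprocessing time required to compute these estimates, once $\Omega$ is given, is $\mathcal O_k(|\Omega|)$. Consequently, choosing $\varepsilon_L\le\varepsilon_\chi/D_\Omega$ and estimating the required PTM entries with the process-shadow derivative-estimation routine yields (with probability at least $1-\delta$) entrywise error $\mathcal O(\varepsilon_\chi)$ with $$\widetilde{\mathcal O}_k\Bigl(\frac{D_\Omega^2}{\varepsilon_\chi^2}\log\frac{|\Omega|}\delta\Bigr)$$ samples, up to polylogarithmic factors in $D_\Omega/\varepsilon_\chi$ and $|\Omega|$.
   Context: Pauli notation. $\mathcal P_n=\{I,X,Y,Z\}^{\otimes n}$; $\operatorname{supp}(\mathbf P)$ is the set of qubits of nontrivial action, $\operatorname{wt}$ its size. For $S\subseteq[n]$, $\overline S=[n]\setminus S$, $\mathcal P_S$ is the set of Pauli strings on $S$, $\mathbf P_S$ the restriction of $\mathbf P$ to $S$ (also viewed as an $n$-qubit string by tensoring with identity). $X\bullet Y$ denotes $M\mapsto XMY$. Generator. A $k$-local Lindblad generator is $\mathcal L=\sum_{e\subseteq[n],|e|\le k}\mathcal L_e=-i[H,\bullet]+\sum_{e}\sum_{a}\bigl(L_{e,a}\bullet L_{e,a}^\dagger-\tfrac12\{L_{e,a}^\dagger L_{e,a},\bullet\}\bigr)$, with $H=\sum_{\operatorname{wt}(\mathbf P)\le k}h_{\mathbf P}\mathbf P$ Hermitian traceless, $L_{e,a}$ traceless supported on $e$, $\mathcal L_e$ the full contribution supported on $e$. It is uniquely $\mathcal L=-i[H,\bullet]+\sum_{\mathbf P,\mathbf Q\ne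 I}G_{\mathbf P,\mathbf Q}(\mathbf P\bullet\mathbf Q-\tfrac12\{\mathbf Q\mathbf P,\bullet\})=\sum_{\mathbf P,\mathbf Q}\chi_{\mathbf P,\mathbf Q}\mathbf P\bullet\mathbf Q$. $\alpha=\max_u\sum_{e\ni u}\|\mathcal L_e^\dagger\|_{2\to2}$ (norm induced by the Hilbert--Schmidt norm). PTM entries: $L_{\mathbf P,\mathbf Q}=2^{-n}\operatorname{Tr}(\mathbf P\mathcal L(\mathbf Q))$. Diagonal extensions. $\mathcal I_k=\{(\mathbf P,\mathbf Q):|\operatorname{supp}(\mathbf P)\cup\operatorname{supp}(\mathbf Q)|\le k\}$, $\mathcal I_k^\circ=\mathcal I_k\setminus\{(I,I)\}$. $\mathfrak d_\Omega$ is the maximum over $S\subseteq[n]$, $\mathbf P_S,\mathbf Q_S\in\mathcal P_S$ of the number of $\mathbf A\in\mathcal P_{\overline S}\setminus\{I\}$ with $(\mathbf P_S\otimes\mathbf A,\mathbf Q_S\otimes\mathbf A)\in\Omega$; $D_\Omega=\sum_{\ell=0}^k\mathfrak d_\Omega^\ell$; $\rho_\Omega$ is the maximum over $S,\mathbf P_S,\mathbf Q_S$ of $\sum|\chi_{\mathbf P_S\otimes\mathbf A,\mathbf Q_S\otimes\mathbf A}|$ over $\mathbf A\in\mathcal P_{\overline S}\setminus\{I\}$ with $(\mathbf P_S\otimes\mathbf A,\mathbf Q_S\otimes\mathbf A)\notin\Omega$. Supplied-support recursive inversion. For $u=(\mathbf P,\mathbf Q)\in\Omega$ with support union $S_u$,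 use PTM estimates $\widehat L$ with error at most $\varepsilon_L$ for all pairs of Pauli strings supported in $S_u$, and compute $\widehat\chi^{(S_u)}_{\mathbf P_{S_u},\mathbf Q_{S_u}}=2^{-3|S_u|}\sum_{\mathbf A,\mathbf B\in\mathcal P_{S_u}}\widehat L_{\mathbf A\otimes I,\mathbf B\otimes I}\operatorname{Tr}(\mathbf A\mathbf Q_{S_u}\mathbf B\mathbf P_{S_u})$. Initialize registers $R_u=0$. Process $u\in\Omega$ in decreasing order of $|S_u|$: set $\widehat\chi_u=\widehat\chi^{(S_u)}_{\mathbf P_{S_u},\mathbf Q_{S_u}}-R_u$, then add $\widehat\chi_u$ to $R_w$ for every $w=(\mathbf P_T,\mathbf Q_T)\in\Omega$ with $T\subsetneq S_u$ and $\mathbf P_{S_u\setminus T}=\mathbf Q_{S_u\setminus T}$ (where $T$ is the support union of $w$). Process-shadow derivative-estimation routine. One sample prepares a random product of single-qubit Pauli eigenstates, evolves it by $e^{t\mathcal L}$ with $t\in[0,T]$, $T=(4\alpha k)^{-1}$, and measures each qubit in a random Pauli basis; samples are independent. The overlaps $2^{-n}\operatorname{Tr}(\mathbf Pe^{t\mathcal L}(\mathbf Q))$ are estimated in parallel by median-of-means at $\mathcal O(d\log d)$ times $t$; a degree-$d$ polynomial in $t$ is fitted by robust polynomial regression, with $d$ logarithmic in the inverse precision; $\widehat L_{\mathbf P,\mathbf Q}$ is its derivative at $0$. $\widetilde{\mathcal O}_k$ also hides constants depending on $k$ and $\alpha$. *)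

theory Defs
  imports
    "HOL-Probability.Product_PMF"
    "HOL-Library.Monad_Syntax"
    "HOL-Computational_Algebra.Polynomial"
    "Jordan_Normal_Form.Schur_Decomposition"
begin

section \<open>Pauli strings\<close>

datatype pauli = PI | PX | PY | PZ

text \<open>Qubits are natural numbers; the system consists of the qubits \<open>{..<n}\<close>. A Pauli string is a
  total function that is \<open>PI\<close> outside the set of qubits it lives on, so that a string on \<open>S\<close> is at the
  same time the \<open>n\<close>-qubit string obtained by tensoring with the identity.\<close>

type_synonym pstr = "nat \<Rightarrow> pauli"

definition Id_str :: pstr where
  "Id_str = (\<lambda>_. PI)"

definition supp :: "pstr \<Rightarrow> nat set" where
  "supp P = {q. P q \<noteq> PI}"

definition wt :: "pstr \<Rightarrow> nat" where
  "wt P = card (supp P)"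

definition pstrs :: "nat set \<Rightarrow> pstr set" where
  "pstrs S = {P. supp P \<subseteq> S}"

definition restr :: "nat set \<Rightarrow> pstr \<Rightarrow> pstr" where
  "restr S P = (\<lambda>q. if q \<in> S then P q else PI)"

definition glue :: "nat set \<Rightarrow> pstr \<Rightarrow> pstr \<Rightarrow> pstr" where
  \<comment> \<open>\<open>P\<^sub>S \<otimes> A\<close> for \<open>P \<in> pstrs S\<close> and \<open>A\<close> a string on the complement of \<open>S\<close>\<close>
  "glue S P A = (\<lambda>q. if q \<in> S then P q else A q)"

definition usupp :: "pstr \<times> pstr \<Rightarrow> nat set" where
  "usupp u = supp (fst u) \<union> supp (snd u)"

section \<open>Operators and superoperators\<close>

definition tensor_mat :: "nat list \<Rightarrow> (nat \<Rightarrow> bool \<Rightarrow> bool \<Rightarrow> complex) \<Rightarrow> complex mat" where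
  \<comment> \<open>tensor product over the qubits in \<open>qs\<close> of the 2 by 2 matrices \<open>f q\<close>; bit \<open>l\<close> of a row or
      column index is the computational-basis state of qubit \<open>qs ! l\<close>\<close>
  "tensor_mat qs f = mat (2 ^ length qs) (2 ^ length qs)
     (\<lambda>(i, j). \<Prod>l<length qs. f (qs ! l) (bit i l) (bit j l))"

fun pauli_entry :: "pauli \<Rightarrow> bool \<Rightarrow> bool \<Rightarrow> complex" where
  "pauli_entry PI x y = (if x = y then 1 else 0)"
| "pauli_entry PX x y = (if x = y then 0 else 1)"
| "pauli_entry PY x y = (if x = y then 0 else if x then \<i> else - \<i>)"
| "pauli_entry PZ x y = (if x = y then (if x then - 1 else 1) else 0)"

definition pauli_mat :: "nat list \<Rightarrow> pstr \<Rightarrow> complex mat" where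
  "pauli_mat qs P = tensor_mat qs (\<lambda>q. pauli_entry (P q))"

abbreviation pmat :: "nat \<Rightarrow> pstr \<Rightarrow> complex mat" where
  "pmat n P \<equiv> pauli_mat [0..<n] P"

definition tr :: "complex mat \<Rightarrow> complex" where
  "tr A = (\<Sum>i<dim_row A. A $$ (i, i))"

definition msum :: "nat \<Rightarrow> 'a set \<Rightarrow> ('a \<Rightarrow> complex mat) \<Rightarrow> complex mat" where
  \<comment> \<open>sum of \<open>N\<close> by \<open>N\<close> matrices; \<^const>\<open>sum\<close> is not applicable to the type of matrices of all sizes\<close>
  "msum N I F = mat N N (\<lambda>ij. \<Sum>a\<in>I. F a $$ ij)"

type_synonym superop = "complex mat \<Rightarrow> complex mat"

definition hs_inner :: "complex mat \<Rightarrow> complex mat \<Rightarrow> complex" where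
  "hs_inner A B = tr (mat_adjoint A * B)"

definition hs_norm :: "complex mat \<Rightarrow> real" where
  "hs_norm A = sqrt (Re (hs_inner A A))"

definition hs_adjoint :: "nat \<Rightarrow> superop \<Rightarrow> superop" where
  \<comment> \<open>adjoint for the Hilbert--Schmidt inner product; the \<open>(i, j)\<close> entry is the inner product with the
      matrix unit at \<open>(i, j)\<close>\<close>
  "hs_adjoint N F M = mat N N
     (\<lambda>ij. hs_inner (F (mat N N (\<lambda>kl. if kl = ij then 1 else 0))) M)"

definition norm_2_2 :: "nat \<Rightarrow> superop \<Rightarrow> real" where
  "norm_2_2 N F = (SUP M\<in>{M \<in> carrier_mat N N. hs_norm M \<le> 1}. hs_norm (F M))"

definition superop_exp :: "nat \<Rightarrow> real \<Rightarrow> superop \<Rightarrow> superop" where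
  "superop_exp N t F M = mat N N (\<lambda>ij. \<Sum>m. complex_of_real (t ^ m / fact m) * ((F ^^ m) M) $$ ij)"

section \<open>Local Lindblad generators\<close>

text \<open>The coefficients of the Hamiltonian, and for every set of qubits \<open>e\<close> the finite family of jump
  operators attached to it.\<close>

record lindblad =
  hcoeff :: "pstr \<Rightarrow> complex"
  jumps :: "nat set \<Rightarrow> complex mat list"

definition ham :: "nat \<Rightarrow> (pstr \<Rightarrow> complex) \<Rightarrow> pstr set \<Rightarrow> complex mat" where
  "ham n h I = msum (2 ^ n) I (\<lambda>P. h P \<cdot>\<^sub>m pmat n P)"

definition ham_part :: "complex mat \<Rightarrow> superop" where
  "ham_part H M = (- \<i>) \<cdot>\<^sub>m (H * M - M * H)"

definition supported_on :: "nat \<Rightarrow> nat set \<Rightarrow> complex mat \<Rightarrow> bool" where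
  "supported_on n e A \<longleftrightarrow> (\<exists>a. A = msum (2 ^ n) (pstrs e) (\<lambda>P. a P \<cdot>\<^sub>m pmat n P))"

definition local_sets :: "nat \<Rightarrow> nat \<Rightarrow> nat set set" where
  "local_sets n k = {e. e \<subseteq> {..<n} \<and> card e \<le> k}"

definition k_local :: "nat \<Rightarrow> nat \<Rightarrow> lindblad \<Rightarrow> bool" where
  "k_local n k lb \<longleftrightarrow>
     (\<forall>P\<in>pstrs {..<n}. k < wt P \<longrightarrow> hcoeff lb P = 0) \<and>
     (let H = ham n (hcoeff lb) (pstrs {..<n}) in mat_adjoint H = H \<and> tr H = 0) \<and>
     (\<forall>e\<in>local_sets n k. \<forall>J\<in>set (jumps lb e). supported_on n e J \<and> tr J = 0)"

definition local_term :: "nat \<Rightarrow> lindblad \<Rightarrow> nat set \<Rightarrow> superop" where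
  "local_term n lb e M =
     ham_part (ham n (hcoeff lb) {P. supp P = e}) M +
     msum (2 ^ n) {..<length (jumps lb e)} (\<lambda>a. let J = jumps lb e ! a; J' = mat_adjoint J in
       J * M * J' - (1 / 2) \<cdot>\<^sub>m (J' * J * M + M * (J' * J)))"

definition generator :: "nat \<Rightarrow> nat \<Rightarrow> lindblad \<Rightarrow> superop" where
  "generator n k lb M = msum (2 ^ n) (local_sets n k) (\<lambda>e. local_term n lb e M)"

definition interaction_strength :: "nat \<Rightarrow> nat \<Rightarrow> lindblad \<Rightarrow> real" where
  "interaction_strength n k lb =
     Max ((\<lambda>q. \<Sum>e\<in>{e \<in> local_sets n k. q \<in> e}.
             norm_2_2 (2 ^ n) (hs_adjoint (2 ^ n) (local_term n lb e))) ` {..<n})"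

text \<open>The two Pauli expansions of a superoperator. The coefficient functions are determined on
  \<open>n\<close>-qubit strings (by linear independence of the maps \<open>M \<mapsto> P M Q\<close>).\<close>

definition chi_expansion :: "nat \<Rightarrow> superop \<Rightarrow> (pstr \<times> pstr \<Rightarrow> complex) \<Rightarrow> bool" where
  "chi_expansion n F chi \<longleftrightarrow> (\<forall>M\<in>carrier_mat (2 ^ n) (2 ^ n).
     F M = msum (2 ^ n) (pstrs {..<n} \<times> pstrs {..<n})
       (\<lambda>(P, Q). chi (P, Q) \<cdot>\<^sub>m (pmat n P * M * pmat n Q)))"

definition gks_expansion ::
  "nat \<Rightarrow> superop \<Rightarrow> (pstr \<Rightarrow> complex) \<Rightarrow> (pstr \<times> pstr \<Rightarrow> complex) \<Rightarrow> bool" where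
  "gks_expansion n F h G \<longleftrightarrow> (\<forall>M\<in>carrier_mat (2 ^ n) (2 ^ n).
     F M = ham_part (ham n h (pstrs {..<n})) M +
       msum (2 ^ n) ((pstrs {..<n} - {Id_str}) \<times> (pstrs {..<n} - {Id_str}))
         (\<lambda>(P, Q). G (P, Q) \<cdot>\<^sub>m (pmat n P * M * pmat n Q -
            (1 / 2) \<cdot>\<^sub>m (pmat n Q * pmat n P * M + M * (pmat n Q * pmat n P)))))"

definition ptm :: "nat \<Rightarrow> superop \<Rightarrow> pstr \<Rightarrow> pstr \<Rightarrow> complex" where
  "ptm n F P Q = tr (pmat n P * F (pmat n Q)) / 2 ^ n"

section \<open>Diagonal extensions\<close>

definition index_pairs :: "nat \<Rightarrow> nat \<Rightarrow> (pstr \<times> pstr) set" where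
  "index_pairs n k = {u \<in> pstrs {..<n} \<times> pstrs {..<n}. card (usupp u) \<le> k}"

definition index_pairs0 :: "nat \<Rightarrow> nat \<Rightarrow> (pstr \<times> pstr) set" where
  "index_pairs0 n k = index_pairs n k - {(Id_str, Id_str)}"

definition compl_strs :: "nat \<Rightarrow> nat set \<Rightarrow> pstr set" where
  "compl_strs n S = pstrs ({..<n} - S) - {Id_str}"

definition ext_degree :: "nat \<Rightarrow> (pstr \<times> pstr) set \<Rightarrow> nat" where
  "ext_degree n \<Omega> = Max {card {A \<in> compl_strs n S. (glue S P A, glue S Q A) \<in> \<Omega>} | S P Q.
     S \<subseteq> {..<n} \<and> P \<in> pstrs S \<and> Q \<in> pstrs S}"

definition ext_sum :: "nat \<Rightarrow> nat \<Rightarrow> (pstr \<times> pstr) set \<Rightarrow> real" where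
  "ext_sum n k \<Omega> = (\<Sum>l\<le>k. real (ext_degree n \<Omega>) ^ l)"

definition ext_residual ::
  "nat \<Rightarrow> (pstr \<times> pstr \<Rightarrow> complex) \<Rightarrow> (pstr \<times> pstr) set \<Rightarrow> real" where
  "ext_residual n chi \<Omega> =
     Max {\<Sum>A\<in>{A \<in> compl_strs n S. (glue S P A, glue S Q A) \<notin> \<Omega>}.
            cmod (chi (glue S P A, glue S Q A)) | S P Q.
       S \<subseteq> {..<n} \<and> P \<in> pstrs S \<and> Q \<in> pstrs S}"

section \<open>Supplied-support recursive inversion\<close>

text \<open>Programs are written in a monad that counts elementary steps. A pair \<open>u\<close> is stored sparsely, by
  its entries on \<open>usupp u\<close>; reading or copying it, and querying or updating a dictionary (\<open>\<Omega>\<close>, the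
  registers, the outputs, the PTM estimates) at it, takes \<open>card (usupp u) + 1\<close> steps. Complex
  arithmetic takes one step per operation, and so does every loop iteration.\<close>

datatype 'a timed = Timed (result: 'a) (cost: nat)

definition ret :: "'a \<Rightarrow> 'a timed" where
  "ret x = Timed x 0"

definition tick :: "nat \<Rightarrow> unit timed" where
  "tick c = Timed () c"

definition bind_timed :: "'a timed \<Rightarrow> ('a \<Rightarrow> 'b timed) \<Rightarrow> 'b timed" where
  "bind_timed m f = Timed (result (f (result m))) (cost m + cost (f (result m)))"

adhoc_overloading Monad_Syntax.bind \<rightleftharpoons> bind_timed

primrec for_each :: "('a \<Rightarrow> 's \<Rightarrow> 's timed) \<Rightarrow> 'a list \<Rightarrow> 's \<Rightarrow> 's timed" where
  "for_each f [] s = ret s"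
| "for_each f (x # xs) s = do { tick 1; s' \<leftarrow> f x s; for_each f xs s' }"

definition pstr_list :: "nat list \<Rightarrow> pstr list" where
  "pstr_list qs = map (\<lambda>ps q. case map_of (zip qs ps) q of None \<Rightarrow> PI | Some p \<Rightarrow> p)
     (List.n_lists (length qs) [PI, PX, PY, PZ])"

definition trace_cost :: "nat \<Rightarrow> nat" where
  \<comment> \<open>entries of four Pauli matrices on \<open>s\<close> qubits, three schoolbook matrix products, and the trace\<close>
  "trace_cost s = 4 * (s * 4 ^ s) + 3 * (2 * 8 ^ s) + 2 ^ s"

definition local_inversion :: "(pstr \<Rightarrow> pstr \<Rightarrow> complex) \<Rightarrow> pstr \<times> pstr \<Rightarrow> complex timed" where
  \<comment> \<open>the sum over all \<open>A\<close> and \<open>B\<close> on the support union\<close>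
  "local_inversion Lh u = (let s = card (usupp u); qs = sorted_list_of_set (usupp u) in do {
     tick (s + 1);
     tick (2 * (s + 1) * 16 ^ s);
     acc \<leftarrow> for_each (\<lambda>(A, B) acc. do {
         tick (2 * (s + 1));
         tick (trace_cost s);
         tick 2;
         ret (acc + Lh A B * tr (pauli_mat qs A * pauli_mat qs (snd u) *
                                 pauli_mat qs B * pauli_mat qs (fst u))) })
       (List.product (pstr_list qs) (pstr_list qs)) 0;
     tick (3 * s + 1);
     ret (acc / 2 ^ (3 * s)) })"

definition propagate :: "(pstr \<times> pstr) set \<Rightarrow> pstr \<times> pstr \<Rightarrow> complex \<Rightarrow>
    (pstr \<times> pstr \<Rightarrow> complex) \<Rightarrow> (pstr \<times> pstr \<Rightarrow> complex) timed" where
  "propagate \<Omega> u x R = (let S = usupp u; s = card S in do {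
     tick ((s + 1) * 2 ^ s);
     for_each (\<lambda>T R. do {
         tick (s + 1);
         if T \<subset> S \<and> (\<forall>q\<in>S - T. fst u q = snd u q) then do {
           let w = (restr T (fst u), restr T (snd u));
           tick (s + 1);
           if w \<in> \<Omega> then do {
             tick (2 * (s + 1) + 1);
             ret (R(w := R w + x)) }
           else ret R }
         else ret R })
       (map set (subseqs (sorted_list_of_set S))) R })"

definition process_pair :: "(pstr \<times> pstr) set \<Rightarrow> (pstr \<Rightarrow> pstr \<Rightarrow> complex) \<Rightarrow> pstr \<times> pstr \<Rightarrow>
    (pstr \<times> pstr \<Rightarrow> complex) \<times> (pstr \<times> pstr \<Rightarrow> complex) \<Rightarrow>
    ((pstr \<times> pstr \<Rightarrow> complex) \<times> (pstr \<times> pstr \<Rightarrow> complex)) timed" where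
  "process_pair \<Omega> Lh u = (\<lambda>(R, X). do {
     c \<leftarrow> local_inversion Lh u;
     tick (2 * (card (usupp u) + 1) + 1);
     let x = c - R u;
     R' \<leftarrow> propagate \<Omega> u x R;
     ret (R', X(u := x)) })"

text \<open>The list \<open>us\<close> enumerates the given set in arbitrary order; one pass over it is made for every
  support size, from \<open>k\<close> down to \<open>0\<close>.\<close>

definition recursive_inversion :: "nat \<Rightarrow> (pstr \<times> pstr) list \<Rightarrow> (pstr \<Rightarrow> pstr \<Rightarrow> complex) \<Rightarrow>
    (pstr \<times> pstr \<Rightarrow> complex) timed" where
  "recursive_inversion k us Lh = do {
     R0 \<leftarrow> for_each (\<lambda>u R. do { tick (2 * (card (usupp u) + 1)); ret (R(u := 0)) }) us (\<lambda>_. 0);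
     RX \<leftarrow> for_each (\<lambda>s. for_each (\<lambda>u RX. do {
               tick (card (usupp u) + 1);
               if card (usupp u) = s then process_pair (set us) Lh u RX else ret RX }) us)
            (rev [0..<Suc k]) (R0, \<lambda>_. 0);
     ret (snd RX) }"

type_synonym estimates =
  "(pstr \<times> pstr \<Rightarrow> complex) \<times> (pstr \<times> pstr \<Rightarrow> complex) \<times> (pstr \<Rightarrow> complex)"

definition postprocess ::
  "nat \<Rightarrow> (pstr \<times> pstr) list \<Rightarrow> (pstr \<Rightarrow> pstr \<Rightarrow> complex) \<Rightarrow> estimates timed" where
  "postprocess k us Lh = do {
     X \<leftarrow> recursive_inversion k us Lh;
     Gh \<leftarrow> for_each (\<lambda>(P, Q) (G, h). do {
         tick (card (usupp (P, Q)) + 1);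
         if P \<noteq> Id_str \<and> Q \<noteq> Id_str then do {
           tick (2 * (card (usupp (P, Q)) + 1));
           ret (G((P, Q) := X (P, Q)), h) }
         else do {
           let A = (if Q = Id_str then P else Q);
           tick (3 * (card (usupp (P, Q)) + 1) + 2);
           ret (G, h(A := \<i> / 2 * (X (A, Id_str) - X (Id_str, A)))) } })
       us (\<lambda>_. 0, \<lambda>_. 0);
     ret (X, Gh) }"

definition entrywise_accurate :: "nat \<Rightarrow> nat \<Rightarrow> (pstr \<times> pstr \<Rightarrow> complex) \<Rightarrow>
    (pstr \<times> pstr \<Rightarrow> complex) \<Rightarrow> (pstr \<Rightarrow> complex) \<Rightarrow> estimates \<Rightarrow> real \<Rightarrow> bool" where
  "entrywise_accurate n k chi G h est \<eta> \<longleftrightarrow> (case est of (X, Gh, hh) \<Rightarrow>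
     (\<forall>u\<in>index_pairs0 n k. cmod (X u - chi u) \<le> \<eta>) \<and>
     (\<forall>P\<in>pstrs {..<n} - {Id_str}. \<forall>Q\<in>pstrs {..<n} - {Id_str}.
        cmod (Gh (P, Q) - G (P, Q)) \<le> \<eta>) \<and>
     (\<forall>P\<in>pstrs {..<n}. cmod (hh P - h P) \<le> \<eta>))"

section \<open>Process-shadow derivative estimation\<close>

text \<open>One shot is recorded as the prepared axes and signs, the measured axes, and the outcomes.
  \<open>True\<close> stands for the eigenvalue \<open>+1\<close> and \<open>False\<close> for \<open>-1\<close>.\<close>

type_synonym shot = "(nat \<Rightarrow> pauli \<times> bool) \<times> (nat \<Rightarrow> pauli) \<times> (nat \<Rightarrow> bool)"

definition sgn_bit :: "bool \<Rightarrow> real" where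
  "sgn_bit b = (if b then 1 else - 1)"

definition eigenprojector :: "nat \<Rightarrow> (nat \<Rightarrow> pauli \<times> bool) \<Rightarrow> complex mat" where
  "eigenprojector n f = tensor_mat [0..<n] (\<lambda>q x y.
     (pauli_entry PI x y + complex_of_real (sgn_bit (snd (f q))) * pauli_entry (fst (f q)) x y) / 2)"

definition outcome_pmf ::
  "nat \<Rightarrow> complex mat \<Rightarrow> (nat \<Rightarrow> pauli) \<Rightarrow> (nat \<Rightarrow> bool) pmf" where
  \<comment> \<open>Born rule\<close>
  "outcome_pmf n \<rho> b = embed_pmf (\<lambda>r.
     if \<forall>q\<ge>n. \<not> r q then Re (tr (eigenprojector n (\<lambda>q. (b q, r q)) * \<rho>)) else 0)"

definition shot_pmf :: "nat \<Rightarrow> superop \<Rightarrow> real \<Rightarrow> shot pmf" where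
  "shot_pmf n F t = do {
     a \<leftarrow> Pi_pmf {..<n} (PX, False) (\<lambda>_. pmf_of_set ({PX, PY, PZ} \<times> UNIV));
     b \<leftarrow> Pi_pmf {..<n} PX (\<lambda>_. pmf_of_set {PX, PY, PZ});
     r \<leftarrow> outcome_pmf n (superop_exp (2 ^ n) t F (eigenprojector n a)) b;
     return_pmf (a, b, r) }"

definition shot_estimate :: "pstr \<Rightarrow> pstr \<Rightarrow> shot \<Rightarrow> real" where
  \<comment> \<open>unbiased single-shot estimate of the overlap of \<open>P\<close> with the evolved \<open>Q\<close>; the factors \<open>3\<close>
      compensate for the probability \<open>1/3\<close> that a random axis matches\<close>
  "shot_estimate P Q = (\<lambda>(a, b, r).
     (\<Prod>q\<in>supp Q. if fst (a q) = Q q then 3 * sgn_bit (snd (a q)) else 0) *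
     (\<Prod>q\<in>supp P. if b q = P q then 3 * sgn_bit (r q) else 0))"

definition median :: "real list \<Rightarrow> real" where
  "median xs = sort xs ! (length xs div 2)"

text \<open>The times are the Chebyshev nodes of \<open>[0, T]\<close>, grouped into \<open>cells\<close> blocks of \<open>per_cell\<close>
  consecutive nodes (the cells of the Chebyshev partition). At every time, \<open>batches\<close> batches of
  \<open>batch_size\<close> shots are taken.\<close>

record design =
  degr :: nat
  cells :: nat
  per_cell :: nat
  batches :: nat
  batch_size :: nat

definition num_times :: "design \<Rightarrow> nat" where
  "num_times g = cells g * per_cell g"

definition num_samples :: "design \<Rightarrow> nat" where
  "num_samples g = num_times g * batches g * batch_size g"

definition node :: "real \<Rightarrow> design \<Rightarrow> nat \<Rightarrow> real" where
  "node T g i = T * (1 - cos (pi * (2 * real i + 1) / (2 * real (num_times g)))) / 2"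

definition shadow_data :: "nat \<Rightarrow> superop \<Rightarrow> real \<Rightarrow> design \<Rightarrow> (nat \<times> nat \<times> nat \<Rightarrow> shot) pmf" where
  "shadow_data n F T g = Pi_pmf ({..<num_times g} \<times> {..<batches g} \<times> {..<batch_size g}) undefined
     (\<lambda>(i, _, _). shot_pmf n F (node T g i))"

definition overlap_estimate ::
  "design \<Rightarrow> (nat \<times> nat \<times> nat \<Rightarrow> shot) \<Rightarrow> pstr \<Rightarrow> pstr \<Rightarrow> nat \<Rightarrow> real" where
  "overlap_estimate g d P Q i = median (map (\<lambda>b.
     (\<Sum>a<batch_size g. shot_estimate P Q (d (i, b, a))) / real (batch_size g)) [0..<batches g])"

text \<open>Robust regression: the fitted polynomial minimises the largest, over the cells of the Chebyshev
  partition, of the median absolute residuals in a cell. It is insensitive to arbitrary errors at fewer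
  than half of the times of each cell.\<close>

definition robust_residual :: "real \<Rightarrow> design \<Rightarrow> (nat \<Rightarrow> real) \<Rightarrow> real poly \<Rightarrow> real" where
  "robust_residual T g y p = Max ((\<lambda>j. median (map (\<lambda>l.
     let i = j * per_cell g + l in \<bar>y i - poly p (node T g i)\<bar>) [0..<per_cell g])) ` {..<cells g})"

definition robust_fit :: "real \<Rightarrow> design \<Rightarrow> (nat \<Rightarrow> real) \<Rightarrow> real poly" where
  "robust_fit T g y = arg_min (robust_residual T g y) (\<lambda>p. degree p \<le> degr g)"

definition ptm_estimate ::
  "real \<Rightarrow> design \<Rightarrow> (nat \<times> nat \<times> nat \<Rightarrow> shot) \<Rightarrow> pstr \<Rightarrow> pstr \<Rightarrow> complex" where
  "ptm_estimate T g d P Q =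
     complex_of_real (poly (pderiv (robust_fit T g (overlap_estimate g d P Q))) 0)"

definition logp :: "real \<Rightarrow> real" where
  \<comment> \<open>logarithm as it occurs in asymptotic bounds, kept away from zero\<close>
  "logp x = max 1 (ln x)"

end

theory Submission
  imports Defs "HOL-Probability.Hoeffding"
begin

text \<open>A trace \<open>tr (A P' B Q')\<close> of Pauli strings factors over the qubits, and one-qubit completeness shows that
  exact local inversion on the support \<open>S\<close> of \<open>(P, Q)\<close> returns the sum of \<open>\<chi> (P \<otimes> A, Q \<otimes> A)\<close> over all
  Pauli strings \<open>A\<close> outside \<open>S\<close>. The recursion subtracts those terms with \<open>A \<noteq> I\<close> that lie in \<open>\<Omega>\<close>, so the
  errors obey \<open>e\<^sub>u \<le> \<epsilon>\<^sub>L + \<rho> + \<Sum> e\<^sub>v\<close> with at most \<open>d\<^sub>\<Omega>\<close> extensions \<open>v\<close> of \<open>u\<close>, all of larger support; after at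
  most \<open>k\<close> levels this gives \<open>(\<epsilon>\<^sub>L + \<rho>) D\<close>.

  For the sampling bound, locality of the generator bounds the \<open>m\<close>-th derivative of an overlap at time \<open>0\<close> by
  \<open>m! (k \<alpha>)\<^sup>m\<close>, so that on \<open>[0, T]\<close> the overlap is within \<open>4\<^sup>-\<^sup>d\<close> of its Taylor polynomial of degree \<open>d\<close>.
  Already one batch at each of \<open>d + 1\<close> Chebyshev nodes suffices: robust regression then is interpolation,
  the derivative of the interpolant at \<open>0\<close> amplifies errors by at most \<open>4 d\<^sup>3 / T\<close>, and Hoeffding's inequality
  with a union bound controls the statistical errors. That the outcomes of a shot have a probability
  distribution at all is the positivity of the semigroup, obtained from Euler's product formula.\<close>

section \<open>Pauli matrices\<close>

text \<open>Two constants shape the bounds. For fixed letters \<open>p\<close>, \<open>q\<close>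
  each \<open>a\<close> admits exactly one \<open>b\<close> with nonzero one-qubit trace, of modulus
  2, so the absolute weights of local inversion add up to 8 per qubit, its own normalisation: PTM
  errors enter each level with factor one, and powers of the extension degree are the only
  amplification. The overlaps have a Taylor series of radius at least
  \<open>1 / (k \<alpha>)\<close>, and \<open>T\<close> is a quarter of that; hence the ratio 1/4 in
  the truncation error.

  Coefficients are given only through expansions of the generator. The same inversion, taken over
  all qubits, shows that an expansion is unique; locality and the formulas for \<open>G\<close> and
  \<open>h\<close> follow by exhibiting one expansion and comparing.

  Superoperators are bare functions, with no linearity built in. An explicit adjoint supplies
  linearity and boundedness at once, so the generator is rewritten as
  \<open>K M + M K* + \<Sum> J M J*\<close>. One batch is enough because a shot is bounded by
  \<open>9^k\<close>: Hoeffding's inequality already gives the logarithm of 1/\<delta> that a median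
  of means is meant to provide.\<close>

instantiation pauli :: finite begin
instance
proof
  have "(UNIV :: pauli set) = {PI, PX, PY, PZ}"
    using pauli.exhaust by auto
  then show "finite (UNIV :: pauli set)" by (metis finite.emptyI finite.insertI)
qed
end

lemma UNIV_pauli: "(UNIV :: pauli set) = {PI, PX, PY, PZ}"
  using pauli.exhaust by auto

lemma sum_pauli: "(\<Sum>a\<in>UNIV. f a) = f PI + f PX + f PY + f PZ"
  for f :: "pauli \<Rightarrow> 'a::comm_monoid_add"
  by (simp add: UNIV_pauli add.assoc)

lemma sum_bool: "(\<Sum>b\<in>UNIV. f b) = f False + f True" for f :: "bool \<Rightarrow> 'a::comm_monoid_add"
  by (simp add: UNIV_bool add.commute)

text \<open>Strings, axes, outcomes and preparations are all total functions with a default off the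
  register. This variant of \<open>prod_sum_PiE\<close> turns sums over them into products of
  one-qubit sums.\<close>

lemma sum_prod_PiE_dflt:
  fixes F :: "'a \<Rightarrow> 'b \<Rightarrow> 'c::comm_semiring_1"
  assumes "finite A" "\<And>x. x \<in> A \<Longrightarrow> finite (B x)"
  shows "(\<Sum>f\<in>PiE_dflt A d B. \<Prod>x\<in>A. F x (f x)) = (\<Prod>x\<in>A. \<Sum>y\<in>B x. F x y)"
proof -
  let ?r = "\<lambda>h x. if x \<in> A then h x else d"
  have "(\<Prod>x\<in>A. \<Sum>y\<in>B x. F x y) = (\<Sum>g\<in>PiE A B. \<Prod>x\<in>A. F x (g x))"
    by (rule prod_sum_PiE) (use assms in auto)
  also have "\<dots> = (\<Sum>f\<in>?r ` PiE A B. \<Prod>x\<in>A. F x (f x))"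
  proof (subst sum.reindex)
    show "inj_on ?r (PiE A B)"
    proof (rule inj_onI)
      fix g h assume gh: "g \<in> PiE A B" "h \<in> PiE A B" and e: "?r g = ?r h"
      show "g = h"
      proof (rule PiE_ext[OF gh])
        fix x assume "x \<in> A" then show "g x = h x" using fun_cong[OF e, of x] by simp
      qed
    qed
  qed (auto intro!: sum.cong prod.cong)
  also have "?r ` PiE A B = PiE_dflt A d B" by (rule dflt_image_PiE)
  finally show ?thesis by simp
qed

section \<open>Sums over Pauli strings\<close>

lemma pstrs_eq: "pstrs S = PiE_dflt S PI (\<lambda>_. UNIV)"
  by (auto simp: pstrs_def supp_def PiE_dflt_def)

lemma finite_pstrs: "finite S \<Longrightarrow> finite (pstrs S)"
  unfolding pstrs_eq by (rule finite_PiE_dflt) auto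

lemma sum_pstrs_prod:
  fixes F :: "nat \<Rightarrow> pauli \<Rightarrow> 'c::comm_semiring_1"
  assumes "finite S"
  shows "(\<Sum>P\<in>pstrs S. \<Prod>q\<in>S. F q (P q)) = (\<Prod>q\<in>S. \<Sum>a\<in>UNIV. F q a)"
  unfolding pstrs_eq by (rule sum_prod_PiE_dflt) (use assms in auto)

lemma card_pstrs: "finite S \<Longrightarrow> card (pstrs S) = 4 ^ card S"
proof -
  assume "finite S"
  have "card (UNIV :: pauli set) = 4" by (simp add: UNIV_pauli)
  with sum_pstrs_prod[OF \<open>finite S\<close>, of "\<lambda>_ _. 1::nat"] show ?thesis by simp
qed

lemma pstrs_mono: "S \<subseteq> T \<Longrightarrow> pstrs S \<subseteq> pstrs T"
  by (auto simp: pstrs_def)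

lemma pstrs_ext:
  assumes "P \<in> pstrs S" "Q \<in> pstrs S" "\<And>q. q \<in> S \<Longrightarrow> P q = Q q" shows "P = Q"
proof
  fix q show "P q = Q q"
  proof (cases "q \<in> S")
    case False
    then have "P q = PI" using assms(1) by (auto simp: pstrs_def supp_def)
    moreover have "Q q = PI" using assms(2) False by (auto simp: pstrs_def supp_def)
    ultimately show ?thesis by simp
  qed (rule assms(3))
qed

lemma Id_str_in_pstrs [simp]: "Id_str \<in> pstrs S"
  by (auto simp: Id_str_def pstrs_def supp_def)

lemma prod_nth_distinct:
  "distinct qs \<Longrightarrow> (\<Prod>l<length qs. g (qs ! l)) = (\<Prod>q\<in>set qs. g q)"
  by (simp only: prod.distinct_set_conv_list prod.list_conv_set_nth length_map atLeast0LessThan)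
     (rule prod.cong, auto)

text \<open>The bits of an index below \<open>2 ^ m\<close> vary independently: the indices with top
  bit set are the remaining ones shifted by \<open>2 ^ m\<close>. It makes products and traces of
  tensor matrices factor over the qubits.\<close>

lemma sum_bits:
  fixes F :: "nat \<Rightarrow> bool \<Rightarrow> 'c::comm_semiring_1"
  shows "(\<Sum>j<(2::nat) ^ m. \<Prod>l<m. F l (bit j l)) = (\<Prod>l<m. \<Sum>b\<in>UNIV. F l b)"
proof (induction m)
  case 0 then show ?case by simp
next
  case (Suc m)
  have split: "{..<(2::nat) ^ Suc m} = {..<2 ^ m} \<union> (\<lambda>j. j + 2 ^ m) ` {..<2 ^ m}"
  proof (rule Set.set_eqI)
    fix x :: nat
    have "x \<in> (\<lambda>j. j + 2 ^ m) ` {..<2 ^ m}" if "x < 2 * 2 ^ m" "\<not> x < 2 ^ m"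
      using that by (intro image_eqI[of _ _ "x - 2 ^ m"]) auto
    then show "x \<in> {..<(2::nat) ^ Suc m} \<longleftrightarrow> x \<in> {..<2 ^ m} \<union> (\<lambda>j. j + 2 ^ m) ` {..<2 ^ m}" by auto
  qed
  have b0: "\<not> bit j m" if "j < 2 ^ m" for j :: nat
    using that by (simp add: bit_iff_odd)
  have b1: "bit (j + 2 ^ m) m" if "j < 2 ^ m" for j :: nat
    using that by (simp add: bit_iff_odd div_add_self2)
  have b2: "bit (j + 2 ^ m) l = bit j l" if "l < m" for j l :: nat
  proof -
    have "(j + 2 ^ m) div 2 ^ l = j div 2 ^ l + 2 ^ (m - l)"
    proof -
      have e: "(2::nat) ^ m = 2 ^ (m - l) * 2 ^ l" using that by (simp flip: power_add)
      show ?thesis unfolding e by simp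
    qed
    then show ?thesis using that by (simp add: bit_iff_odd)
  qed
  have "(\<Sum>j<(2::nat) ^ Suc m. \<Prod>l<Suc m. F l (bit j l)) =
     (\<Sum>j<(2::nat) ^ m. \<Prod>l<Suc m. F l (bit j l)) +
     (\<Sum>j\<in>(\<lambda>j. j + 2 ^ m) ` {..<(2::nat) ^ m}. \<Prod>l<Suc m. F l (bit j l))"
    unfolding split by (rule sum.union_disjoint) auto
  also have "(\<Sum>j\<in>(\<lambda>j. j + 2 ^ m) ` {..<(2::nat) ^ m}. \<Prod>l<Suc m. F l (bit j l)) =
     (\<Sum>j<(2::nat) ^ m. \<Prod>l<Suc m. F l (bit (j + 2 ^ m) l))"
    by (subst sum.reindex) (auto simp: inj_on_def)
  also have "\<dots> = (\<Sum>j<(2::nat) ^ m. (\<Prod>l<m. F l (bit j l)) * F m True)"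
    by (rule sum.cong) (simp_all add: b1 b2)
  also have "(\<Sum>j<(2::nat) ^ m. \<Prod>l<Suc m. F l (bit j l)) = (\<Sum>j<(2::nat) ^ m. (\<Prod>l<m. F l (bit j l)) * F m False)"
    by (rule sum.cong) (simp_all add: b0)
  finally show ?case
    by (simp add: Suc.IH sum_distrib_right[symmetric] sum_bool distrib_left)
qed

section \<open>Tensor products of one-qubit matrices\<close>

lemma tensor_mat_carrier [simp]: "tensor_mat qs f \<in> carrier_mat (2 ^ length qs) (2 ^ length qs)"
  by (simp add: tensor_mat_def)

lemma tensor_mat_dim [simp]: "dim_row (tensor_mat qs f) = 2 ^ length qs" "dim_col (tensor_mat qs f) = 2 ^ length qs"
  by (simp_all add: tensor_mat_def)

lemma tensor_mat_index: "i < 2 ^ length qs \<Longrightarrow> j < 2 ^ length qs \<Longrightarrow>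
    tensor_mat qs f $$ (i, j) = (\<Prod>l<length qs. f (qs ! l) (bit i l) (bit j l))"
  by (simp add: tensor_mat_def)

lemma tensor_mat_mult:
  "tensor_mat qs f * tensor_mat qs g = tensor_mat qs (\<lambda>q x y. \<Sum>z\<in>UNIV. f q x z * g q z y)"
proof (rule eq_matI)
  fix i j assume ij: "i < dim_row (tensor_mat qs (\<lambda>q x y. \<Sum>z\<in>UNIV. f q x z * g q z y))"
    "j < dim_col (tensor_mat qs (\<lambda>q x y. \<Sum>z\<in>UNIV. f q x z * g q z y))"
  have "(tensor_mat qs f * tensor_mat qs g) $$ (i, j) =
     (\<Sum>k<(2::nat) ^ length qs. \<Prod>l<length qs. f (qs ! l) (bit i l) (bit k l) * g (qs ! l) (bit k l) (bit j l))"
    using ij by (simp add: scalar_prod_def tensor_mat_index prod.distrib atLeast0LessThan)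
  also have "\<dots> = (\<Prod>l<length qs. \<Sum>z\<in>UNIV. f (qs ! l) (bit i l) z * g (qs ! l) z (bit j l))"
    by (rule sum_bits)
  finally show "(tensor_mat qs f * tensor_mat qs g) $$ (i, j) =
      tensor_mat qs (\<lambda>q x y. \<Sum>z\<in>UNIV. f q x z * g q z y) $$ (i, j)"
    using ij by (simp add: tensor_mat_index)
qed simp_all

lemma tr_tensor_mat: "tr (tensor_mat qs f) = (\<Prod>l<length qs. \<Sum>b\<in>UNIV. f (qs ! l) b b)"
  unfolding tr_def by (simp add: tensor_mat_index sum_bits[of "\<lambda>l b. f (qs ! l) b b"])

lemma tensor_mat_cong:
  assumes "\<And>q x y. q \<in> set qs \<Longrightarrow> f q x y = g q x y" shows "tensor_mat qs f = tensor_mat qs g"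
  by (rule eq_matI) (auto simp: tensor_mat_index intro!: prod.cong assms)

lemma mat_adjoint_index [simp]:
  "i < dim_col A \<Longrightarrow> j < dim_row A \<Longrightarrow> mat_adjoint A $$ (i, j) = cnj (A $$ (j, i))"
  for A :: "complex mat"
  by (simp add: mat_adjoint_def mat_of_rows_def conjugate_vec_def)

lemma mat_adjoint_dim [simp]: "dim_row (mat_adjoint A) = dim_col A" "dim_col (mat_adjoint A) = dim_row A"
  by (simp_all add: mat_adjoint_def)

lemma mat_adjoint_carrier [simp]: "A \<in> carrier_mat n m \<Longrightarrow> mat_adjoint A \<in> carrier_mat m n"
  unfolding carrier_mat_def by simp

lemma mat_adjoint_adjoint [simp]: "mat_adjoint (mat_adjoint A) = A" for A :: "complex mat"
  by (rule eq_matI) auto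

lemma mat_adjoint_mult:
  assumes "A \<in> carrier_mat n m" "B \<in> carrier_mat m l"
  shows "mat_adjoint (A * B) = mat_adjoint B * mat_adjoint (A :: complex mat)"
  by (rule eq_matI) (use assms in \<open>auto simp: scalar_prod_def cnj_sum mult.commute intro!: sum.cong\<close>)

lemma mat_adjoint_tensor_mat:
  "mat_adjoint (tensor_mat qs f) = tensor_mat qs (\<lambda>q x y. cnj (f q y x))"
  by (rule eq_matI) (auto simp: tensor_mat_index cnj_prod)

section \<open>One-qubit Pauli algebra\<close>

fun pauli_mul :: "pauli \<Rightarrow> pauli \<Rightarrow> pauli" where
  "pauli_mul PI b = b"
| "pauli_mul a PI = a"
| "pauli_mul PX PX = PI" | "pauli_mul PX PY = PZ" | "pauli_mul PX PZ = PY"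
| "pauli_mul PY PX = PZ" | "pauli_mul PY PY = PI" | "pauli_mul PY PZ = PX"
| "pauli_mul PZ PX = PY" | "pauli_mul PZ PY = PX" | "pauli_mul PZ PZ = PI"

text \<open>\<open>pauli_mul\<close> is the Klein four-group, the product up to phase. The phase is
  kept apart because whether a trace vanishes depends on the group element alone.\<close>

fun pauli_phase :: "pauli \<Rightarrow> pauli \<Rightarrow> complex" where
  "pauli_phase PX PY = \<i>" | "pauli_phase PY PX = - \<i>"
| "pauli_phase PY PZ = \<i>" | "pauli_phase PZ PY = - \<i>"
| "pauli_phase PZ PX = \<i>" | "pauli_phase PX PZ = - \<i>"
| "pauli_phase a b = 1"

lemma pauli_entry_mult:
  "(\<Sum>z\<in>UNIV. pauli_entry a x z * pauli_entry b z y) = pauli_phase a b * pauli_entry (pauli_mul a b) x y"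
  by (cases a; cases b; cases x; cases y; simp add: sum_bool)

lemma pauli_entry_orth:
  "(\<Sum>x\<in>UNIV. \<Sum>y\<in>UNIV. pauli_entry a x y * pauli_entry b y x) = (if a = b then 2 else 0)"
  by (cases a; cases b; simp add: sum_bool)

lemma cnj_pauli_entry: "cnj (pauli_entry a y x) = pauli_entry a x y"
  by (cases a; cases x; cases y; simp)

text \<open>The trace of the one-qubit product \<open>a b c d\<close>, evaluated in pairs:
  \<open>a b\<close> and \<open>c d\<close> are phases times Pauli matrices, and the product of two
  of these has trace 2 or 0.\<close>

definition pauli_trace4 :: "pauli \<Rightarrow> pauli \<Rightarrow> pauli \<Rightarrow> pauli \<Rightarrow> complex" where
  "pauli_trace4 a b c d =
     pauli_phase a b * pauli_phase c d * (if pauli_mul a b = pauli_mul c d then 2 else 0)"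

text \<open>With its letters in this order the second factor is the complex conjugate of
  \<open>pauli_trace4 a r b s\<close>, so this is the orthogonality of the sixteen maps
  \<open>M \<mapsto> p M q\<close>. For equal maps each \<open>a\<close> has one \<open>b\<close>,
  contributing 4; hence 16.\<close>

lemma pauli_trace4_complete:
  "(\<Sum>a\<in>UNIV. \<Sum>b\<in>UNIV. pauli_trace4 a p b q * pauli_trace4 a s b r) = (if p = r \<and> q = s then 16 else 0)"
  by (cases p; cases q; cases r; cases s; simp add: sum_pauli pauli_trace4_def)

lemma pauli_trace4_Id: "pauli_trace4 PI p PI q = (if p = q then 2 else 0)"
  by (cases p; cases q; simp add: pauli_trace4_def)

text \<open>Each \<open>a\<close> has exactly one \<open>b\<close> with nonzero trace, and its
  modulus is 2. The value 8 per qubit is the normalisation of the local inversion, which therefore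
  does not amplify errors.\<close>

lemma sum_norm_pauli_trace4:
  "(\<Sum>a\<in>UNIV. \<Sum>b\<in>UNIV. cmod (pauli_trace4 a q b p)) = 8"
  by (cases p; cases q; simp add: sum_pauli pauli_trace4_def)

section \<open>Pauli strings as matrices\<close>

lemma pauli_mat_carrier [simp]: "pauli_mat qs P \<in> carrier_mat (2 ^ length qs) (2 ^ length qs)"
  by (simp add: pauli_mat_def)

lemma pmat_carrier [simp]: "pmat n P \<in> carrier_mat (2 ^ n) (2 ^ n)"
  using pauli_mat_carrier[of "[0..<n]"] by simp

lemma pmat_dim [simp]: "dim_row (pmat n P) = 2 ^ n" "dim_col (pmat n P) = 2 ^ n"
  using pmat_carrier[of n P] unfolding carrier_mat_def by blast+

lemma pauli_mat_mult:
  "pauli_mat qs P * pauli_mat qs Q = tensor_mat qs (\<lambda>q x y. pauli_phase (P q) (Q q) * pauli_entry (pauli_mul (P q) (Q q)) x y)"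
  by (simp add: pauli_mat_def tensor_mat_mult pauli_entry_mult)

lemma tr_pauli_mat4:
  assumes "distinct qs"
  shows "tr (pauli_mat qs A * pauli_mat qs B * pauli_mat qs C * pauli_mat qs D) =
    (\<Prod>q\<in>set qs. pauli_trace4 (A q) (B q) (C q) (D q))"
proof -
  have "pauli_mat qs A * pauli_mat qs B * pauli_mat qs C * pauli_mat qs D =
      (pauli_mat qs A * pauli_mat qs B) * (pauli_mat qs C * pauli_mat qs D)"
    by (meson assoc_mult_mat mult_carrier_mat pauli_mat_carrier)
  also have "tr \<dots> = (\<Prod>l<length qs. pauli_trace4 (A (qs!l)) (B (qs!l)) (C (qs!l)) (D (qs!l)))"
    unfolding pauli_mat_mult tensor_mat_mult tr_tensor_mat
  proof (rule prod.cong[OF refl])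
    fix l
    let ?a = "A (qs!l)" and ?b = "B (qs!l)" and ?c = "C (qs!l)" and ?d = "D (qs!l)"
    have "(\<Sum>b\<in>UNIV. \<Sum>z\<in>UNIV. pauli_phase ?a ?b * pauli_entry (pauli_mul ?a ?b) b z *
           (pauli_phase ?c ?d * pauli_entry (pauli_mul ?c ?d) z b)) =
          pauli_phase ?a ?b * pauli_phase ?c ?d *
          (\<Sum>b\<in>UNIV. \<Sum>z\<in>UNIV. pauli_entry (pauli_mul ?a ?b) b z * pauli_entry (pauli_mul ?c ?d) z b)"
      by (simp add: sum_distrib_left mult_ac)
    then show "(\<Sum>b\<in>UNIV. \<Sum>z\<in>UNIV. pauli_phase ?a ?b * pauli_entry (pauli_mul ?a ?b) b z *
           (pauli_phase ?c ?d * pauli_entry (pauli_mul ?c ?d) z b)) = pauli_trace4 ?a ?b ?c ?d"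
      by (simp add: pauli_entry_orth pauli_trace4_def)
  qed
  also have "\<dots> = (\<Prod>q\<in>set qs. pauli_trace4 (A q) (B q) (C q) (D q))"
    using assms by (rule prod_nth_distinct)
  finally show ?thesis .
qed

lemma pauli_mat_Id: "pauli_mat qs Id_str = 1\<^sub>m (2 ^ length qs)"
proof (rule eq_matI)
  fix i j assume "i < dim_row (1\<^sub>m (2 ^ length qs) :: complex mat)" "j < dim_col (1\<^sub>m (2 ^ length qs) :: complex mat)"
  then have ij: "i < 2 ^ length qs" "j < 2 ^ length qs" by auto
  have "pauli_mat qs Id_str $$ (i, j) = (\<Prod>l<length qs. if bit i l = bit j l then 1 else 0)"
    using ij by (simp add: pauli_mat_def tensor_mat_index Id_str_def)
  also have "\<dots> = (if i = j then 1 else 0)"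
  proof (cases "i = j")
    case False
    have "\<exists>l<length qs. bit i l \<noteq> bit j l"
    proof (rule ccontr)
      assume "\<not> ?thesis"
      then have "take_bit (length qs) i = take_bit (length qs) j"
        by (intro bit_eqI) (auto simp: bit_take_bit_iff)
      then show False using ij False by (simp add: take_bit_nat_eq_self)
    qed
    then show ?thesis using False by auto
  qed simp
  finally show "pauli_mat qs Id_str $$ (i, j) = 1\<^sub>m (2 ^ length qs) $$ (i, j)" using ij by simp
qed (simp_all add: pauli_mat_def)

lemma pmat_Id [simp]: "pmat n Id_str = 1\<^sub>m (2 ^ n)"
  by (simp add: pauli_mat_Id)

lemma mat_adjoint_pauli_mat [simp]: "mat_adjoint (pauli_mat qs P) = pauli_mat qs P"
  by (simp add: pauli_mat_def mat_adjoint_tensor_mat cnj_pauli_entry)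

lemma pauli_mat_commute:
  assumes "supp P \<inter> supp Q = {}"
  shows "pauli_mat qs P * pauli_mat qs Q = pauli_mat qs Q * pauli_mat qs P"
proof -
  have "P q = PI \<or> Q q = PI" for q using assms by (auto simp: supp_def)
  moreover have "a = PI \<or> b = PI \<Longrightarrow> pauli_phase a b = 1 \<and> pauli_phase b a = 1 \<and> pauli_mul a b = pauli_mul b a" for a b
    by (cases a; cases b; simp)
  ultimately show ?thesis unfolding pauli_mat_mult by (intro tensor_mat_cong) metis
qed

section \<open>Sums, adjoints and traces of matrices\<close>

lemma msum_carrier [simp]: "msum N I F \<in> carrier_mat N N"
  by (simp add: msum_def)

lemma msum_dim [simp]: "dim_row (msum N I F) = N" "dim_col (msum N I F) = N"
  by (simp_all add: msum_def)

lemma msum_index [simp]: "i < N \<Longrightarrow> j < N \<Longrightarrow> msum N I F $$ (i, j) = (\<Sum>a\<in>I. F a $$ (i, j))"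
  by (simp add: msum_def)

lemma msum_cong: "I = J \<Longrightarrow> (\<And>a. a \<in> J \<Longrightarrow> F a = G a) \<Longrightarrow> msum N I F = msum N J G"
  by (auto simp: msum_def)

lemma mult_msum:
  assumes "A \<in> carrier_mat N N" "\<And>a. a \<in> I \<Longrightarrow> F a \<in> carrier_mat N N"
  shows "A * msum N I F = msum N I (\<lambda>a. A * F a)"
proof (rule eq_matI)
  fix i j assume ij: "i < dim_row (msum N I (\<lambda>a. A * F a))" "j < dim_col (msum N I (\<lambda>a. A * F a))"
  have "(A * msum N I F) $$ (i, j) = (\<Sum>k<N. \<Sum>a\<in>I. A $$ (i, k) * F a $$ (k, j))"
    using ij assms(1) by (simp add: scalar_prod_def sum_distrib_left atLeast0LessThan)
  also have "\<dots> = (\<Sum>a\<in>I. \<Sum>k<N. A $$ (i, k) * F a $$ (k, j))" by (rule sum.swap)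
  also have "\<dots> = (\<Sum>a\<in>I. (A * F a) $$ (i, j))"
    using ij assms(1) by (intro sum.cong refl) (auto simp: scalar_prod_def atLeast0LessThan dest!: assms(2))
  finally show "(A * msum N I F) $$ (i, j) = msum N I (\<lambda>a. A * F a) $$ (i, j)" using ij by simp
qed (use assms in auto)

lemma msum_mult:
  assumes "A \<in> carrier_mat N N" "\<And>a. a \<in> I \<Longrightarrow> F a \<in> carrier_mat N N"
  shows "msum N I F * A = msum N I (\<lambda>a. F a * A)"
proof (rule eq_matI)
  fix i j assume ij: "i < dim_row (msum N I (\<lambda>a. F a * A))" "j < dim_col (msum N I (\<lambda>a. F a * A))"
  have "(msum N I F * A) $$ (i, j) = (\<Sum>k<N. \<Sum>a\<in>I. F a $$ (i, k) * A $$ (k, j))"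
    using ij assms(1) by (simp add: scalar_prod_def sum_distrib_right atLeast0LessThan)
  also have "\<dots> = (\<Sum>a\<in>I. \<Sum>k<N. F a $$ (i, k) * A $$ (k, j))" by (rule sum.swap)
  also have "\<dots> = (\<Sum>a\<in>I. (F a * A) $$ (i, j))"
    using ij assms(1) by (intro sum.cong refl) (auto simp: scalar_prod_def atLeast0LessThan dest!: assms(2))
  finally show "(msum N I F * A) $$ (i, j) = msum N I (\<lambda>a. F a * A) $$ (i, j)" using ij by simp
qed (use assms in auto)

lemma mat_adjoint_msum:
  assumes "\<And>a. a \<in> I \<Longrightarrow> F a \<in> carrier_mat N N"
  shows "mat_adjoint (msum N I F) = msum N I (\<lambda>a. mat_adjoint (F a))"
  by (rule eq_matI) (auto simp: cnj_sum intro!: sum.cong dest!: assms)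

lemma mat_adjoint_smult: "mat_adjoint (c \<cdot>\<^sub>m A) = cnj c \<cdot>\<^sub>m mat_adjoint A" for A :: "complex mat"
  by (rule eq_matI) auto

lemma mat_adjoint_add: "A \<in> carrier_mat n m \<Longrightarrow> B \<in> carrier_mat n m \<Longrightarrow>
    mat_adjoint (A + B) = mat_adjoint A + mat_adjoint B" for A :: "complex mat"
  by (rule eq_matI) auto

lemma tr_mult: "A \<in> carrier_mat N M \<Longrightarrow> B \<in> carrier_mat M N \<Longrightarrow>
    tr (A * B) = (\<Sum>i<N. \<Sum>j<M. A $$ (i, j) * B $$ (j, i))"
  by (auto simp: tr_def scalar_prod_def atLeast0LessThan intro!: sum.cong)

lemma tr_mult_commute: "A \<in> carrier_mat N M \<Longrightarrow> B \<in> carrier_mat M N \<Longrightarrow> tr (A * B) = tr (B * A)"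
  by (simp add: tr_mult mult.commute) (rule sum.swap)

lemma tr_add: "A \<in> carrier_mat N N \<Longrightarrow> B \<in> carrier_mat N N \<Longrightarrow> tr (A + B) = tr A + tr B"
  by (auto simp: tr_def sum.distrib)

lemma tr_smult: "A \<in> carrier_mat N N \<Longrightarrow> tr (c \<cdot>\<^sub>m A) = c * tr A"
  by (auto simp: tr_def sum_distrib_left)

lemma tr_msum:
  assumes "\<And>a. a \<in> I \<Longrightarrow> F a \<in> carrier_mat N N"
  shows "tr (msum N I F) = (\<Sum>a\<in>I. tr (F a))"
proof -
  have "tr (msum N I F) = (\<Sum>i<N. \<Sum>a\<in>I. F a $$ (i, i))" by (simp add: tr_def)
  also have "\<dots> = (\<Sum>a\<in>I. \<Sum>i<N. F a $$ (i, i))" by (rule sum.swap)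
  also have "\<dots> = (\<Sum>a\<in>I. tr (F a))" by (intro sum.cong refl) (auto simp: tr_def dest!: assms)
  finally show ?thesis .
qed

lemma tr_adjoint: "A \<in> carrier_mat N N \<Longrightarrow> tr (mat_adjoint A) = cnj (tr A)"
  by (auto simp: tr_def cnj_sum)

lemma tr_pmat4:
  "tr (pmat n A * pmat n B * pmat n C * pmat n D) = (\<Prod>q<n. pauli_trace4 (A q) (B q) (C q) (D q))"
  by (subst tr_pauli_mat4) (auto simp: atLeast0LessThan)

text \<open>On qubit \<open>q\<close> the trace is that of a single traceless Pauli matrix. This is
  why a product of operators supported on \<open>e\<close> has no Pauli component that acts outside
  \<open>e\<close>.\<close>

lemma tr_pmat3_eq_0:
  assumes "q < n" "A q = PI" "B q = PI" "C q \<noteq> PI"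
  shows "tr (pmat n A * pmat n B * pmat n C) = 0"
proof -
  have "pmat n A * pmat n B * pmat n C = pmat n A * pmat n B * pmat n C * pmat n Id_str"
    by (metis mult_carrier_mat pmat_carrier pmat_Id right_mult_one_mat)
  moreover have "pauli_trace4 (A q) (B q) (C q) (Id_str q) = 0"
    using assms by (cases "C q") (auto simp: pauli_trace4_def Id_str_def)
  ultimately show ?thesis using assms(1) by (metis (no_types, lifting) finite_lessThan lessThan_iff prod_zero tr_pmat4)
qed

lemma tr_pmat2:
  assumes "A \<in> pstrs {..<n}" "B \<in> pstrs {..<n}"
  shows "tr (pmat n A * pmat n B) = (if A = B then 2 ^ n else 0)"
proof -
  have "tr (pmat n A * pmat n B) = tr (pmat n Id_str * pmat n A * pmat n Id_str * pmat n B)"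
    by (metis left_mult_one_mat right_mult_one_mat pmat_carrier pmat_Id)
  also have "\<dots> = (\<Prod>q<n. if A q = B q then 2 else 0)"
    unfolding tr_pmat4 by (simp add: Id_str_def pauli_trace4_Id)
  also have "\<dots> = (if A = B then 2 ^ n else 0)"
  proof (cases "A = B")
    case False
    then obtain q where "q < n" "A q \<noteq> B q" using pstrs_ext[OF assms] by auto
    then have "(\<Prod>q<n. if A q = B q then 2 else 0) = (0::complex)"
      by (intro prod_zero) auto
    then show ?thesis using False by simp
  qed simp
  finally show ?thesis .
qed

lemma tr_pmat: "A \<in> pstrs {..<n} \<Longrightarrow> tr (pmat n A) = (if A = Id_str then 2 ^ n else 0)"
  using tr_pmat2[of A n Id_str] by (metis Id_str_in_pstrs pmat_Id pmat_carrier right_mult_one_mat)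

section \<open>The recursive inversion as a recursion over extensions\<close>

text \<open>\<open>v\<close> is \<open>u\<close> with one nontrivial string placed on both sides
  outside the support union of \<open>u\<close>. It is stated by restriction because
  \<open>propagate\<close> goes down from \<open>v\<close> to \<open>u\<close>;
  \<open>extensions_eq\<close> gives the upward description by \<open>glue\<close>.\<close>

definition extends :: "pstr \<times> pstr \<Rightarrow> pstr \<times> pstr \<Rightarrow> bool" where
  "extends v u \<longleftrightarrow> usupp u \<subset> usupp v \<and> (\<forall>q\<in>usupp v - usupp u. fst v q = snd v q) \<and>
     u = (restr (usupp u) (fst v), restr (usupp u) (snd v))"

section \<open>Results and costs of the monadic loops\<close>

lemma timed_simps [simp]:
  "result (ret x) = x" "cost (ret x) = 0" "result (tick c) = ()" "cost (tick c) = c"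
  "result (bind_timed m f) = result (f (result m))"
  "cost (bind_timed m f) = cost m + cost (f (result m))"
  by (simp_all add: ret_def tick_def bind_timed_def)

lemma for_each_append: "result (for_each f (xs @ ys) s) = result (for_each f ys (result (for_each f xs s)))"
  by (induction xs arbitrary: s) auto

lemma for_each_add: "(\<And>x s. result (f x s) = s + g x) \<Longrightarrow>
    result (for_each f xs s) = s + sum_list (map g xs)" for s :: "'a::comm_monoid_add"
  by (induction xs arbitrary: s) (auto simp: add.assoc)

text \<open>One filtered pass per support size is a bucket sort: its effect is that of a single pass
  over the concatenated buckets.\<close>

lemma for_each_nested:
  "result (for_each (\<lambda>s. for_each (\<lambda>u r. do { tick (c u); if p u = s then F u r else ret r }) us) ss r) =
   result (for_each F (concat (map (\<lambda>s. filter (\<lambda>u. p u = s) us) ss)) r)"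
proof (induction ss arbitrary: r)
  case (Cons s ss)
  have "result (for_each (\<lambda>u r. do { tick (c u); if p u = s then F u r else ret r }) us r) =
     result (for_each F (filter (\<lambda>u. p u = s) us) r)" for r
    by (induction us arbitrary: r) auto
  then show ?case by (simp add: for_each_append Cons.IH)
qed simp

lemma cost_for_each_le:
  "(\<And>x s. x \<in> set xs \<Longrightarrow> cost (f x s) \<le> c) \<Longrightarrow> cost (for_each f xs s) \<le> length xs * (c + 1)"
proof (induction xs arbitrary: s)
  case (Cons x xs)
  have "cost (f x s) \<le> c" using Cons.prems by simp
  moreover have "cost (for_each f xs (result (f x s))) \<le> length xs * (c + 1)"
    by (rule Cons.IH) (use Cons.prems in simp)
  ultimately show ?case by simp
qed simp

lemma usupp_restr: "T \<subseteq> usupp u \<Longrightarrow> usupp (restr T (fst u), restr T (snd u)) = T"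
  by (auto simp: usupp_def supp_def restr_def)

lemma set_subset_list:
  assumes "finite S"
  shows "set (map set (subseqs (sorted_list_of_set S))) = Pow S"
    "distinct (map set (subseqs (sorted_list_of_set S)))"
    "length (map set (subseqs (sorted_list_of_set S))) = 2 ^ card S"
  using assms subseqs_powset[of "sorted_list_of_set S"] distinct_set_subseqs[of "sorted_list_of_set S"]
  by (simp_all add: length_subseqs)

text \<open>The entry at \<open>w\<close> can change only in the iteration whose subset is
  \<open>usupp w\<close>, since the pair written for \<open>T\<close> has support union
  \<open>T\<close>; the subsets are listed without repetition, so \<open>x\<close> is added at most
  once.\<close>

lemma result_propagate:
  assumes "finite (usupp u)"
  shows "result (propagate \<Omega> u x R) w = R w + (if w \<in> \<Omega> \<and> extends u w then x else 0)"
proof -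
  let ?S = "usupp u"
  define f where "f = (\<lambda>T R. do {
         tick (card ?S + 1);
         if T \<subset> ?S \<and> (\<forall>q\<in>?S - T. fst u q = snd u q) then do {
           let w = (restr T (fst u), restr T (snd u));
           tick (card ?S + 1);
           if w \<in> \<Omega> then do {
             tick (2 * (card ?S + 1) + 1);
             ret (R(w := R w + x)) }
           else ret R }
         else ret R })"
  \<comment> \<open>Generalised from the list of all subsets to any repetition-free list of subsets,
    so that induction applies.\<close>
  have *: "result (for_each f Ts R) w = R w + (if w \<in> \<Omega> \<and> extends u w \<and> usupp w \<in> set Ts then x else 0)"
    if "distinct Ts" "set Ts \<subseteq> Pow ?S" for Ts R
    using that
  proof (induction Ts arbitrary: R)
    case (Cons T Ts)
    let ?w = "(restr T (fst u), restr T (snd u))"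
    have T: "T \<subseteq> ?S" "T \<notin> set Ts" using Cons.prems by auto
    note us = usupp_restr[OF T(1)]
    have 1: "result (f T R) w = R w + (if w = ?w \<and> w \<in> \<Omega> \<and> extends u w then x else 0)"
    proof (cases "w = ?w")
      case True
      have "extends u ?w \<longleftrightarrow> T \<subset> ?S \<and> (\<forall>q\<in>?S - T. fst u q = snd u q)"
        unfolding extends_def us by simp
      then show ?thesis using True by (simp add: f_def Let_def)
    next
      case False
      then show ?thesis by (simp add: f_def Let_def)
    qed
    have 2: "w = ?w \<longleftrightarrow> usupp w = T" if "extends u w"
    proof
      assume "w = ?w" then show "usupp w = T" using us by (simp only:)
    next
      assume "usupp w = T" then show "w = ?w" using that unfolding extends_def by simp
    qed
    have "result (for_each f (T # Ts) R) w = result (for_each f Ts (result (f T R))) w" by simp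
    also have "\<dots> = result (f T R) w + (if w \<in> \<Omega> \<and> extends u w \<and> usupp w \<in> set Ts then x else 0)"
      by (rule Cons.IH) (use Cons.prems in auto)
    also have "\<dots> = R w + (if w \<in> \<Omega> \<and> extends u w \<and> usupp w \<in> set (T # Ts) then x else 0)"
      unfolding 1 using 2 T(2) by (cases "w \<in> \<Omega> \<and> extends u w") auto
    finally show ?case .
  qed simp
  have "result (propagate \<Omega> u x R) = result (for_each f (map set (subseqs (sorted_list_of_set ?S))) R)"
    by (simp add: propagate_def Let_def f_def)
  moreover have "extends u w \<Longrightarrow> usupp w \<in> Pow ?S" by (auto simp: extends_def)
  ultimately show ?thesis
    using *[of "map set (subseqs (sorted_list_of_set ?S))" R] set_subset_list[OF assms] by auto
qed

definition local_value :: "(pstr \<Rightarrow> pstr \<Rightarrow> complex) \<Rightarrow> pstr \<times> pstr \<Rightarrow> complex" where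
  "local_value Lh u = (let qs = sorted_list_of_set (usupp u) in
     (\<Sum>A\<in>pstrs (usupp u). \<Sum>B\<in>pstrs (usupp u). Lh A B * tr (pauli_mat qs A * pauli_mat qs (snd u) *
        pauli_mat qs B * pauli_mat qs (fst u))) / 2 ^ (3 * card (usupp u)))"

lemma pstr_list:
  assumes "distinct qs"
  shows "distinct (pstr_list qs)" "set (pstr_list qs) = pstrs (set qs)" "length (pstr_list qs) = 4 ^ length qs"
proof -
  have ev: "(case map_of (zip qs ps) (qs ! i) of None \<Rightarrow> PI | Some p \<Rightarrow> p) = ps ! i"
    if "length ps = length qs" "i < length qs" for ps i
    using that assms by (simp add: map_of_zip_nth)
  have sl: "set (List.n_lists (length qs) [PI, PX, PY, PZ]) = {ps. length ps = length qs}"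
    using UNIV_pauli by (simp add: set_n_lists) 
  show "length (pstr_list qs) = 4 ^ length qs"
    by (simp add: pstr_list_def length_n_lists eval_nat_numeral)
  show "distinct (pstr_list qs)" unfolding pstr_list_def
  proof (subst distinct_map, intro conjI)
    show "distinct (List.n_lists (length qs) [PI, PX, PY, PZ])" by (rule distinct_n_lists) simp
    show "inj_on (\<lambda>ps q. case map_of (zip qs ps) q of None \<Rightarrow> PI | Some p \<Rightarrow> p)
       (set (List.n_lists (length qs) [PI, PX, PY, PZ]))"
    proof (rule inj_onI)
      fix ps ps' assume l: "ps \<in> set (List.n_lists (length qs) [PI, PX, PY, PZ])"
        "ps' \<in> set (List.n_lists (length qs) [PI, PX, PY, PZ])"
        and e: "(\<lambda>q. case map_of (zip qs ps) q of None \<Rightarrow> PI | Some p \<Rightarrow> p) =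
          (\<lambda>q. case map_of (zip qs ps') q of None \<Rightarrow> PI | Some p \<Rightarrow> p)"
      show "ps = ps'"
      proof (rule nth_equalityI)
        show "length ps = length ps'" using l unfolding sl by simp
        fix i assume "i < length ps"
        then show "ps ! i = ps' ! i"
          using l ev[of ps i] ev[of ps' i] fun_cong[OF e, of "qs ! i"] unfolding sl by simp
      qed
    qed
  qed
  show "set (pstr_list qs) = pstrs (set qs)"
  proof (intro equalityI subsetI)
    fix P assume "P \<in> set (pstr_list qs)"
    then obtain ps where ps: "length ps = length qs" "P = (\<lambda>q. case map_of (zip qs ps) q of None \<Rightarrow> PI | Some p \<Rightarrow> p)"
      unfolding pstr_list_def set_map sl by auto
    have "P q = PI" if "q \<notin> set qs" for q
    proof -
      have "map_of (zip qs ps) q = None" using that ps(1) by (simp add: map_of_zip_is_None)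
      then show ?thesis using ps(2) by simp
    qed
    then show "P \<in> pstrs (set qs)" by (auto simp: pstrs_def supp_def)
  next
    fix P assume P: "P \<in> pstrs (set qs)"
    have "P = (\<lambda>q. case map_of (zip qs (map P qs)) q of None \<Rightarrow> PI | Some p \<Rightarrow> p)"
    proof
      fix q
      show "P q = (case map_of (zip qs (map P qs)) q of None \<Rightarrow> PI | Some p \<Rightarrow> p)"
      proof (cases "q \<in> set qs")
        case True
        then obtain i where "i < length qs" "q = qs ! i" by (auto simp: in_set_conv_nth)
        then show ?thesis using ev[of "map P qs" i] by simp
      next
        case False
        then have "map_of (zip qs (map P qs)) q = None" by (simp add: map_of_zip_is_None)
        moreover have "P q = PI" using P False by (auto simp: pstrs_def supp_def)
        ultimately show ?thesis by (simp only: option.case)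
      qed
    qed
    then show "P \<in> set (pstr_list qs)"
      unfolding pstr_list_def set_map sl by (intro image_eqI[of _ _ "map P qs"]) auto
  qed
qed

lemma result_local_inversion:
  assumes "finite (usupp u)"
  shows "result (local_inversion Lh u) = local_value Lh u"
proof -
  let ?qs = "sorted_list_of_set (usupp u)"
  let ?g = "\<lambda>A B. Lh A B * tr (pauli_mat ?qs A * pauli_mat ?qs (snd u) * pauli_mat ?qs B * pauli_mat ?qs (fst u))"
  have d: "distinct ?qs" and s: "set ?qs = usupp u" using assms by auto
  have dp: "distinct (List.product (pstr_list ?qs) (pstr_list ?qs))"
    using pstr_list(1)[OF d] by (simp add: distinct_product)
  have "result (local_inversion Lh u) =
      sum_list (map (\<lambda>x. ?g (fst x) (snd x)) (List.product (pstr_list ?qs) (pstr_list ?qs))) / 2 ^ (3 * card (usupp u))"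
    unfolding local_inversion_def Let_def
    by (simp, subst for_each_add[where g="\<lambda>x. ?g (fst x) (snd x)"]) (auto split: prod.splits)
  also have "sum_list (map (\<lambda>x. ?g (fst x) (snd x)) (List.product (pstr_list ?qs) (pstr_list ?qs))) =
      (\<Sum>x\<in>pstrs (usupp u) \<times> pstrs (usupp u). ?g (fst x) (snd x))"
    using dp by (simp add: sum_list_distinct_conv_sum_set pstr_list(2)[OF d] s)
  also have "\<dots> = (\<Sum>A\<in>pstrs (usupp u). \<Sum>B\<in>pstrs (usupp u). ?g A B)"
    by (simp add: sum.cartesian_product case_prod_unfold)
  finally show ?thesis by (simp add: local_value_def Let_def)
qed

text \<open>Invariant of the main loop: the register of \<open>w\<close> holds the sum of the values
  of those extensions of \<open>w\<close> that have been processed. The order forbids a pair to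
  extend an earlier one, so the register read for \<open>u\<close> is already complete, and later
  steps leave the equation for \<open>u\<close> intact. The induction appends at the end of the
  list, following the run.\<close>

lemma result_process_list:
  assumes "distinct ws" "sorted_wrt (\<lambda>v u. \<not> extends u v) ws" "set ws \<subseteq> \<Omega>"
    "\<And>u. u \<in> set ws \<Longrightarrow> finite (usupp u)"
    and RX: "result (for_each (process_pair \<Omega> Lh) ws (\<lambda>_. 0, \<lambda>_. 0)) = (R, X)"
  shows "(\<forall>w\<in>\<Omega>. R w = (\<Sum>v\<in>{v\<in>set ws. extends v w}. X v)) \<and> (\<forall>u. u \<notin> set ws \<longrightarrow> X u = 0) \<and>
    (\<forall>u\<in>set ws. X u = local_value Lh u - (\<Sum>v\<in>{v\<in>set ws. extends v u}. X v))"
  using assms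
proof (induction ws arbitrary: R X rule: rev_induct)
  case (snoc w ws)
  obtain R0 X0 where RX0: "result (for_each (process_pair \<Omega> Lh) ws (\<lambda>_. 0, \<lambda>_. 0)) = (R0, X0)"
    by fastforce
  have ih: "(\<forall>w\<in>\<Omega>. R0 w = (\<Sum>v\<in>{v\<in>set ws. extends v w}. X0 v))" "(\<forall>u. u \<notin> set ws \<longrightarrow> X0 u = 0)"
    "(\<forall>u\<in>set ws. X0 u = local_value Lh u - (\<Sum>v\<in>{v\<in>set ws. extends v u}. X0 v))"
  proof -
    have "distinct ws" "sorted_wrt (\<lambda>v u. \<not> extends u v) ws" "set ws \<subseteq> \<Omega>"
      "\<And>u. u \<in> set ws \<Longrightarrow> finite (usupp u)"
      using snoc.prems by (auto simp: sorted_wrt_append)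
    note i = snoc.IH[OF this RX0]
    show "\<forall>w\<in>\<Omega>. R0 w = (\<Sum>v\<in>{v\<in>set ws. extends v w}. X0 v)" using i by (rule conjunct1)
    show "\<forall>u. u \<notin> set ws \<longrightarrow> X0 u = 0" using i by (rule conjunct1[OF conjunct2])
    show "\<forall>u\<in>set ws. X0 u = local_value Lh u - (\<Sum>v\<in>{v\<in>set ws. extends v u}. X0 v)"
      using i by (rule conjunct2[OF conjunct2])
  qed
  have w: "w \<in> \<Omega>" "w \<notin> set ws" "finite (usupp w)" using snoc.prems by auto
  have ww: "\<not> extends w w" by (simp add: extends_def)
  have nw: "\<not> extends w v" if "v \<in> set ws" for v using snoc.prems(2) that by (auto simp: sorted_wrt_append)
  define x where "x = local_value Lh w - R0 w"
  have R: "R = result (propagate \<Omega> w x R0)" and X: "X = X0(w := x)"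
  proof -
    have "result (process_pair \<Omega> Lh w (R0, X0)) = (result (propagate \<Omega> w x R0), X0(w := x))"
      by (simp add: process_pair_def Let_def result_local_inversion[OF w(3)] x_def)
    moreover have "(R, X) = result (process_pair \<Omega> Lh w (R0, X0))"
      using snoc.prems(5) unfolding for_each_append RX0 by simp
    ultimately show "R = result (propagate \<Omega> w x R0)" "X = X0(w := x)" by simp_all
  qed
  have R': "R y = R0 y + (if extends w y then x else 0)" if "y \<in> \<Omega>" for y
    unfolding R using result_propagate[OF w(3)] that by simp
  have s: "(\<Sum>v\<in>{v\<in>set (ws @ [w]). extends v y}. X v) =
      (\<Sum>v\<in>{v\<in>set ws. extends v y}. X0 v) + (if extends w y then x else 0)" for y
  proof -
    have "(\<Sum>v\<in>{v\<in>set ws. extends v y}. X v) = (\<Sum>v\<in>{v\<in>set ws. extends v y}. X0 v)"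
      by (rule sum.cong) (use w(2) X in auto)
    moreover have "{v\<in>set (ws @ [w]). extends v y} = (if extends w y then insert w {v\<in>set ws. extends v y} else {v\<in>set ws. extends v y})"
      by auto
    ultimately show ?thesis using w(2) by (simp add: X add.commute)
  qed
  show ?case
  proof (intro conjI ballI allI impI)
    fix y assume y: "y \<in> \<Omega>"
    have "R0 y = (\<Sum>v\<in>{v\<in>set ws. extends v y}. X0 v)" using ih(1) y by (rule bspec)
    then show "R y = (\<Sum>v\<in>{v\<in>set (ws @ [w]). extends v y}. X v)"
      unfolding s R'[OF y] by simp
  next
    fix u assume "u \<notin> set (ws @ [w])" then show "X u = 0" using ih(2)[rule_format, of u] X by simp
  next
    fix u assume u: "u \<in> set (ws @ [w])"
    show "X u = local_value Lh u - (\<Sum>v\<in>{v\<in>set (ws @ [w]). extends v u}. X v)"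
    proof (cases "u = w")
      case True
      have "R0 w = (\<Sum>v\<in>{v\<in>set ws. extends v w}. X0 v)" using ih(1) w(1) by (rule bspec)
      then show ?thesis unfolding s True using ww by (simp add: X x_def)
    next
      case False
      then have "u \<in> set ws" using u by simp
      have "X0 u = local_value Lh u - (\<Sum>v\<in>{v\<in>set ws. extends v u}. X0 v)"
        using ih(3) \<open>u \<in> set ws\<close> by (rule bspec)
      then show ?thesis unfolding s using False nw[OF \<open>u \<in> set ws\<close>] by (simp add: X)
    qed
  qed
qed auto

lemma extends_card_less: "extends v u \<Longrightarrow> finite (usupp v) \<Longrightarrow> card (usupp u) < card (usupp v)"
  by (simp add: extends_def psubset_card_mono)

text \<open>Eliminates the registers: what remains is a triangular system. An extension has strictly
  larger support, so decreasing support size is an admissible processing order.\<close>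

theorem result_recursive_inversion:
  assumes us: "distinct us" and fin: "\<And>u. u \<in> set us \<Longrightarrow> finite (usupp u)"
    and k: "\<And>u. u \<in> set us \<Longrightarrow> card (usupp u) \<le> k"
    and X: "X = result (recursive_inversion k us Lh)"
  shows "u \<notin> set us \<Longrightarrow> X u = 0"
    and "u \<in> set us \<Longrightarrow> X u = local_value Lh u - (\<Sum>v\<in>{v\<in>set us. extends v u}. X v)"
proof -
  \<comment> \<open>The order in which pairs are really processed: buckets of equal support size,
    largest first.\<close>
  define ws where "ws = concat (map (\<lambda>s. filter (\<lambda>u. card (usupp u) = s) us) (rev [0..<Suc k]))"
  have init: "result (for_each (\<lambda>u R. do { tick (2 * (card (usupp u) + 1)); ret (R(u := 0)) }) us (\<lambda>_. 0)) = (\<lambda>_. 0)"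
    for us :: "(pstr \<times> pstr) list"
    by (induction us) (auto simp: fun_upd_idem)
  obtain R X' where RX: "result (for_each (process_pair (set us) Lh) ws (\<lambda>_. 0, \<lambda>_. 0)) = (R, X')"
    by fastforce
  have "X = X'" unfolding X recursive_inversion_def timed_simps init for_each_nested ws_def[symmetric] RX
    by simp
  have "set ws = {u \<in> set us. card (usupp u) \<le> k}"
    unfolding ws_def set_concat set_map set_filter set_rev set_upt by force
  then have set_ws: "set ws = set us" using k by blast
  have dist: "distinct (concat (map (\<lambda>s. filter (\<lambda>u. card (usupp u) = s) us) ss))" if "distinct ss" for ss
    using that us by (induction ss) auto
  have sorted: "sorted_wrt (\<lambda>v u. card (usupp u) \<le> card (usupp v)) (concat (map (\<lambda>s. filter (\<lambda>u. card (usupp u) = s) us) ss))"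
    if "sorted_wrt (\<lambda>s t. t \<le> s) ss" for ss
    using that
  proof (induction ss)
    case (Cons s ss)
    have "sorted_wrt (\<lambda>v u. card (usupp u) \<le> card (usupp v)) (filter (\<lambda>u. card (usupp u) = s) us)"
      by (induction us) auto
    then show ?case using Cons by (auto simp: sorted_wrt_append)
  qed simp
  have sr: "sorted_wrt (\<lambda>s t. t \<le> s) (rev [0..<Suc k])"
    by (simp add: sorted_wrt_rev del: upt_Suc)
  have "sorted_wrt (\<lambda>v u. \<not> extends u v) ws"
  proof (rule sorted_wrt_mono_rel[rotated])
    show "sorted_wrt (\<lambda>v u. card (usupp u) \<le> card (usupp v)) ws" unfolding ws_def by (rule sorted[OF sr])
    fix v u assume "v \<in> set ws" "u \<in> set ws" "card (usupp u) \<le> card (usupp v)"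
    then show "\<not> extends u v" using extends_card_less[of u v] fin set_ws by fastforce
  qed
  moreover have "distinct ws" unfolding ws_def by (rule dist) simp
  ultimately have *:  "(\<forall>u. u \<notin> set ws \<longrightarrow> X' u = 0) \<and>
    (\<forall>u\<in>set ws. X' u = local_value Lh u - (\<Sum>v\<in>{v\<in>set ws. extends v u}. X' v))"
  proof -
    assume "distinct ws" "sorted_wrt (\<lambda>v u. \<not> extends u v) ws"
    moreover have "set ws \<subseteq> set us" "\<And>u. u \<in> set ws \<Longrightarrow> finite (usupp u)" using set_ws fin by auto
    ultimately show ?thesis by (rule conjunct2[OF result_process_list[OF _ _ _ _ RX]])
  qed
  note a = conjunct1[OF *] and b = conjunct2[OF *]
  show "X u = 0" if "u \<notin> set us" using that a unfolding set_ws \<open>X = X'\<close> by blast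
  show "X u = local_value Lh u - (\<Sum>v\<in>{v\<in>set us. extends v u}. X v)" if "u \<in> set us"
    using b that unfolding set_ws \<open>X = X'\<close> by (rule bspec)
qed

text \<open>The equation for \<open>hh\<close> holds at every string and not only where the program
  writes: if neither \<open>(P, Id_str)\<close> nor \<open>(Id_str, P)\<close> is in the list, the
  initial 0 agrees with it because \<open>X\<close> vanishes off the list. The same applies to
  \<open>Gh\<close>.\<close>

theorem result_postprocess:
  assumes us: "distinct us" and fin: "\<And>u. u \<in> set us \<Longrightarrow> finite (usupp u)"
    and k: "\<And>u. u \<in> set us \<Longrightarrow> card (usupp u) \<le> k" and I: "(Id_str, Id_str) \<notin> set us"
  obtains X Gh hh where "result (postprocess k us Lh) = (X, Gh, hh)"
    "X = result (recursive_inversion k us Lh)"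
    "\<And>P Q. P \<noteq> Id_str \<Longrightarrow> Q \<noteq> Id_str \<Longrightarrow> Gh (P, Q) = X (P, Q)"
    "\<And>P. hh P = \<i> / 2 * (X (P, Id_str) - X (Id_str, P))"
proof -
  define X where "X = result (recursive_inversion k us Lh)"
  have X0: "X u = 0" if "u \<notin> set us" for u
    using result_recursive_inversion(1)[OF us fin k X_def] that by blast
  define f where "f = (\<lambda>(P, Q) (G, h). do {
         tick (card (usupp (P, Q)) + 1);
         if P \<noteq> Id_str \<and> Q \<noteq> Id_str then do {
           tick (2 * (card (usupp (P, Q)) + 1));
           ret (G((P, Q) := X (P, Q)), h) }
         else do {
           let A = (if Q = Id_str then P else Q);
           tick (3 * (card (usupp (P, Q)) + 1) + 2);
           ret (G, h(A := \<i> / 2 * (X (A, Id_str) - X (Id_str, A)))) } })"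
  have G: "fst (result (for_each f vs (\<lambda>_. 0, \<lambda>_. 0))) (P, Q) = (if (P, Q) \<in> set vs then X (P, Q) else 0)"
    if "P \<noteq> Id_str" "Q \<noteq> Id_str" for P Q vs
    using that
    by (induction vs rule: rev_induct) (auto simp: for_each_append f_def Let_def split: prod.splits)
  have h: "snd (result (for_each f vs (\<lambda>_. 0, \<lambda>_. 0))) P = \<i> / 2 * (X (P, Id_str) - X (Id_str, P)) \<or>
    (snd (result (for_each f vs (\<lambda>_. 0, \<lambda>_. 0))) P = 0 \<and> (P, Id_str) \<notin> set vs \<and> (Id_str, P) \<notin> set vs)" for P vs
    by (induction vs rule: rev_induct) (auto simp: for_each_append f_def Let_def split: prod.splits)
  obtain Gh hh where GH: "result (for_each f us (\<lambda>_. 0, \<lambda>_. 0)) = (Gh, hh)" by fastforce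
  have "result (postprocess k us Lh) = (X, Gh, hh)"
    unfolding postprocess_def timed_simps X_def[symmetric] f_def[symmetric] GH ..
  moreover have "Gh (P, Q) = X (P, Q)" if "P \<noteq> Id_str" "Q \<noteq> Id_str" for P Q
    using G[OF that, of us] GH X0 by auto
  moreover have "hh P = \<i> / 2 * (X (P, Id_str) - X (Id_str, P))" for P
    using h[of us P] GH X0 by auto
  ultimately show ?thesis using that X_def by blast
qed

section \<open>Number of steps\<close>

definition process_cost :: "nat \<Rightarrow> nat" where
  "process_cost s = (s + 1) + 2 * (s + 1) * 16 ^ s + 16 ^ s * (2 * (s + 1) + trace_cost s + 2 + 1) + (3 * s + 1) +
     (2 * (s + 1) + 1) + ((s + 1) * 2 ^ s + 2 ^ s * ((s + 1) + (s + 1) + (2 * (s + 1) + 1) + 1))"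

lemma cost_process_pair:
  assumes "finite (usupp u)"
  shows "cost (process_pair \<Omega> Lh u RX) \<le> process_cost (card (usupp u))"
proof -
  let ?s = "card (usupp u)" and ?qs = "sorted_list_of_set (usupp u)"
  obtain R X where RX: "RX = (R, X)" by fastforce
  have d: "distinct ?qs" using assms by auto
  have len: "length (List.product (pstr_list ?qs) (pstr_list ?qs)) = 16 ^ ?s"
    using pstr_list(3)[OF d] assms by (simp add: length_product power_mult_distrib[symmetric])
  have "cost (for_each (\<lambda>(A, B) acc. do {
         tick (2 * (?s + 1));
         tick (trace_cost ?s);
         tick 2;
         ret (acc + Lh A B * tr (pauli_mat ?qs A * pauli_mat ?qs (snd u) *
                                 pauli_mat ?qs B * pauli_mat ?qs (fst u))) })
       (List.product (pstr_list ?qs) (pstr_list ?qs)) 0) \<le>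
       length (List.product (pstr_list ?qs) (pstr_list ?qs)) * ((2 * (?s + 1) + trace_cost ?s + 2) + 1)"
    by (rule cost_for_each_le) (auto split: prod.splits)
  then have 1: "cost (local_inversion Lh u) \<le> (?s + 1) + 2 * (?s + 1) * 16 ^ ?s +
      16 ^ ?s * (2 * (?s + 1) + trace_cost ?s + 2 + 1) + (3 * ?s + 1)"
    unfolding len local_inversion_def Let_def by simp
  have 2: "cost (propagate \<Omega> u x R) \<le> (?s + 1) * 2 ^ ?s + 2 ^ ?s * ((?s + 1) + (?s + 1) + (2 * (?s + 1) + 1) + 1)" for x R
  proof -
    have "cost (propagate \<Omega> u x R) \<le> (?s + 1) * 2 ^ ?s +
       length (map set (subseqs ?qs)) * (((?s + 1) + (?s + 1) + (2 * (?s + 1) + 1)) + 1)"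
      unfolding propagate_def Let_def timed_simps
      by (intro add_mono order_refl cost_for_each_le) auto
    then show ?thesis using set_subset_list(3)[OF assms] by simp
  qed
  show ?thesis
    using 1 2[of "result (local_inversion Lh u) - R u" R]
    by (simp add: RX process_pair_def process_cost_def Let_def)
qed

text \<open>Each of the \<open>k + 1\<close> passes reads the whole list, and the bound on the work
  per pair depends on its support size alone. The maximum with 1 covers the ticks of the outer loop,
  which occur even for an empty list.\<close>

theorem cost_postprocess:
  "\<exists>Ck>0. \<forall>us Lh. distinct us \<longrightarrow> (\<forall>u\<in>set us. finite (usupp u) \<and> card (usupp u) \<le> k) \<longrightarrow>
     real (cost (postprocess k us Lh)) \<le> Ck * max 1 (real (card (set us)))"
proof -
  \<comment> \<open>A sum over all sizes dominates each summand, which spares a proof that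
    \<open>process_cost\<close> is monotone.\<close>
  define M where "M = (\<Sum>s\<le>k. process_cost s)"
  define c where "c = (2 * (k + 1) + 1) + (k + 1) * (((k + 1) + M + 1) + 1) + ((k + 1) + (3 * (k + 1) + 2) + 1)"
  have M: "process_cost s \<le> M" if "s \<le> k" for s
    unfolding M_def by (rule member_le_sum) (use that in auto)
  have "real (cost (postprocess k us Lh)) \<le> real c * max 1 (real (card (set us)))"
    if us: "distinct us" "\<forall>u\<in>set us. finite (usupp u) \<and> card (usupp u) \<le> k" for us Lh
  proof -
    let ?m = "max 1 (length us)"
    have c1: "cost (for_each (\<lambda>u R. do { tick (2 * (card (usupp u) + 1)); ret (R(u := 0)) }) us (\<lambda>_. 0 :: complex))
        \<le> length us * (2 * (k + 1) + 1)"
      by (rule cost_for_each_le) (use us in auto)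
    have p: "cost (process_pair (set us) Lh u RX) \<le> M" if "u \<in> set us" for u RX
      using cost_process_pair[of u "set us" Lh RX] M[of "card (usupp u)"] us that by fastforce
    have c2: "cost (for_each (\<lambda>s. for_each (\<lambda>u RX. do {
               tick (card (usupp u) + 1);
               if card (usupp u) = s then process_pair (set us) Lh u RX else ret RX }) us)
            (rev [0..<Suc k]) RX) \<le> length (rev [0..<Suc k]) * (length us * (((k + 1) + M) + 1) + 1)" for RX
    proof (intro cost_for_each_le)
      fix s u RX assume u: "u \<in> set us"
      then have "card (usupp u) \<le> k" using us by simp
      then show "cost (do { tick (card (usupp u) + 1);
          if card (usupp u) = s then process_pair (set us) Lh u RX else ret RX }) \<le> (k + 1) + M"
        using p[OF u, of RX] by auto
    qed
    have c3: "cost (for_each (\<lambda>(P, Q) (G, h). do {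
         tick (card (usupp (P, Q)) + 1);
         if P \<noteq> Id_str \<and> Q \<noteq> Id_str then do {
           tick (2 * (card (usupp (P, Q)) + 1));
           ret (G((P, Q) := X (P, Q)), h) }
         else do {
           let A = (if Q = Id_str then P else Q);
           tick (3 * (card (usupp (P, Q)) + 1) + 2);
           ret (G, h(A := \<i> / 2 * (X (A, Id_str) - X (Id_str, A)))) } })
       us Gh) \<le> length us * (((k + 1) + (3 * (k + 1) + 2)) + 1)" for X Gh
    proof (rule cost_for_each_le, goal_cases)
      case (1 u Gh)
      obtain P Q G h where e: "u = (P, Q)" "Gh = (G, h)" by (metis surj_pair)
      have "card (usupp (P, Q)) \<le> k" using us 1 e by auto
      then show ?case unfolding e by (simp add: Let_def)
    qed
    have "cost (postprocess k us Lh) \<le> length us * (2 * (k + 1) + 1) +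
      (k + 1) * (length us * (((k + 1) + M) + 1) + 1) + length us * (((k + 1) + (3 * (k + 1) + 2)) + 1)"
      unfolding postprocess_def recursive_inversion_def timed_simps
    proof (intro add_mono, goal_cases)
      case 1 show ?case by (rule c1)
    next
      case 2 show ?case using c2 by simp
    next
      case 3 show ?case using c3 by simp
    qed
    also have "\<dots> \<le> ?m * (2 * (k + 1) + 1) +
      (k + 1) * (?m * (((k + 1) + M) + 1) + ?m) + ?m * (((k + 1) + (3 * (k + 1) + 2)) + 1)"
      by (intro add_mono mult_le_mono) auto
    also have "\<dots> = c * ?m" unfolding c_def by (simp add: algebra_simps)
    finally have "real (cost (postprocess k us Lh)) \<le> real (c * ?m)" by (rule of_nat_mono)
    then show ?thesis using distinct_card[OF us(1)] by (simp add: of_nat_max)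
  qed
  moreover have "0 < real c" unfolding of_nat_0_less_iff by (simp add: c_def)
  ultimately show ?thesis by blast
qed

section \<open>Local inversion and uniqueness of the coefficients\<close>

lemma pstrs_outside: "P \<in> pstrs S \<Longrightarrow> q \<notin> S \<Longrightarrow> P q = PI"
  by (auto simp: pstrs_def supp_def)

text \<open>The sum of \<open>P \<otimes> P\<close> over all strings is \<open>2 ^ n\<close> times
  the swap operator. It suffices to check one qubit, as the entries factor over the bits of the
  indices.\<close>

lemma pmat_complete:
  assumes "i < 2 ^ n" "j < 2 ^ n" "k < 2 ^ n" "l < 2 ^ n"
  shows "(\<Sum>P\<in>pstrs {..<n}. pmat n P $$ (i, j) * pmat n P $$ (k, l)) = (if i = l \<and> j = k then 2 ^ n else 0)"
proof -
  have pe: "(\<Sum>a\<in>UNIV. pauli_entry a x y * pauli_entry a z w) = (if x = w \<and> y = z then 2 else 0)" for x y z w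
    by (cases x; cases y; cases z; cases w; simp add: sum_pauli)
  have bits: "i = l \<longleftrightarrow> (\<forall>q<n. bit i q = bit l q)" if "i < 2 ^ n" "l < 2 ^ n" for i l :: nat
  proof
    assume "\<forall>q<n. bit i q = bit l q"
    then have "take_bit n i = take_bit n l" by (intro bit_eqI) (auto simp: bit_take_bit_iff)
    then show "i = l" using that by (simp add: take_bit_nat_eq_self)
  qed simp
  have "(\<Sum>P\<in>pstrs {..<n}. pmat n P $$ (i, j) * pmat n P $$ (k, l)) =
     (\<Sum>P\<in>pstrs {..<n}. \<Prod>q<n. pauli_entry (P q) (bit i q) (bit j q) * pauli_entry (P q) (bit k q) (bit l q))"
    using assms by (intro sum.cong refl) (simp add: pauli_mat_def tensor_mat_index prod.distrib)
  also have "\<dots> = (\<Prod>q<n. if bit i q = bit l q \<and> bit j q = bit k q then 2 else 0)"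
    by (subst sum_pstrs_prod) (auto simp: pe)
  also have "\<dots> = (if i = l \<and> j = k then 2 ^ n else 0)"
  proof (cases "i = l \<and> j = k")
    case False
    then have "\<exists>q<n. \<not> (bit i q = bit l q \<and> bit j q = bit k q)"
      using bits[of i l] bits[of j k] assms by blast
    then show ?thesis using False by (auto intro!: prod_zero)
  qed simp
  finally show ?thesis .
qed

lemma pauli_expansion:
  assumes "X \<in> carrier_mat (2 ^ n) (2 ^ n)"
  shows "X = msum (2 ^ n) (pstrs {..<n}) (\<lambda>P. (tr (X * pmat n P) / 2 ^ n) \<cdot>\<^sub>m pmat n P)"
proof (rule eq_matI)
  fix i j assume "i < dim_row (msum (2 ^ n) (pstrs {..<n}) (\<lambda>P. (tr (X * pmat n P) / 2 ^ n) \<cdot>\<^sub>m pmat n P))"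
    "j < dim_col (msum (2 ^ n) (pstrs {..<n}) (\<lambda>P. (tr (X * pmat n P) / 2 ^ n) \<cdot>\<^sub>m pmat n P))"
  then have ij: "i < 2 ^ n" "j < 2 ^ n" by auto
  have "(\<Sum>P\<in>pstrs {..<n}. tr (X * pmat n P) * pmat n P $$ (i, j)) =
     (\<Sum>P\<in>pstrs {..<n}. \<Sum>k<2 ^ n. \<Sum>l<2 ^ n. X $$ (k, l) * (pmat n P $$ (l, k) * pmat n P $$ (i, j)))"
    by (simp add: tr_mult[OF assms pmat_carrier] sum_distrib_left sum_distrib_right mult_ac)
  also have "\<dots> = (\<Sum>k<2 ^ n. \<Sum>P\<in>pstrs {..<n}. \<Sum>l<2 ^ n. X $$ (k, l) * (pmat n P $$ (l, k) * pmat n P $$ (i, j)))"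
    by (rule sum.swap)
  also have "\<dots> = (\<Sum>k<2 ^ n. \<Sum>l<2 ^ n. \<Sum>P\<in>pstrs {..<n}. X $$ (k, l) * (pmat n P $$ (l, k) * pmat n P $$ (i, j)))"
    by (intro sum.cong refl sum.swap)
  also have "\<dots> = (\<Sum>k<2 ^ n. \<Sum>l<2 ^ n. X $$ (k, l) * (if l = j \<and> k = i then 2 ^ n else 0))"
    using ij by (intro sum.cong refl) (simp add: sum_distrib_left[symmetric] pmat_complete)
  also have "\<dots> = (\<Sum>k<2 ^ n. if k = i then \<Sum>l<2 ^ n. if l = j then 2 ^ n * X $$ (k, l) else 0 else 0)"
    by (intro sum.cong refl) (auto simp: mult_delta_right mult.commute)
  also have "\<dots> = 2 ^ n * X $$ (i, j)" using ij by (simp only: sum.delta finite_lessThan lessThan_iff if_True)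
  finally show "X $$ (i, j) = msum (2 ^ n) (pstrs {..<n}) (\<lambda>P. (tr (X * pmat n P) / 2 ^ n) \<cdot>\<^sub>m pmat n P) $$ (i, j)"
    using ij by (simp add: sum_divide_distrib[symmetric] times_divide_eq_left)
qed (use assms in auto)

section \<open>Calculus of expansions in the maps \<open>M \<mapsto> P M Q\<close>\<close>

lemma chi_expansion_conj:
  assumes X: "X \<in> carrier_mat (2 ^ n) (2 ^ n)" and Y: "Y \<in> carrier_mat (2 ^ n) (2 ^ n)"
  shows "chi_expansion n (\<lambda>M. X * M * Y) (\<lambda>(P, Q). tr (X * pmat n P) * tr (Y * pmat n Q) / 4 ^ n)"
  unfolding chi_expansion_def
proof (intro ballI eq_matI)
  fix M :: "complex mat" and i j
  let ?N = "2 ^ n" and ?S = "pstrs {..<n}"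
  let ?x = "\<lambda>P. tr (X * pmat n P) / 2 ^ n" and ?y = "\<lambda>P. tr (Y * pmat n P) / 2 ^ n"
  let ?R = "msum ?N (?S \<times> ?S) (\<lambda>(P, Q). (case (P, Q) of (P, Q) \<Rightarrow> tr (X * pmat n P) * tr (Y * pmat n Q) / 4 ^ n)
             \<cdot>\<^sub>m (pmat n P * M * pmat n Q))"
  assume M: "M \<in> carrier_mat ?N ?N" and "i < dim_row ?R" "j < dim_col ?R"
  then have ij: "i < ?N" "j < ?N" by auto
  have "X * M * Y = msum ?N ?S (\<lambda>P. ?x P \<cdot>\<^sub>m pmat n P) * M * msum ?N ?S (\<lambda>Q. ?y Q \<cdot>\<^sub>m pmat n Q)"
    using pauli_expansion[OF X] pauli_expansion[OF Y] by simp
  also have "\<dots> = msum ?N ?S (\<lambda>P. ?x P \<cdot>\<^sub>m pmat n P * M) * msum ?N ?S (\<lambda>Q. ?y Q \<cdot>\<^sub>m pmat n Q)"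
    by (subst msum_mult[OF M]) auto
  also have "\<dots> = msum ?N ?S (\<lambda>P. (?x P \<cdot>\<^sub>m pmat n P * M) * msum ?N ?S (\<lambda>Q. ?y Q \<cdot>\<^sub>m pmat n Q))"
    by (subst msum_mult[OF msum_carrier]) (use M in auto)
  also have "\<dots> = msum ?N ?S (\<lambda>P. msum ?N ?S (\<lambda>Q. (?x P \<cdot>\<^sub>m pmat n P * M) * (?y Q \<cdot>\<^sub>m pmat n Q)))"
    by (intro msum_cong refl mult_msum) (use M in auto)
  also have "\<dots> = msum ?N ?S (\<lambda>P. msum ?N ?S (\<lambda>Q. (?x P * ?y Q) \<cdot>\<^sub>m (pmat n P * M * pmat n Q)))"
  proof (intro msum_cong refl)
    fix P Q
    have c: "pmat n P \<in> carrier_mat ?N ?N" "pmat n Q \<in> carrier_mat ?N ?N" by simp_all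
    then have c2: "pmat n P * M \<in> carrier_mat ?N ?N" using M by auto
    have "(?x P \<cdot>\<^sub>m pmat n P * M) * (?y Q \<cdot>\<^sub>m pmat n Q) = (?x P \<cdot>\<^sub>m (pmat n P * M)) * (?y Q \<cdot>\<^sub>m pmat n Q)"
      using mult_smult_assoc_mat[OF c(1) M] by simp
    also have "\<dots> = ?x P \<cdot>\<^sub>m ((pmat n P * M) * (?y Q \<cdot>\<^sub>m pmat n Q))"
      by (rule mult_smult_assoc_mat[OF c2]) (use c in auto)
    also have "\<dots> = ?x P \<cdot>\<^sub>m (?y Q \<cdot>\<^sub>m ((pmat n P * M) * pmat n Q))"
      by (subst mult_smult_distrib[OF c2 c(2)]) simp
    finally show "(?x P \<cdot>\<^sub>m pmat n P * M) * (?y Q \<cdot>\<^sub>m pmat n Q) = (?x P * ?y Q) \<cdot>\<^sub>m (pmat n P * M * pmat n Q)"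
      by (auto intro!: eq_matI)
  qed
  finally have e: "X * M * Y = msum ?N ?S (\<lambda>P. msum ?N ?S (\<lambda>Q. (?x P * ?y Q) \<cdot>\<^sub>m (pmat n P * M * pmat n Q)))" .
  show "(X * M * Y) $$ (i, j) = ?R $$ (i, j)"
    unfolding e using ij M
    by (auto simp: sum.cartesian_product power_mult_distrib[symmetric] intro!: sum.cong)
qed (use X Y in auto)

lemma chi_expansion_add:
  assumes "chi_expansion n F f" "chi_expansion n G g"
  shows "chi_expansion n (\<lambda>M. F M + G M) (\<lambda>u. f u + g u)"
  unfolding chi_expansion_def
proof
  fix M :: "complex mat" assume M: "M \<in> carrier_mat (2 ^ n) (2 ^ n)"
  note F = bspec[OF assms(1)[unfolded chi_expansion_def] M] and G = bspec[OF assms(2)[unfolded chi_expansion_def] M]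
  show "F M + G M = msum (2 ^ n) (pstrs {..<n} \<times> pstrs {..<n})
    (\<lambda>(P, Q). (f (P, Q) + g (P, Q)) \<cdot>\<^sub>m (pmat n P * M * pmat n Q))"
    unfolding F G by (rule eq_matI) (simp_all add: case_prod_unfold sum.distrib distrib_right del: index_mult_mat(1))
qed

lemma chi_expansion_minus:
  assumes "chi_expansion n F f" "chi_expansion n G g"
  shows "chi_expansion n (\<lambda>M. F M - G M) (\<lambda>u. f u - g u)"
  unfolding chi_expansion_def
proof
  fix M :: "complex mat" assume M: "M \<in> carrier_mat (2 ^ n) (2 ^ n)"
  note F = bspec[OF assms(1)[unfolded chi_expansion_def] M] and G = bspec[OF assms(2)[unfolded chi_expansion_def] M]
  show "F M - G M = msum (2 ^ n) (pstrs {..<n} \<times> pstrs {..<n})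
    (\<lambda>(P, Q). (f (P, Q) - g (P, Q)) \<cdot>\<^sub>m (pmat n P * M * pmat n Q))"
    unfolding F G by (rule eq_matI) (simp_all add: case_prod_unfold sum_subtractf left_diff_distrib del: index_mult_mat(1))
qed

lemma chi_expansion_smult:
  assumes "chi_expansion n F f"
  shows "chi_expansion n (\<lambda>M. c \<cdot>\<^sub>m F M) (\<lambda>u. c * f u)"
  unfolding chi_expansion_def
proof
  fix M :: "complex mat" assume M: "M \<in> carrier_mat (2 ^ n) (2 ^ n)"
  note F = bspec[OF assms[unfolded chi_expansion_def] M]
  show "c \<cdot>\<^sub>m F M = msum (2 ^ n) (pstrs {..<n} \<times> pstrs {..<n})
    (\<lambda>(P, Q). (c * f (P, Q)) \<cdot>\<^sub>m (pmat n P * M * pmat n Q))"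
    unfolding F by (rule eq_matI) (simp_all add: case_prod_unfold sum_distrib_left mult.assoc del: index_mult_mat(1))
qed

lemma chi_expansion_msum:
  assumes "\<And>a. a \<in> I \<Longrightarrow> chi_expansion n (F a) (f a)"
  shows "chi_expansion n (\<lambda>M. msum (2 ^ n) I (\<lambda>a. F a M)) (\<lambda>u. \<Sum>a\<in>I. f a u)"
  unfolding chi_expansion_def
proof (intro ballI eq_matI)
  fix M :: "complex mat" and i j
  let ?S = "pstrs {..<n} \<times> pstrs {..<n}"
  let ?R = "msum (2 ^ n) ?S (\<lambda>(P, Q). (\<Sum>a\<in>I. f a (P, Q)) \<cdot>\<^sub>m (pmat n P * M * pmat n Q))"
  assume M: "M \<in> carrier_mat (2 ^ n) (2 ^ n)" and "i < dim_row ?R" "j < dim_col ?R"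
  then have ij: "i < 2 ^ n" "j < 2 ^ n" by auto
  have "msum (2 ^ n) I (\<lambda>a. F a M) $$ (i, j) =
     (\<Sum>a\<in>I. \<Sum>u\<in>?S. f a u * (pmat n (fst u) * M * pmat n (snd u)) $$ (i, j))"
  proof -
    have "F a M $$ (i, j) = (\<Sum>u\<in>?S. f a u * (pmat n (fst u) * M * pmat n (snd u)) $$ (i, j))" if "a \<in> I" for a
      unfolding bspec[OF assms[OF that, unfolded chi_expansion_def] M] using ij by (simp add: case_prod_unfold del: index_mult_mat(1))
    then show ?thesis using ij by simp
  qed
  also have "\<dots> = (\<Sum>u\<in>?S. \<Sum>a\<in>I. f a u * (pmat n (fst u) * M * pmat n (snd u)) $$ (i, j))"
    by (rule sum.swap)
  also have "\<dots> = ?R $$ (i, j)"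
    using ij by (simp add: case_prod_unfold sum_distrib_right del: index_mult_mat(1))
  finally show "msum (2 ^ n) I (\<lambda>a. F a M) $$ (i, j) = ?R $$ (i, j)" .
qed auto

section \<open>Pauli transfer matrices and their inversion\<close>

lemma ptm_chi:
  assumes "chi_expansion n F chi"
  shows "ptm n F A B = (\<Sum>u\<in>pstrs {..<n} \<times> pstrs {..<n}. chi u *
     (\<Prod>q<n. pauli_trace4 (A q) (fst u q) (B q) (snd u q))) / 2 ^ n"
proof -
  let ?S = "pstrs {..<n} \<times> pstrs {..<n}"
  have "pmat n A * F (pmat n B) = msum (2 ^ n) ?S (\<lambda>u. pmat n A * (chi u \<cdot>\<^sub>m (pmat n (fst u) * pmat n B * pmat n (snd u))))"
    using assms by (subst mult_msum[symmetric]) (auto simp: chi_expansion_def case_prod_unfold)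
  also have "\<dots> = msum (2 ^ n) ?S (\<lambda>u. chi u \<cdot>\<^sub>m (pmat n A * pmat n (fst u) * pmat n B * pmat n (snd u)))"
  proof (intro msum_cong refl)
    fix u
    have "pmat n A * (chi u \<cdot>\<^sub>m (pmat n (fst u) * pmat n B * pmat n (snd u))) =
       chi u \<cdot>\<^sub>m (pmat n A * (pmat n (fst u) * pmat n B * pmat n (snd u)))"
      by (rule mult_smult_distrib) (auto intro!: mult_carrier_mat)
    also have "pmat n A * (pmat n (fst u) * pmat n B * pmat n (snd u)) =
        pmat n A * pmat n (fst u) * pmat n B * pmat n (snd u)"
    proof -
      have "pmat n A * (pmat n (fst u) * pmat n B * pmat n (snd u)) = pmat n A * (pmat n (fst u) * pmat n B) * pmat n (snd u)"
        by (rule assoc_mult_mat[symmetric]) (auto intro!: mult_carrier_mat)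
      also have "pmat n A * (pmat n (fst u) * pmat n B) = pmat n A * pmat n (fst u) * pmat n B"
        by (rule assoc_mult_mat[symmetric]) auto
      finally show ?thesis .
    qed
    finally show "pmat n A * (chi u \<cdot>\<^sub>m (pmat n (fst u) * pmat n B * pmat n (snd u))) =
       chi u \<cdot>\<^sub>m (pmat n A * pmat n (fst u) * pmat n B * pmat n (snd u))" .
  qed
  finally have "tr (pmat n A * F (pmat n B)) =
      (\<Sum>u\<in>?S. tr (chi u \<cdot>\<^sub>m (pmat n A * pmat n (fst u) * pmat n B * pmat n (snd u))))"
    by (subst tr_msum[symmetric, where N="2 ^ n"]) (auto intro!: mult_carrier_mat)
  also have "\<dots> = (\<Sum>u\<in>?S. chi u * (\<Prod>q<n. pauli_trace4 (A q) (fst u q) (B q) (snd u q)))"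
    by (intro sum.cong refl, subst tr_smult[where N="2 ^ n"]) (auto simp: tr_pmat4 intro!: mult_carrier_mat)
  finally show ?thesis unfolding ptm_def by simp
qed

text \<open>The weight \<open>pauli_trace4 (A q) (Q q) (B q) (P q)\<close> is the conjugate of the
  factor with which \<open>(P, Q)\<close> enters the PTM entry at \<open>(A, B)\<close>, so this is
  the inverse transform. A set of qubits instead of a sorted list leaves only products.\<close>

definition inversion_sum :: "nat set \<Rightarrow> (pstr \<Rightarrow> pstr \<Rightarrow> complex) \<Rightarrow> pstr \<Rightarrow> pstr \<Rightarrow> complex" where
  "inversion_sum S L P Q = (\<Sum>A\<in>pstrs S. \<Sum>B\<in>pstrs S. L A B *
     (\<Prod>q\<in>S. pauli_trace4 (A q) (Q q) (B q) (P q))) / 8 ^ card S"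

lemma local_value_inversion_sum:
  assumes "finite (usupp u)"
  shows "local_value L u = inversion_sum (usupp u) L (fst u) (snd u)"
proof -
  have "distinct (sorted_list_of_set (usupp u))" "set (sorted_list_of_set (usupp u)) = usupp u"
    using assms by auto
  then show ?thesis
    by (simp add: local_value_def inversion_sum_def Let_def tr_pauli_mat4 power_mult)
qed

lemma sum_pstrs2_prod:
  fixes F :: "nat \<Rightarrow> pauli \<Rightarrow> pauli \<Rightarrow> 'c::comm_semiring_1"
  assumes "finite S"
  shows "(\<Sum>A\<in>pstrs S. \<Sum>B\<in>pstrs S. \<Prod>q\<in>S. F q (A q) (B q)) = (\<Prod>q\<in>S. \<Sum>a\<in>UNIV. \<Sum>b\<in>UNIV. F q a b)"
proof -
  have "(\<Sum>A\<in>pstrs S. \<Sum>B\<in>pstrs S. \<Prod>q\<in>S. F q (A q) (B q)) =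
     (\<Sum>A\<in>pstrs S. \<Prod>q\<in>S. \<Sum>b\<in>UNIV. F q (A q) b)"
    by (intro sum.cong refl) (rule sum_pstrs_prod[OF assms])
  also have "\<dots> = (\<Prod>q\<in>S. \<Sum>a\<in>UNIV. \<Sum>b\<in>UNIV. F q a b)"
    by (rule sum_pstrs_prod[OF assms])
  finally show ?thesis .
qed

lemma prod_if_const:
  "finite S \<Longrightarrow> (\<Prod>q\<in>S. if p q then c else 0) = (if \<forall>q\<in>S. p q then c ^ card S else (0::'a::comm_semiring_1))"
proof (cases "\<forall>q\<in>S. p q")
  case False
  moreover assume "finite S"
  ultimately show ?thesis by (auto intro!: prod_zero)
qed simp

text \<open>Outside \<open>S\<close> the strings \<open>A\<close> and \<open>B\<close> are trivial,
  so the one-qubit trace forces the two letters of \<open>u\<close> to agree there; inside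
  \<open>S\<close> completeness forces them to be those of \<open>P\<close> and \<open>Q\<close>.
  What survives are the pairs \<open>(P \<otimes> C, Q \<otimes> C)\<close>, including the trivial
  \<open>C\<close>.\<close>

lemma inversion_sum_ptm:
  assumes chi: "chi_expansion n F chi" and S: "S \<subseteq> {..<n}" and P: "P \<in> pstrs S" "Q \<in> pstrs S"
  shows "inversion_sum S (ptm n F) P Q = (\<Sum>C\<in>pstrs ({..<n} - S). chi (glue S P C, glue S Q C))"
proof -
  let ?U = "pstrs {..<n} \<times> pstrs {..<n}" and ?s = "card S"
  have fS: "finite S" using S finite_subset by blast
  have card: "card ({..<n} - S) = n - ?s" "?s \<le> n"
    using S fS card_mono[OF _ S] by (auto simp: card_Diff_subset)
  define W where "W u = (if (\<forall>q\<in>S. fst u q = P q \<and> snd u q = Q q) \<and> (\<forall>q\<in>{..<n} - S. fst u q = snd u q)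
    then 1 else 0 :: complex)" for u
  have split: "(\<Prod>q<n. pauli_trace4 (A q) (fst u q) (B q) (snd u q)) =
     (\<Prod>q\<in>S. pauli_trace4 (A q) (fst u q) (B q) (snd u q)) *
     (if \<forall>q\<in>{..<n} - S. fst u q = snd u q then 2 ^ (n - ?s) else 0)"
    if "A \<in> pstrs S" "B \<in> pstrs S" for A B u
  proof -
    have "(\<Prod>q\<in>{..<n} - S. pauli_trace4 (A q) (fst u q) (B q) (snd u q)) =
        (\<Prod>q\<in>{..<n} - S. if fst u q = snd u q then 2 else 0)"
    proof (rule prod.cong[OF refl])
      fix q assume "q \<in> {..<n} - S"
      then have "A q = PI" "B q = PI" using that by (auto simp: pstrs_def supp_def)
      then show "pauli_trace4 (A q) (fst u q) (B q) (snd u q) = (if fst u q = snd u q then 2 else 0)"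
        by (simp add: pauli_trace4_Id)
    qed
    also have "\<dots> = (if \<forall>q\<in>{..<n} - S. fst u q = snd u q then 2 ^ (n - ?s) else 0)"
      using card by (subst prod_if_const) auto
    finally show ?thesis
      using prod.subset_diff[OF S, of "\<lambda>q. pauli_trace4 (A q) (fst u q) (B q) (snd u q)"]
      by (simp add: mult.commute)
  qed
  have W: "(\<Sum>A\<in>pstrs S. \<Sum>B\<in>pstrs S. (\<Prod>q<n. pauli_trace4 (A q) (fst u q) (B q) (snd u q)) *
       (\<Prod>q\<in>S. pauli_trace4 (A q) (Q q) (B q) (P q))) = 2 ^ n * 8 ^ ?s * W u" for u
  proof -
    let ?c = "if \<forall>q\<in>{..<n} - S. fst u q = snd u q then 2 ^ (n - ?s) else 0 :: complex"
    have "(\<Sum>A\<in>pstrs S. \<Sum>B\<in>pstrs S. (\<Prod>q<n. pauli_trace4 (A q) (fst u q) (B q) (snd u q)) *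
       (\<Prod>q\<in>S. pauli_trace4 (A q) (Q q) (B q) (P q))) =
      (\<Sum>A\<in>pstrs S. \<Sum>B\<in>pstrs S. ?c * (\<Prod>q\<in>S. pauli_trace4 (A q) (fst u q) (B q) (snd u q) *
          pauli_trace4 (A q) (Q q) (B q) (P q)))"
      by (intro sum.cong refl) (simp add: split prod.distrib mult_ac)
    also have "\<dots> = ?c * (\<Prod>q\<in>S. \<Sum>a\<in>UNIV. \<Sum>b\<in>UNIV. pauli_trace4 a (fst u q) b (snd u q) *
          pauli_trace4 a (Q q) b (P q))"
      by (simp only: sum_distrib_left[symmetric] sum_pstrs2_prod[OF fS,
        of "\<lambda>q a b. pauli_trace4 a (fst u q) b (snd u q) * pauli_trace4 a (Q q) b (P q)"])
    also have "\<dots> = ?c * (if \<forall>q\<in>S. fst u q = P q \<and> snd u q = Q q then 16 ^ ?s else 0)"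
      by (simp only: pauli_trace4_complete prod_if_const[OF fS])
    also have "\<dots> = 2 ^ n * 8 ^ ?s * W u"
    proof -
      \<comment> \<open>A factor 2 from each qubit outside \<open>S\<close> and 16 from each inside:
        together the PTM normalisation \<open>2 ^ n\<close> times the normalisation
        \<open>8 ^ ?s\<close> of the inversion.\<close>
      have "(2::complex) ^ (n - ?s) * 16 ^ ?s = 2 ^ n * 8 ^ ?s"
      proof -
        have "(2::complex) ^ n = 2 ^ (n - ?s) * 2 ^ ?s" using card(2) by (simp flip: power_add)
        moreover have "(16::complex) ^ ?s = 2 ^ ?s * 8 ^ ?s" by (simp flip: power_mult_distrib)
        ultimately show ?thesis by simp
      qed
      then show ?thesis by (auto simp: W_def)
    qed
    finally show ?thesis .
  qed
  have "inversion_sum S (ptm n F) P Q =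
     (\<Sum>A\<in>pstrs S. \<Sum>B\<in>pstrs S. \<Sum>u\<in>?U. chi u * ((\<Prod>q<n. pauli_trace4 (A q) (fst u q) (B q) (snd u q)) *
       (\<Prod>q\<in>S. pauli_trace4 (A q) (Q q) (B q) (P q)))) / 2 ^ n / 8 ^ ?s"
  proof -
    have "(\<Sum>u\<in>?U. chi u * (\<Prod>q<n. pauli_trace4 (A q) (fst u q) (B q) (snd u q))) / 2 ^ n *
        (\<Prod>q\<in>S. pauli_trace4 (A q) (Q q) (B q) (P q)) =
      (\<Sum>u\<in>?U. chi u * ((\<Prod>q<n. pauli_trace4 (A q) (fst u q) (B q) (snd u q)) *
        (\<Prod>q\<in>S. pauli_trace4 (A q) (Q q) (B q) (P q)))) / 2 ^ n" for A B
      unfolding times_divide_eq_left sum_distrib_right mult.assoc ..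
    then show ?thesis
      unfolding inversion_sum_def ptm_chi[OF chi] by (simp only: sum_divide_distrib[symmetric])
  qed
  also have "(\<Sum>A\<in>pstrs S. \<Sum>B\<in>pstrs S. \<Sum>u\<in>?U. chi u * ((\<Prod>q<n. pauli_trace4 (A q) (fst u q) (B q) (snd u q)) *
       (\<Prod>q\<in>S. pauli_trace4 (A q) (Q q) (B q) (P q)))) =
     (\<Sum>A\<in>pstrs S. \<Sum>u\<in>?U. \<Sum>B\<in>pstrs S. chi u * ((\<Prod>q<n. pauli_trace4 (A q) (fst u q) (B q) (snd u q)) *
       (\<Prod>q\<in>S. pauli_trace4 (A q) (Q q) (B q) (P q))))"
    by (intro sum.cong refl sum.swap)
  also have "\<dots> = (\<Sum>u\<in>?U. \<Sum>A\<in>pstrs S. \<Sum>B\<in>pstrs S. chi u * ((\<Prod>q<n. pauli_trace4 (A q) (fst u q) (B q) (snd u q)) *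
       (\<Prod>q\<in>S. pauli_trace4 (A q) (Q q) (B q) (P q))))"
    by (rule sum.swap)
  also have "\<dots> = (\<Sum>u\<in>?U. chi u * (2 ^ n * 8 ^ ?s * W u))"
    by (simp only: sum_distrib_left[symmetric] W)
  also have "\<dots> / 2 ^ n / 8 ^ ?s = (\<Sum>u\<in>?U. chi u * W u)"
    by (simp add: sum_divide_distrib)
  also have "\<dots> = (\<Sum>u\<in>(\<lambda>C. (glue S P C, glue S Q C)) ` pstrs ({..<n} - S). chi u)"
  proof (rule sum.mono_neutral_cong_right)
    show "finite ?U" by (simp add: finite_pstrs)
    have g: "glue S P C \<in> pstrs {..<n}" if "C \<in> pstrs ({..<n} - S)" "P \<in> pstrs S" for P C
      using that S by (auto simp: pstrs_def supp_def glue_def split: if_splits)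
    show "(\<lambda>C. (glue S P C, glue S Q C)) ` pstrs ({..<n} - S) \<subseteq> ?U" using g P by auto
    show "\<forall>u\<in>?U - (\<lambda>C. (glue S P C, glue S Q C)) ` pstrs ({..<n} - S). chi u * W u = 0"
    proof (intro ballI, rule ccontr)
      fix u assume u: "u \<in> ?U - (\<lambda>C. (glue S P C, glue S Q C)) ` pstrs ({..<n} - S)" and "chi u * W u \<noteq> 0"
      then have eq: "\<forall>q\<in>S. fst u q = P q \<and> snd u q = Q q" "\<forall>q\<in>{..<n} - S. fst u q = snd u q"
        by (auto simp: W_def split: if_splits)
      have o: "fst u q = PI \<and> snd u q = PI" if "q \<notin> {..<n}" for q
        using u that by (auto simp: pstrs_def supp_def)
      let ?C = "restr ({..<n} - S) (fst u)"
      have "?C \<in> pstrs ({..<n} - S)" by (auto simp: pstrs_def supp_def restr_def)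
      moreover have "fst u = glue S P ?C"
      proof
        fix q show "fst u q = glue S P ?C q" using eq o[of q] by (auto simp: glue_def restr_def)
      qed
      moreover have "snd u = glue S Q ?C"
      proof
        fix q show "snd u q = glue S Q ?C q" using eq o[of q] by (auto simp: glue_def restr_def)
      qed
      ultimately have "u = (glue S P ?C, glue S Q ?C)" by (metis prod.collapse)
      then show False using u \<open>?C \<in> pstrs ({..<n} - S)\<close> by blast
    qed
    fix u assume "u \<in> (\<lambda>C. (glue S P C, glue S Q C)) ` pstrs ({..<n} - S)"
    then show "chi u * W u = chi u" by (auto simp: W_def glue_def)
  qed
  also have "\<dots> = (\<Sum>C\<in>pstrs ({..<n} - S). chi (glue S P C, glue S Q C))"
  proof (subst sum.reindex)
    show "inj_on (\<lambda>C. (glue S P C, glue S Q C)) (pstrs ({..<n} - S))"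
    proof (rule inj_onI)
      fix C D assume CD: "C \<in> pstrs ({..<n} - S)" "D \<in> pstrs ({..<n} - S)"
        "(glue S P C, glue S Q C) = (glue S P D, glue S Q D)"
      then have "glue S P C = glue S P D" by simp
      show "C = D"
      proof (rule pstrs_ext[OF CD(1,2)])
        fix q assume "q \<in> {..<n} - S"
        then show "C q = D q" using fun_cong[OF \<open>glue S P C = glue S P D\<close>, of q] by (simp add: glue_def)
      qed
    qed
  qed simp
  finally show ?thesis .
qed

text \<open>Over the whole register no nontrivial extension is left, so the inversion returns a
  single coefficient. As it reads only the superoperator, expansions are unique.\<close>

lemma inversion_sum_ptm_full:
  assumes "chi_expansion n F chi" "P \<in> pstrs {..<n}" "Q \<in> pstrs {..<n}"
  shows "inversion_sum {..<n} (ptm n F) P Q = chi (P, Q)"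
proof -
  have "pstrs ({..<n} - {..<n}) = {Id_str}"
    by (auto simp: pstrs_def supp_def Id_str_def)
  moreover have "glue {..<n} R Id_str = R" if "R \<in> pstrs {..<n}" for R
  proof
    fix q show "glue {..<n} R Id_str q = R q"
      using pstrs_outside[OF that, of q] by (cases "q < n") (auto simp: glue_def Id_str_def)
  qed
  ultimately show ?thesis using inversion_sum_ptm[OF assms(1) subset_refl assms(2,3)] assms by simp
qed

lemma chi_expansion_unique:
  assumes "chi_expansion n F chi" "chi_expansion n F chi'" "u \<in> pstrs {..<n} \<times> pstrs {..<n}"
  shows "chi u = chi' u"
  using inversion_sum_ptm_full[OF assms(1), of "fst u" "snd u"] inversion_sum_ptm_full[OF assms(2), of "fst u" "snd u"] assms(3)
  by auto

lemma chi_expansion_cong: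
  assumes "chi_expansion n F chi" "\<And>M. M \<in> carrier_mat (2 ^ n) (2 ^ n) \<Longrightarrow> F M = G M"
  shows "chi_expansion n G chi"
  using assms by (simp add: chi_expansion_def)

section \<open>Coefficients of a local generator\<close>

lemma tr_msum_mult:
  assumes "\<And>a. a \<in> I \<Longrightarrow> F a \<in> carrier_mat N N" "X \<in> carrier_mat N N"
  shows "tr (msum N I (\<lambda>a. c a \<cdot>\<^sub>m F a) * X) = (\<Sum>a\<in>I. c a * tr (F a * X))"
proof -
  have "msum N I (\<lambda>a. c a \<cdot>\<^sub>m F a) * X = msum N I (\<lambda>a. c a \<cdot>\<^sub>m (F a * X))"
    using assms by (subst msum_mult) (auto intro!: msum_cong mult_smult_assoc_mat)
  moreover have "F a * X \<in> carrier_mat N N" if "a \<in> I" for a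
    using assms(1)[OF that] assms(2) by (rule mult_carrier_mat)
  ultimately show ?thesis by (simp add: tr_msum tr_smult[of _ N])
qed

section \<open>Support of operators\<close>

lemma supported_on_carrier: "supported_on n e A \<Longrightarrow> A \<in> carrier_mat (2 ^ n) (2 ^ n)"
  by (auto simp: supported_on_def)

lemma supported_onI: "A = msum (2 ^ n) (pstrs e) (\<lambda>P. a P \<cdot>\<^sub>m pmat n P) \<Longrightarrow> supported_on n e A"
  unfolding supported_on_def by blast

lemma supported_on_mono:
  assumes "supported_on n e A" "e \<subseteq> e'" "finite e'" shows "supported_on n e' A"
proof -
  obtain a where a: "A = msum (2 ^ n) (pstrs e) (\<lambda>P. a P \<cdot>\<^sub>m pmat n P)"
    using assms(1) by (auto simp: supported_on_def)
  have "A = msum (2 ^ n) (pstrs e') (\<lambda>P. (if P \<in> pstrs e then a P else 0) \<cdot>\<^sub>m pmat n P)"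
    unfolding a
    by (rule eq_matI)
       (auto intro!: sum.mono_neutral_cong_left finite_pstrs[OF assms(3)] pstrs_mono[OF assms(2), THEN subsetD])
  then show ?thesis by (rule supported_onI)
qed

lemma supported_on_adjoint:
  assumes "supported_on n e A" shows "supported_on n e (mat_adjoint A)"
proof -
  obtain a where a: "A = msum (2 ^ n) (pstrs e) (\<lambda>P. a P \<cdot>\<^sub>m pmat n P)"
    using assms by (auto simp: supported_on_def)
  have "mat_adjoint A = msum (2 ^ n) (pstrs e) (\<lambda>P. cnj (a P) \<cdot>\<^sub>m pmat n P)"
    unfolding a by (subst mat_adjoint_msum) (auto simp: mat_adjoint_smult)
  then show ?thesis by (rule supported_onI)
qed

lemma pstrs_mem: "P \<in> pstrs S \<longleftrightarrow> supp P \<subseteq> S"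
  by (simp add: pstrs_def)

lemma supported_on_ham:
  assumes "finite e" shows "supported_on n e (ham n h {P. supp P = e})"
proof -
  have "ham n h {P. supp P = e} = msum (2 ^ n) (pstrs e) (\<lambda>P. (if supp P = e then h P else 0) \<cdot>\<^sub>m pmat n P)"
    unfolding ham_def
    by (rule eq_matI) (auto intro!: sum.mono_neutral_cong_left finite_pstrs[OF assms] simp: pstrs_mem split: if_splits)
  then show ?thesis by (rule supported_onI)
qed

text \<open>The coefficient form of \<open>supported_on\<close>: closure under products and sums
  becomes the vanishing of traces. For \<open>e\<close> inside the register the two notions agree,
  see \<open>supported_on_iff\<close>.\<close>

definition pauli_local :: "nat \<Rightarrow> nat set \<Rightarrow> complex mat \<Rightarrow> bool" where
  "pauli_local n e X \<longleftrightarrow> X \<in> carrier_mat (2 ^ n) (2 ^ n) \<and>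
     (\<forall>P\<in>pstrs {..<n}. \<not> supp P \<subseteq> e \<longrightarrow> tr (X * pmat n P) = 0)"

text \<open>A string \<open>R\<close> that leaves \<open>e\<close> acts on a qubit where both
  factors, expanded over \<open>pstrs e\<close>, are trivial; that qubit makes every trace of three
  strings vanish.\<close>

lemma pauli_local_mult:
  assumes "supported_on n e A" "supported_on n e B"
  shows "pauli_local n e (A * B)"
  unfolding pauli_local_def
proof (intro conjI ballI impI)
  show "A * B \<in> carrier_mat (2 ^ n) (2 ^ n)"
    using assms supported_on_carrier by (intro mult_carrier_mat)
  fix R assume R: "R \<in> pstrs {..<n}" "\<not> supp R \<subseteq> e"
  obtain q where q: "q \<in> supp R" "q \<notin> e" using R(2) by auto
  then have "q < n" "R q \<noteq> PI" using R(1) by (auto simp: pstrs_def supp_def)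
  obtain a where a: "A = msum (2 ^ n) (pstrs e) (\<lambda>P. a P \<cdot>\<^sub>m pmat n P)"
    using assms(1) by (auto simp: supported_on_def)
  obtain b where b: "B = msum (2 ^ n) (pstrs e) (\<lambda>P. b P \<cdot>\<^sub>m pmat n P)"
    using assms(2) by (auto simp: supported_on_def)
  have BR: "B * pmat n R \<in> carrier_mat (2 ^ n) (2 ^ n)" and Bc: "B \<in> carrier_mat (2 ^ n) (2 ^ n)"
    and Ac: "A \<in> carrier_mat (2 ^ n) (2 ^ n)"
    using assms(1,2)[THEN supported_on_carrier] by auto
  have "tr (A * B * pmat n R) = tr (A * (B * pmat n R))"
    by (simp add: assoc_mult_mat[OF Ac Bc pmat_carrier])
  also have "\<dots> = (\<Sum>P\<in>pstrs e. a P * tr (pmat n P * (B * pmat n R)))"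
    unfolding a by (rule tr_msum_mult[OF pmat_carrier BR])
  also have "\<dots> = (\<Sum>P\<in>pstrs e. 0)"
  proof (rule sum.cong[OF refl])
    fix P assume P: "P \<in> pstrs e"
    have RP: "pmat n R * pmat n P \<in> carrier_mat (2 ^ n) (2 ^ n)" by auto
    have "tr (pmat n P * (B * pmat n R)) = tr (B * pmat n R * pmat n P)"
      by (rule tr_mult_commute[OF pmat_carrier BR])
    also have "\<dots> = tr (B * (pmat n R * pmat n P))" by (simp add: assoc_mult_mat[OF Bc pmat_carrier pmat_carrier])
    also have "\<dots> = (\<Sum>Q\<in>pstrs e. b Q * tr (pmat n Q * (pmat n R * pmat n P)))"
      unfolding b by (rule tr_msum_mult[OF pmat_carrier RP])
    also have "\<dots> = (\<Sum>Q\<in>pstrs e. 0)"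
    proof (rule sum.cong[OF refl])
      fix Q assume Q: "Q \<in> pstrs e"
      have "tr (pmat n Q * (pmat n R * pmat n P)) = tr (pmat n Q * pmat n R * pmat n P)"
        by (simp add: assoc_mult_mat[OF pmat_carrier pmat_carrier pmat_carrier])
      also have "\<dots> = tr (pmat n P * (pmat n Q * pmat n R))"
        by (rule tr_mult_commute[of _ "2 ^ n" "2 ^ n"]) auto
      also have "\<dots> = tr (pmat n P * pmat n Q * pmat n R)"
        by (simp add: assoc_mult_mat[OF pmat_carrier pmat_carrier pmat_carrier])
      also have "\<dots> = 0"
        using \<open>q < n\<close> \<open>R q \<noteq> PI\<close> P Q q(2) by (intro tr_pmat3_eq_0[of q]) (auto intro: pstrs_outside)
      finally show "b Q * tr (pmat n Q * (pmat n R * pmat n P)) = 0" by simp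
    qed
    finally show "a P * tr (pmat n P * (B * pmat n R)) = 0" by simp
  qed
  finally show "tr (A * B * pmat n R) = 0" by simp
qed

lemma supported_on_one: "finite e \<Longrightarrow> supported_on n e (1\<^sub>m (2 ^ n))"
proof -
  assume e: "finite e"
  have "1\<^sub>m (2 ^ n) = msum (2 ^ n) (pstrs e) (\<lambda>P. (if P = Id_str then 1 else 0) \<cdot>\<^sub>m pmat n P)"
  proof (rule eq_matI)
    fix i j assume "i < dim_row (msum (2 ^ n) (pstrs e) (\<lambda>P. (if P = Id_str then 1 else 0) \<cdot>\<^sub>m pmat n P))"
      "j < dim_col (msum (2 ^ n) (pstrs e) (\<lambda>P. (if P = Id_str then 1 else 0) \<cdot>\<^sub>m pmat n P))"
    then have ij: "i < 2 ^ n" "j < 2 ^ n" by auto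
    have "(\<Sum>P\<in>pstrs e. ((if P = Id_str then 1 else 0) \<cdot>\<^sub>m pmat n P) $$ (i, j)) =
        (\<Sum>P\<in>pstrs e. if P = Id_str then pmat n Id_str $$ (i, j) else 0)"
      by (rule sum.cong) (use ij in auto)
    then show "1\<^sub>m (2 ^ n) $$ (i, j) = msum (2 ^ n) (pstrs e) (\<lambda>P. (if P = Id_str then 1 else 0) \<cdot>\<^sub>m pmat n P) $$ (i, j)"
      using ij finite_pstrs[OF e] by simp
  qed auto
  then show ?thesis by (rule supported_onI)
qed

lemma pauli_local_supported: "finite e \<Longrightarrow> supported_on n e A \<Longrightarrow> pauli_local n e A"
  using pauli_local_mult[of n e A "1\<^sub>m (2 ^ n)"] supported_on_one[of e n] supported_on_carrier[of n e A] by simp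

text \<open>Existential in \<open>chi\<close>, so that the closure lemmas can follow the way a local
  term is built; uniqueness of expansions transfers the result to a given
  \<open>chi\<close>.\<close>

definition chi_local :: "nat \<Rightarrow> nat set \<Rightarrow> superop \<Rightarrow> bool" where
  "chi_local n e F \<longleftrightarrow> (\<exists>chi. chi_expansion n F chi \<and>
     (\<forall>u\<in>pstrs {..<n} \<times> pstrs {..<n}. \<not> usupp u \<subseteq> e \<longrightarrow> chi u = 0))"

lemma chi_local_conj:
  assumes "pauli_local n e X" "pauli_local n e Y" shows "chi_local n e (\<lambda>M. X * M * Y)"
proof -
  have "\<forall>u\<in>pstrs {..<n} \<times> pstrs {..<n}. \<not> usupp u \<subseteq> e \<longrightarrow>
     (\<lambda>(P, Q). tr (X * pmat n P) * tr (Y * pmat n Q) / 4 ^ n) u = 0"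
    using assms by (auto simp: pauli_local_def usupp_def)
  then show ?thesis unfolding chi_local_def
    using chi_expansion_conj[of X n Y] assms by (blast intro: pauli_local_def[THEN iffD1, THEN conjunct1])
qed

lemma chi_local_cong:
  "chi_local n e F \<Longrightarrow> (\<And>M. M \<in> carrier_mat (2 ^ n) (2 ^ n) \<Longrightarrow> F M = G M) \<Longrightarrow> chi_local n e G"
  unfolding chi_local_def using chi_expansion_cong[of n F _ G] by blast

lemma chi_local_add:
  assumes "chi_local n e F" "chi_local n e G" shows "chi_local n e (\<lambda>M. F M + G M)"
proof -
  obtain f g where "chi_expansion n F f" "chi_expansion n G g"
    "\<forall>u\<in>pstrs {..<n} \<times> pstrs {..<n}. \<not> usupp u \<subseteq> e \<longrightarrow> f u = 0"
    "\<forall>u\<in>pstrs {..<n} \<times> pstrs {..<n}. \<not> usupp u \<subseteq> e \<longrightarrow> g u = 0"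
    using assms unfolding chi_local_def by metis
  then show ?thesis unfolding chi_local_def
    by (intro exI[of _ "\<lambda>u. f u + g u"] conjI chi_expansion_add) auto
qed

lemma chi_local_minus:
  assumes "chi_local n e F" "chi_local n e G" shows "chi_local n e (\<lambda>M. F M - G M)"
proof -
  obtain f g where "chi_expansion n F f" "chi_expansion n G g"
    "\<forall>u\<in>pstrs {..<n} \<times> pstrs {..<n}. \<not> usupp u \<subseteq> e \<longrightarrow> f u = 0"
    "\<forall>u\<in>pstrs {..<n} \<times> pstrs {..<n}. \<not> usupp u \<subseteq> e \<longrightarrow> g u = 0"
    using assms unfolding chi_local_def by metis
  then show ?thesis unfolding chi_local_def
    by (intro exI[of _ "\<lambda>u. f u - g u"] conjI chi_expansion_minus) auto
qed

lemma chi_local_smult: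
  assumes "chi_local n e F" shows "chi_local n e (\<lambda>M. c \<cdot>\<^sub>m F M)"
proof -
  obtain f where "chi_expansion n F f"
    "\<forall>u\<in>pstrs {..<n} \<times> pstrs {..<n}. \<not> usupp u \<subseteq> e \<longrightarrow> f u = 0"
    using assms unfolding chi_local_def by metis
  then show ?thesis unfolding chi_local_def
    by (intro exI[of _ "\<lambda>u. c * f u"] conjI chi_expansion_smult) auto
qed

lemma chi_local_msum:
  assumes "\<And>a. a \<in> I \<Longrightarrow> chi_local n e (F a)" shows "chi_local n e (\<lambda>M. msum (2 ^ n) I (\<lambda>a. F a M))"
proof -
  obtain f where f: "\<forall>a\<in>I. chi_expansion n (F a) (f a) \<and>
    (\<forall>u\<in>pstrs {..<n} \<times> pstrs {..<n}. \<not> usupp u \<subseteq> e \<longrightarrow> f a u = 0)"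
    using assms unfolding chi_local_def by metis
  show ?thesis unfolding chi_local_def
    by (rule exI[of _ "\<lambda>u. \<Sum>a\<in>I. f a u"], intro conjI chi_expansion_msum ballI impI sum.neutral)
       (use f in blast)+
qed

lemma chi_expansion_left:
  assumes "X \<in> carrier_mat (2 ^ n) (2 ^ n)"
  shows "chi_expansion n (\<lambda>M. X * M) (\<lambda>(P, Q). tr (X * pmat n P) * tr (pmat n Q) / 4 ^ n)"
proof -
  have "chi_expansion n (\<lambda>M. X * M * 1\<^sub>m (2 ^ n)) (\<lambda>(P, Q). tr (X * pmat n P) * tr (1\<^sub>m (2 ^ n) * pmat n Q) / 4 ^ n)"
    by (rule chi_expansion_conj[OF assms]) simp
  then have "chi_expansion n (\<lambda>M. X * M) (\<lambda>(P, Q). tr (X * pmat n P) * tr (1\<^sub>m (2 ^ n) * pmat n Q) / 4 ^ n)"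
    by (rule chi_expansion_cong) (rule right_mult_one_mat, use assms in auto)
  then show ?thesis by (simp only: left_mult_one_mat[OF pmat_carrier])
qed

lemma chi_expansion_right:
  assumes "X \<in> carrier_mat (2 ^ n) (2 ^ n)"
  shows "chi_expansion n (\<lambda>M. M * X) (\<lambda>(P, Q). tr (pmat n P) * tr (X * pmat n Q) / 4 ^ n)"
proof -
  have "chi_expansion n (\<lambda>M. 1\<^sub>m (2 ^ n) * M * X) (\<lambda>(P, Q). tr (1\<^sub>m (2 ^ n) * pmat n P) * tr (X * pmat n Q) / 4 ^ n)"
    by (rule chi_expansion_conj[OF _ assms]) simp
  then have "chi_expansion n (\<lambda>M. M * X) (\<lambda>(P, Q). tr (1\<^sub>m (2 ^ n) * pmat n P) * tr (X * pmat n Q) / 4 ^ n)"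
    by (rule chi_expansion_cong) (use assms in auto)
  then show ?thesis by (simp only: left_mult_one_mat[OF pmat_carrier])
qed

lemma chi_local_left:
  assumes "finite e" "pauli_local n e X" shows "chi_local n e (\<lambda>M. X * M)"
proof (rule chi_local_cong)
  show "chi_local n e (\<lambda>M. X * M * 1\<^sub>m (2 ^ n))"
    by (intro chi_local_conj assms pauli_local_supported supported_on_one)
  show "X * M * 1\<^sub>m (2 ^ n) = X * M" if "M \<in> carrier_mat (2 ^ n) (2 ^ n)" for M
    by (rule right_mult_one_mat) (use assms that in \<open>auto simp: pauli_local_def\<close>)
qed

lemma chi_local_right:
  assumes "finite e" "pauli_local n e X" shows "chi_local n e (\<lambda>M. M * X)"
proof (rule chi_local_cong)
  show "chi_local n e (\<lambda>M. 1\<^sub>m (2 ^ n) * M * X)"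
    by (intro chi_local_conj assms pauli_local_supported supported_on_one)
  show "1\<^sub>m (2 ^ n) * M * X = M * X" if "M \<in> carrier_mat (2 ^ n) (2 ^ n)" for M
    using that by simp
qed

lemma chi_local_local_term:
  assumes e: "finite e" and J: "\<forall>J\<in>set (jumps lb e). supported_on n e J"
  shows "chi_local n e (local_term n lb e)"
proof -
  have H: "pauli_local n e (ham n (hcoeff lb) {P. supp P = e})"
    by (rule pauli_local_supported[OF e supported_on_ham[OF e]])
  have J': "supported_on n e (jumps lb e ! a)" if "a \<in> {..<length (jumps lb e)}" for a
    using J that by auto
  show ?thesis
    unfolding local_term_def[abs_def] ham_part_def Let_def
    by (intro chi_local_add chi_local_smult chi_local_minus chi_local_msum chi_local_left chi_local_right e H
        chi_local_conj pauli_local_mult pauli_local_supported supported_on_adjoint J')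
qed

text \<open>Each local term expands in pairs supported on its set \<open>e\<close>, of size at most
  \<open>k\<close>, so a pair with larger support union has coefficient 0 in every summand;
  uniqueness carries this to \<open>chi\<close>.\<close>

lemma chi_generator_local:
  assumes kl: "k_local n k lb" and chi: "chi_expansion n (generator n k lb) chi"
    and u: "u \<in> pstrs {..<n} \<times> pstrs {..<n}" "u \<notin> index_pairs n k"
  shows "chi u = 0"
proof -
  have "\<exists>f. chi_expansion n (local_term n lb e) f \<and> f u = 0" if e: "e \<in> local_sets n k" for e
  proof -
    have fin: "finite e" using e finite_subset by (auto simp: local_sets_def)
    have "chi_local n e (local_term n lb e)"
      by (rule chi_local_local_term[OF fin]) (use kl e in \<open>auto simp: k_local_def\<close>)
    moreover have "\<not> usupp u \<subseteq> e"
      using u e card_mono[OF fin, of "usupp u"] by (auto simp: index_pairs_def local_sets_def)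
    ultimately show ?thesis using u(1) unfolding chi_local_def by blast
  qed
  then obtain f where f: "\<And>e. e \<in> local_sets n k \<Longrightarrow> chi_expansion n (local_term n lb e) (f e) \<and> f e u = 0"
    by metis
  have "chi_expansion n (generator n k lb) (\<lambda>u. \<Sum>e\<in>local_sets n k. f e u)"
    unfolding generator_def[abs_def] by (rule chi_expansion_msum) (use f in blast)
  from chi_expansion_unique[OF chi this u(1)] show ?thesis using f by simp
qed

section \<open>Comparison with the coefficients \<open>G\<close> and \<open>h\<close>\<close>

lemma tr_ham:
  assumes "P \<in> pstrs {..<n}" shows "tr (ham n h (pstrs {..<n}) * pmat n P) = h P * 2 ^ n"
proof -
  have "tr (ham n h (pstrs {..<n}) * pmat n P) = (\<Sum>R\<in>pstrs {..<n}. h R * tr (pmat n R * pmat n P))"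
    unfolding ham_def by (rule tr_msum_mult) auto
  also have "\<dots> = (\<Sum>R\<in>pstrs {..<n}. if R = P then h P * 2 ^ n else 0)"
    by (rule sum.cong) (auto simp: tr_pmat2[OF _ assms])
  also have "\<dots> = h P * 2 ^ n" using assms by (simp add: finite_pstrs)
  finally show ?thesis .
qed

text \<open>For nontrivial \<open>P\<close> and \<open>Q\<close> the commutator and anticommutator
  terms drop out, having the identity on one side. On the pairs \<open>(P, I)\<close> and
  \<open>(I, P)\<close> the anticommutator contributes equally, so the difference isolates the
  Hamiltonian, which contributes \<open>- \<i> h P\<close> and \<open>\<i> h P\<close>.\<close>

theorem gks_coefficients:
  assumes chi: "chi_expansion n F chi" and gks: "gks_expansion n F h G"
  shows "P \<in> pstrs {..<n} - {Id_str} \<Longrightarrow> Q \<in> pstrs {..<n} - {Id_str} \<Longrightarrow> G (P, Q) = chi (P, Q)"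
    and "P \<in> pstrs {..<n} - {Id_str} \<Longrightarrow> h P = \<i> / 2 * (chi (P, Id_str) - chi (Id_str, P))"
proof -
  let ?H = "ham n h (pstrs {..<n})" and ?D = "(pstrs {..<n} - {Id_str}) \<times> (pstrs {..<n} - {Id_str})"
  let ?g = "\<lambda>(R, S) u. G (R, S) * ((\<lambda>(P, Q). tr (pmat n R * pmat n P) * tr (pmat n S * pmat n Q) / 4 ^ n) u -
       (1 / 2) * ((\<lambda>(P, Q). tr (pmat n S * pmat n R * pmat n P) * tr (pmat n Q) / 4 ^ n) u +
          (\<lambda>(P, Q). tr (pmat n P) * tr (pmat n S * pmat n R * pmat n Q) / 4 ^ n) u))"
  define f where "f = (\<lambda>u. (- \<i>) * ((\<lambda>(P, Q). tr (?H * pmat n P) * tr (pmat n Q) / 4 ^ n) u -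
       (\<lambda>(P, Q). tr (pmat n P) * tr (?H * pmat n Q) / 4 ^ n) u) + (\<Sum>a\<in>?D. ?g a u))"
  have H: "?H \<in> carrier_mat (2 ^ n) (2 ^ n)" by (simp add: ham_def)
  have "chi_expansion n (\<lambda>M. ham_part ?H M + msum (2 ^ n) ?D (\<lambda>(P, Q). G (P, Q) \<cdot>\<^sub>m (pmat n P * M * pmat n Q -
            (1 / 2) \<cdot>\<^sub>m (pmat n Q * pmat n P * M + M * (pmat n Q * pmat n P))))) f"
    unfolding f_def ham_part_def
  proof (intro chi_expansion_add chi_expansion_smult chi_expansion_minus chi_expansion_left[OF H] chi_expansion_right[OF H]
      chi_expansion_msum)
    fix a show "chi_expansion n (\<lambda>M. case a of (P, Q) \<Rightarrow> G (P, Q) \<cdot>\<^sub>m (pmat n P * M * pmat n Q -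
            (1 / 2) \<cdot>\<^sub>m (pmat n Q * pmat n P * M + M * (pmat n Q * pmat n P)))) (?g a)"
      unfolding case_prod_beta
      by (intro chi_expansion_add chi_expansion_smult chi_expansion_minus
          chi_expansion_left[unfolded case_prod_beta] chi_expansion_right[unfolded case_prod_beta]
          chi_expansion_conj[unfolded case_prod_beta] pmat_carrier mult_carrier_mat[of _ "2 ^ n" "2 ^ n"])
  qed
  then have "chi_expansion n F f"
    by (rule chi_expansion_cong) (use gks in \<open>simp add: gks_expansion_def\<close>)
  from chi_expansion_unique[OF chi this] have chi_f: "chi (P, Q) = f (P, Q)" if "P \<in> pstrs {..<n}" "Q \<in> pstrs {..<n}" for P Q
    using that by blast
  have four: "(4::complex) ^ n = 2 ^ n * 2 ^ n" by (simp flip: power_mult_distrib)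
  show "G (P, Q) = chi (P, Q)" if PQ: "P \<in> pstrs {..<n} - {Id_str}" "Q \<in> pstrs {..<n} - {Id_str}"
  proof -
    have z: "tr (pmat n P) = 0" "tr (pmat n Q) = 0" using PQ tr_pmat by auto
    have "(\<Sum>a\<in>?D. ?g a (P, Q)) = (\<Sum>a\<in>?D. if a = (P, Q) then G a else 0)"
    proof (rule sum.cong[OF refl])
      fix a assume "a \<in> ?D"
      then have a: "fst a \<in> pstrs {..<n}" "snd a \<in> pstrs {..<n}" by auto
      have e: "a = (P, Q) \<longleftrightarrow> fst a = P \<and> snd a = Q" by (cases a) auto
      have PQ': "P \<in> pstrs {..<n}" "Q \<in> pstrs {..<n}" using PQ by auto
      show "?g a (P, Q) = (if a = (P, Q) then G a else 0)"
        unfolding e by (simp add: case_prod_beta z tr_pmat2[OF a(1) PQ'(1)] tr_pmat2[OF a(2) PQ'(2)] four)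
    qed
    also have "\<dots> = G (P, Q)" using PQ by (simp add: finite_pstrs)
    finally have "f (P, Q) = G (P, Q)" by (simp add: f_def z)
    then show ?thesis using chi_f[of P Q] PQ by simp
  qed
  show "h P = \<i> / 2 * (chi (P, Id_str) - chi (Id_str, P))" if P: "P \<in> pstrs {..<n} - {Id_str}"
  proof -
    have z: "tr (pmat n P) = 0" and P': "P \<in> pstrs {..<n}" using P tr_pmat by auto
    have tI: "tr (1\<^sub>m (2 ^ n)) = (2 ^ n :: complex)" using tr_pmat[of Id_str n] by simp
    have "(\<Sum>a\<in>?D. ?g a (P, Id_str)) = (\<Sum>a\<in>?D. ?g a (Id_str, P))"
    proof (rule sum.cong[OF refl])
      fix a assume "a \<in> ?D"
      then have "tr (pmat n (fst a)) = 0" "tr (pmat n (snd a)) = 0" by (auto simp: tr_pmat)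
      then show "?g a (P, Id_str) = ?g a (Id_str, P)"
        by (simp add: case_prod_beta z mult.commute right_mult_one_mat[OF pmat_carrier])
    qed
    then have "f (P, Id_str) - f (Id_str, P) = - 2 * \<i> * (tr (?H * pmat n P) * tr (1\<^sub>m (2 ^ n)) / 4 ^ n)"
      by (simp add: f_def z algebra_simps)
    also have "\<dots> = - 2 * \<i> * h P" using tr_ham[OF P'] by (simp add: four tI)
    finally show ?thesis using chi_f[of P Id_str] chi_f[of Id_str P] P' by simp
  qed
qed

lemma hcoeff_Id: "k_local n k lb \<Longrightarrow> hcoeff lb Id_str = 0"
  using tr_ham[of Id_str n "hcoeff lb"]
  by (simp add: k_local_def Let_def right_mult_one_mat[of _ "2 ^ n" "2 ^ n"] ham_def)

section \<open>Propagation of errors\<close>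

text \<open>The absolute weights add up to \<open>8 ^ card S\<close>, exactly the denominator; hence
  the factor 1 in front of \<epsilon>, independent of the support size.\<close>

lemma norm_inversion_sum_le:
  assumes "finite S" "\<And>A B. A \<in> pstrs S \<Longrightarrow> B \<in> pstrs S \<Longrightarrow> cmod (L A B - L' A B) \<le> \<epsilon>"
  shows "cmod (inversion_sum S L P Q - inversion_sum S L' P Q) \<le> \<epsilon>"
proof -
  let ?t = "\<lambda>A B. \<Prod>q\<in>S. pauli_trace4 (A q) (Q q) (B q) (P q)"
  have "cmod (\<Sum>A\<in>pstrs S. \<Sum>B\<in>pstrs S. (L A B - L' A B) * ?t A B) \<le>
      (\<Sum>A\<in>pstrs S. \<Sum>B\<in>pstrs S. \<epsilon> * cmod (?t A B))"
    by (intro sum_norm_le) (use assms(2) in \<open>auto simp: norm_mult intro!: mult_right_mono sum_norm_le\<close>)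
  also have "\<dots> = \<epsilon> * (\<Sum>A\<in>pstrs S. \<Sum>B\<in>pstrs S. \<Prod>q\<in>S. cmod (pauli_trace4 (A q) (Q q) (B q) (P q)))"
    by (simp add: sum_distrib_left prod_norm)
  also have "\<dots> = \<epsilon> * 8 ^ card S"
    by (simp only: sum_pstrs2_prod[OF assms(1), of "\<lambda>q a b. cmod (pauli_trace4 a (Q q) b (P q))"]
        sum_norm_pauli_trace4 prod_constant)
  finally have "cmod (\<Sum>A\<in>pstrs S. \<Sum>B\<in>pstrs S. (L A B - L' A B) * ?t A B) / 8 ^ card S \<le> \<epsilon>"
    by (simp add: divide_le_eq)
  moreover have "inversion_sum S L P Q - inversion_sum S L' P Q =
      (\<Sum>A\<in>pstrs S. \<Sum>B\<in>pstrs S. (L A B - L' A B) * ?t A B) / 8 ^ card S"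
    by (simp add: inversion_sum_def left_diff_distrib sum_subtractf diff_divide_distrib)
  ultimately show ?thesis by (simp add: norm_divide norm_power)
qed

lemma finite_index_pairs: "finite (index_pairs0 n k)"
  by (rule finite_subset[of _ "pstrs {..<n} \<times> pstrs {..<n}"])
     (auto simp: index_pairs0_def index_pairs_def finite_pstrs)

lemma finite_compl_strs: "finite (compl_strs n S)"
  by (simp add: compl_strs_def finite_pstrs)

lemma ext_bounds:
  assumes "S \<subseteq> {..<n}" "P \<in> pstrs S" "Q \<in> pstrs S"
  shows "card {A \<in> compl_strs n S. (glue S P A, glue S Q A) \<in> \<Omega>} \<le> ext_degree n \<Omega>"
    and "(\<Sum>A\<in>{A \<in> compl_strs n S. (glue S P A, glue S Q A) \<notin> \<Omega>}. cmod (chi (glue S P A, glue S Q A)))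
      \<le> ext_residual n chi \<Omega>"
proof -
  have fin: "finite {f S P Q | S P Q. S \<subseteq> {..<n} \<and> P \<in> pstrs S \<and> Q \<in> pstrs S}" for f :: "nat set \<Rightarrow> pstr \<Rightarrow> pstr \<Rightarrow> 'c"
  proof (rule finite_subset)
    show "{f S P Q | S P Q. S \<subseteq> {..<n} \<and> P \<in> pstrs S \<and> Q \<in> pstrs S} \<subseteq>
      (\<lambda>(S, P, Q). f S P Q) ` (Pow {..<n} \<times> pstrs {..<n} \<times> pstrs {..<n})"
    proof
      fix x assume "x \<in> {f S P Q | S P Q. S \<subseteq> {..<n} \<and> P \<in> pstrs S \<and> Q \<in> pstrs S}"
      then obtain S P Q where x: "x = f S P Q" "S \<subseteq> {..<n}" "P \<in> pstrs S" "Q \<in> pstrs S" by blast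
      then have "(S, P, Q) \<in> Pow {..<n} \<times> pstrs {..<n} \<times> pstrs {..<n}"
        using pstrs_mono[OF x(2)] by blast
      then show "x \<in> (\<lambda>(S, P, Q). f S P Q) ` (Pow {..<n} \<times> pstrs {..<n} \<times> pstrs {..<n})"
        unfolding x(1) by (rule image_eqI[rotated]) simp
    qed
  qed (simp add: finite_pstrs)
  show "card {A \<in> compl_strs n S. (glue S P A, glue S Q A) \<in> \<Omega>} \<le> ext_degree n \<Omega>"
    unfolding ext_degree_def by (rule Max_ge[OF fin]) (use assms in blast)
  show "(\<Sum>A\<in>{A \<in> compl_strs n S. (glue S P A, glue S Q A) \<notin> \<Omega>}. cmod (chi (glue S P A, glue S Q A)))
      \<le> ext_residual n chi \<Omega>"
    unfolding ext_residual_def by (rule Max_ge[OF fin]) (use assms in blast)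
qed

lemma ext_sum_ge_1: "1 \<le> ext_sum n k \<Omega>"
proof -
  have "real (ext_degree n \<Omega>) ^ 0 \<le> ext_sum n k \<Omega>"
    unfolding ext_sum_def by (rule member_le_sum) auto
  then show ?thesis by simp
qed

lemma ext_residual_nonneg: "0 \<le> ext_residual n chi \<Omega>"
  by (rule order_trans[OF sum_nonneg ext_bounds(2)[of "{}" n Id_str Id_str chi \<Omega>]]) simp_all

text \<open>Passes from the relation used by the program to the parametrisation by strings
  \<open>A\<close> used in the definitions of degree and residual. Injectivity makes the sums over
  both sides agree.\<close>

lemma extensions_eq:
  assumes "\<Omega> \<subseteq> pstrs {..<n} \<times> pstrs {..<n}" "u \<in> pstrs {..<n} \<times> pstrs {..<n}"
  shows "{v \<in> \<Omega>. extends v u} = (\<lambda>A. (glue (usupp u) (fst u) A, glue (usupp u) (snd u) A)) `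
     {A \<in> compl_strs n (usupp u). (glue (usupp u) (fst u) A, glue (usupp u) (snd u) A) \<in> \<Omega>}"
    and "inj_on (\<lambda>A. (glue (usupp u) (fst u) A, glue (usupp u) (snd u) A)) (compl_strs n (usupp u))"
proof -
  let ?S = "usupp u" and ?g = "\<lambda>A. (glue (usupp u) (fst u) A, glue (usupp u) (snd u) A)"
  have u0: "fst u q = PI" "snd u q = PI" if "q \<notin> ?S" for q using that by (auto simp: usupp_def supp_def)
  show "{v \<in> \<Omega>. extends v u} = ?g ` {A \<in> compl_strs n ?S. ?g A \<in> \<Omega>}"
  proof (intro equalityI subsetI)
    fix v assume "v \<in> {v \<in> \<Omega>. extends v u}"
    then have v: "v \<in> \<Omega>" and sub: "?S \<subset> usupp v" and eq: "\<And>q. q \<in> usupp v - ?S \<Longrightarrow> fst v q = snd v q"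
      and r: "fst u = restr ?S (fst v)" "snd u = restr ?S (snd v)"
      unfolding extends_def by (auto dest: arg_cong[of _ _ fst] arg_cong[of _ _ snd])
    have v0: "fst v q = PI" "snd v q = PI" if "q \<notin> usupp v" for q using that by (auto simp: usupp_def supp_def)
    have vn: "fst v q = PI" if "\<not> q < n" for q
      using v assms(1) that pstrs_outside[of "fst v" "{..<n}" q] by auto
    \<comment> \<open>Either component of \<open>v\<close> would do: off \<open>?S\<close> they
      agree.\<close>
    let ?A = "restr (- ?S) (fst v)"
    obtain q where q: "q \<in> usupp v" "q \<notin> ?S" using sub by blast
    have "fst v q \<noteq> PI \<or> snd v q \<noteq> PI" using q(1) unfolding usupp_def supp_def by blast
    moreover have "fst v q = snd v q" using eq q by blast
    ultimately have "fst v q \<noteq> PI" by metis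
    then have "?A q \<noteq> Id_str q" using q by (simp add: restr_def Id_str_def)
    then have "?A \<noteq> Id_str" by metis
    moreover have "?A \<in> pstrs ({..<n} - ?S)"
      using vn by (auto simp: pstrs_def supp_def restr_def split: if_splits)
    ultimately have A: "?A \<in> compl_strs n ?S" by (simp add: compl_strs_def)
    have e1: "glue ?S (fst u) ?A = fst v" unfolding r(1) by (auto simp: glue_def restr_def)
    have e2: "glue ?S (snd u) ?A = snd v"
    proof
      fix q show "glue ?S (snd u) ?A q = snd v q"
        unfolding r(2) using eq[of q] v0[of q] by (cases "q \<in> usupp v") (auto simp: glue_def restr_def)
    qed
    have "?g ?A = v" unfolding e1 e2 by simp
    then show "v \<in> ?g ` {A \<in> compl_strs n ?S. ?g A \<in> \<Omega>}" using A v by (auto intro!: image_eqI[of _ _ ?A])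
  next
    fix v assume "v \<in> ?g ` {A \<in> compl_strs n ?S. ?g A \<in> \<Omega>}"
    then obtain A where A: "A \<in> compl_strs n ?S" "v \<in> \<Omega>" and v: "v = ?g A" by auto
    have A0: "A q = PI" if "q \<in> ?S" for q using A(1) that pstrs_outside[of A "{..<n} - ?S" q] by (auto simp: compl_strs_def)
    have uv: "usupp v = ?S \<union> supp A"
      unfolding v using A0 by (auto simp: usupp_def supp_def glue_def split: if_splits)
    obtain q where "A q \<noteq> PI" using A(1) unfolding compl_strs_def Id_str_def by blast
    then have "?S \<subset> usupp v" unfolding uv using A0[of q] by (auto simp: supp_def)
    moreover have "u = (restr ?S (fst v), restr ?S (snd v))"
      unfolding v prod_eq_iff using u0 by (auto simp: restr_def glue_def)
    moreover have "\<forall>q\<in>usupp v - ?S. fst v q = snd v q" unfolding v by (auto simp: glue_def)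
    ultimately show "v \<in> {v \<in> \<Omega>. extends v u}" using A(2) unfolding extends_def by blast
  qed
  show "inj_on ?g (compl_strs n ?S)"
  proof (rule inj_onI)
    fix C D assume CD: "C \<in> compl_strs n ?S" "D \<in> compl_strs n ?S" "?g C = ?g D"
    then have "glue ?S (fst u) C = glue ?S (fst u) D" by simp
    have "C \<in> pstrs ({..<n} - ?S)" "D \<in> pstrs ({..<n} - ?S)" using CD by (auto simp: compl_strs_def)
    then show "C = D"
    proof (rule pstrs_ext)
      fix q assume "q \<in> {..<n} - ?S"
      then show "C q = D q" using fun_cong[OF \<open>glue ?S (fst u) C = glue ?S (fst u) D\<close>, of q] by (simp add: glue_def)
    qed
  qed
qed

text \<open>Exact inversion yields \<open>chi u\<close> plus all of its nontrivial extensions; the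
  recursion removes those inside \<Omega>, and the rest is one of the sums maximised in
  \<open>ext_residual\<close>.\<close>

lemma local_value_exact:
  assumes chi: "chi_expansion n F chi" and \<Omega>: "\<Omega> \<subseteq> pstrs {..<n} \<times> pstrs {..<n}"
    and u: "u \<in> pstrs {..<n} \<times> pstrs {..<n}"
  shows "cmod (chi u - (local_value (ptm n F) u - (\<Sum>v\<in>{v\<in>\<Omega>. extends v u}. chi v))) \<le> ext_residual n chi \<Omega>"
proof -
  let ?S = "usupp u" and ?g = "\<lambda>A. (glue (usupp u) (fst u) A, glue (usupp u) (snd u) A)"
  have S: "?S \<subseteq> {..<n}" using u by (auto simp: usupp_def pstrs_def)
  then have fS: "finite ?S" using finite_subset by blast
  have PQ: "fst u \<in> pstrs ?S" "snd u \<in> pstrs ?S" by (auto simp: pstrs_def usupp_def)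
  have g0: "?g Id_str = u"
  proof -
    have "glue ?S (fst u) Id_str = fst u" "glue ?S (snd u) Id_str = snd u"
      using pstrs_outside[OF PQ(1)] pstrs_outside[OF PQ(2)] by (auto simp: glue_def Id_str_def)
    then show ?thesis by simp
  qed
  have "local_value (ptm n F) u = (\<Sum>C\<in>pstrs ({..<n} - ?S). chi (?g C))"
    unfolding local_value_inversion_sum[OF fS] by (rule inversion_sum_ptm[OF chi S PQ])
  also have "pstrs ({..<n} - ?S) = insert Id_str (compl_strs n ?S)" by (auto simp: compl_strs_def)
  also have "(\<Sum>C\<in>insert Id_str (compl_strs n ?S). chi (?g C)) = chi u + (\<Sum>C\<in>compl_strs n ?S. chi (?g C))"
  proof -
    have "Id_str \<notin> compl_strs n ?S" by (simp add: compl_strs_def)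
    then show ?thesis using g0 finite_compl_strs[of n ?S] by simp
  qed
  also have "(\<Sum>C\<in>compl_strs n ?S. chi (?g C)) =
     (\<Sum>C\<in>{A \<in> compl_strs n ?S. ?g A \<in> \<Omega>}. chi (?g C)) + (\<Sum>C\<in>{A \<in> compl_strs n ?S. ?g A \<notin> \<Omega>}. chi (?g C))"
    by (subst sum.union_disjoint[symmetric]) (auto simp: finite_compl_strs intro!: sum.cong)
  also have "(\<Sum>C\<in>{A \<in> compl_strs n ?S. ?g A \<in> \<Omega>}. chi (?g C)) = (\<Sum>v\<in>{v\<in>\<Omega>. extends v u}. chi v)"
    unfolding extensions_eq(1)[OF \<Omega> u]
    by (subst sum.reindex) (auto intro: inj_on_subset[OF extensions_eq(2)[OF \<Omega> u]])
  finally have "chi u - (local_value (ptm n F) u - (\<Sum>v\<in>{v\<in>\<Omega>. extends v u}. chi v)) =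
      - (\<Sum>C\<in>{A \<in> compl_strs n ?S. ?g A \<notin> \<Omega>}. chi (?g C))" by simp
  then have "cmod (chi u - (local_value (ptm n F) u - (\<Sum>v\<in>{v\<in>\<Omega>. extends v u}. chi v))) =
      cmod (\<Sum>C\<in>{A \<in> compl_strs n ?S. ?g A \<notin> \<Omega>}. chi (?g C))"
    by (simp only: norm_minus_cancel)
  also have "\<dots> \<le> (\<Sum>C\<in>{A \<in> compl_strs n ?S. ?g A \<notin> \<Omega>}. cmod (chi (?g C)))"
    by (rule norm_sum)
  also have "\<dots> \<le> ext_residual n chi \<Omega>" by (rule ext_bounds(2)[OF S PQ, of chi \<Omega>])
  finally show ?thesis .
qed

theorem recursion_error:
  assumes chi: "chi_expansion n F chi" and \<Omega>: "\<Omega> \<subseteq> index_pairs0 n k"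
    and X: "\<And>u. u \<in> \<Omega> \<Longrightarrow> X u = local_value Lh u - (\<Sum>v\<in>{v\<in>\<Omega>. extends v u}. X v)"
    and L: "\<And>u A B. u \<in> \<Omega> \<Longrightarrow> A \<in> pstrs (usupp u) \<Longrightarrow> B \<in> pstrs (usupp u) \<Longrightarrow> cmod (Lh A B - ptm n F A B) \<le> \<epsilon>"
    and \<epsilon>: "0 \<le> \<epsilon>" and u: "u \<in> \<Omega>"
  shows "cmod (X u - chi u) \<le> (\<epsilon> + ext_residual n chi \<Omega>) * ext_sum n k \<Omega>"
proof -
  let ?\<rho> = "ext_residual n chi \<Omega>" and ?d = "real (ext_degree n \<Omega>)"
  have \<Omega>': "\<Omega> \<subseteq> pstrs {..<n} \<times> pstrs {..<n}" using \<Omega> by (auto simp: index_pairs0_def index_pairs_def)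
  have card: "card (usupp u) \<le> k" if "u \<in> \<Omega>" for u using \<Omega> that by (auto simp: index_pairs0_def index_pairs_def)
  have sub: "usupp u \<subseteq> {..<n}" if "u \<in> \<Omega>" for u
    using subsetD[OF \<Omega>' that] by (auto simp: usupp_def pstrs_def)
  then have fin: "finite (usupp u)" if "u \<in> \<Omega>" for u using that finite_subset by blast
  have \<rho>: "0 \<le> ?\<rho>" by (rule ext_residual_nonneg)
  have step: "cmod (X u - chi u) \<le> \<epsilon> + (\<Sum>v\<in>{v\<in>\<Omega>. extends v u}. cmod (X v - chi v)) + ?\<rho>"
    if u: "u \<in> \<Omega>" for u
  proof -
    let ?E = "{v\<in>\<Omega>. extends v u}"
    let ?a = "local_value Lh u - local_value (ptm n F) u" and ?b = "\<Sum>v\<in>?E. X v - chi v"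
      and ?c = "chi u - (local_value (ptm n F) u - (\<Sum>v\<in>?E. chi v))"
    have tri: "cmod x \<le> cmod a + cmod b + cmod c" if "x = a - b - c" for x a b c
      unfolding that using norm_triangle_ineq4[of "a - b" c] norm_triangle_ineq4[of a b] by linarith
    have "cmod (X u - chi u) \<le> cmod ?a + cmod ?b + cmod ?c"
      by (rule tri) (unfold sum_subtractf, subst X[OF u], simp)
    moreover have "cmod ?a \<le> \<epsilon>"
      unfolding local_value_inversion_sum[OF fin[OF u]]
      by (rule norm_inversion_sum_le[OF fin[OF u]]) (use L u in auto)
    moreover have "cmod ?b \<le> (\<Sum>v\<in>?E. cmod (X v - chi v))" by (rule norm_sum)
    moreover have "cmod ?c \<le> ?\<rho>" by (rule local_value_exact[OF chi \<Omega>']) (use \<Omega>' u in blast)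
    ultimately show ?thesis by linarith
  qed
  \<comment> \<open>\<open>m\<close> bounds how many qubits an extension may still add. Each level
    of extension uses up at least one, so \<open>m\<close> levels give the partial geometric sum up
    to \<open>m\<close>.\<close>
  have "cmod (X u - chi u) \<le> (\<epsilon> + ?\<rho>) * (\<Sum>l\<le>m. ?d ^ l)" if "u \<in> \<Omega>" "k - card (usupp u) \<le> m" for u m
    using that
  proof (induction m arbitrary: u)
    case 0
    \<comment> \<open>The support already has size \<open>k\<close>, and an extension would exceed
      it.\<close>
    have "\<not> extends v u" if "v \<in> \<Omega>" for v
      using extends_card_less[of v u] fin[OF that] card[OF that] 0 by auto
    then have none: "{v\<in>\<Omega>. extends v u} = {}" by blast
    show ?case using step[OF 0(1)] unfolding none by simp
  next
    case (Suc m)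
    let ?E = "{v\<in>\<Omega>. extends v u}"
    have u: "u \<in> pstrs {..<n} \<times> pstrs {..<n}" using Suc.prems \<Omega>' by blast
    have ih: "cmod (X v - chi v) \<le> (\<epsilon> + ?\<rho>) * (\<Sum>l\<le>m. ?d ^ l)" if v: "v \<in> ?E" for v
    proof (rule Suc.IH)
      show "v \<in> \<Omega>" using v by simp
      then show "k - card (usupp v) \<le> m"
        using Suc.prems(2) extends_card_less[of v u] fin[of v] v by auto
    qed
    have "card ?E \<le> card {A \<in> compl_strs n (usupp u). (glue (usupp u) (fst u) A, glue (usupp u) (snd u) A) \<in> \<Omega>}"
      unfolding extensions_eq(1)[OF \<Omega>' u] by (rule card_image_le) (simp add: finite_compl_strs)
    also have "\<dots> \<le> ext_degree n \<Omega>"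
      by (rule ext_bounds(1)) (use sub[OF Suc.prems(1)] in \<open>auto simp: pstrs_def usupp_def\<close>)
    finally have cE: "real (card ?E) \<le> ?d" by simp
    have "(\<Sum>v\<in>?E. cmod (X v - chi v)) \<le> real (card ?E) * ((\<epsilon> + ?\<rho>) * (\<Sum>l\<le>m. ?d ^ l))"
      by (rule sum_bounded_above) (rule ih)
    also have "\<dots> \<le> ?d * ((\<epsilon> + ?\<rho>) * (\<Sum>l\<le>m. ?d ^ l))"
      using cE \<epsilon> \<rho> by (intro mult_right_mono) (auto intro!: mult_nonneg_nonneg sum_nonneg)
    finally have "cmod (X u - chi u) \<le> \<epsilon> + ?d * ((\<epsilon> + ?\<rho>) * (\<Sum>l\<le>m. ?d ^ l)) + ?\<rho>"
      using step[OF Suc.prems(1)] by linarith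
    also have "\<dots> = (\<epsilon> + ?\<rho>) * (1 + ?d * (\<Sum>l\<le>m. ?d ^ l))" by (simp add: algebra_simps)
    also have "1 + ?d * (\<Sum>l\<le>m. ?d ^ l) = (\<Sum>l\<le>Suc m. ?d ^ l)"
      by (subst sum.atMost_Suc_shift) (simp add: sum_distrib_left)
    finally show ?case .
  qed
  from this[OF u, of k] show ?thesis by (simp add: ext_sum_def)
qed

section \<open>Moments of a local generator\<close>

lemma sq_mult_carrier: "A \<in> carrier_mat N N \<Longrightarrow> B \<in> carrier_mat N N \<Longrightarrow> A * B \<in> carrier_mat N N"
  by (rule mult_carrier_mat)

lemmas sq_intros = sq_mult_carrier add_carrier_mat minus_carrier_mat smult_carrier_mat mat_adjoint_carrier
  msum_carrier pmat_carrier

section \<open>The Hilbert-Schmidt inner product\<close>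

lemma hs_inner_sum:
  assumes "A \<in> carrier_mat N N" "B \<in> carrier_mat N N"
  shows "hs_inner A B = (\<Sum>p\<in>{..<N} \<times> {..<N}. cnj (A $$ p) * B $$ p)"
proof -
  have "hs_inner A B = (\<Sum>i<N. \<Sum>j<N. cnj (A $$ (j, i)) * B $$ (j, i))"
    unfolding hs_inner_def using assms by (subst tr_mult[of _ N N]) auto
  also have "\<dots> = (\<Sum>j<N. \<Sum>i<N. cnj (A $$ (j, i)) * B $$ (j, i))" by (rule sum.swap)
  finally show ?thesis by (simp add: sum.cartesian_product case_prod_unfold)
qed

lemma hs_norm_L2_set:
  assumes "A \<in> carrier_mat N N"
  shows "hs_norm A = L2_set (\<lambda>p. cmod (A $$ p)) ({..<N} \<times> {..<N})"
proof -
  have "Re (hs_inner A A) = (\<Sum>p\<in>{..<N} \<times> {..<N}. (cmod (A $$ p))\<^sup>2)"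
    unfolding hs_inner_sum[OF assms assms] Re_sum
    by (intro sum.cong refl) (unfold cmod_power2, simp add: power2_eq_square)
  then show ?thesis by (simp add: hs_norm_def L2_set_def)
qed

lemma hs_norm_nonneg: "A \<in> carrier_mat N N \<Longrightarrow> 0 \<le> hs_norm A"
  by (simp add: hs_norm_L2_set L2_set_nonneg)

lemma hs_Cauchy_Schwarz:
  assumes "A \<in> carrier_mat N N" "B \<in> carrier_mat N N"
  shows "cmod (hs_inner A B) \<le> hs_norm A * hs_norm B"
proof -
  have "cmod (hs_inner A B) \<le> (\<Sum>p\<in>{..<N} \<times> {..<N}. \<bar>cmod (A $$ p)\<bar> * \<bar>cmod (B $$ p)\<bar>)"
    unfolding hs_inner_sum[OF assms] by (rule order_trans[OF norm_sum]) (simp add: norm_mult)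
  also have "\<dots> \<le> hs_norm A * hs_norm B"
    unfolding hs_norm_L2_set[OF assms(1)] hs_norm_L2_set[OF assms(2)] by (rule L2_set_mult_ineq)
  finally show ?thesis .
qed

lemma norm_entry_le_hs_norm:
  assumes "A \<in> carrier_mat N N" "i < N" "j < N" shows "cmod (A $$ (i, j)) \<le> hs_norm A"
  unfolding hs_norm_L2_set[OF assms(1)] by (rule member_le_L2_set) (use assms in auto)

lemma hs_norm_smult:
  assumes "A \<in> carrier_mat N N" shows "hs_norm (c \<cdot>\<^sub>m A) = cmod c * hs_norm A"
proof -
  have "hs_norm (c \<cdot>\<^sub>m A) = L2_set (\<lambda>p. cmod c * cmod (A $$ p)) ({..<N} \<times> {..<N})"
    using assms by (subst hs_norm_L2_set[of _ N]) (auto intro!: L2_set_cong simp: norm_mult)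
  then show ?thesis by (simp add: hs_norm_L2_set[OF assms] L2_set_right_distrib)
qed

lemma hs_norm_zero: "hs_norm (0\<^sub>m N N) = 0"
  unfolding hs_norm_L2_set[OF zero_carrier_mat] L2_set_def by (auto intro!: sum.neutral)

lemma hs_norm_add_le:
  assumes "A \<in> carrier_mat N N" "B \<in> carrier_mat N N" shows "hs_norm (A + B) \<le> hs_norm A + hs_norm B"
proof -
  have "hs_norm (A + B) \<le> L2_set (\<lambda>p. cmod (A $$ p) + cmod (B $$ p)) ({..<N} \<times> {..<N})"
    unfolding hs_norm_L2_set[OF add_carrier_mat[OF assms(2), of A]]
    using assms by (intro L2_set_mono) (auto intro: norm_triangle_ineq)
  also have "\<dots> \<le> hs_norm A + hs_norm B"
    unfolding hs_norm_L2_set[OF assms(1)] hs_norm_L2_set[OF assms(2)] by (rule L2_set_triangle_ineq)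
  finally show ?thesis .
qed

lemma hs_norm_pmat: "hs_norm (pmat n P) = sqrt (2 ^ n)" if "P \<in> pstrs {..<n}"
  unfolding hs_norm_def hs_inner_def using tr_pmat2[OF that that] by simp

lemma hs_inner_add_right:
  assumes "A \<in> carrier_mat N N" "B \<in> carrier_mat N N" "C \<in> carrier_mat N N"
  shows "hs_inner A (B + C) = hs_inner A B + hs_inner A C"
proof -
  have "hs_inner A (B + C) = (\<Sum>p\<in>{..<N} \<times> {..<N}. cnj (A $$ p) * B $$ p + cnj (A $$ p) * C $$ p)"
    unfolding hs_inner_sum[OF assms(1) add_carrier_mat[OF assms(3)]]
    by (rule sum.cong) (use assms in \<open>auto simp: distrib_left\<close>)
  then show ?thesis by (simp only: hs_inner_sum[OF assms(1,2)] hs_inner_sum[OF assms(1,3)] sum.distrib)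
qed

lemma hs_inner_add_left:
  assumes "A \<in> carrier_mat N N" "B \<in> carrier_mat N N" "C \<in> carrier_mat N N"
  shows "hs_inner (A + B) C = hs_inner A C + hs_inner B C"
proof -
  have "hs_inner (A + B) C = (\<Sum>p\<in>{..<N} \<times> {..<N}. cnj (A $$ p) * C $$ p + cnj (B $$ p) * C $$ p)"
    unfolding hs_inner_sum[OF add_carrier_mat[OF assms(2)] assms(3)]
    by (rule sum.cong) (use assms in \<open>auto simp: distrib_right\<close>)
  then show ?thesis by (simp only: hs_inner_sum[OF assms(1,3)] hs_inner_sum[OF assms(2,3)] sum.distrib)
qed

lemma hs_inner_smult_right:
  assumes "A \<in> carrier_mat N N" "B \<in> carrier_mat N N" shows "hs_inner A (c \<cdot>\<^sub>m B) = c * hs_inner A B"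
proof -
  have "hs_inner A (c \<cdot>\<^sub>m B) = (\<Sum>p\<in>{..<N} \<times> {..<N}. c * (cnj (A $$ p) * B $$ p))"
    unfolding hs_inner_sum[OF assms(1) smult_carrier_mat[OF assms(2)]]
    by (rule sum.cong) (use assms in auto)
  then show ?thesis by (simp only: hs_inner_sum[OF assms] sum_distrib_left)
qed

lemma hs_inner_cnj:
  "A \<in> carrier_mat N N \<Longrightarrow> B \<in> carrier_mat N N \<Longrightarrow> cnj (hs_inner A B) = hs_inner B A"
  by (simp add: hs_inner_sum[of _ N] cnj_sum mult.commute)

lemma hs_inner_msum_right:
  assumes "A \<in> carrier_mat N N" "\<And>a. a \<in> I \<Longrightarrow> F a \<in> carrier_mat N N"
  shows "hs_inner A (msum N I F) = (\<Sum>a\<in>I. hs_inner A (F a))"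
proof -
  have "hs_inner A (msum N I F) = (\<Sum>p\<in>{..<N} \<times> {..<N}. \<Sum>a\<in>I. cnj (A $$ p) * F a $$ p)"
    by (subst hs_inner_sum[OF assms(1) msum_carrier]) (auto simp: sum_distrib_left intro!: sum.cong)
  also have "\<dots> = (\<Sum>a\<in>I. \<Sum>p\<in>{..<N} \<times> {..<N}. cnj (A $$ p) * F a $$ p)" by (rule sum.swap)
  finally show ?thesis by (simp add: hs_inner_sum[OF assms(1) assms(2)])
qed

lemma hs_inner_msum_left:
  assumes "A \<in> carrier_mat N N" "\<And>a. a \<in> I \<Longrightarrow> F a \<in> carrier_mat N N"
  shows "hs_inner (msum N I F) A = (\<Sum>a\<in>I. hs_inner (F a) A)"
proof -
  have "hs_inner (msum N I F) A = cnj (hs_inner A (msum N I F))"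
    by (rule hs_inner_cnj[OF assms(1) msum_carrier, symmetric])
  also have "\<dots> = (\<Sum>a\<in>I. cnj (hs_inner A (F a)))"
    by (simp only: hs_inner_msum_right[OF assms] cnj_sum)
  also have "\<dots> = (\<Sum>a\<in>I. hs_inner (F a) A)"
    by (intro sum.cong refl hs_inner_cnj[OF assms(1)] assms(2))
  finally show ?thesis .
qed

lemma hs_inner_mult_left:
  assumes "A \<in> carrier_mat N N" "X \<in> carrier_mat N N" "M \<in> carrier_mat N N"
  shows "hs_inner A (X * M) = hs_inner (mat_adjoint X * A) M"
proof -
  have "mat_adjoint (mat_adjoint X * A) = mat_adjoint A * X"
    using assms by (subst mat_adjoint_mult[of _ N N]) auto
  then show ?thesis unfolding hs_inner_def
    using assms by (metis assoc_mult_mat mat_adjoint_carrier)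
qed

lemma hs_inner_mult_right:
  assumes "A \<in> carrier_mat N N" "X \<in> carrier_mat N N" "M \<in> carrier_mat N N"
  shows "hs_inner A (M * X) = hs_inner (A * mat_adjoint X) M"
proof -
  have 1: "mat_adjoint (A * mat_adjoint X) = X * mat_adjoint A"
    using assms by (subst mat_adjoint_mult[of _ N N]) auto
  have "tr (mat_adjoint A * (M * X)) = tr (mat_adjoint A * M * X)"
    using assms by (simp add: assoc_mult_mat[of _ N N _ N _ N])
  also have "\<dots> = tr (X * (mat_adjoint A * M))"
    by (rule tr_mult_commute[of _ N N]) (intro sq_intros assms)+
  also have "\<dots> = tr (X * mat_adjoint A * M)"
    using assms by (simp add: assoc_mult_mat[of _ N N _ N _ N])
  finally show ?thesis unfolding hs_inner_def 1 .
qed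

definition mat_unit :: "nat \<Rightarrow> nat \<times> nat \<Rightarrow> complex mat" where
  "mat_unit N ij = mat N N (\<lambda>kl. if kl = ij then 1 else 0)"

lemma mat_unit_carrier [simp]: "mat_unit N p \<in> carrier_mat N N"
  by (simp add: mat_unit_def)

lemma hs_inner_mat_unit:
  assumes "A \<in> carrier_mat N N" "p \<in> {..<N} \<times> {..<N}" shows "hs_inner (mat_unit N p) A = A $$ p"
proof -
  have "hs_inner (mat_unit N p) A = (\<Sum>q\<in>{..<N} \<times> {..<N}. if q = p then A $$ p else 0)"
    unfolding hs_inner_sum[OF mat_unit_carrier assms(1)]
    by (rule sum.cong) (auto simp: mat_unit_def)
  then show ?thesis using assms(2) by simp
qed

text \<open>\<open>hs_adjoint\<close> is defined through matrix units for an arbitrary function. The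
  adjunction identity, tested on these units, identifies it with any explicit candidate
  \<open>F'\<close>.\<close>

lemma hs_adjoint_eqI:
  assumes "\<And>A. A \<in> carrier_mat N N \<Longrightarrow> F' A \<in> carrier_mat N N"
    and "\<And>A M. A \<in> carrier_mat N N \<Longrightarrow> M \<in> carrier_mat N N \<Longrightarrow> hs_inner (F M) A = hs_inner M (F' A)"
    and "A \<in> carrier_mat N N"
  shows "hs_adjoint N F A = F' A"
proof (rule eq_matI)
  have c: "F' A \<in> carrier_mat N N" by (rule assms(1)[OF assms(3)])
  fix i j assume "i < dim_row (F' A)" "j < dim_col (F' A)"
  then have ij: "i < N" "j < N" using c by auto
  have "hs_inner (F (mat_unit N (i, j))) A = F' A $$ (i, j)"
    unfolding assms(2)[OF assms(3) mat_unit_carrier] by (rule hs_inner_mat_unit[OF c]) (use ij in auto)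
  then show "hs_adjoint N F A $$ (i, j) = F' A $$ (i, j)"
    using ij by (simp add: hs_adjoint_def mat_unit_def)
qed (use assms(1)[OF assms(3)] in \<open>auto simp: hs_adjoint_def\<close>)

text \<open>An adjoint \<open>F'\<close> makes every entry of \<open>F M\<close> an inner product of
  \<open>M\<close> with a fixed matrix, and Cauchy-Schwarz does the rest. Boundedness is needed
  because the supremum in \<open>norm_2_2\<close> says nothing for an unbounded set.\<close>

lemma hs_norm_bounded:
  assumes "\<And>A. A \<in> carrier_mat N N \<Longrightarrow> F A \<in> carrier_mat N N" "\<And>A. A \<in> carrier_mat N N \<Longrightarrow> F' A \<in> carrier_mat N N"
    and "\<And>A M. A \<in> carrier_mat N N \<Longrightarrow> M \<in> carrier_mat N N \<Longrightarrow> hs_inner A (F M) = hs_inner (F' A) M"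
  shows "\<exists>C\<ge>0. \<forall>M\<in>carrier_mat N N. hs_norm (F M) \<le> C * hs_norm M"
proof (intro exI conjI ballI)
  let ?D = "{..<N} \<times> {..<N}"
  let ?C = "L2_set (\<lambda>p. hs_norm (F' (mat_unit N p))) ?D"
  show "0 \<le> ?C" by (rule L2_set_nonneg)
  fix M :: "complex mat" assume M: "M \<in> carrier_mat N N"
  have "hs_norm (F M) \<le> L2_set (\<lambda>p. hs_norm (F' (mat_unit N p)) * hs_norm M) ?D"
    unfolding hs_norm_L2_set[OF assms(1)[OF M]]
  proof (rule L2_set_mono)
    fix p assume p: "p \<in> ?D"
    have "F M $$ p = hs_inner (F' (mat_unit N p)) M"
      using hs_inner_mat_unit[OF assms(1)[OF M] p] assms(3)[OF mat_unit_carrier M] by simp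
    then show "cmod (F M $$ p) \<le> hs_norm (F' (mat_unit N p)) * hs_norm M"
      using hs_Cauchy_Schwarz[OF assms(2)[OF mat_unit_carrier] M] by simp
  qed simp
  also have "\<dots> = ?C * hs_norm M"
    using hs_norm_nonneg[OF M] by (subst L2_set_left_distrib) auto
  finally show "hs_norm (F M) \<le> ?C * hs_norm M" .
qed

text \<open>The generator with drift \<open>K = - \<i> H - 1/2 \<Sum> J* J\<close>, which absorbs
  the Hamiltonian and the anticommutator. The condition on \<open>K\<close> that preserves the trace
  is kept separate, and the index set is arbitrary: the same form serves the local terms, the whole
  generator, and a perturbation of it with one more jump.\<close>

definition lindform :: "nat \<Rightarrow> 'a set \<Rightarrow> complex mat \<Rightarrow> ('a \<Rightarrow> complex mat) \<Rightarrow> superop" where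
  "lindform N I K J M = K * M + M * mat_adjoint K + msum N I (\<lambda>a. J a * M * mat_adjoint (J a))"

definition lindform_adj :: "nat \<Rightarrow> 'a set \<Rightarrow> complex mat \<Rightarrow> ('a \<Rightarrow> complex mat) \<Rightarrow> superop" where
  "lindform_adj N I K J A = mat_adjoint K * A + A * K + msum N I (\<lambda>a. mat_adjoint (J a) * A * J a)"

lemma lindform_carrier [simp]: "lindform N I K J M \<in> carrier_mat N N"
  by (simp add: lindform_def)

lemma lindform_adj_carrier [simp]: "lindform_adj N I K J M \<in> carrier_mat N N"
  by (simp add: lindform_adj_def)

lemma hs_inner_lindform:
  assumes K: "K \<in> carrier_mat N N" and J: "\<And>a. a \<in> I \<Longrightarrow> J a \<in> carrier_mat N N"
    and A: "A \<in> carrier_mat N N" and M: "M \<in> carrier_mat N N"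
  shows "hs_inner A (lindform N I K J M) = hs_inner (lindform_adj N I K J A) M"
proof -
  have "hs_inner A (lindform N I K J M) = hs_inner A (K * M) + hs_inner A (M * mat_adjoint K) +
      hs_inner A (msum N I (\<lambda>a. J a * M * mat_adjoint (J a)))"
    unfolding lindform_def
    by (subst hs_inner_add_right[of _ N], (intro sq_intros A K M)+)+ simp
  also have "hs_inner A (msum N I (\<lambda>a. J a * M * mat_adjoint (J a))) = (\<Sum>a\<in>I. hs_inner A (J a * M * mat_adjoint (J a)))"
    by (rule hs_inner_msum_right[OF A]) (intro sq_intros J M)
  also have "\<dots> = (\<Sum>a\<in>I. hs_inner (mat_adjoint (J a) * A * J a) M)"
  proof (rule sum.cong[OF refl])
    fix a assume "a \<in> I"
    note Ja = J[OF this]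
    have "hs_inner A (J a * M * mat_adjoint (J a)) = hs_inner (A * mat_adjoint (mat_adjoint (J a))) (J a * M)"
      by (rule hs_inner_mult_right[of _ N]) (intro sq_intros A Ja M)+
    also have "\<dots> = hs_inner (mat_adjoint (J a) * (A * J a)) M"
      by (subst hs_inner_mult_left[of _ N]) (simp_all add: sq_intros A Ja M)
    also have "mat_adjoint (J a) * (A * J a) = mat_adjoint (J a) * A * J a"
      by (rule assoc_mult_mat[symmetric, of _ N N _ N _ N]) (intro sq_intros A Ja)+
    finally show "hs_inner A (J a * M * mat_adjoint (J a)) = hs_inner (mat_adjoint (J a) * A * J a) M" .
  qed
  also have "\<dots> = hs_inner (msum N I (\<lambda>a. mat_adjoint (J a) * A * J a)) M"
    by (rule hs_inner_msum_left[symmetric, OF M]) (intro sq_intros A J)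
  also have "hs_inner A (K * M) = hs_inner (mat_adjoint K * A) M" by (rule hs_inner_mult_left[OF A K M])
  also have "hs_inner A (M * mat_adjoint K) = hs_inner (A * K) M"
    using hs_inner_mult_right[OF A mat_adjoint_carrier[OF K] M] by simp
  also have "hs_inner (mat_adjoint K * A) M + hs_inner (A * K) M +
      hs_inner (msum N I (\<lambda>a. mat_adjoint (J a) * A * J a)) M = hs_inner (lindform_adj N I K J A) M"
    unfolding lindform_adj_def
    by (subst hs_inner_add_left[of _ N], (intro sq_intros A K M)+)+ simp
  finally show ?thesis .
qed

lemma hs_adjoint_lindform:
  assumes K: "K \<in> carrier_mat N N" and J: "\<And>a. a \<in> I \<Longrightarrow> J a \<in> carrier_mat N N" and A: "A \<in> carrier_mat N N"
    and F: "\<And>M. M \<in> carrier_mat N N \<Longrightarrow> F M = lindform N I K J M"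
  shows "hs_adjoint N F A = lindform_adj N I K J A"
proof (rule hs_adjoint_eqI[OF _ _ A])
  fix A M :: "complex mat" assume AM: "A \<in> carrier_mat N N" "M \<in> carrier_mat N N"
  have "hs_inner (lindform N I K J M) A = cnj (hs_inner A (lindform N I K J M))"
    by (rule hs_inner_cnj[symmetric, of _ N]) (use AM in auto)
  also have "\<dots> = hs_inner M (lindform_adj N I K J A)"
    by (simp only: hs_inner_lindform[OF K J AM] hs_inner_cnj[OF lindform_adj_carrier AM(2)])
  finally show "hs_inner (F M) A = hs_inner M (lindform_adj N I K J A)" unfolding F[OF AM(2)] .
qed simp

lemma lindform_bounded:
  assumes K: "K \<in> carrier_mat N N" and J: "\<And>a. a \<in> I \<Longrightarrow> J a \<in> carrier_mat N N"
  shows "\<exists>C\<ge>0. \<forall>M\<in>carrier_mat N N. hs_norm (lindform N I K J M) \<le> C * hs_norm M"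
  by (rule hs_norm_bounded[of N _ "lindform_adj N I K J"]) (auto intro: hs_inner_lindform[OF K J])

text \<open>Homogeneity reduces to the unit ball; boundedness makes the supremum over it an upper
  bound.\<close>

lemma hs_norm_le_norm_2_2:
  assumes F: "\<And>A. A \<in> carrier_mat N N \<Longrightarrow> F A \<in> carrier_mat N N"
    and bd: "\<forall>M\<in>carrier_mat N N. hs_norm (F M) \<le> C * hs_norm M" "0 \<le> C"
    and sc: "\<And>A c. A \<in> carrier_mat N N \<Longrightarrow> F (c \<cdot>\<^sub>m A) = c \<cdot>\<^sub>m F A"
    and A: "A \<in> carrier_mat N N"
  shows "hs_norm (F A) \<le> norm_2_2 N F * hs_norm A"
proof (cases "hs_norm A = 0")
  case True
  then show ?thesis using bd(1)[rule_format, OF A] by simp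
next
  case False
  then have pos: "0 < hs_norm A" using hs_norm_nonneg[OF A] by simp
  let ?c = "complex_of_real (1 / hs_norm A)"
  have bdd: "bdd_above ((\<lambda>M. hs_norm (F M)) ` {M \<in> carrier_mat N N. hs_norm M \<le> 1})"
  proof (rule bdd_aboveI2)
    fix M :: "complex mat" assume "M \<in> {M \<in> carrier_mat N N. hs_norm M \<le> 1}"
    then show "hs_norm (F M) \<le> C" using bd(1)[rule_format, of M] mult_left_le[of "hs_norm M" C] bd(2) by auto
  qed
  have "hs_norm (F (?c \<cdot>\<^sub>m A)) \<le> norm_2_2 N F"
    unfolding norm_2_2_def
    by (rule cSUP_upper[OF _ bdd]) (use A pos in \<open>simp add: hs_norm_smult[OF A] norm_divide\<close>)
  then show ?thesis
    using pos by (simp add: sc[OF A] hs_norm_smult[OF F[OF A]] norm_divide divide_le_eq)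
qed

lemma norm_2_2_nonneg:
  assumes F: "\<And>A. A \<in> carrier_mat N N \<Longrightarrow> F A \<in> carrier_mat N N"
    and bd: "\<forall>M\<in>carrier_mat N N. hs_norm (F M) \<le> C * hs_norm M" "0 \<le> C"
  shows "0 \<le> norm_2_2 N F"
proof -
  have bdd: "bdd_above ((\<lambda>M. hs_norm (F M)) ` {M \<in> carrier_mat N N. hs_norm M \<le> 1})"
  proof (rule bdd_aboveI2)
    fix M :: "complex mat" assume "M \<in> {M \<in> carrier_mat N N. hs_norm M \<le> 1}"
    then show "hs_norm (F M) \<le> C" using bd(1)[rule_format, of M] mult_left_le[of "hs_norm M" C] bd(2) by auto
  qed
  have "0 \<le> hs_norm (F (0\<^sub>m N N))" by (rule hs_norm_nonneg[of _ N]) (intro F zero_carrier_mat)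
  also have "\<dots> \<le> norm_2_2 N F"
    unfolding norm_2_2_def by (rule cSUP_upper[OF _ bdd]) (simp add: hs_norm_zero)
  finally show ?thesis .
qed

section \<open>Local terms as Lindblad forms\<close>

definition loc_ham :: "nat \<Rightarrow> lindblad \<Rightarrow> nat set \<Rightarrow> complex mat" where
  "loc_ham n lb e = ham n (hcoeff lb) {P. supp P = e}"

definition loc_drift :: "nat \<Rightarrow> lindblad \<Rightarrow> nat set \<Rightarrow> complex mat" where
  "loc_drift n lb e = (- \<i>) \<cdot>\<^sub>m loc_ham n lb e +
     (- 1 / 2) \<cdot>\<^sub>m msum (2 ^ n) {..<length (jumps lb e)} (\<lambda>a. mat_adjoint (jumps lb e ! a) * (jumps lb e ! a))"

text \<open>Hermiticity is assumed of the whole Hamiltonian only; real coefficients carry it over to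
  the part on each set \<open>e\<close>.\<close>

lemma hcoeff_real:
  assumes "k_local n k lb" "P \<in> pstrs {..<n}" shows "cnj (hcoeff lb P) = hcoeff lb P"
proof -
  let ?H = "ham n (hcoeff lb) (pstrs {..<n})"
  have H: "mat_adjoint ?H = ?H" "?H \<in> carrier_mat (2 ^ n) (2 ^ n)"
    using assms(1) by (auto simp: k_local_def Let_def ham_def)
  have "cnj (tr (?H * pmat n P)) = tr (mat_adjoint (?H * pmat n P))"
    by (rule tr_adjoint[symmetric, of _ "2 ^ n"]) (intro sq_intros H)
  also have "mat_adjoint (?H * pmat n P) = pmat n P * ?H"
    by (subst mat_adjoint_mult[OF H(2) pmat_carrier]) (simp add: H)
  also have "tr (pmat n P * ?H) = tr (?H * pmat n P)" by (rule tr_mult_commute[OF pmat_carrier H(2)])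
  finally show ?thesis by (simp add: tr_ham[OF assms(2)])
qed

lemma loc_ham_carrier [simp]: "loc_ham n lb e \<in> carrier_mat (2 ^ n) (2 ^ n)"
  by (simp add: loc_ham_def ham_def)

lemma loc_drift_carrier [simp]: "loc_drift n lb e \<in> carrier_mat (2 ^ n) (2 ^ n)"
  by (simp add: loc_drift_def)

lemma jumps_supported:
  assumes "k_local n k lb" "e \<in> local_sets n k" "a < length (jumps lb e)"
  shows "supported_on n e (jumps lb e ! a)"
  using assms by (auto simp: k_local_def)

lemma loc_drift_adjoint:
  assumes kl: "k_local n k lb" and e: "e \<in> local_sets n k"
  shows "mat_adjoint (loc_drift n lb e) = \<i> \<cdot>\<^sub>m loc_ham n lb e +
    (- 1 / 2) \<cdot>\<^sub>m msum (2 ^ n) {..<length (jumps lb e)} (\<lambda>a. mat_adjoint (jumps lb e ! a) * (jumps lb e ! a))"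
proof -
  let ?N = "2 ^ n" and ?I = "{..<length (jumps lb e)}" and ?J = "(!) (jumps lb e)" and ?H = "loc_ham n lb e"
  let ?S = "msum ?N ?I (\<lambda>a. mat_adjoint (?J a) * ?J a)"
  have e': "e \<subseteq> {..<n}" using e by (auto simp: local_sets_def)
  have J: "?J a \<in> carrier_mat ?N ?N" if "a \<in> ?I" for a
    using jumps_supported[OF kl e] that by (intro supported_on_carrier[of n e]) auto
  have Hh: "mat_adjoint ?H = ?H"
    unfolding loc_ham_def ham_def using e' hcoeff_real[OF kl]
    by (subst mat_adjoint_msum) (auto intro!: msum_cong simp: mat_adjoint_smult pstrs_def)
  have Sh: "mat_adjoint ?S = ?S"
  proof (subst mat_adjoint_msum)
    show "mat_adjoint (?J a) * ?J a \<in> carrier_mat ?N ?N" if "a \<in> ?I" for a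
      using J[OF that] by (intro sq_intros)
    show "msum ?N ?I (\<lambda>a. mat_adjoint (mat_adjoint (?J a) * ?J a)) = ?S"
      by (rule msum_cong[OF refl]) (simp add: mat_adjoint_mult[OF mat_adjoint_carrier[OF J] J])
  qed
  show ?thesis
    unfolding loc_drift_def
    by (subst mat_adjoint_add[of _ ?N ?N]) (auto simp: mat_adjoint_smult Hh Sh)
qed

lemma local_term_lindform:
  assumes kl: "k_local n k lb" and e: "e \<in> local_sets n k" and M: "M \<in> carrier_mat (2 ^ n) (2 ^ n)"
  shows "local_term n lb e M = lindform (2 ^ n) {..<length (jumps lb e)} (loc_drift n lb e) ((!) (jumps lb e)) M"
proof -
  let ?N = "2 ^ n" and ?I = "{..<length (jumps lb e)}" and ?J = "(!) (jumps lb e)" and ?H = "loc_ham n lb e"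
  let ?S = "msum ?N ?I (\<lambda>a. mat_adjoint (?J a) * ?J a)"
  have J: "?J a \<in> carrier_mat ?N ?N" if "a \<in> ?I" for a
    using jumps_supported[OF kl e] that by (intro supported_on_carrier[of n e]) auto
  have Hc: "?H \<in> carrier_mat ?N ?N" and Sc: "?S \<in> carrier_mat ?N ?N" by simp_all
  note Kh = loc_drift_adjoint[OF kl e]
  have SM: "?S * M = msum ?N ?I (\<lambda>a. mat_adjoint (?J a) * ?J a * M)"
    by (rule msum_mult[OF M]) (intro sq_intros J)
  have MS: "M * ?S = msum ?N ?I (\<lambda>a. M * (mat_adjoint (?J a) * ?J a))"
    by (rule mult_msum[OF M]) (intro sq_intros J)
  have KM: "loc_drift n lb e * M = (- \<i>) \<cdot>\<^sub>m (?H * M) + (- 1 / 2) \<cdot>\<^sub>m (?S * M)"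
    unfolding loc_drift_def using M Hc Sc
    by (simp add: add_mult_distrib_mat[of _ ?N ?N _ _ ?N] mult_smult_assoc_mat[of _ ?N ?N _ ?N])
  have MK: "M * mat_adjoint (loc_drift n lb e) = \<i> \<cdot>\<^sub>m (M * ?H) + (- 1 / 2) \<cdot>\<^sub>m (M * ?S)"
    unfolding Kh using M Hc Sc
    by (simp add: mult_add_distrib_mat[of _ ?N ?N _ ?N] mult_smult_distrib[of _ ?N ?N _ ?N])
  have jd: "dim_row (?J a) = ?N" "dim_col (?J a) = ?N" if "a < length (jumps lb e)" for a
    using J[of a] that by auto
  show ?thesis
    unfolding lindform_def KM MK SM MS local_term_def ham_part_def Let_def loc_ham_def[symmetric]
  proof (rule eq_matI, goal_cases)
    case (1 i j)
    then have ij: "i < ?N" "j < ?N" by auto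
    have d: "dim_row ?H = ?N" "dim_col ?H = ?N" "dim_row M = ?N" "dim_col M = ?N"
      using carrier_matD[OF Hc] carrier_matD[OF M] by simp_all
    have "(\<Sum>a\<in>?I. (?J a * M * mat_adjoint (?J a) -
        (1 / 2) \<cdot>\<^sub>m (mat_adjoint (?J a) * ?J a * M + M * (mat_adjoint (?J a) * ?J a))) $$ (i, j)) =
      (\<Sum>a\<in>?I. (?J a * M * mat_adjoint (?J a)) $$ (i, j)) -
      (1 / 2) * ((\<Sum>a\<in>?I. (mat_adjoint (?J a) * ?J a * M) $$ (i, j)) + (\<Sum>a\<in>?I. (M * (mat_adjoint (?J a) * ?J a)) $$ (i, j)))"
      unfolding sum.distrib[symmetric] sum_distrib_left sum_subtractf[symmetric]
      by (intro sum.cong refl) (use ij d jd in \<open>simp del: index_mult_mat(1)\<close>)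
    then show ?case using ij d by (simp add: algebra_simps del: index_mult_mat(1))
  qed (use carrier_matD[OF Hc] carrier_matD[OF M] in auto)
qed

lemma supported_on_iff:
  assumes "e \<subseteq> {..<n}" shows "supported_on n e X \<longleftrightarrow> pauli_local n e X"
proof
  have fin: "finite e" using assms finite_subset by blast
  show "pauli_local n e X" if "supported_on n e X" using pauli_local_supported[OF fin that] .
  assume X: "pauli_local n e X"
  show "supported_on n e X"
  proof (rule supported_onI)
    have Xc: "X \<in> carrier_mat (2 ^ n) (2 ^ n)" using X by (simp add: pauli_local_def)
    have "msum (2 ^ n) (pstrs {..<n}) (\<lambda>P. (tr (X * pmat n P) / 2 ^ n) \<cdot>\<^sub>m pmat n P) =
        msum (2 ^ n) (pstrs e) (\<lambda>P. (tr (X * pmat n P) / 2 ^ n) \<cdot>\<^sub>m pmat n P)"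
      by (rule eq_matI)
        (use X pstrs_mono[OF assms] in \<open>auto intro!: sum.mono_neutral_right finite_pstrs simp: pauli_local_def pstrs_mem\<close>)
    then show "X = msum (2 ^ n) (pstrs e) (\<lambda>P. (tr (X * pmat n P) / 2 ^ n) \<cdot>\<^sub>m pmat n P)"
      using pauli_expansion[OF Xc] by simp
  qed
qed

lemma supported_on_mult:
  assumes "e \<subseteq> {..<n}" "supported_on n e X" "supported_on n e Y" shows "supported_on n e (X * Y)"
  using pauli_local_mult[OF assms(2,3)] supported_on_iff[OF assms(1)] by simp

lemma supported_on_smult:
  assumes "e \<subseteq> {..<n}" "supported_on n e X" shows "supported_on n e (c \<cdot>\<^sub>m X)"
proof -
  have X: "X \<in> carrier_mat (2 ^ n) (2 ^ n)" by (rule supported_on_carrier[OF assms(2)])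
  have "tr (c \<cdot>\<^sub>m X * pmat n P) = c * tr (X * pmat n P)" for P
    unfolding mult_smult_assoc_mat[OF X pmat_carrier]
    by (rule tr_smult[of _ "2 ^ n"]) (intro sq_intros X)
  then show ?thesis
    using assms X unfolding supported_on_iff[OF assms(1)] pauli_local_def by simp
qed

lemma supported_on_add:
  assumes "e \<subseteq> {..<n}" "supported_on n e X" "supported_on n e Y" shows "supported_on n e (X + Y)"
proof -
  have XY: "X \<in> carrier_mat (2 ^ n) (2 ^ n)" "Y \<in> carrier_mat (2 ^ n) (2 ^ n)"
    using assms supported_on_carrier by auto
  have "tr ((X + Y) * pmat n P) = tr (X * pmat n P) + tr (Y * pmat n P)" for P
    unfolding add_mult_distrib_mat[OF XY pmat_carrier]
    by (rule tr_add[of _ "2 ^ n"]) (intro sq_intros XY)+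
  then show ?thesis
    using assms XY unfolding supported_on_iff[OF assms(1)] pauli_local_def by simp
qed

lemma supported_on_msum:
  assumes "e \<subseteq> {..<n}" "\<And>a. a \<in> I \<Longrightarrow> supported_on n e (F a)" shows "supported_on n e (msum (2 ^ n) I F)"
proof -
  have F: "F a \<in> carrier_mat (2 ^ n) (2 ^ n)" if "a \<in> I" for a
    using assms(2)[OF that] by (rule supported_on_carrier)
  have "tr (msum (2 ^ n) I F * pmat n P) = (\<Sum>a\<in>I. tr (F a * pmat n P))" for P
    by (subst msum_mult[OF pmat_carrier F], assumption, rule tr_msum) (intro sq_intros F)
  then show ?thesis
    using assms(2) unfolding supported_on_iff[OF assms(1)] pauli_local_def by simp
qed

lemma supported_on_commute:
  assumes "supported_on n e X" "supported_on n S A" "e \<inter> S = {}"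
  shows "X * A = A * X"
proof -
  obtain x where x: "X = msum (2 ^ n) (pstrs e) (\<lambda>P. x P \<cdot>\<^sub>m pmat n P)"
    using assms(1) by (auto simp: supported_on_def)
  obtain a where a: "A = msum (2 ^ n) (pstrs S) (\<lambda>P. a P \<cdot>\<^sub>m pmat n P)"
    using assms(2) by (auto simp: supported_on_def)
  have A: "A \<in> carrier_mat (2 ^ n) (2 ^ n)" by (simp add: a)
  have "(x P \<cdot>\<^sub>m pmat n P) * A = A * (x P \<cdot>\<^sub>m pmat n P)" if P: "P \<in> pstrs e" for P
  proof -
    have xc: "x P \<cdot>\<^sub>m pmat n P \<in> carrier_mat (2 ^ n) (2 ^ n)" by simp
    have "(x P \<cdot>\<^sub>m pmat n P) * A = msum (2 ^ n) (pstrs S) (\<lambda>Q. (x P \<cdot>\<^sub>m pmat n P) * (a Q \<cdot>\<^sub>m pmat n Q))"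
      unfolding a by (rule mult_msum[OF xc]) simp
    also have "\<dots> = msum (2 ^ n) (pstrs S) (\<lambda>Q. (a Q \<cdot>\<^sub>m pmat n Q) * (x P \<cdot>\<^sub>m pmat n P))"
    proof (rule msum_cong[OF refl])
      fix Q assume "Q \<in> pstrs S"
      then have "supp P \<inter> supp Q = {}" using P assms(3) unfolding pstrs_def by blast
      then have "pmat n P * pmat n Q = pmat n Q * pmat n P" by (rule pauli_mat_commute)
      then show "(x P \<cdot>\<^sub>m pmat n P) * (a Q \<cdot>\<^sub>m pmat n Q) = (a Q \<cdot>\<^sub>m pmat n Q) * (x P \<cdot>\<^sub>m pmat n P)"
        by (simp add: mult_smult_assoc_mat[of _ "2 ^ n" "2 ^ n" _ "2 ^ n"] mult_smult_distrib[of _ "2 ^ n" "2 ^ n" _ "2 ^ n"] mult.commute)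
           (auto intro!: eq_matI)
    qed
    also have "\<dots> = A * (x P \<cdot>\<^sub>m pmat n P)"
      unfolding a by (rule msum_mult[OF xc, symmetric]) simp
    finally show ?thesis .
  qed
  then have "msum (2 ^ n) (pstrs e) (\<lambda>P. (x P \<cdot>\<^sub>m pmat n P) * A) = msum (2 ^ n) (pstrs e) (\<lambda>P. A * (x P \<cdot>\<^sub>m pmat n P))"
    by (intro msum_cong refl)
  moreover have "X * A = msum (2 ^ n) (pstrs e) (\<lambda>P. (x P \<cdot>\<^sub>m pmat n P) * A)"
    unfolding x by (rule msum_mult[OF A]) simp
  moreover have "A * X = msum (2 ^ n) (pstrs e) (\<lambda>P. A * (x P \<cdot>\<^sub>m pmat n P))"
    unfolding x by (rule mult_msum[OF A]) simp
  ultimately show ?thesis by simp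
qed

lemma loc_drift_supported:
  assumes "k_local n k lb" "e \<in> local_sets n k" shows "supported_on n e (loc_drift n lb e)"
proof -
  have e: "e \<subseteq> {..<n}" "finite e" using assms(2) finite_subset by (auto simp: local_sets_def)
  show ?thesis
    unfolding loc_drift_def loc_ham_def
    by (intro supported_on_add supported_on_smult supported_on_msum supported_on_mult supported_on_adjoint
        supported_on_ham e jumps_supported[OF assms]) auto
qed

text \<open>The Heisenberg form of trace preservation: the adjoint map annihilates the
  identity.\<close>

lemma loc_drift_sum:
  assumes "k_local n k lb" "e \<in> local_sets n k"
  shows "mat_adjoint (loc_drift n lb e) + loc_drift n lb e +
    msum (2 ^ n) {..<length (jumps lb e)} (\<lambda>a. mat_adjoint (jumps lb e ! a) * (jumps lb e ! a)) = 0\<^sub>m (2 ^ n) (2 ^ n)"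
  unfolding loc_drift_adjoint[OF assms] unfolding loc_drift_def
  using carrier_matD[OF loc_ham_carrier[of n lb e]] by (intro eq_matI) (auto simp: field_simps)

abbreviation loc_adj :: "nat \<Rightarrow> lindblad \<Rightarrow> nat set \<Rightarrow> superop" where
  "loc_adj n lb e \<equiv> lindform_adj (2 ^ n) {..<length (jumps lb e)} (loc_drift n lb e) ((!) (jumps lb e))"

lemma loc_adj_supported:
  assumes kl: "k_local n k lb" and e: "e \<in> local_sets n k" and S: "S \<subseteq> {..<n}" and A: "supported_on n S A"
  shows "supported_on n (S \<union> e) (loc_adj n lb e A)"
proof -
  have Se: "S \<union> e \<subseteq> {..<n}" and fin: "finite (S \<union> e)"
    using S e finite_subset[of "S \<union> e" "{..<n}"] by (auto simp: local_sets_def)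
  have A': "supported_on n (S \<union> e) A" by (rule supported_on_mono[OF A _ fin]) auto
  have K: "supported_on n (S \<union> e) (loc_drift n lb e)"
    by (rule supported_on_mono[OF loc_drift_supported[OF kl e] _ fin]) auto
  have J: "supported_on n (S \<union> e) (jumps lb e ! a)" if "a \<in> {..<length (jumps lb e)}" for a
    by (rule supported_on_mono[OF jumps_supported[OF kl e] _ fin]) (use that in auto)
  show ?thesis unfolding lindform_adj_def
    by (intro supported_on_add supported_on_mult supported_on_msum supported_on_adjoint Se A' K J)
qed

text \<open>\<open>A\<close> commutes with the drift and the jumps, so the adjoint map sends it to
  \<open>A\<close> times the image of the identity, which is 0.\<close>

lemma loc_adj_eq_0:
  assumes kl: "k_local n k lb" and e: "e \<in> local_sets n k" and A: "supported_on n S A" and dis: "e \<inter> S = {}"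
  shows "loc_adj n lb e A = 0\<^sub>m (2 ^ n) (2 ^ n)"
proof -
  let ?N = "2 ^ n" and ?I = "{..<length (jumps lb e)}" and ?J = "(!) (jumps lb e)" and ?K = "loc_drift n lb e"
  let ?S = "msum ?N ?I (\<lambda>a. mat_adjoint (?J a) * ?J a)"
  have Ac: "A \<in> carrier_mat ?N ?N" by (rule supported_on_carrier[OF A])
  have J: "supported_on n e (?J a)" if "a \<in> ?I" for a using jumps_supported[OF kl e] that by auto
  have Jc: "?J a \<in> carrier_mat ?N ?N" if "a \<in> ?I" for a by (rule supported_on_carrier[OF J[OF that]])
  have 1: "mat_adjoint ?K * A = A * mat_adjoint ?K"
    by (rule supported_on_commute[OF supported_on_adjoint[OF loc_drift_supported[OF kl e]] A dis])
  have "msum ?N ?I (\<lambda>a. mat_adjoint (?J a) * A * ?J a) = msum ?N ?I (\<lambda>a. A * (mat_adjoint (?J a) * ?J a))"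
  proof (rule msum_cong[OF refl])
    fix a assume a: "a \<in> ?I"
    have "mat_adjoint (?J a) * A * ?J a = A * mat_adjoint (?J a) * ?J a"
      using supported_on_commute[OF supported_on_adjoint[OF J[OF a]] A dis] by simp
    also have "\<dots> = A * (mat_adjoint (?J a) * ?J a)"
      by (rule assoc_mult_mat[OF Ac mat_adjoint_carrier[OF Jc[OF a]] Jc[OF a]])
    finally show "mat_adjoint (?J a) * A * ?J a = A * (mat_adjoint (?J a) * ?J a)" .
  qed
  also have "\<dots> = A * ?S" by (rule mult_msum[OF Ac, symmetric]) (intro sq_intros Jc)
  finally have "loc_adj n lb e A = A * mat_adjoint ?K + A * ?K + A * ?S"
    unfolding lindform_adj_def 1 by simp
  also have "\<dots> = A * (mat_adjoint ?K + ?K + ?S)"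
  proof -
    have c: "mat_adjoint ?K \<in> carrier_mat ?N ?N" "?K \<in> carrier_mat ?N ?N" "?S \<in> carrier_mat ?N ?N"
      "mat_adjoint ?K + ?K \<in> carrier_mat ?N ?N" by (simp_all add: sq_intros)
    show ?thesis by (simp only: mult_add_distrib_mat[OF Ac c(4) c(3)] mult_add_distrib_mat[OF Ac c(1) c(2)])
  qed
  also have "\<dots> = 0\<^sub>m ?N ?N" unfolding loc_drift_sum[OF kl e] by (rule right_mult_zero_mat[OF Ac])
  finally show ?thesis .
qed

definition loc_norm :: "nat \<Rightarrow> lindblad \<Rightarrow> nat set \<Rightarrow> real" where
  "loc_norm n lb e = norm_2_2 (2 ^ n) (hs_adjoint (2 ^ n) (local_term n lb e))"

text \<open>The norm of the adjoint, which enters the interaction strength, becomes usable once the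
  adjoint of the local term is known in closed form.\<close>

lemma hs_norm_loc_adj:
  assumes kl: "k_local n k lb" and e: "e \<in> local_sets n k"
  shows "0 \<le> loc_norm n lb e"
    and "A \<in> carrier_mat (2 ^ n) (2 ^ n) \<Longrightarrow> hs_norm (loc_adj n lb e A) \<le> loc_norm n lb e * hs_norm A"
proof -
  let ?N = "2 ^ n" and ?I = "{..<length (jumps lb e)}" and ?J = "(!) (jumps lb e)" and ?K = "loc_drift n lb e"
  let ?F = "hs_adjoint ?N (local_term n lb e)"
  have J: "?J a \<in> carrier_mat ?N ?N" if "a \<in> ?I" for a
    using jumps_supported[OF kl e] that by (intro supported_on_carrier[of n e]) auto
  have F: "?F A = loc_adj n lb e A" if A: "A \<in> carrier_mat ?N ?N" for A
    by (rule hs_adjoint_lindform[OF _ J A local_term_lindform[OF kl e]]) auto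
  have Fc: "?F A \<in> carrier_mat ?N ?N" if A: "A \<in> carrier_mat ?N ?N" for A unfolding F[OF A] by simp
  have "\<exists>C\<ge>0. \<forall>M\<in>carrier_mat ?N ?N. hs_norm (loc_adj n lb e M) \<le> C * hs_norm M"
  proof (rule hs_norm_bounded[of ?N _ "lindform ?N ?I ?K ?J"])
    fix A M :: "complex mat" assume AM: "A \<in> carrier_mat ?N ?N" "M \<in> carrier_mat ?N ?N"
    show "hs_inner A (loc_adj n lb e M) = hs_inner (lindform ?N ?I ?K ?J A) M"
    proof -
      have "hs_inner M (lindform ?N ?I ?K ?J A) = hs_inner (loc_adj n lb e M) A"
        by (rule hs_inner_lindform[OF loc_drift_carrier J AM(2,1)])
      from arg_cong[OF this, where f=cnj] show ?thesis
        by (simp only: hs_inner_cnj[OF AM(2) lindform_carrier] hs_inner_cnj[OF lindform_adj_carrier AM(1)])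
    qed
  qed auto
  then obtain C where C: "0 \<le> C" "\<forall>M\<in>carrier_mat ?N ?N. hs_norm (?F M) \<le> C * hs_norm M"
    using F by auto
  show "0 \<le> loc_norm n lb e" unfolding loc_norm_def by (rule norm_2_2_nonneg[OF Fc C(2,1)])
  assume A: "A \<in> carrier_mat ?N ?N"
  have "hs_norm (?F A) \<le> norm_2_2 ?N ?F * hs_norm A"
  proof (rule hs_norm_le_norm_2_2[OF Fc C(2,1) _ A])
    fix A :: "complex mat" and c assume A: "A \<in> carrier_mat ?N ?N"
    have "hs_inner M (c \<cdot>\<^sub>m A) = c * hs_inner M A" if "M \<in> carrier_mat ?N ?N" for M
      by (rule hs_inner_smult_right[OF that A])
    moreover have "local_term n lb e (mat_unit ?N p) \<in> carrier_mat ?N ?N" for p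
      by (simp add: local_term_lindform[OF kl e])
    ultimately show "?F (c \<cdot>\<^sub>m A) = c \<cdot>\<^sub>m ?F A"
      unfolding hs_adjoint_def mat_unit_def[symmetric] by (intro eq_matI) auto
  qed
  then show "hs_norm (loc_adj n lb e A) \<le> loc_norm n lb e * hs_norm A"
    unfolding loc_norm_def F[OF A] .
qed

lemma finite_local_sets: "finite (local_sets n k)"
  by (rule finite_subset[of _ "Pow {..<n}"]) (auto simp: local_sets_def)

lemma generator_carrier [simp]: "generator n k lb M \<in> carrier_mat (2 ^ n) (2 ^ n)"
  by (simp add: generator_def)

lemma generator_pow_carrier:
  "M \<in> carrier_mat (2 ^ n) (2 ^ n) \<Longrightarrow> (generator n k lb ^^ m) M \<in> carrier_mat (2 ^ n) (2 ^ n)"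
  by (induction m) auto

text \<open>In the Heisenberg picture an operator supported on \<open>S\<close> is only moved by the terms that meet \<open>S\<close>,
  and each of them enlarges the support by at most \<open>k\<close> qubits.\<close>

theorem moment_bound:
  assumes kl: "k_local n k lb" and n: "1 \<le> n" and \<alpha>: "interaction_strength n k lb \<le> \<alpha>"
    and M: "M \<in> carrier_mat (2 ^ n) (2 ^ n)"
    and "supported_on n S A" "S \<subseteq> {..<n}" "card S \<le> (j + 1) * k"
  shows "cmod (hs_inner A ((generator n k lb ^^ m) M)) \<le> (\<Prod>i<m. real (j + 1 + i) * (real k * \<alpha>)) * hs_norm A * hs_norm M"
  using assms(5-7)
\<comment> \<open>A support of at most \<open>(j + 1) * k\<close> qubits costs a factor
  \<open>(j + 1) k \<alpha>\<close> and grows to at most \<open>(j + 2) * k\<close>. Generalising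
  over \<open>j\<close> lets the product of these factors be peeled from its lower end.\<close>
proof (induction m arbitrary: A S j)
  case 0
  then show ?case using hs_Cauchy_Schwarz[OF supported_on_carrier[OF 0(1)] M] by simp
next
  case (Suc m)
  let ?N = "2 ^ n" and ?G = "generator n k lb" and ?B = "(generator n k lb ^^ m) M"
  let ?c = "\<Prod>i<m. real (Suc j + 1 + i) * (real k * \<alpha>)"
  have sumq: "(\<Sum>e\<in>{e \<in> local_sets n k. q \<in> e}. loc_norm n lb e) \<le> \<alpha>" if "q < n" for q
  proof -
    have "(\<Sum>e\<in>{e \<in> local_sets n k. q \<in> e}. loc_norm n lb e) \<le> interaction_strength n k lb"
      unfolding interaction_strength_def loc_norm_def[symmetric] by (rule Max_ge) (use that in auto)
    then show ?thesis using \<alpha> by linarith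
  qed
  have "0 \<le> (\<Sum>e\<in>{e \<in> local_sets n k. 0 \<in> e}. loc_norm n lb e)"
    by (intro sum_nonneg hs_norm_loc_adj(1)[OF kl]) auto
  then have \<alpha>0: "0 \<le> \<alpha>" using sumq[of 0] n by linarith
  then have c0: "0 \<le> ?c" by (intro prod_nonneg) auto
  have A: "A \<in> carrier_mat ?N ?N" by (rule supported_on_carrier[OF Suc.prems(1)])
  have B: "?B \<in> carrier_mat ?N ?N" by (rule generator_pow_carrier[OF M])
  have fS: "finite S" using Suc.prems(2) finite_subset by blast
  let ?E = "{e \<in> local_sets n k. e \<inter> S \<noteq> {}}"
  have "hs_inner A ((?G ^^ Suc m) M) = hs_inner A (?G ?B)" by simp
  also have "\<dots> = (\<Sum>e\<in>local_sets n k. hs_inner A (local_term n lb e ?B))"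
    unfolding generator_def
    by (rule hs_inner_msum_right[OF A]) (simp add: local_term_lindform[OF kl _ B[unfolded generator_def[abs_def]]])
  also have "\<dots> = (\<Sum>e\<in>local_sets n k. hs_inner (loc_adj n lb e A) ?B)"
  proof (rule sum.cong[OF refl])
    fix e assume e: "e \<in> local_sets n k"
    have J: "jumps lb e ! a \<in> carrier_mat ?N ?N" if "a \<in> {..<length (jumps lb e)}" for a
      using jumps_supported[OF kl e] that by (intro supported_on_carrier[of n e]) auto
    show "hs_inner A (local_term n lb e ?B) = hs_inner (loc_adj n lb e A) ?B"
      unfolding local_term_lindform[OF kl e B] by (rule hs_inner_lindform[OF loc_drift_carrier J A B])
  qed
  also have "\<dots> = (\<Sum>e\<in>?E. hs_inner (loc_adj n lb e A) ?B)"
  proof (rule sum.mono_neutral_right[OF finite_local_sets])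
    show "\<forall>e\<in>local_sets n k - ?E. hs_inner (loc_adj n lb e A) ?B = 0"
    proof
      fix e assume "e \<in> local_sets n k - ?E"
      then have "loc_adj n lb e A = 0\<^sub>m ?N ?N" by (intro loc_adj_eq_0[OF kl _ Suc.prems(1)]) auto
      then show "hs_inner (loc_adj n lb e A) ?B = 0"
        using hs_Cauchy_Schwarz[OF zero_carrier_mat B] by (simp add: hs_norm_zero)
    qed
  qed auto
  finally have eq: "hs_inner A ((?G ^^ Suc m) M) = (\<Sum>e\<in>?E. hs_inner (loc_adj n lb e A) ?B)" .
  have "cmod (hs_inner A ((?G ^^ Suc m) M)) \<le> (\<Sum>e\<in>?E. ?c * (loc_norm n lb e * hs_norm A) * hs_norm M)"
    unfolding eq
  proof (rule sum_norm_le)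
    fix e assume "e \<in> ?E"
    then have e: "e \<in> local_sets n k" by simp
    have "card (S \<union> e) \<le> card S + card e" by (rule card_Un_le)
    also have "\<dots> \<le> (Suc j + 1) * k" using Suc.prems(3) e by (simp add: local_sets_def)
    finally have "cmod (hs_inner (loc_adj n lb e A) ?B) \<le> ?c * hs_norm (loc_adj n lb e A) * hs_norm M"
      using e Suc.prems(2) by (intro Suc.IH[OF loc_adj_supported[OF kl e Suc.prems(2,1)]]) (auto simp: local_sets_def)
    also have "\<dots> \<le> ?c * (loc_norm n lb e * hs_norm A) * hs_norm M"
      by (intro mult_right_mono mult_left_mono c0 hs_norm_loc_adj(2)[OF kl e A] hs_norm_nonneg[OF M])
    finally show "cmod (hs_inner (loc_adj n lb e A) ?B) \<le> ?c * (loc_norm n lb e * hs_norm A) * hs_norm M" .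
  qed
  also have "\<dots> = ?c * hs_norm A * hs_norm M * (\<Sum>e\<in>?E. loc_norm n lb e)"
    by (simp add: sum_distrib_left mult_ac)
  also have "\<dots> \<le> ?c * hs_norm A * hs_norm M * (real (j + 1) * (real k * \<alpha>))"
  proof (intro mult_left_mono mult_nonneg_nonneg c0 hs_norm_nonneg[OF A] hs_norm_nonneg[OF M])
    have pos: "0 \<le> (if q \<in> e then loc_norm n lb e else 0)" if "e \<in> local_sets n k" for q e
      using hs_norm_loc_adj(1)[OF kl that] by simp
    \<comment> \<open>A set that meets \<open>S\<close> is counted once for every qubit in common,
      hence at least once; exchanging the sums leaves at most \<alpha> per qubit of
      \<open>S\<close>.\<close>
    have "(\<Sum>e\<in>?E. loc_norm n lb e) \<le> (\<Sum>e\<in>?E. \<Sum>q\<in>S. if q \<in> e then loc_norm n lb e else 0)"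
    proof (rule sum_mono)
      fix e assume "e \<in> ?E"
      then obtain q where q: "q \<in> S" "q \<in> e" and e: "e \<in> local_sets n k" by auto
      show "loc_norm n lb e \<le> (\<Sum>q\<in>S. if q \<in> e then loc_norm n lb e else 0)"
        using member_le_sum[of q S "\<lambda>q. if q \<in> e then loc_norm n lb e else 0"] q fS pos[OF e] by auto
    qed
    also have "\<dots> \<le> (\<Sum>e\<in>local_sets n k. \<Sum>q\<in>S. if q \<in> e then loc_norm n lb e else 0)"
      by (rule sum_mono2[OF finite_local_sets]) (auto intro!: sum_nonneg pos)
    also have "\<dots> = (\<Sum>q\<in>S. \<Sum>e\<in>{e \<in> local_sets n k. q \<in> e}. loc_norm n lb e)"
      by (subst sum.swap) (simp add: sum.inter_filter[OF finite_local_sets])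
    also have "\<dots> \<le> (\<Sum>q\<in>S. \<alpha>)" by (rule sum_mono) (use sumq Suc.prems(2) in auto)
    also have "\<dots> \<le> real ((j + 1) * k) * \<alpha>"
      using Suc.prems(3) \<alpha>0 by (simp only: sum_constant) (intro mult_right_mono of_nat_mono)
    finally show "(\<Sum>e\<in>?E. loc_norm n lb e) \<le> real (j + 1) * (real k * \<alpha>)" by (simp add: algebra_simps)
  qed
  also have "\<dots> = (\<Prod>i<Suc m. real (j + 1 + i) * (real k * \<alpha>)) * hs_norm A * hs_norm M"
    by (subst prod.lessThan_Suc_shift) (simp add: mult_ac)
  finally show ?case .
qed

text \<open>The case \<open>j = 0\<close>: the product of the factors is
  \<open>m! (k \<alpha>)^m\<close>, and the norms \<open>sqrt (2 ^ n)\<close> of the two strings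
  cancel the normalisation.\<close>

lemma ptm_moment_bound:
  assumes kl: "k_local n k lb" and n: "1 \<le> n" and \<alpha>: "interaction_strength n k lb \<le> \<alpha>"
    and P: "P \<in> pstrs {..<n}" "card (supp P) \<le> k" and Q: "Q \<in> pstrs {..<n}"
  shows "cmod (tr (pmat n P * (generator n k lb ^^ m) (pmat n Q)) / 2 ^ n) \<le> fact m * (real k * \<alpha>) ^ m"
proof -
  have "supported_on n (supp P) (pmat n P)"
    using P(1) by (subst supported_on_iff) (auto simp: pauli_local_def tr_pmat2 pstrs_mem)
  then have "cmod (hs_inner (pmat n P) ((generator n k lb ^^ m) (pmat n Q))) \<le>
      (\<Prod>i<m. real (0 + 1 + i) * (real k * \<alpha>)) * hs_norm (pmat n P) * hs_norm (pmat n Q)"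
    by (rule moment_bound[OF kl n \<alpha> pmat_carrier]) (use P in \<open>auto simp: pstrs_def\<close>)
  also have "\<dots> = fact m * (real k * \<alpha>) ^ m * 2 ^ n"
    by (simp add: hs_norm_pmat P(1) Q prod.distrib fact_prod_Suc atLeast0LessThan)
  finally show ?thesis by (simp add: hs_inner_def norm_divide norm_power divide_le_eq)
qed

section \<open>The semigroup\<close>

text \<open>Trace preservation is left out of the assumptions because the locale is applied to
  \<open>L1 s\<close> as well, where the extra jump may break it.\<close>

locale lindblad_form =
  fixes N :: nat and I :: "'a set" and K :: "complex mat" and J :: "'a \<Rightarrow> complex mat"
  assumes finite_I: "finite I" and K: "K \<in> carrier_mat N N" and J: "\<And>a. a \<in> I \<Longrightarrow> J a \<in> carrier_mat N N"
begin

abbreviation L :: superop where "L \<equiv> lindform N I K J"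

lemma pow_carrier: "M \<in> carrier_mat N N \<Longrightarrow> (L ^^ m) M \<in> carrier_mat N N"
  by (cases m) auto

lemma hs_inner_pow:
  "A \<in> carrier_mat N N \<Longrightarrow> M \<in> carrier_mat N N \<Longrightarrow>
    hs_inner A ((L ^^ m) M) = hs_inner ((lindform_adj N I K J ^^ m) A) M"
proof (induction m arbitrary: A)
  case (Suc m)
  have "hs_inner A ((L ^^ Suc m) M) = hs_inner (lindform_adj N I K J A) ((L ^^ m) M)"
    using hs_inner_lindform[OF K J Suc.prems(1) pow_carrier[OF Suc.prems(2)]] by simp
  then show ?case using Suc.IH[OF lindform_adj_carrier Suc.prems(2)] by (simp add: funpow_swap1)
qed simp

text \<open>Powers of the adjoint supply the coefficients \<open>c\<close>. Linearity of the powers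
  of \<open>L\<close> enters in this form, both for the exponential and for the binomial expansion
  of \<open>Psi\<close>.\<close>

lemma tr_pow_linear:
  assumes B: "B \<in> carrier_mat N N"
  obtains c where "\<And>M. M \<in> carrier_mat N N \<Longrightarrow> tr (B * (L ^^ m) M) = (\<Sum>p\<in>{..<N} \<times> {..<N}. c p * M $$ p)"
proof -
  have c: "(lindform_adj N I K J ^^ m) (mat_adjoint B) \<in> carrier_mat N N"
    using B by (cases m) auto
  have "tr (B * (L ^^ m) M) = (\<Sum>p\<in>{..<N} \<times> {..<N}. cnj ((lindform_adj N I K J ^^ m) (mat_adjoint B) $$ p) * M $$ p)"
    if "M \<in> carrier_mat N N" for M
    using hs_inner_pow[OF mat_adjoint_carrier[OF B] that, of m] unfolding hs_inner_sum[OF c that]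
    by (simp add: hs_inner_def)
  then show ?thesis by (rule that)
qed

lemma pow_bounded:
  assumes "\<forall>M\<in>carrier_mat N N. hs_norm (L M) \<le> C * hs_norm M" "0 \<le> C" "M \<in> carrier_mat N N"
  shows "hs_norm ((L ^^ m) M) \<le> C ^ m * hs_norm M"
proof (induction m)
  case (Suc m)
  have "hs_norm ((L ^^ Suc m) M) \<le> C * hs_norm ((L ^^ m) M)"
    using assms(1) pow_carrier[OF assms(3), of m] by simp
  also have "\<dots> \<le> C * (C ^ m * hs_norm M)" by (rule mult_left_mono[OF Suc assms(2)])
  finally show ?case by simp
qed simp

lemma norm_tr_pow_le:
  assumes "\<forall>M\<in>carrier_mat N N. hs_norm (L M) \<le> C * hs_norm M" "0 \<le> C" "M \<in> carrier_mat N N" "B \<in> carrier_mat N N"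
  shows "cmod (tr (B * (L ^^ m) M)) \<le> C ^ m * (hs_norm (mat_adjoint B) * hs_norm M)"
proof -
  have "cmod (tr (B * (L ^^ m) M)) \<le> hs_norm (mat_adjoint B) * hs_norm ((L ^^ m) M)"
    using hs_Cauchy_Schwarz[OF mat_adjoint_carrier[OF assms(4)] pow_carrier[OF assms(3), of m]] by (simp add: hs_inner_def)
  also have "\<dots> \<le> hs_norm (mat_adjoint B) * (C ^ m * hs_norm M)"
    by (intro mult_left_mono pow_bounded[OF assms(1-3)] hs_norm_nonneg[OF mat_adjoint_carrier[OF assms(4)]])
  finally show ?thesis by (simp add: mult_ac)
qed

lemma bounded: obtains C where "0 \<le> C" "\<forall>M\<in>carrier_mat N N. hs_norm (L M) \<le> C * hs_norm M"
proof -
  have "\<exists>C\<ge>0. \<forall>M\<in>carrier_mat N N. hs_norm (L M) \<le> C * hs_norm M" by (rule lindform_bounded[OF K J])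
  then obtain C where "0 \<le> C" "\<forall>M\<in>carrier_mat N N. hs_norm (L M) \<le> C * hs_norm M" by (elim exE conjE)
  then show ?thesis by (rule that)
qed

lemma summable_entries:
  assumes M: "M \<in> carrier_mat N N" and ij: "i < N" "j < N"
  shows "summable (\<lambda>m. complex_of_real (t ^ m / fact m) * ((L ^^ m) M) $$ (i, j))"
proof -
  obtain C where C: "0 \<le> C" "\<forall>M\<in>carrier_mat N N. hs_norm (L M) \<le> C * hs_norm M" by (rule bounded)
  have "summable (\<lambda>m. inverse (fact m) *\<^sub>R (\<bar>t\<bar> * C) ^ m * hs_norm M)"
    by (intro summable_mult2 summable_exp_generic)
  then show ?thesis
  proof (rule summable_comparison_test')
    fix m
    have "cmod (((L ^^ m) M) $$ (i, j)) \<le> C ^ m * hs_norm M"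
      using norm_entry_le_hs_norm[OF pow_carrier[OF M] ij] pow_bounded[OF C(2,1) M] by (rule order_trans)
    then have "\<bar>t\<bar> ^ m / fact m * cmod (((L ^^ m) M) $$ (i, j)) \<le> \<bar>t\<bar> ^ m / fact m * (C ^ m * hs_norm M)"
      by (intro mult_left_mono) auto
    then show "cmod (complex_of_real (t ^ m / fact m) * ((L ^^ m) M) $$ (i, j)) \<le> inverse (fact m) *\<^sub>R (\<bar>t\<bar> * C) ^ m * hs_norm M"
      unfolding norm_mult norm_of_real by (simp add: abs_mult power_abs power_mult_distrib divide_inverse mult_ac)
  qed
qed

lemma exp_carrier [simp]: "superop_exp N t F M \<in> carrier_mat N N"
  by (simp add: superop_exp_def)

lemma tr_exp_sums:
  assumes M: "M \<in> carrier_mat N N" and B: "B \<in> carrier_mat N N"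
  shows "(\<lambda>m. complex_of_real (t ^ m / fact m) * tr (B * (L ^^ m) M)) sums tr (B * superop_exp N t L M)"
proof -
  have "(\<lambda>m. \<Sum>i<N. \<Sum>j<N. B $$ (i, j) * (complex_of_real (t ^ m / fact m) * ((L ^^ m) M) $$ (j, i)))
     sums (\<Sum>i<N. \<Sum>j<N. B $$ (i, j) * superop_exp N t L M $$ (j, i))"
  proof (intro sums_sum sums_mult)
    fix i j assume ij: "i \<in> {..<N}" "j \<in> {..<N}"
    then have "superop_exp N t L M $$ (j, i) = (\<Sum>m. complex_of_real (t ^ m / fact m) * ((L ^^ m) M) $$ (j, i))"
      unfolding superop_exp_def by (subst index_mat) auto
    then show "(\<lambda>m. complex_of_real (t ^ m / fact m) * ((L ^^ m) M) $$ (j, i)) sums superop_exp N t L M $$ (j, i)"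
      using ij by (simp only: summable_sums[OF summable_entries[OF M]] lessThan_iff)
  qed
  moreover have "(\<Sum>i<N. \<Sum>j<N. B $$ (i, j) * (complex_of_real (t ^ m / fact m) * ((L ^^ m) M) $$ (j, i))) =
      complex_of_real (t ^ m / fact m) * tr (B * (L ^^ m) M)" for m
    unfolding tr_mult[OF B pow_carrier[OF M]] by (simp add: sum_distrib_left mult_ac)
  ultimately show ?thesis unfolding tr_mult[OF B exp_carrier] by simp
qed

lemma tr_exp_linear:
  assumes B: "B \<in> carrier_mat N N" and M: "\<And>a. a \<in> A \<Longrightarrow> M a \<in> carrier_mat N N"
  shows "(\<Sum>a\<in>A. w a * tr (B * superop_exp N t L (M a))) = tr (B * superop_exp N t L (msum N A (\<lambda>a. w a \<cdot>\<^sub>m M a)))"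
proof -
  have lin: "(\<Sum>a\<in>A. w a * tr (B * (L ^^ m) (M a))) = tr (B * (L ^^ m) (msum N A (\<lambda>a. w a \<cdot>\<^sub>m M a)))" for m
  proof -
    obtain c where c: "\<And>M. M \<in> carrier_mat N N \<Longrightarrow> tr (B * (L ^^ m) M) = (\<Sum>p\<in>{..<N} \<times> {..<N}. c p * M $$ p)"
      using tr_pow_linear[OF B] by blast
    have "(\<Sum>a\<in>A. w a * tr (B * (L ^^ m) (M a))) = (\<Sum>a\<in>A. \<Sum>p\<in>{..<N} \<times> {..<N}. c p * (w a * M a $$ p))"
      by (intro sum.cong refl) (simp add: c M sum_distrib_left mult_ac)
    also have "\<dots> = (\<Sum>p\<in>{..<N} \<times> {..<N}. \<Sum>a\<in>A. c p * (w a * M a $$ p))" by (rule sum.swap)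
    also have "\<dots> = (\<Sum>p\<in>{..<N} \<times> {..<N}. c p * msum N A (\<lambda>a. w a \<cdot>\<^sub>m M a) $$ p)"
    proof (rule sum.cong[OF refl])
      fix p assume p: "p \<in> {..<N} \<times> {..<N}"
      then have "(w a \<cdot>\<^sub>m M a) $$ p = w a * M a $$ p" if "a \<in> A" for a
        using M[OF that] by (cases p) auto
      then show "(\<Sum>a\<in>A. c p * (w a * M a $$ p)) = c p * msum N A (\<lambda>a. w a \<cdot>\<^sub>m M a) $$ p"
        using p by (cases p) (simp add: sum_distrib_left)
    qed
    finally show ?thesis by (simp add: c)
  qed
  have "(\<lambda>m. \<Sum>a\<in>A. w a * (complex_of_real (t ^ m / fact m) * tr (B * (L ^^ m) (M a)))) sums
     (\<Sum>a\<in>A. w a * tr (B * superop_exp N t L (M a)))"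
    by (intro sums_sum sums_mult tr_exp_sums M B)
  moreover have "(\<Sum>a\<in>A. w a * (complex_of_real (t ^ m / fact m) * tr (B * (L ^^ m) (M a)))) =
      complex_of_real (t ^ m / fact m) * tr (B * (L ^^ m) (msum N A (\<lambda>a. w a \<cdot>\<^sub>m M a)))" for m
    unfolding lin[symmetric] by (simp add: sum_distrib_left mult_ac)
  ultimately show ?thesis
    using tr_exp_sums[OF msum_carrier B, of t A "\<lambda>a. w a \<cdot>\<^sub>m M a"] by (simp only: sums_unique2)
qed

end

section \<open>Trace preservation and positivity\<close>

lemma lindform_trace:
  assumes K: "K \<in> carrier_mat N N" and J: "\<And>a. a \<in> I \<Longrightarrow> J a \<in> carrier_mat N N" and M: "M \<in> carrier_mat N N"
    and 0: "mat_adjoint K + K + msum N I (\<lambda>a. mat_adjoint (J a) * J a) = 0\<^sub>m N N"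
  shows "tr (lindform N I K J M) = 0"
proof -
  have "tr (lindform N I K J M) = hs_inner (1\<^sub>m N) (lindform N I K J M)"
  proof -
    have "mat_adjoint (1\<^sub>m N) = (1\<^sub>m N :: complex mat)" by (rule eq_matI) auto
    then show ?thesis by (simp only: hs_inner_def left_mult_one_mat[OF lindform_carrier])
  qed
  also have "\<dots> = hs_inner (lindform_adj N I K J (1\<^sub>m N)) M" by (rule hs_inner_lindform[OF K J one_carrier_mat M])
  also have "lindform_adj N I K J (1\<^sub>m N) = mat_adjoint K + K + msum N I (\<lambda>a. mat_adjoint (J a) * J a)"
  proof -
    have "msum N I (\<lambda>a. mat_adjoint (J a) * 1\<^sub>m N * J a) = msum N I (\<lambda>a. mat_adjoint (J a) * J a)"
      by (rule msum_cong[OF refl]) (simp add: right_mult_one_mat[OF mat_adjoint_carrier[OF J]])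
    then show ?thesis
      unfolding lindform_adj_def using K by (simp add: right_mult_one_mat[OF mat_adjoint_carrier[OF K]])
  qed
  also have "hs_inner \<dots> M = 0"
    unfolding 0 using hs_Cauchy_Schwarz[OF zero_carrier_mat M] by (simp add: hs_norm_zero)
  finally show ?thesis .
qed

text \<open>Tested by traces with \<open>B\<close> on both sides instead of by vectors, so that
  \<open>M \<mapsto> X M X*\<close> is handled by replacing \<open>B\<close> by \<open>B X\<close>.
  Only the Hermitian part of \<open>M\<close> is constrained, since real parts are taken; so does
  the Born rule in \<open>outcome_pmf\<close>.\<close>

definition psd :: "nat \<Rightarrow> complex mat \<Rightarrow> bool" where
  "psd N M \<longleftrightarrow> M \<in> carrier_mat N N \<and> (\<forall>B\<in>carrier_mat N N. 0 \<le> Re (tr (B * M * mat_adjoint B)))"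

lemma psd_conj:
  assumes "psd N M" "X \<in> carrier_mat N N" shows "psd N (X * M * mat_adjoint X)"
  unfolding psd_def
proof (intro conjI ballI)
  have M: "M \<in> carrier_mat N N" using assms(1) by (simp add: psd_def)
  show "X * M * mat_adjoint X \<in> carrier_mat N N" by (intro sq_intros assms M)
  fix B :: "complex mat" assume B: "B \<in> carrier_mat N N"
  have "B * (X * M * mat_adjoint X) * mat_adjoint B = (B * X) * M * mat_adjoint (B * X)"
  proof -
    note a = assoc_mult_mat[of _ N N _ N _ N]
    show ?thesis unfolding mat_adjoint_mult[OF B assms(2)]
      using B assms(2) M by (simp add: a sq_intros)
  qed
  then show "0 \<le> Re (tr (B * (X * M * mat_adjoint X) * mat_adjoint B))"
    using assms(1) sq_mult_carrier[OF B assms(2)] by (simp add: psd_def)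
qed

lemma psd_hermitian_square:
  assumes "W \<in> carrier_mat N N" shows "psd N (W * mat_adjoint W)"
proof -
  have "psd N (1\<^sub>m N)" unfolding psd_def
  proof (intro conjI ballI)
    fix B :: "complex mat" assume B: "B \<in> carrier_mat N N"
    have "tr (B * mat_adjoint B) = (\<Sum>i<N. \<Sum>j<N. B $$ (i, j) * cnj (B $$ (i, j)))"
      using B by (subst tr_mult[OF B mat_adjoint_carrier[OF B]]) auto
    then show "0 \<le> Re (tr (B * 1\<^sub>m N * mat_adjoint B))"
      by (simp only: right_mult_one_mat[OF B] Re_sum) (intro sum_nonneg, simp)
  qed simp
  from psd_conj[OF this assms] show ?thesis using assms by simp
qed

lemma psd_add_scaled_msum:
  assumes "psd N M" "\<And>a. a \<in> I \<Longrightarrow> psd N (F a)" "0 \<le> s"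
  shows "psd N (M + complex_of_real s \<cdot>\<^sub>m msum N I F)"
  unfolding psd_def
proof (intro conjI ballI)
  have M: "M \<in> carrier_mat N N" and F: "\<And>a. a \<in> I \<Longrightarrow> F a \<in> carrier_mat N N" using assms by (auto simp: psd_def)
  show "M + complex_of_real s \<cdot>\<^sub>m msum N I F \<in> carrier_mat N N" by (intro sq_intros M)
  fix B :: "complex mat" assume B: "B \<in> carrier_mat N N"
  let ?B' = "mat_adjoint B"
  have e: "tr (B * X * ?B') = tr (?B' * B * X)" if X: "X \<in> carrier_mat N N" for X
    using tr_mult_commute[of "B * X" N N ?B'] B X
    by (simp add: sq_intros assoc_mult_mat[of _ N N _ N _ N])
  have D: "?B' * B \<in> carrier_mat N N" by (intro sq_intros B)
  have "tr (?B' * B * (M + complex_of_real s \<cdot>\<^sub>m msum N I F)) = tr (?B' * B * M) + complex_of_real s * (\<Sum>a\<in>I. tr (?B' * B * F a))"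
  proof -
    have "?B' * B * (M + complex_of_real s \<cdot>\<^sub>m msum N I F) = ?B' * B * M + complex_of_real s \<cdot>\<^sub>m msum N I (\<lambda>a. ?B' * B * F a)"
      using mult_add_distrib_mat[OF D M, of "complex_of_real s \<cdot>\<^sub>m msum N I F"]
      by (simp add: mult_smult_distrib[OF D msum_carrier] mult_msum[OF D F])
    moreover have "tr (msum N I (\<lambda>a. ?B' * B * F a)) = (\<Sum>a\<in>I. tr (?B' * B * F a))"
      by (rule tr_msum) (intro sq_intros B F)
    ultimately show ?thesis
      by (simp add: tr_add[of _ N] tr_smult[of _ N] sq_mult_carrier[OF D M])
  qed
  moreover have "0 \<le> Re (tr (?B' * B * M))"    using assms(1) B unfolding psd_def e[OF M, symmetric] by blast
  moreover have "0 \<le> Re (tr (?B' * B * F a))" if "a \<in> I" for a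
    using assms(2)[OF that] B unfolding psd_def e[OF F[OF that], symmetric] by blast
  ultimately show "0 \<le> Re (tr (B * (M + complex_of_real s \<cdot>\<^sub>m msum N I F) * ?B'))"
    using assms(3) e[of "M + complex_of_real s \<cdot>\<^sub>m msum N I F"] M
    by (simp add: sq_intros sum_nonneg)
qed

text \<open>The binomial theorem for \<open>(1 + s L)^m\<close>, stated for the scalars
  \<open>T m j = tr (D L^j (1 + s L)^m M)\<close> so that no algebra of superoperators is
  required.\<close>

lemma binomial_step:
  fixes T :: "nat \<Rightarrow> nat \<Rightarrow> complex"
  assumes "\<And>m j. T (Suc m) j = T m j + s * T m (Suc j)"
  shows "T m j = (\<Sum>i\<le>m. of_nat (m choose i) * s ^ i * T 0 (j + i))"
proof (induction m arbitrary: j)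
  case (Suc m)
  have z: "(\<Sum>i\<le>m. of_nat (m choose i) * s ^ i * T 0 (j + i)) = (\<Sum>i\<le>Suc m. of_nat (m choose i) * s ^ i * T 0 (j + i))"
    by simp
  have "T (Suc m) j = (\<Sum>i\<le>Suc m. of_nat (m choose i) * s ^ i * T 0 (j + i)) +
      (\<Sum>i\<le>m. of_nat (m choose i) * s ^ Suc i * T 0 (j + Suc i))"
    unfolding assms Suc[of j] Suc[of "Suc j"] z by (simp add: sum_distrib_left mult_ac)
  also have "(\<Sum>i\<le>Suc m. of_nat (m choose i) * s ^ i * T 0 (j + i)) =
      T 0 j + (\<Sum>i\<le>m. of_nat (m choose Suc i) * s ^ Suc i * T 0 (j + Suc i))"
    by (subst sum.atMost_Suc_shift) simp
  also have "T 0 j + (\<Sum>i\<le>m. of_nat (m choose Suc i) * s ^ Suc i * T 0 (j + Suc i)) +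
      (\<Sum>i\<le>m. of_nat (m choose i) * s ^ Suc i * T 0 (j + Suc i)) =
      T 0 j + (\<Sum>i\<le>m. of_nat (Suc m choose Suc i) * s ^ Suc i * T 0 (j + Suc i))"
    unfolding add.assoc sum.distrib[symmetric]
    by (intro arg_cong2[where f="(+)"] sum.cong refl) (simp add: distrib_right add.commute)
  also have "\<dots> = (\<Sum>i\<le>Suc m. of_nat (Suc m choose i) * s ^ i * T 0 (j + i))"
    by (subst sum.atMost_Suc_shift) simp
  finally show ?case .
qed simp

lemma binomial_over_power_tendsto: "(\<lambda>m. real (m choose i) / real m ^ i) \<longlonglongrightarrow> 1 / fact i"
proof -
  have "(\<lambda>m. (\<Prod>l<i. 1 - real l / real m) / fact i) \<longlonglongrightarrow> (\<Prod>l<i. 1 - 0) / fact i"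
    by (intro tendsto_intros lim_const_over_n) auto
  moreover have "\<forall>\<^sub>F m in sequentially. (\<Prod>l<i. 1 - real l / real m) / fact i = real (m choose i) / real m ^ i"
    using eventually_gt_at_top[of 0]
  proof eventually_elim
    case (elim m)
    have "real (m choose i) = (\<Prod>l<i. real m - real l) / fact i"
      by (simp add: binomial_gbinomial gbinomial_prod_rev atLeast0LessThan)
    also have "(\<Prod>l<i. real m - real l) = (\<Prod>l<i. real m * (1 - real l / real m))"
      by (rule prod.cong) (use elim in \<open>auto simp: field_simps\<close>)
    finally show ?case using elim by (simp add: prod.distrib)
  qed
  ultimately show ?thesis by (simp add: Lim_transform_eventually)
qed

section \<open>Entrywise limits of matrices\<close>

definition mat_tendsto :: "nat \<Rightarrow> (nat \<Rightarrow> complex mat) \<Rightarrow> complex mat \<Rightarrow> bool" where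
  "mat_tendsto N X A \<longleftrightarrow> (\<forall>m. X m \<in> carrier_mat N N) \<and> A \<in> carrier_mat N N \<and>
     (\<forall>i<N. \<forall>j<N. (\<lambda>m. X m $$ (i, j)) \<longlonglongrightarrow> A $$ (i, j))"

lemma mat_tendsto_const: "A \<in> carrier_mat N N \<Longrightarrow> mat_tendsto N (\<lambda>_. A) A"
  by (simp add: mat_tendsto_def)

lemma mat_tendsto_add: "mat_tendsto N X A \<Longrightarrow> mat_tendsto N Y B \<Longrightarrow> mat_tendsto N (\<lambda>m. X m + Y m) (A + B)"
proof -
  assume *: "mat_tendsto N X A" "mat_tendsto N Y B"
  have e: "(U + V) $$ (i, j) = U $$ (i, j) + V $$ (i, j)"
    if "U \<in> carrier_mat N N" "V \<in> carrier_mat N N" "i < N" "j < N" for U V :: "complex mat" and i j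
    using that by auto
  show ?thesis using * unfolding mat_tendsto_def by (simp add: e tendsto_add)
qed

lemma mat_tendsto_smult: "s \<longlonglongrightarrow> c \<Longrightarrow> mat_tendsto N X A \<Longrightarrow> mat_tendsto N (\<lambda>m. s m \<cdot>\<^sub>m X m) (c \<cdot>\<^sub>m A)"
proof -
  assume *: "s \<longlonglongrightarrow> c" "mat_tendsto N X A"
  have e: "(a \<cdot>\<^sub>m U) $$ (i, j) = a * U $$ (i, j)"
    if "U \<in> carrier_mat N N" "i < N" "j < N" for a and U :: "complex mat" and i j
    using that by auto
  show ?thesis using * unfolding mat_tendsto_def by (simp add: e tendsto_mult)
qed

lemma mat_tendsto_mult:
  assumes "mat_tendsto N X A" "mat_tendsto N Y B" shows "mat_tendsto N (\<lambda>m. X m * Y m) (A * B)"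
proof -
  have e: "(U * V) $$ (i, j) = (\<Sum>k<N. U $$ (i, k) * V $$ (k, j))"
    if "U \<in> carrier_mat N N" "V \<in> carrier_mat N N" "i < N" "j < N" for U V :: "complex mat" and i j
    using that by (simp add: scalar_prod_def atLeast0LessThan)
  show ?thesis using assms unfolding mat_tendsto_def
    by (auto simp: e sq_mult_carrier intro!: tendsto_sum tendsto_mult)
qed

lemma mat_tendsto_msum:
  assumes "\<And>a. a \<in> I \<Longrightarrow> mat_tendsto N (X a) (A a)" shows "mat_tendsto N (\<lambda>m. msum N I (\<lambda>a. X a m)) (msum N I A)"
  using assms unfolding mat_tendsto_def by (auto intro!: tendsto_sum)

lemma mat_tendsto_tr: "mat_tendsto N X A \<Longrightarrow> (\<lambda>m. tr (X m)) \<longlonglongrightarrow> tr A"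
proof -
  assume X: "mat_tendsto N X A"
  have e: "tr U = (\<Sum>i<N. U $$ (i, i))" if "U \<in> carrier_mat N N" for U using that by (auto simp: tr_def)
  show ?thesis using X unfolding mat_tendsto_def by (auto simp: e intro!: tendsto_sum)
qed

context lindblad_form
begin

text \<open>\<open>1 + s L + s\<^sup>2 K \<bullet> K\<^sup>*\<close> is completely positive, and for \<open>s = t / m\<close> its \<open>m\<close>-th power tends to the
  exponential of \<open>t L\<close>. The quadratic correction is absorbed into an additional jump operator.\<close>

definition J1 :: "real \<Rightarrow> 'a option \<Rightarrow> complex mat" where
  "J1 s = case_option (complex_of_real (sqrt s) \<cdot>\<^sub>m K) J"

definition L1 :: "real \<Rightarrow> superop" where
  "L1 s = lindform N (insert None (Some ` I)) K (J1 s)"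

definition Psi :: "real \<Rightarrow> superop" where
  "Psi s M = (1\<^sub>m N + complex_of_real s \<cdot>\<^sub>m K) * M * mat_adjoint (1\<^sub>m N + complex_of_real s \<cdot>\<^sub>m K) +
     complex_of_real s \<cdot>\<^sub>m msum N I (\<lambda>a. J a * M * mat_adjoint (J a))"

lemma L1_form: "lindblad_form N (insert None (Some ` I)) K (J1 s)"
proof
  show "finite (insert None (Some ` I))" using finite_I by simp
  show "K \<in> carrier_mat N N" by (rule K)
  fix a assume "a \<in> insert None (Some ` I)" then show "J1 s a \<in> carrier_mat N N" using K J by (auto simp: J1_def)
qed

lemma L1_eq:
  assumes s: "0 \<le> s" and M: "M \<in> carrier_mat N N"
  shows "L1 s M = L M + complex_of_real s \<cdot>\<^sub>m (K * M * mat_adjoint K)"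
proof -
  have c: "K * M * mat_adjoint K \<in> carrier_mat N N" by (intro sq_intros K M)
  have KK: "(complex_of_real (sqrt s) \<cdot>\<^sub>m K) * M * mat_adjoint (complex_of_real (sqrt s) \<cdot>\<^sub>m K) =
      complex_of_real s \<cdot>\<^sub>m (K * M * mat_adjoint K)"
  proof -
    have "(complex_of_real (sqrt s) \<cdot>\<^sub>m K) * M * mat_adjoint (complex_of_real (sqrt s) \<cdot>\<^sub>m K) =
        complex_of_real (sqrt s) \<cdot>\<^sub>m (complex_of_real (sqrt s) \<cdot>\<^sub>m (K * M * mat_adjoint K))"
      using K M by (simp add: mat_adjoint_smult mult_smult_assoc_mat[of _ N N _ N] mult_smult_distrib[of _ N N _ N] sq_intros)
    also have "\<dots> = complex_of_real s \<cdot>\<^sub>m (K * M * mat_adjoint K)"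
      using s carrier_matD[OF c] by (intro eq_matI) (auto simp: mult.assoc[symmetric] simp flip: of_real_mult)
    finally show ?thesis .
  qed
  have "msum N (insert None (Some ` I)) (\<lambda>a. J1 s a * M * mat_adjoint (J1 s a)) =
      complex_of_real s \<cdot>\<^sub>m (K * M * mat_adjoint K) + msum N I (\<lambda>a. J a * M * mat_adjoint (J a))"
  proof (rule eq_matI, goal_cases)
    case (1 i j)
    then have ij: "i < N" "j < N" using c by auto
    have "(\<Sum>a\<in>insert None (Some ` I). (J1 s a * M * mat_adjoint (J1 s a)) $$ (i, j)) =
        (complex_of_real s \<cdot>\<^sub>m (K * M * mat_adjoint K)) $$ (i, j) + (\<Sum>a\<in>I. (J a * M * mat_adjoint (J a)) $$ (i, j))"
      using finite_I by (simp add: J1_def KK sum.reindex del: index_smult_mat(1) index_mult_mat(1))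
    then show ?case using ij by simp
  qed auto
  then show ?thesis
    unfolding L1_def lindform_def using K M
    by (intro eq_matI) (auto simp del: index_mult_mat(1))
qed

text \<open>Expanding the conjugation by \<open>1 + s K\<close> leaves the quadratic term
  \<open>s^2 K M K*\<close>. The extra jump of \<open>L1 s\<close> has amplitude
  \<open>sqrt s\<close>, so it contributes \<open>s K M K*\<close> to \<open>L1 s M\<close> and,
  with the prefactor \<open>s\<close>, exactly this term.\<close>

lemma Psi_eq:
  assumes s: "0 \<le> s" and M: "M \<in> carrier_mat N N"
  shows "Psi s M = M + complex_of_real s \<cdot>\<^sub>m L1 s M"
proof -
  let ?s = "complex_of_real s"
  have a: "mat_adjoint (1\<^sub>m N + ?s \<cdot>\<^sub>m K) = 1\<^sub>m N + ?s \<cdot>\<^sub>m mat_adjoint K"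
    using K by (intro eq_matI) auto
  have X: "(1\<^sub>m N + ?s \<cdot>\<^sub>m K) * M = M + ?s \<cdot>\<^sub>m (K * M)"
    using K M by (simp add: add_mult_distrib_mat[of _ N N _ _ N] mult_smult_assoc_mat[of _ N N _ N])
  have Xc: "M + ?s \<cdot>\<^sub>m (K * M) \<in> carrier_mat N N" by (intro sq_intros K M)
  have Y: "(M + ?s \<cdot>\<^sub>m (K * M)) * (1\<^sub>m N + ?s \<cdot>\<^sub>m mat_adjoint K) =
      M + ?s \<cdot>\<^sub>m (K * M) + ?s \<cdot>\<^sub>m (M * mat_adjoint K + ?s \<cdot>\<^sub>m (K * M * mat_adjoint K))"
    unfolding mult_add_distrib_mat[OF Xc one_carrier_mat smult_carrier_mat[OF mat_adjoint_carrier[OF K]]]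
    using K M by (simp add: right_mult_one_mat[OF Xc] mult_smult_distrib[OF Xc mat_adjoint_carrier[OF K]]
      add_mult_distrib_mat[of _ N N _ _ N] mult_smult_assoc_mat[of _ N N _ N] sq_intros)
  show ?thesis unfolding Psi_def a X Y L1_eq[OF s M] lindform_def
    using K M by (intro eq_matI) (auto simp: algebra_simps simp del: index_mult_mat(1))
qed

lemma psd_Psi: "0 \<le> s \<Longrightarrow> psd N M \<Longrightarrow> psd N (Psi s M)"
  unfolding Psi_def by (intro psd_add_scaled_msum psd_conj J sq_intros one_carrier_mat K)

lemma psd_Psi_pow: "0 \<le> s \<Longrightarrow> psd N M \<Longrightarrow> psd N ((Psi s ^^ m) M)"
  by (induction m) (auto intro: psd_Psi)

lemma L1_pow_carrier: "M \<in> carrier_mat N N \<Longrightarrow> (L1 s ^^ m) M \<in> carrier_mat N N"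
  unfolding L1_def by (rule lindblad_form.pow_carrier[OF L1_form])

lemma tr_Psi_pow:
  assumes s: "0 \<le> s" and M: "psd N M" and D: "D \<in> carrier_mat N N"
  shows "tr (D * (Psi s ^^ m) M) = (\<Sum>i\<le>m. of_nat (m choose i) * complex_of_real s ^ i * tr (D * (L1 s ^^ i) M))"
proof -
  define T where "T m j = tr (D * (L1 s ^^ j) ((Psi s ^^ m) M))" for m j
  have "T (Suc m) j = T m j + complex_of_real s * T m (Suc j)" for m j
  proof -
    let ?X = "(Psi s ^^ m) M"
    have X: "?X \<in> carrier_mat N N" using psd_Psi_pow[OF s M] by (simp add: psd_def)
    obtain c where c: "\<And>M. M \<in> carrier_mat N N \<Longrightarrow> tr (D * (L1 s ^^ j) M) = (\<Sum>p\<in>{..<N} \<times> {..<N}. c p * M $$ p)"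
      using lindblad_form.tr_pow_linear[OF L1_form D] unfolding L1_def by metis
    have LX: "L1 s ?X \<in> carrier_mat N N" by (simp add: L1_def)
    have "T (Suc m) j = tr (D * (L1 s ^^ j) (?X + complex_of_real s \<cdot>\<^sub>m L1 s ?X))"
      unfolding T_def using Psi_eq[OF s X] by simp
    also have "\<dots> = (\<Sum>p\<in>{..<N} \<times> {..<N}. c p * (?X + complex_of_real s \<cdot>\<^sub>m L1 s ?X) $$ p)"
      by (rule c) (intro sq_intros LX)
    also have "\<dots> = (\<Sum>p\<in>{..<N} \<times> {..<N}. c p * ?X $$ p + complex_of_real s * (c p * L1 s ?X $$ p))"
      by (rule sum.cong) (use X LX in \<open>auto simp: algebra_simps\<close>)
    also have "\<dots> = tr (D * (L1 s ^^ j) ?X) + complex_of_real s * tr (D * (L1 s ^^ j) (L1 s ?X))"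
      by (simp only: sum.distrib sum_distrib_left[symmetric] c[OF X] c[OF LX])
    finally show ?thesis by (simp add: T_def funpow_swap1)
  qed
  from binomial_step[of T, OF this, of m 0] show ?thesis by (simp add: T_def)
qed

lemma L1_pow_tendsto:
  assumes M: "M \<in> carrier_mat N N" and s: "s \<longlonglongrightarrow> 0" "\<And>m. 0 \<le> s m"
  shows "mat_tendsto N (\<lambda>m. (L1 (s m) ^^ i) M) ((L ^^ i) M)"
proof (induction i)
  case 0 then show ?case using M by (simp add: mat_tendsto_const)
next
  case (Suc i)
  have c: "(L ^^ i) M \<in> carrier_mat N N" by (rule pow_carrier[OF M])
  have "mat_tendsto N (\<lambda>m. L ((L1 (s m) ^^ i) M) + complex_of_real (s m) \<cdot>\<^sub>m (K * ((L1 (s m) ^^ i) M) * mat_adjoint K))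
     (L ((L ^^ i) M) + complex_of_real 0 \<cdot>\<^sub>m (K * ((L ^^ i) M) * mat_adjoint K))"
    unfolding lindform_def[of N I K J]
    by (intro mat_tendsto_add mat_tendsto_smult mat_tendsto_mult mat_tendsto_msum mat_tendsto_const K J
        mat_adjoint_carrier Suc[unfolded lindform_def[of N I K J]] tendsto_of_real s(1))
  moreover have "L ((L ^^ i) M) + complex_of_real 0 \<cdot>\<^sub>m (K * ((L ^^ i) M) * mat_adjoint K) = (L ^^ Suc i) M"
    using K c carrier_matD[OF lindform_carrier[of N I K J "(L ^^ i) M"]]
    by (intro eq_matI) (auto simp del: index_mult_mat(1))
  moreover have "L ((L1 (s m) ^^ i) M) + complex_of_real (s m) \<cdot>\<^sub>m (K * ((L1 (s m) ^^ i) M) * mat_adjoint K) = (L1 (s m) ^^ Suc i) M" for m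
    using L1_eq[OF s(2) L1_pow_carrier[OF M]] by simp
  ultimately show ?case by simp
qed

text \<open>Euler's product formula, tested against \<open>D = B* B\<close>: the traces of the
  powers of \<open>Psi (t / m)\<close> are binomial sums whose terms converge to those of the
  exponential series and are dominated by a constant times \<open>(t C)^i / i!\<close>, uniformly in
  \<open>m\<close>. Tannery's theorem exchanges limit and sum, and positivity passes to the
  limit.\<close>

theorem psd_exp:
  assumes M: "psd N M" and t: "0 \<le> t"
  shows "psd N (superop_exp N t L M)"
  unfolding psd_def
proof (intro conjI ballI)
  show "superop_exp N t L M \<in> carrier_mat N N" by simp
  fix B :: "complex mat" assume B: "B \<in> carrier_mat N N"
  have Mc: "M \<in> carrier_mat N N" using M by (simp add: psd_def)
  let ?D = "mat_adjoint B * B"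
  have D: "?D \<in> carrier_mat N N" by (intro sq_intros B)
  have e: "tr (B * X * mat_adjoint B) = tr (?D * X)" if X: "X \<in> carrier_mat N N" for X
    using tr_mult_commute[of "B * X" N N "mat_adjoint B"] B X
    by (simp add: sq_intros assoc_mult_mat[of _ N N _ N _ N])
  \<comment> \<open>At \<open>m = 0\<close> this is 0, so the bounds
    \<open>0 \<le> s m \<le> t\<close> hold for every \<open>m\<close>.\<close>
  define s where "s m = t / real m" for m
  have s0: "0 \<le> s m" "s m \<le> t" for m using t by (auto simp: s_def divide_le_eq intro: mult_le_cancel_left1[THEN iffD2])
  have slim: "s \<longlonglongrightarrow> 0" unfolding s_def by (rule lim_const_over_n)
  obtain C1 where C1: "0 \<le> C1" "\<forall>M\<in>carrier_mat N N. hs_norm (L M) \<le> C1 * hs_norm M" by (rule bounded)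
  have "\<exists>C\<ge>0. \<forall>M\<in>carrier_mat N N. hs_norm (K * M * mat_adjoint K) \<le> C * hs_norm M"
  proof (rule hs_norm_bounded[of N _ "\<lambda>A. mat_adjoint K * (A * K)"])
    fix A M :: "complex mat" assume AM: "A \<in> carrier_mat N N" "M \<in> carrier_mat N N"
    have "hs_inner A (K * M * mat_adjoint K) = hs_inner (A * K) (K * M)"
      using hs_inner_mult_right[OF AM(1) mat_adjoint_carrier[OF K] sq_mult_carrier[OF K AM(2)]] by simp
    also have "\<dots> = hs_inner (mat_adjoint K * (A * K)) M"
      by (rule hs_inner_mult_left[of _ N]) (intro sq_intros K AM)+
    finally show "hs_inner A (K * M * mat_adjoint K) = hs_inner (mat_adjoint K * (A * K)) M" .
  qed (intro sq_intros K, assumption)+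
  then obtain C2 where C2: "0 \<le> C2" "\<forall>M\<in>carrier_mat N N. hs_norm (K * M * mat_adjoint K) \<le> C2 * hs_norm M" by blast
  \<comment> \<open>One constant for all \<open>L1 (s m)\<close>: the perturbation is
    \<open>s m\<close> times a bounded map, and \<open>s m \<le> t\<close>.\<close>
  define C where "C = C1 + t * C2"
  have C0: "0 \<le> C" using C1 C2 t by (simp add: C_def)
  have L1b: "\<forall>X\<in>carrier_mat N N. hs_norm (L1 (s m) X) \<le> C * hs_norm X" for m
  proof
    fix X :: "complex mat" assume X: "X \<in> carrier_mat N N"
    have c: "K * X * mat_adjoint K \<in> carrier_mat N N" by (intro sq_intros K X)
    have "hs_norm (L1 (s m) X) \<le> hs_norm (L X) + hs_norm (complex_of_real (s m) \<cdot>\<^sub>m (K * X * mat_adjoint K))"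
      unfolding L1_eq[OF s0(1) X] by (rule hs_norm_add_le[of _ N]) (intro lindform_carrier smult_carrier_mat c)+
    also have "\<dots> \<le> C1 * hs_norm X + t * (C2 * hs_norm X)"
      unfolding hs_norm_smult[OF c] using s0[of m] C1 C2 X hs_norm_nonneg[OF c] t
      by (intro add_mono mult_mono) auto
    finally show "hs_norm (L1 (s m) X) \<le> C * hs_norm X" by (simp add: C_def algebra_simps)
  qed
  define c0 where "c0 = hs_norm (mat_adjoint ?D) * hs_norm M"
  have c0: "0 \<le> c0" unfolding c0_def by (intro mult_nonneg_nonneg hs_norm_nonneg[of _ N] sq_intros B Mc)
  \<comment> \<open>Binomial coefficients vanish for \<open>i > m\<close>, so the finite sum can be
    read as a series whose index set does not depend on \<open>m\<close>.\<close>
  define a where "a i m = complex_of_real (real (m choose i) * s m ^ i) * tr (?D * (L1 (s m) ^^ i) M)" for i m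
  have suma: "suminf (\<lambda>i. a i m) = tr (?D * (Psi (s m) ^^ m) M)" for m
  proof -
    have "suminf (\<lambda>i. a i m) = (\<Sum>i\<le>m. a i m)"
      by (rule suminf_finite) (auto simp: a_def)
    then show ?thesis unfolding tr_Psi_pow[OF s0(1) M D] a_def by simp
  qed
  have lim: "(\<lambda>m. a i m) \<longlonglongrightarrow> complex_of_real (t ^ i / fact i) * tr (?D * (L ^^ i) M)" for i
  proof -
    have "(\<lambda>m. real (m choose i) / real m ^ i * t ^ i) \<longlonglongrightarrow> 1 / fact i * t ^ i"
      by (intro tendsto_intros binomial_over_power_tendsto)
    then have "(\<lambda>m. real (m choose i) * s m ^ i) \<longlonglongrightarrow> t ^ i / fact i"
      by (simp add: s_def power_divide)
    then show ?thesis unfolding a_def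
      by (intro tendsto_mult tendsto_of_real
          mat_tendsto_tr[OF mat_tendsto_mult[OF mat_tendsto_const[OF D] L1_pow_tendsto[OF Mc slim s0(1)]]])
  qed
  have bnd: "cmod (a i m) \<le> inverse (fact i) *\<^sub>R (t * C) ^ i * c0" for i m
  proof -
    have "real (m choose i) * s m ^ i \<le> t ^ i / fact i"
    proof (cases "m = 0")
      case True then show ?thesis using t by (cases i) (auto simp: s_def)
    next
      case False
      have "real ((m choose i) * fact i) \<le> real (m ^ i)" by (rule of_nat_mono[OF binomial_fact_pow])
      then have "real (m choose i) / real m ^ i \<le> 1 / fact i" using False by (simp add: field_simps)
      then have "real (m choose i) / real m ^ i * t ^ i \<le> 1 / fact i * t ^ i" using t by (intro mult_right_mono) auto
      then show ?thesis by (simp add: s_def power_divide)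
    qed
    moreover have "cmod (tr (?D * (L1 (s m) ^^ i) M)) \<le> C ^ i * c0"
      using lindblad_form.norm_tr_pow_le[OF L1_form L1b[unfolded L1_def] C0 Mc D, of i] unfolding L1_def c0_def by simp
    ultimately have "real (m choose i) * s m ^ i * cmod (tr (?D * (L1 (s m) ^^ i) M)) \<le> t ^ i / fact i * (C ^ i * c0)"
      using t s0(1) by (intro mult_mono) auto
    then show ?thesis using s0(1)[of m] by (simp add: a_def norm_mult power_mult_distrib divide_inverse mult_ac norm_power)
  qed
  have sm: "summable (\<lambda>i. inverse (fact i) *\<^sub>R (t * C) ^ i * c0)" by (intro summable_mult2 summable_exp_generic)
  have "\<forall>\<^sub>F (i, m) in at_top \<times>\<^sub>F sequentially. cmod (a i m) \<le> inverse (fact i) *\<^sub>R (t * C) ^ i * c0"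
    by (rule always_eventually) (use bnd in auto)
  from tannerys_theorem[OF lim this sm] have "(\<lambda>m. suminf (\<lambda>i. a i m)) \<longlonglongrightarrow> suminf (\<lambda>i. complex_of_real (t ^ i / fact i) * tr (?D * (L ^^ i) M))"
    by simp
  also have "suminf (\<lambda>i. complex_of_real (t ^ i / fact i) * tr (?D * (L ^^ i) M)) = tr (?D * superop_exp N t L M)"
    using tr_exp_sums[OF Mc D] by (rule sums_unique[symmetric])
  finally have "(\<lambda>m. Re (tr (?D * (Psi (s m) ^^ m) M))) \<longlonglongrightarrow> Re (tr (?D * superop_exp N t L M))"
    unfolding suma by (rule tendsto_Re)
  moreover have "0 \<le> Re (tr (?D * (Psi (s m) ^^ m) M))" for m
    using psd_Psi_pow[OF s0(1)[of m] M, of m] B e by (auto simp: psd_def)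
  ultimately have "0 \<le> Re (tr (?D * superop_exp N t L M))" by (intro LIMSEQ_le_const) auto
  then show "0 \<le> Re (tr (B * superop_exp N t L M * mat_adjoint B))" using e[OF exp_carrier] by simp
qed

lemma tr_exp:
  assumes M: "M \<in> carrier_mat N N" and 0: "mat_adjoint K + K + msum N I (\<lambda>a. mat_adjoint (J a) * J a) = 0\<^sub>m N N"
  shows "tr (superop_exp N t L M) = tr M"
proof -
  have z: "complex_of_real (t ^ m / fact m) * tr (1\<^sub>m N * (L ^^ m) M) = (if m = 0 then tr M else 0)" for m
  proof (cases m)
    case (Suc l)
    have "tr ((L ^^ m) M) = tr (L ((L ^^ l) M))" by (simp add: Suc)
    also have "\<dots> = 0" by (rule lindform_trace[OF K J pow_carrier[OF M] 0])
    finally show ?thesis using Suc left_mult_one_mat[OF pow_carrier[OF M, of m]] by simp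
  qed (use M in simp)
  have "(\<lambda>m. if m = 0 then tr M else 0) sums tr (1\<^sub>m N * superop_exp N t L M)"
    using tr_exp_sums[OF M one_carrier_mat, of t] unfolding z .
  moreover have "(\<lambda>m. if m = 0 then tr M else 0) sums tr M" using sums_single[of 0 "\<lambda>_. tr M"] by simp
  ultimately show ?thesis using sums_unique2 left_mult_one_mat[OF exp_carrier[of t L M]] by metis
qed

end

section \<open>The whole generator as one Lindblad form\<close>

lemma lindform_dim [simp]: "dim_row (lindform N I K J M) = N" "dim_col (lindform N I K J M) = N"
  by (simp_all add: lindform_def)

lemma generator_dim [simp]: "dim_row (generator n k lb M) = 2 ^ n" "dim_col (generator n k lb M) = 2 ^ n"
  by (simp_all add: generator_def)

lemma eigenprojector_dim [simp]: "dim_row (eigenprojector n f) = 2 ^ n" "dim_col (eigenprojector n f) = 2 ^ n"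
  by (simp_all add: eigenprojector_def)

definition gen_drift :: "nat \<Rightarrow> nat \<Rightarrow> lindblad \<Rightarrow> complex mat" where
  "gen_drift n k lb = msum (2 ^ n) (local_sets n k) (loc_drift n lb)"

definition gen_index :: "nat \<Rightarrow> nat \<Rightarrow> lindblad \<Rightarrow> (nat set \<times> nat) set" where
  "gen_index n k lb = Sigma (local_sets n k) (\<lambda>e. {..<length (jumps lb e)})"

definition gen_jump :: "lindblad \<Rightarrow> nat set \<times> nat \<Rightarrow> complex mat" where
  "gen_jump lb p = jumps lb (fst p) ! snd p"

lemma gen_form: "k_local n k lb \<Longrightarrow> lindblad_form (2 ^ n) (gen_index n k lb) (gen_drift n k lb) (gen_jump lb)"
proof
  assume kl: "k_local n k lb"
  show "finite (gen_index n k lb)" by (auto simp: gen_index_def finite_local_sets)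
  show "gen_drift n k lb \<in> carrier_mat (2 ^ n) (2 ^ n)" by (simp add: gen_drift_def)
  fix p assume "p \<in> gen_index n k lb"
  then show "gen_jump lb p \<in> carrier_mat (2 ^ n) (2 ^ n)"
    using jumps_supported[OF kl] by (intro supported_on_carrier[of n "fst p"]) (auto simp: gen_index_def gen_jump_def)
qed

lemma sum_gen_index:
  "(\<Sum>p\<in>gen_index n k lb. f (fst p) (snd p)) = (\<Sum>e\<in>local_sets n k. \<Sum>a<length (jumps lb e). f e a)"
  unfolding gen_index_def by (subst sum.Sigma) (auto simp: finite_local_sets case_prod_unfold)

lemma mat_adjoint_gen_drift:
  "mat_adjoint (gen_drift n k lb) = msum (2 ^ n) (local_sets n k) (\<lambda>e. mat_adjoint (loc_drift n lb e))"
  unfolding gen_drift_def by (rule mat_adjoint_msum) simp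

lemma generator_lindform:
  assumes kl: "k_local n k lb" and M: "M \<in> carrier_mat (2 ^ n) (2 ^ n)"
  shows "generator n k lb M = lindform (2 ^ n) (gen_index n k lb) (gen_drift n k lb) (gen_jump lb) M"
proof (rule eq_matI, goal_cases)
  case (1 i j)
  then have ij: "i < 2 ^ n" "j < 2 ^ n" by auto
  let ?a = "\<lambda>e. (loc_drift n lb e * M) $$ (i, j)" and ?b = "\<lambda>e. (M * mat_adjoint (loc_drift n lb e)) $$ (i, j)"
    and ?c = "\<lambda>e a. (jumps lb e ! a * M * mat_adjoint (jumps lb e ! a)) $$ (i, j)"
  have "generator n k lb M $$ (i, j) = (\<Sum>e\<in>local_sets n k. ?a e + ?b e + (\<Sum>a<length (jumps lb e). ?c e a))"
  proof -
    have "local_term n lb e M $$ (i, j) = ?a e + ?b e + (\<Sum>a<length (jumps lb e). ?c e a)" if "e \<in> local_sets n k" for e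
      unfolding local_term_lindform[OF kl that M] lindform_def
      using ij M carrier_matD[OF loc_drift_carrier[of n lb e]] by (simp del: index_mult_mat(1))
    then show ?thesis using ij by (simp add: generator_def)
  qed
  also have "\<dots> = (\<Sum>e\<in>local_sets n k. ?a e) + (\<Sum>e\<in>local_sets n k. ?b e) + (\<Sum>e\<in>local_sets n k. \<Sum>a<length (jumps lb e). ?c e a)"
    by (simp only: sum.distrib)
  also have "(\<Sum>e\<in>local_sets n k. ?a e) = (gen_drift n k lb * M) $$ (i, j)"
    unfolding gen_drift_def by (subst msum_mult[OF M]) (use ij in auto)
  also have "(\<Sum>e\<in>local_sets n k. ?b e) = (M * mat_adjoint (gen_drift n k lb)) $$ (i, j)"
    unfolding mat_adjoint_gen_drift by (subst mult_msum[OF M]) (use ij in auto)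
  also have "(\<Sum>e\<in>local_sets n k. \<Sum>a<length (jumps lb e). ?c e a) =
      (\<Sum>p\<in>gen_index n k lb. (gen_jump lb p * M * mat_adjoint (gen_jump lb p)) $$ (i, j))"
    unfolding gen_jump_def by (rule sum_gen_index[symmetric])
  finally show ?case
    unfolding lindform_def using ij M by (simp add: gen_drift_def del: index_mult_mat(1))
qed auto

lemma gen_drift_sum:
  assumes kl: "k_local n k lb"
  shows "mat_adjoint (gen_drift n k lb) + gen_drift n k lb +
    msum (2 ^ n) (gen_index n k lb) (\<lambda>a. mat_adjoint (gen_jump lb a) * gen_jump lb a) = 0\<^sub>m (2 ^ n) (2 ^ n)"
proof (rule eq_matI, goal_cases)
  case (1 i j)
  then have ij: "i < 2 ^ n" "j < 2 ^ n" by auto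
  let ?c = "\<lambda>e a. (mat_adjoint (jumps lb e ! a) * (jumps lb e ! a)) $$ (i, j)"
  have "mat_adjoint (loc_drift n lb e) $$ (i, j) + loc_drift n lb e $$ (i, j) + (\<Sum>a<length (jumps lb e). ?c e a) = 0"
    if "e \<in> local_sets n k" for e
    using arg_cong[OF loc_drift_sum[OF kl that], where f="\<lambda>X. X $$ (i, j)"] ij carrier_matD[OF loc_drift_carrier[of n lb e]]
    by (simp del: index_mult_mat(1))
  then have "0 = (\<Sum>e\<in>local_sets n k. mat_adjoint (loc_drift n lb e) $$ (i, j) + loc_drift n lb e $$ (i, j) +
      (\<Sum>a<length (jumps lb e). ?c e a))" by simp
  also have "\<dots> = (\<Sum>e\<in>local_sets n k. mat_adjoint (loc_drift n lb e) $$ (i, j)) +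
      (\<Sum>e\<in>local_sets n k. loc_drift n lb e $$ (i, j)) + (\<Sum>e\<in>local_sets n k. \<Sum>a<length (jumps lb e). ?c e a)"
    by (simp only: sum.distrib)
  also have "(\<Sum>e\<in>local_sets n k. \<Sum>a<length (jumps lb e). ?c e a) =
      (\<Sum>p\<in>gen_index n k lb. (mat_adjoint (gen_jump lb p) * gen_jump lb p) $$ (i, j))"
    unfolding gen_jump_def by (rule sum_gen_index[symmetric])
  finally show ?case
    using ij unfolding mat_adjoint_gen_drift by (simp add: gen_drift_def del: index_mult_mat(1) mat_adjoint_index)
qed (auto simp: gen_drift_def)

lemma generator_pow_lindform:
  assumes kl: "k_local n k lb" and M: "M \<in> carrier_mat (2 ^ n) (2 ^ n)"
  shows "(generator n k lb ^^ m) M = (lindform (2 ^ n) (gen_index n k lb) (gen_drift n k lb) (gen_jump lb) ^^ m) M"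
proof (induction m)
  case (Suc m)
  then show ?case using generator_lindform[OF kl generator_pow_carrier[OF M, where k=k and lb=lb and m=m]] by simp
qed simp

lemma generator_exp_lindform:
  assumes "k_local n k lb" "M \<in> carrier_mat (2 ^ n) (2 ^ n)"
  shows "superop_exp (2 ^ n) t (generator n k lb) M =
    superop_exp (2 ^ n) t (lindform (2 ^ n) (gen_index n k lb) (gen_drift n k lb) (gen_jump lb)) M"
  by (simp add: superop_exp_def generator_pow_lindform[OF assms])

section \<open>Process shadows\<close>

definition eig_entry :: "pauli \<times> bool \<Rightarrow> bool \<Rightarrow> bool \<Rightarrow> complex" where
  "eig_entry p x y = (pauli_entry PI x y + complex_of_real (sgn_bit (snd p)) * pauli_entry (fst p) x y) / 2"

lemma eigenprojector_eq: "eigenprojector n f = tensor_mat [0..<n] (\<lambda>q. eig_entry (f q))"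
  by (simp add: eigenprojector_def eig_entry_def[abs_def])

lemma eigenprojector_carrier [simp]: "eigenprojector n f \<in> carrier_mat (2 ^ n) (2 ^ n)"
  using tensor_mat_carrier[of "[0..<n]"] by (simp add: eigenprojector_eq)

lemma eigenprojector_index: "i < 2 ^ n \<Longrightarrow> j < 2 ^ n \<Longrightarrow>
    eigenprojector n f $$ (i, j) = (\<Prod>q<n. eig_entry (f q) (bit i q) (bit j q))"
  by (simp add: eigenprojector_eq tensor_mat_index)

text \<open>Each one-qubit factor is a self-adjoint idempotent, also at the letter
  \<open>PI\<close>, where it is the identity or 0.\<close>

lemma eigenprojector_square: "eigenprojector n f * mat_adjoint (eigenprojector n f) = eigenprojector n f"
proof -
  have "(\<Sum>z\<in>UNIV. eig_entry p x z * cnj (eig_entry p y z)) = eig_entry p x y" for p x y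
    by (cases "fst p"; cases "snd p"; cases x; cases y; simp add: eig_entry_def sgn_bit_def sum_bool)
  then show ?thesis unfolding eigenprojector_eq mat_adjoint_tensor_mat tensor_mat_mult by simp
qed

lemma eigenprojector_adjoint: "mat_adjoint (eigenprojector n f) = eigenprojector n f"
proof -
  have "cnj (eig_entry p y x) = eig_entry p x y" for p x y by (simp add: eig_entry_def cnj_pauli_entry)
  then show ?thesis unfolding eigenprojector_eq mat_adjoint_tensor_mat by simp
qed

lemma psd_eigenprojector: "psd (2 ^ n) (eigenprojector n f)"
  using psd_hermitian_square[OF eigenprojector_carrier[of n f]] by (simp add: eigenprojector_square)

lemma tr_eigenprojector:
  assumes "\<And>q. q < n \<Longrightarrow> fst (f q) \<noteq> PI" shows "tr (eigenprojector n f) = 1"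
proof -
  have "(\<Sum>b\<in>UNIV. eig_entry p b b) = 1" if "fst p \<noteq> PI" for p
    using that by (cases "fst p") (auto simp: eig_entry_def sum_bool add_divide_distrib diff_divide_distrib)
  then show ?thesis using assms by (simp add: eigenprojector_eq tr_tensor_mat)
qed

text \<open>The defaults of this set and the next two repeat those of \<open>outcome_pmf\<close> and
  \<open>shot_pmf\<close>, so that expectations become finite sums over them.\<close>

definition outcomes :: "nat \<Rightarrow> (nat \<Rightarrow> bool) set" where
  "outcomes n = PiE_dflt {..<n} False (\<lambda>_. UNIV)"

definition axes :: "nat \<Rightarrow> (nat \<Rightarrow> pauli) set" where
  "axes n = PiE_dflt {..<n} PX (\<lambda>_. {PX, PY, PZ})"

definition preparations :: "nat \<Rightarrow> (nat \<Rightarrow> pauli \<times> bool) set" where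
  "preparations n = PiE_dflt {..<n} (PX, False) (\<lambda>_. {PX, PY, PZ} \<times> UNIV)"

lemma finite_settings: "finite (outcomes n)" "finite (axes n)" "finite (preparations n)"
  by (auto simp: outcomes_def axes_def preparations_def)

text \<open>The one-qubit factor of \<open>shot_estimate\<close>, with value 1 at \<open>PI\<close>
  so that products run over all qubits.\<close>

definition shot_weight :: "pauli \<Rightarrow> pauli \<times> bool \<Rightarrow> real" where
  "shot_weight p c = (if p = PI then 1 else if fst c = p then 3 * sgn_bit (snd c) else 0)"

lemma shot_estimate_eq:
  assumes "P \<in> pstrs {..<n}" "Q \<in> pstrs {..<n}"
  shows "shot_estimate P Q (a, b, r) = (\<Prod>q<n. shot_weight (Q q) (a q)) * (\<Prod>q<n. shot_weight (P q) (b q, r q))"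
proof -
  have *: "(\<Prod>q\<in>supp P. if fst (c q) = P q then 3 * sgn_bit (snd (c q)) else 0) = (\<Prod>q<n. shot_weight (P q) (c q))"
    if "P \<in> pstrs {..<n}" for P c
    using that by (intro prod.mono_neutral_cong_left) (auto simp: pstrs_def supp_def shot_weight_def)
  show ?thesis unfolding shot_estimate_def *[OF assms(2), symmetric] *[OF assms(1), symmetric] by (simp only: split fst_conv snd_conv)
qed

lemma prod_norm_shot_weight_le:
  assumes P: "P \<in> pstrs {..<n}" "card (supp P) \<le> k"
  shows "\<bar>\<Prod>q<n. shot_weight (P q) (c q)\<bar> \<le> 3 ^ k"
proof -
  have "\<bar>\<Prod>q<n. shot_weight (P q) (c q)\<bar> \<le> (\<Prod>q<n. if q \<in> supp P then 3 else 1)"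
    unfolding abs_prod by (intro prod_mono) (auto simp: shot_weight_def supp_def sgn_bit_def)
  also have "\<dots> = (\<Prod>q\<in>supp P. 3)"
    using P(1) by (intro prod.mono_neutral_cong_right) (auto simp: pstrs_def)
  also have "\<dots> \<le> 3 ^ k" using P(2) by (simp add: power_increasing)
  finally show ?thesis .
qed

lemma abs_shot_estimate_le:
  assumes "P \<in> pstrs {..<n}" "Q \<in> pstrs {..<n}" "card (supp P) \<le> k" "card (supp Q) \<le> k"
  shows "\<bar>shot_estimate P Q s\<bar> \<le> 9 ^ k"
proof -
  obtain a b r where s: "s = (a, b, r)" by (metis surj_pair)
  have "\<bar>shot_estimate P Q s\<bar> \<le> 3 ^ k * 3 ^ k"
    unfolding s shot_estimate_eq[OF assms(1,2)] abs_mult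
    by (intro mult_mono prod_norm_shot_weight_le assms) auto
  then show ?thesis by (simp flip: power_mult_distrib)
qed

text \<open>One qubit at a time: for \<open>PI\<close> the two projectors of any axis add up to the
  identity; for another letter the axis matches once in three, the factor 3 compensates, and the
  difference of the two projectors is the Pauli matrix.\<close>

lemma measurement_average:
  assumes "P \<in> pstrs {..<n}"
  shows "pmat n P = msum (2 ^ n) (axes n) (\<lambda>b. complex_of_real (1 / 3 ^ n) \<cdot>\<^sub>m msum (2 ^ n) (outcomes n)
     (\<lambda>r. complex_of_real (\<Prod>q<n. shot_weight (P q) (b q, r q)) \<cdot>\<^sub>m eigenprojector n (\<lambda>q. (b q, r q))))"
    (is "_ = ?R")
proof (rule eq_matI)
  fix i j assume "i < dim_row ?R" "j < dim_col ?R"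
  then have ij: "i < 2 ^ n" "j < 2 ^ n" by auto
  let ?f = "\<lambda>q b r. complex_of_real (shot_weight (P q) (b, r)) * eig_entry (b, r) (bit i q) (bit j q)"
  have "?R $$ (i, j) = (\<Sum>b\<in>axes n. complex_of_real (1 / 3 ^ n) * (\<Sum>r\<in>outcomes n. \<Prod>q<n. ?f q (b q) (r q)))"
    using ij by (simp add: eigenprojector_index prod.distrib)
  also have "\<dots> = (\<Sum>b\<in>axes n. complex_of_real (1 / 3 ^ n) * (\<Prod>q<n. \<Sum>r\<in>UNIV. ?f q (b q) r))"
    unfolding outcomes_def by (subst sum_prod_PiE_dflt) auto
  also have "\<dots> = (\<Sum>b\<in>axes n. \<Prod>q<n. (\<Sum>r\<in>UNIV. ?f q (b q) r) / 3)"
    by (simp add: prod_dividef)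
  also have "\<dots> = (\<Prod>q<n. \<Sum>b\<in>{PX, PY, PZ}. (\<Sum>r\<in>UNIV. ?f q b r) / 3)"
    unfolding axes_def by (rule sum_prod_PiE_dflt) auto
  also have "\<dots> = (\<Prod>q<n. pauli_entry (P q) (bit i q) (bit j q))"
  proof (rule prod.cong[OF refl])
    fix q
    show "(\<Sum>b\<in>{PX, PY, PZ}. (\<Sum>r\<in>UNIV. ?f q b r) / 3) = pauli_entry (P q) (bit i q) (bit j q)"
      by (cases "P q") (auto simp: sum_bool shot_weight_def eig_entry_def sgn_bit_def)
  qed
  also have "\<dots> = pmat n P $$ (i, j)" using ij by (simp add: pauli_mat_def tensor_mat_index)
  finally show "pmat n P $$ (i, j) = ?R $$ (i, j)" by simp
qed auto

text \<open>As for measurements, but averaging also over the two signs: there are 6 settings per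
  qubit, and a factor 1/2 is left. These factors supply the normalisation \<open>1 / 2 ^ n\<close>
  of the PTM entries.\<close>

lemma preparation_average:
  assumes "Q \<in> pstrs {..<n}"
  shows "msum (2 ^ n) (preparations n) (\<lambda>a. complex_of_real ((\<Prod>q<n. shot_weight (Q q) (a q)) / 6 ^ n) \<cdot>\<^sub>m eigenprojector n a) =
     complex_of_real (1 / 2 ^ n) \<cdot>\<^sub>m pmat n Q" (is "?R = _")
proof (rule eq_matI)
  fix i j assume "i < dim_row (complex_of_real (1 / 2 ^ n) \<cdot>\<^sub>m pmat n Q)" "j < dim_col (complex_of_real (1 / 2 ^ n) \<cdot>\<^sub>m pmat n Q)"
  then have ij: "i < 2 ^ n" "j < 2 ^ n" by auto
  let ?f = "\<lambda>q a. complex_of_real (shot_weight (Q q) a) * eig_entry a (bit i q) (bit j q) / 6"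
  have "?R $$ (i, j) = (\<Sum>a\<in>preparations n. \<Prod>q<n. ?f q (a q))"
    using ij by (simp add: eigenprojector_index prod.distrib prod_dividef)
  also have "\<dots> = (\<Prod>q<n. \<Sum>a\<in>{PX, PY, PZ} \<times> UNIV. ?f q a)"
    unfolding preparations_def by (rule sum_prod_PiE_dflt) auto
  also have "\<dots> = (\<Prod>q<n. pauli_entry (Q q) (bit i q) (bit j q) / 2)"
  proof (rule prod.cong[OF refl])
    fix q
    have "(\<Sum>a\<in>{PX, PY, PZ} \<times> UNIV. ?f q a) = (\<Sum>p\<in>{PX, PY, PZ}. \<Sum>s\<in>UNIV. ?f q (p, s))"
      by (simp add: sum.cartesian_product case_prod_unfold)
    also have "\<dots> = pauli_entry (Q q) (bit i q) (bit j q) / 2"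
      by (cases "Q q") (auto simp: sum_bool shot_weight_def eig_entry_def sgn_bit_def)
    finally show "(\<Sum>a\<in>{PX, PY, PZ} \<times> UNIV. ?f q a) = pauli_entry (Q q) (bit i q) (bit j q) / 2" .
  qed
  also have "\<dots> = (complex_of_real (1 / 2 ^ n) \<cdot>\<^sub>m pmat n Q) $$ (i, j)"
    using ij by (simp add: pauli_mat_def tensor_mat_index prod_dividef)
  finally show "?R $$ (i, j) = (complex_of_real (1 / 2 ^ n) \<cdot>\<^sub>m pmat n Q) $$ (i, j)" .
qed auto

lemma msum_outcomes: "msum (2 ^ n) (outcomes n) (\<lambda>r. eigenprojector n (\<lambda>q. (b q, r q))) = 1\<^sub>m (2 ^ n)"
proof -
  have "msum (2 ^ n) (outcomes n) (\<lambda>r. eigenprojector n (\<lambda>q. (b q, r q))) = pmat n Id_str"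
  proof (rule eq_matI)
    fix i j assume "i < dim_row (pmat n Id_str)" "j < dim_col (pmat n Id_str)"
    then have ij: "i < 2 ^ n" "j < 2 ^ n" by auto
    have "msum (2 ^ n) (outcomes n) (\<lambda>r. eigenprojector n (\<lambda>q. (b q, r q))) $$ (i, j) =
        (\<Sum>r\<in>outcomes n. \<Prod>q<n. eig_entry (b q, r q) (bit i q) (bit j q))"
      using ij by (simp add: eigenprojector_index)
    also have "\<dots> = (\<Prod>q<n. \<Sum>r\<in>UNIV. eig_entry (b q, r) (bit i q) (bit j q))"
      unfolding outcomes_def by (rule sum_prod_PiE_dflt) auto
    also have "\<dots> = (\<Prod>q<n. pauli_entry PI (bit i q) (bit j q))"
      by (rule prod.cong[OF refl]) (simp add: sum_bool eig_entry_def sgn_bit_def add_divide_distrib diff_divide_distrib)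
    finally show "msum (2 ^ n) (outcomes n) (\<lambda>r. eigenprojector n (\<lambda>q. (b q, r q))) $$ (i, j) = pmat n Id_str $$ (i, j)"
      using ij unfolding pauli_mat_def by (simp add: tensor_mat_index Id_str_def)
  qed auto
  then show ?thesis by simp
qed

text \<open>\<open>embed_pmf\<close> has the intended values if the Born weights are nonnegative and
  sum to 1. The first follows from positivity of \<rho>, writing a projector as \<open>E E*\<close>;
  the second from the resolution of the identity by the outcomes.\<close>

lemma outcome_pmf:
  assumes \<rho>: "psd (2 ^ n) \<rho>" "tr \<rho> = 1"
  shows "pmf (outcome_pmf n \<rho> b) r = (if r \<in> outcomes n then Re (tr (eigenprojector n (\<lambda>q. (b q, r q)) * \<rho>)) else 0)"
proof -
  let ?E = "\<lambda>r. eigenprojector n (\<lambda>q. (b q, r q))"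
  let ?f = "\<lambda>r. if r \<in> outcomes n then Re (tr (?E r * \<rho>)) else 0"
  have c: "\<rho> \<in> carrier_mat (2 ^ n) (2 ^ n)" using \<rho> by (simp add: psd_def)
  have pos: "0 \<le> Re (tr (?E r * \<rho>))" for r
  proof -
    have "tr (?E r * \<rho>) = tr (?E r * mat_adjoint (?E r) * \<rho>)" by (simp only: eigenprojector_square)
    also have "\<dots> = tr (mat_adjoint (?E r) * \<rho> * ?E r)"
      using tr_mult_commute[of "?E r" "2 ^ n" "2 ^ n" "mat_adjoint (?E r) * \<rho>"] c
      by (simp add: sq_intros assoc_mult_mat[of _ "2 ^ n" "2 ^ n" _ "2 ^ n" _ "2 ^ n"])
    also have "\<dots> = tr (?E r * \<rho> * mat_adjoint (?E r))" by (simp only: eigenprojector_adjoint)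
    finally show ?thesis using \<rho>(1) eigenprojector_carrier unfolding psd_def by metis
  qed
  have "(\<Sum>r\<in>outcomes n. tr (?E r * \<rho>)) = tr \<rho>"
  proof -
    have "(\<Sum>r\<in>outcomes n. tr (?E r * \<rho>)) = tr (msum (2 ^ n) (outcomes n) (\<lambda>r. ?E r * \<rho>))"
      by (rule tr_msum[symmetric]) (intro sq_intros eigenprojector_carrier c)
    also have "msum (2 ^ n) (outcomes n) (\<lambda>r. ?E r * \<rho>) = 1\<^sub>m (2 ^ n) * \<rho>"
      unfolding msum_outcomes[of n b, symmetric] by (rule msum_mult[OF c, symmetric]) simp
    finally show ?thesis using c by simp
  qed
  then have sum1: "(\<Sum>r\<in>outcomes n. Re (tr (?E r * \<rho>))) = 1" using \<rho>(2) by (metis Re_sum one_complex.sel(1))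
  have "outcome_pmf n \<rho> b = embed_pmf ?f"
    unfolding outcome_pmf_def by (intro arg_cong[of _ _ embed_pmf] ext) (auto simp: outcomes_def PiE_dflt_def)
  also have "pmf \<dots> r = ?f r"
  proof (rule pmf_embed_pmf)
    show "0 \<le> ?f r" for r using pos by simp
    have "(\<integral>\<^sup>+ r. ennreal (?f r) \<partial>count_space UNIV) = (\<Sum>r\<in>outcomes n. ennreal (?f r))"
      by (rule nn_integral_count_space'[OF finite_settings(1)]) auto
    also have "\<dots> = ennreal (\<Sum>r\<in>outcomes n. ?f r)" by (rule sum_ennreal) (use pos in auto)
    finally show "(\<integral>\<^sup>+ r. ennreal (?f r) \<partial>count_space UNIV) = 1" using sum1 by simp
  qed
  finally show ?thesis .
qed

text \<open>Averaging over axes and outcomes turns Born probabilities into the trace against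
  \<open>P\<close>; by linearity of the semigroup the average over preparations then replaces the
  prepared states by \<open>Q / 2 ^ n\<close>.\<close>

theorem expectation_shot:
  assumes kl: "k_local n k lb" and P: "P \<in> pstrs {..<n}" and Q: "Q \<in> pstrs {..<n}" and t: "0 \<le> t"
  shows "measure_pmf.expectation (shot_pmf n (generator n k lb) t) (shot_estimate P Q) =
     Re (tr (pmat n P * superop_exp (2 ^ n) t (generator n k lb) (pmat n Q)) / 2 ^ n)"
proof -
  interpret lindblad_form "2 ^ n" "gen_index n k lb" "gen_drift n k lb" "gen_jump lb" by (rule gen_form[OF kl])
  let ?N = "2 ^ n" and ?F = "generator n k lb"
  let ?w = "\<lambda>R c. \<Prod>q<n. shot_weight (R q) (c q)"
  let ?\<rho> = "\<lambda>a. superop_exp ?N t ?F (eigenprojector n a)"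
  let ?E = "\<lambda>b r. eigenprojector n (\<lambda>q. (b q, r q))"
  have \<rho>c: "?\<rho> a \<in> carrier_mat ?N ?N" for a by (simp add: superop_exp_def)
  \<comment> \<open>The evolved preparations are positive of trace 1, which makes the Born rule a
    distribution for them.\<close>
  have \<rho>: "psd ?N (?\<rho> a)" "tr (?\<rho> a) = 1" if "a \<in> preparations n" for a
  proof -
    have "fst (a q) \<noteq> PI" if "q < n" for q
      using \<open>a \<in> preparations n\<close> that unfolding preparations_def PiE_dflt_def by force
    then show "tr (?\<rho> a) = 1"
      unfolding generator_exp_lindform[OF kl eigenprojector_carrier] tr_exp[OF eigenprojector_carrier gen_drift_sum[OF kl]]
      by (rule tr_eigenprojector)
    show "psd ?N (?\<rho> a)"
      unfolding generator_exp_lindform[OF kl eigenprojector_carrier] by (rule psd_exp[OF psd_eigenprojector t])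
  qed
  define pa where "pa = Pi_pmf {..<n} (PX, False) (\<lambda>_. pmf_of_set ({PX, PY, PZ} \<times> (UNIV :: bool set)))"
  define pb where "pb = Pi_pmf {..<n} PX (\<lambda>_. pmf_of_set {PX, PY, PZ})"
  have sa: "set_pmf pa = preparations n" unfolding pa_def preparations_def by (subst set_Pi_pmf) (auto simp: comp_def)
  have sb: "set_pmf pb = axes n" unfolding pb_def axes_def by (subst set_Pi_pmf) (auto simp: comp_def)
  have wa: "pmf pa a = 1 / 6 ^ n" if "a \<in> preparations n" for a
    unfolding pa_def using that
    by (subst pmf_Pi') (auto simp: preparations_def PiE_dflt_def card_cartesian_product power_one_over)
  have wb: "pmf pb b = 1 / 3 ^ n" if "b \<in> axes n" for b
    unfolding pb_def using that by (subst pmf_Pi') (auto simp: axes_def PiE_dflt_def power_one_over)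
  have so: "set_pmf (outcome_pmf n (?\<rho> a) b) \<subseteq> outcomes n" if "a \<in> preparations n" for a b
    using outcome_pmf[OF \<rho>[OF that]] by (auto simp: set_pmf_eq split: if_splits)
  have fo: "finite (set_pmf (outcome_pmf n (?\<rho> a) b))" if "a \<in> preparations n" for a b
    by (rule finite_subset[OF so[OF that] finite_settings(1)])
  have Er: "measure_pmf.expectation (outcome_pmf n (?\<rho> a) b \<bind> (\<lambda>r. return_pmf (a, b, r))) (shot_estimate P Q) =
      Re (complex_of_real (?w Q a) * (\<Sum>r\<in>outcomes n. complex_of_real (?w P (\<lambda>q. (b q, r q))) * tr (?E b r * ?\<rho> a)))"
    if a: "a \<in> preparations n" for a b
  proof -
    have "measure_pmf.expectation (outcome_pmf n (?\<rho> a) b \<bind> (\<lambda>r. return_pmf (a, b, r))) (shot_estimate P Q) =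
       (\<Sum>r\<in>outcomes n. Re (tr (?E b r * ?\<rho> a)) * (?w Q a * ?w P (\<lambda>q. (b q, r q))))"
      by (subst pmf_expectation_bind[OF finite_settings(1) _ so[OF a]])
         (auto simp: outcome_pmf[OF \<rho>[OF a]] shot_estimate_eq[OF P Q] intro!: sum.cong)
    then show ?thesis by (simp add: sum_distrib_left mult_ac del: of_real_prod)
  qed
  have Eb: "measure_pmf.expectation (pb \<bind> (\<lambda>b. outcome_pmf n (?\<rho> a) b \<bind> (\<lambda>r. return_pmf (a, b, r)))) (shot_estimate P Q) =
      Re (complex_of_real (?w Q a) * tr (pmat n P * ?\<rho> a))" if a: "a \<in> preparations n" for a
  proof -
    have "tr (pmat n P * ?\<rho> a) = (\<Sum>b\<in>axes n. complex_of_real (1 / 3 ^ n) *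
       (\<Sum>r\<in>outcomes n. complex_of_real (?w P (\<lambda>q. (b q, r q))) * tr (?E b r * ?\<rho> a)))"
      by (subst measurement_average[OF P]) (simp add: tr_msum_mult[OF _ \<rho>c] del: of_real_prod)
    moreover have "measure_pmf.expectation (pb \<bind> (\<lambda>b. outcome_pmf n (?\<rho> a) b \<bind> (\<lambda>r. return_pmf (a, b, r)))) (shot_estimate P Q) =
      (\<Sum>b\<in>axes n. 1 / 3 ^ n * Re (complex_of_real (?w Q a) * (\<Sum>r\<in>outcomes n. complex_of_real (?w P (\<lambda>q. (b q, r q))) * tr (?E b r * ?\<rho> a))))"
      by (subst pmf_expectation_bind[of "axes n"]) (use fo[OF a] in \<open>auto simp: sb wb Er[OF a] finite_settings intro!: sum.cong\<close>)
    ultimately show ?thesis by (simp add: sum_distrib_left mult_ac del: of_real_prod)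
  qed
  have "shot_pmf n ?F t = pa \<bind> (\<lambda>a. pb \<bind> (\<lambda>b. outcome_pmf n (?\<rho> a) b \<bind> (\<lambda>r. return_pmf (a, b, r))))"
    by (simp add: shot_pmf_def pa_def pb_def)
  then have "measure_pmf.expectation (shot_pmf n ?F t) (shot_estimate P Q) =
     (\<Sum>a\<in>preparations n. 1 / 6 ^ n * Re (complex_of_real (?w Q a) * tr (pmat n P * ?\<rho> a)))"
    by (simp, subst pmf_expectation_bind[of "preparations n"])
       (use fo in \<open>auto simp: sa sb wa Eb finite_settings intro!: sum.cong\<close>)
  also have "\<dots> = Re (\<Sum>a\<in>preparations n. complex_of_real (?w Q a / 6 ^ n) * tr (pmat n P * ?\<rho> a))"
    by (simp add: mult_ac del: of_real_prod)
  also have "(\<Sum>a\<in>preparations n. complex_of_real (?w Q a / 6 ^ n) * tr (pmat n P * ?\<rho> a)) =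
     tr (pmat n P * superop_exp ?N t L (complex_of_real (1 / 2 ^ n) \<cdot>\<^sub>m pmat n Q))"
    unfolding generator_exp_lindform[OF kl eigenprojector_carrier]
    by (subst tr_exp_linear) (simp_all only: preparation_average[OF Q] pmat_carrier eigenprojector_carrier)
  also have "\<dots> = complex_of_real (1 / 2 ^ n) * tr (pmat n P * superop_exp ?N t L (pmat n Q))"
  proof -
    have "msum ?N {Q} (\<lambda>Q. complex_of_real (1 / 2 ^ n) \<cdot>\<^sub>m pmat n Q) = complex_of_real (1 / 2 ^ n) \<cdot>\<^sub>m pmat n Q"
      by (rule eq_matI) auto
    then show ?thesis
      using tr_exp_linear[OF pmat_carrier, of "{Q}" "pmat n" "\<lambda>_. complex_of_real (1 / 2 ^ n)" P t] by simp
  qed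
  finally show ?thesis using generator_exp_lindform[OF kl pmat_carrier] by simp
qed

section \<open>Overlaps and their Taylor coefficients\<close>

definition overlap :: "nat \<Rightarrow> superop \<Rightarrow> pstr \<Rightarrow> pstr \<Rightarrow> real \<Rightarrow> real" where
  "overlap n F P Q t = Re (tr (pmat n P * superop_exp (2 ^ n) t F (pmat n Q)) / 2 ^ n)"

text \<open>For a local generator, the \<open>m\<close>-th derivative of \<open>overlap\<close> at
  time 0; for \<open>m = 1\<close> it is the PTM entry.\<close>

definition moment :: "nat \<Rightarrow> superop \<Rightarrow> pstr \<Rightarrow> pstr \<Rightarrow> nat \<Rightarrow> real" where
  "moment n F P Q m = Re (tr (pmat n P * (F ^^ m) (pmat n Q)) / 2 ^ n)"

lemma overlap_sums:
  assumes kl: "k_local n k lb"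
  shows "(\<lambda>m. t ^ m / fact m * moment n (generator n k lb) P Q m) sums overlap n (generator n k lb) P Q t"
proof -
  interpret lindblad_form "2 ^ n" "gen_index n k lb" "gen_drift n k lb" "gen_jump lb" by (rule gen_form[OF kl])
  have "(\<lambda>m. Re (complex_of_real (t ^ m / fact m) * tr (pmat n P * (L ^^ m) (pmat n Q)) / 2 ^ n)) sums
      Re (tr (pmat n P * superop_exp (2 ^ n) t L (pmat n Q)) / 2 ^ n)"
    by (intro sums_Re sums_divide tr_exp_sums pmat_carrier)
  moreover have "Re (complex_of_real (t ^ m / fact m) * tr (pmat n P * (L ^^ m) (pmat n Q)) / 2 ^ n) =
     t ^ m / fact m * Re (tr (pmat n P * (L ^^ m) (pmat n Q)) / 2 ^ n)" for m
  proof -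
    have "Re (complex_of_real x * w) = x * Re w" for x w by simp
    then show ?thesis unfolding times_divide_eq_right[symmetric] .
  qed
  ultimately show ?thesis
    unfolding overlap_def moment_def generator_pow_lindform[OF kl pmat_carrier] generator_exp_lindform[OF kl pmat_carrier] by simp
qed

text \<open>With a single batch the median is the mean of that batch. A shot lies in an interval of
  length \<open>2 * 9 ^ k\<close>, whose square \<open>4 * 81 ^ k\<close> turns Hoeffding's exponent
  into \<open>m \<eta>^2 / (2 * 81 ^ k)\<close> for batch size \<open>m\<close>.\<close>

theorem overlap_estimate_deviation:
  assumes kl: "k_local n k lb" and P: "P \<in> pstrs {..<n}" "card (supp P) \<le> k" and Q: "Q \<in> pstrs {..<n}" "card (supp Q) \<le> k"
    and i: "i < num_times g" and b: "batches g = 1" and m: "0 < batch_size g" and \<eta>: "0 \<le> \<eta>" and t: "0 \<le> node T g i"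
  shows "measure_pmf.prob (shadow_data n (generator n k lb) T g)
     {d. \<bar>overlap_estimate g d P Q i - overlap n (generator n k lb) P Q (node T g i)\<bar> \<ge> \<eta>} \<le>
     2 * exp (- real (batch_size g) * \<eta>\<^sup>2 / (2 * 81 ^ k))"
proof -
  let ?F = "generator n k lb" and ?m = "batch_size g"
  let ?I = "{..<num_times g} \<times> {..<batches g} \<times> {..<batch_size g}"
  let ?M = "shadow_data n ?F T g"
  \<comment> \<open>The shots at time \<open>i\<close>; the batch index can only be 0.\<close>
  define J where "J = (\<lambda>a. (i, 0::nat, a)) ` {..<?m}"
  have J: "J \<subseteq> ?I" using i b by (auto simp: J_def)
  have indep: "prob_space.indep_vars (measure_pmf ?M) (\<lambda>_. borel) (\<lambda>x d. shot_estimate P Q (d x)) J"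
  proof -
    have "prob_space.indep_vars (measure_pmf ?M) (\<lambda>_. count_space UNIV) (\<lambda>x d. d x) ?I"
      unfolding shadow_data_def by (rule indep_vars_Pi_pmf) simp
    then have "prob_space.indep_vars (measure_pmf ?M) (\<lambda>_. count_space UNIV) (\<lambda>x d. d x) J"
      by (rule prob_space.indep_vars_subset[OF prob_space_measure_pmf _ J])
    then show ?thesis
      by (rule prob_space.indep_vars_compose2[OF prob_space_measure_pmf, where N="\<lambda>_. borel" and Y="\<lambda>_. shot_estimate P Q"]) simp
  qed
  interpret H: Hoeffding_ineq "measure_pmf ?M" J "\<lambda>x d. shot_estimate P Q (d x)" "\<lambda>_. - (9 ^ k)" "\<lambda>_. 9 ^ k"
    "\<Sum>x\<in>J. measure_pmf.expectation ?M (\<lambda>d. shot_estimate P Q (d x))"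
  proof unfold_locales
    show "finite J" by (simp add: J_def)
    show "prob_space.indep_vars (measure_pmf ?M) (\<lambda>_. borel) (\<lambda>x d. shot_estimate P Q (d x)) J" by (rule indep)
    show "AE d in measure_pmf ?M. shot_estimate P Q (d x) \<in> {- (9 ^ k)..9 ^ k}" for x
      using abs_shot_estimate_le[OF P(1) Q(1) P(2) Q(2)] by (simp add: abs_le_iff minus_le_iff)
  qed
  have inj: "inj_on (\<lambda>a. (i, 0::nat, a)) {..<?m}" by (auto simp: inj_on_def)
  have ex: "measure_pmf.expectation ?M (\<lambda>d. shot_estimate P Q (d x)) = overlap n ?F P Q (node T g i)" if "x \<in> J" for x
  proof -
    have "measure_pmf.expectation ?M (\<lambda>d. shot_estimate P Q (d x)) =
        measure_pmf.expectation (map_pmf (\<lambda>d. d x) ?M) (shot_estimate P Q)" by simp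
    also have "map_pmf (\<lambda>d. d x) ?M = shot_pmf n ?F (node T g i)"
      using that J unfolding shadow_data_def by (subst Pi_pmf_component) (auto simp: J_def)
    finally show ?thesis unfolding overlap_def using expectation_shot[OF kl P(1) Q(1) t] by simp
  qed
  have cJ: "card J = ?m" unfolding J_def by (simp add: card_image[OF inj])
  have sq: "(9 ^ k - - (9 ^ k :: real))\<^sup>2 = 4 * 81 ^ k"
    by (simp add: power2_eq_square flip: power_mult_distrib)
  have est: "overlap_estimate g d P Q i = (\<Sum>x\<in>J. shot_estimate P Q (d x)) / real ?m" for d
    unfolding overlap_estimate_def b J_def by (simp add: median_def sum.reindex[OF inj])
  have "measure_pmf.prob ?M {d \<in> space (measure_pmf ?M). \<bar>(\<Sum>x\<in>J. shot_estimate P Q (d x)) -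
      (\<Sum>x\<in>J. measure_pmf.expectation ?M (\<lambda>d. shot_estimate P Q (d x)))\<bar> \<ge> real ?m * \<eta>} \<le>
      2 * exp (-2 * (real ?m * \<eta>)\<^sup>2 / (\<Sum>x\<in>J. (9 ^ k - - (9 ^ k))\<^sup>2))"
    by (rule H.Hoeffding_ineq_abs_ge) (use m \<eta> in \<open>simp_all add: cJ sq\<close>)
  also have "(\<Sum>x\<in>J. (9 ^ k - - (9 ^ k :: real))\<^sup>2) = real ?m * (4 * 81 ^ k)" by (simp only: sum_constant cJ sq)
  also have "-2 * (real ?m * \<eta>)\<^sup>2 / (real ?m * (4 * 81 ^ k)) = - real ?m * \<eta>\<^sup>2 / (2 * 81 ^ k)"
    using m by (simp add: power2_eq_square field_simps)
  also have "{d \<in> space (measure_pmf ?M). \<bar>(\<Sum>x\<in>J. shot_estimate P Q (d x)) -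
      (\<Sum>x\<in>J. measure_pmf.expectation ?M (\<lambda>d. shot_estimate P Q (d x)))\<bar> \<ge> real ?m * \<eta>} =
      {d. \<bar>overlap_estimate g d P Q i - overlap n ?F P Q (node T g i)\<bar> \<ge> \<eta>}"
  proof -
    have "\<bar>x - real ?m * y\<bar> \<ge> real ?m * \<eta> \<longleftrightarrow> \<bar>x / real ?m - y\<bar> \<ge> \<eta>" for x y :: real
    proof -
      have "x - real ?m * y = real ?m * (x / real ?m - y)" using m by (simp add: field_simps)
      then show ?thesis using m by (simp add: abs_mult)
    qed
    then show ?thesis by (simp add: ex cJ est)
  qed
  finally show ?thesis .
qed

section \<open>Interpolation at the Chebyshev nodes\<close>

fun cheb :: "nat \<Rightarrow> real poly" where
  "cheb 0 = 1"
| "cheb (Suc 0) = [:0, 1:]"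
| "cheb (Suc (Suc n)) = [:0, 2:] * cheb (Suc n) - cheb n"

lemma poly_cheb_cos: "poly (cheb n) (cos x) = cos (real n * x)"
proof (induction n rule: cheb.induct)
  case (3 n)
  have "cos (real (Suc (Suc n)) * x) + cos (real n * x) = 2 * cos x * cos (real (Suc n) * x)"
    using cos_add[of "real (Suc n) * x" x] cos_diff[of "real (Suc n) * x" x] by (simp add: algebra_simps)
  then show ?case using 3 by simp
qed auto

lemma degree_cheb: "degree (cheb n) \<le> n"
proof (induction n rule: cheb.induct)
  case (3 n)
  have "degree ([:0, 2:] * cheb (Suc n)) \<le> Suc (Suc n)"
    using degree_mult_le[of "[:0, 2:]" "cheb (Suc n)"] 3(1) by simp
  then show ?case using 3(2) by (simp add: degree_diff_le del: mult_pCons_left)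
qed auto

text \<open>The endpoint 1 is the image of time 0 under \<open>t \<mapsto> 1 - 2 t / T\<close>, so
  this value governs the derivative at 0.\<close>

lemma pderiv_cheb_1: "poly (pderiv (cheb n)) 1 = (real n)\<^sup>2"
proof (induction n rule: cheb.induct)
  case (3 n)
  have "poly (cheb m) 1 = 1" for m using poly_cheb_cos[of m 0] by simp
  then show ?case using 3 by (simp add: pderiv_diff pderiv_mult pderiv_smult pderiv_pCons power2_eq_square algebra_simps)
qed (auto simp: pderiv_pCons)

text \<open>The usual halving of the constant term, scaled by 2: with these weights the cosine sum
  is a Dirichlet kernel.\<close>

definition cheb_weight :: "nat \<Rightarrow> real" where
  "cheb_weight j = (if j = 0 then 1 else 2)"

text \<open>Multiplication by \<open>sin (x / 2)\<close> makes the sum telescope; keeping the factor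
  on the left avoids a division where it vanishes.\<close>

lemma dirichlet_kernel:
  assumes "0 < N"
  shows "sin (x / 2) * (\<Sum>j<N. cheb_weight j * cos (real j * x)) = sin ((real N - 1 / 2) * x)"
  using assms
proof (induction N rule: nat_induct_non_zero)
  case (Suc N)
  have "sin ((real (Suc N) - 1 / 2) * x) - sin ((real N - 1 / 2) * x) = 2 * sin (x / 2) * cos (real N * x)"
    using sin_add[of "real N * x" "x / 2"] sin_diff[of "real N * x" "x / 2"] by (simp add: algebra_simps)
  then show ?case using Suc by (simp add: cheb_weight_def algebra_simps)
qed (simp add: cheb_weight_def)

text \<open>At these points the right-hand side of the kernel identity is
  \<open>sin (m pi - x / 2)\<close>, a sign times \<open>sin (x / 2)\<close>; the condition on
  \<open>m\<close> keeps \<open>x / 2\<close> strictly between 0 and pi, so the factor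
  cancels.\<close>

lemma dirichlet_kernel_node:
  assumes "0 < m" "m < 2 * N"
  shows "(\<Sum>j<N. cheb_weight j * cos (real j * (pi * real m / real N))) = - ((-1) ^ m)"
proof -
  let ?x = "pi * real m / real N"
  have N: "0 < N" using assms by auto
  have "0 < ?x / 2" "?x / 2 < pi"
    using assms N by (auto simp: field_simps) (simp flip: of_nat_mult)?
  then have s: "sin (?x / 2) \<noteq> 0" using sin_gt_zero by fastforce
  have "(real N - 1 / 2) * ?x = real m * pi - ?x / 2" using N by (simp add: field_simps)
  then have "sin ((real N - 1 / 2) * ?x) = - ((-1) ^ m) * sin (?x / 2)" by (simp add: sin_diff)
  with dirichlet_kernel[OF N, of ?x] have "sin (?x / 2) * (\<Sum>j<N. cheb_weight j * cos (real j * ?x)) = sin (?x / 2) * (- ((-1) ^ m))"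
    by (simp only: mult.commute)
  then show ?thesis by (rule mult_left_cancel[OF s, THEN iffD1])
qed

definition cheb_angle :: "nat \<Rightarrow> nat \<Rightarrow> real" where
  "cheb_angle N i = pi * (2 * real i + 1) / (2 * real N)"

text \<open>Product-to-sum leads to the kernel at the distance of \<open>i\<close> and
  \<open>l\<close> and at \<open>i + l + 1\<close>, numbers of opposite parity, so for distinct
  nodes the two values cancel. For \<open>i = l\<close> the first is the sum of the weights,
  \<open>2 N - 1\<close>, and the second is 1. The sum runs over the degree \<open>j\<close>, which
  is the form needed to evaluate the interpolant at a node.\<close>

lemma cheb_orthogonal:
  assumes "i < N" "l < N"
  shows "(\<Sum>j<N. cheb_weight j * cos (real j * cheb_angle N i) * cos (real j * cheb_angle N l)) = (if i = l then real N else 0)"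
proof -
  have N: "0 < N" using assms by auto
  define m where "m = (if i < l then l - i else i - l)"
  have c: "cos (real j * cheb_angle N i) * cos (real j * cheb_angle N l) =
      (cos (real j * (pi * real m / real N)) + cos (real j * (pi * real (i + l + 1) / real N))) / 2" for j
  proof -
    let ?a = "real j * cheb_angle N i" and ?b = "real j * cheb_angle N l"
    have s: "?a + ?b = real j * (pi * real (i + l + 1) / real N)" using N by (simp add: cheb_angle_def field_simps)
    have "cos (?a - ?b) = cos (real j * (pi * real m / real N))"
    proof (cases "i < l")
      case True
      have "?b - ?a = real j * (pi * real m / real N)" using N True by (simp add: cheb_angle_def m_def field_simps of_nat_diff)
      then show ?thesis by (metis cos_minus minus_diff_eq)
    next
      case False
      have "?a - ?b = real j * (pi * real m / real N)" using N False by (simp add: cheb_angle_def m_def field_simps of_nat_diff)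
      then show ?thesis by simp
    qed
    then show ?thesis unfolding s[symmetric] by (simp add: cos_times_cos)
  qed
  have "(\<Sum>j<N. cheb_weight j * cos (real j * cheb_angle N i) * cos (real j * cheb_angle N l)) =
      ((\<Sum>j<N. cheb_weight j * cos (real j * (pi * real m / real N))) +
       (\<Sum>j<N. cheb_weight j * cos (real j * (pi * real (i + l + 1) / real N)))) / 2"
    unfolding mult.assoc c sum.distrib[symmetric] sum_divide_distrib by (intro sum.cong refl) (simp add: algebra_simps)
  also have "(\<Sum>j<N. cheb_weight j * cos (real j * (pi * real (i + l + 1) / real N))) = - ((-1) ^ (i + l + 1))"
    by (rule dirichlet_kernel_node) (use assms in auto)
  also have "((\<Sum>j<N. cheb_weight j * cos (real j * (pi * real m / real N))) + - ((-1) ^ (i + l + 1))) / 2 = (if i = l then real N else 0)"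
  proof (cases "i = l")
    case True
    have "(\<Sum>j<N. cheb_weight j) = 2 * real N - 1"
      using N by (induction N rule: nat_induct_non_zero) (auto simp: cheb_weight_def)
    then show ?thesis using True by (simp add: m_def)
  next
    case False
    have "(\<Sum>j<N. cheb_weight j * cos (real j * (pi * real m / real N))) = - ((-1) ^ m)"
      by (rule dirichlet_kernel_node) (use assms False in \<open>auto simp: m_def\<close>)
    moreover have "even m \<longleftrightarrow> even (i + l)" by (auto simp: m_def)
    ultimately show ?thesis using False by (simp add: uminus_power_if)
  qed
  finally show ?thesis .
qed

text \<open>By discrete orthogonality at the nodes, these are the Chebyshev coefficients of the interpolant; each is at
  most twice the largest value, and \<open>T\<^sub>j' 1 = j\<^sup>2\<close>.\<close>

definition cheb_coeff :: "nat \<Rightarrow> (nat \<Rightarrow> real) \<Rightarrow> nat \<Rightarrow> real" where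
  "cheb_coeff N y j = cheb_weight j / real N * (\<Sum>l<N. y l * cos (real j * cheb_angle N l))"

definition cheb_interpolant :: "real \<Rightarrow> nat \<Rightarrow> (nat \<Rightarrow> real) \<Rightarrow> real poly" where
  "cheb_interpolant T N y = (\<Sum>j<N. Polynomial.smult (cheb_coeff N y j) (pcompose (cheb j) [:1, - 2 / T:]))"

definition cheb_node :: "real \<Rightarrow> nat \<Rightarrow> nat \<Rightarrow> real" where
  "cheb_node T N i = T * (1 - cos (cheb_angle N i)) / 2"

lemma poly_cheb_interpolant:
  assumes "i < N" "T \<noteq> 0" shows "poly (cheb_interpolant T N y) (cheb_node T N i) = y i"
proof -
  have N: "0 < N" using assms by auto
  have x: "1 - 2 / T * cheb_node T N i = cos (cheb_angle N i)" using assms(2) by (simp add: cheb_node_def field_simps)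
  have "poly (cheb_interpolant T N y) (cheb_node T N i) = (\<Sum>j<N. cheb_coeff N y j * cos (real j * cheb_angle N i))"
    unfolding cheb_interpolant_def poly_sum
    by (intro sum.cong refl) (use x in \<open>simp add: poly_pcompose mult.commute flip: poly_cheb_cos\<close>)
  also have "\<dots> = (\<Sum>j<N. \<Sum>l<N. y l / real N * (cheb_weight j * cos (real j * cheb_angle N i) * cos (real j * cheb_angle N l)))"
    by (simp add: cheb_coeff_def sum_distrib_left sum_distrib_right mult_ac)
  also have "\<dots> = (\<Sum>l<N. \<Sum>j<N. y l / real N * (cheb_weight j * cos (real j * cheb_angle N i) * cos (real j * cheb_angle N l)))"
    by (rule sum.swap)
  also have "\<dots> = (\<Sum>l<N. if l = i then y l else 0)"
  proof (rule sum.cong[OF refl])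
    fix l assume "l \<in> {..<N}"
    then have "(\<Sum>j<N. y l / real N * (cheb_weight j * cos (real j * cheb_angle N i) * cos (real j * cheb_angle N l))) =
        y l / real N * (if i = l then real N else 0)"
      by (simp only: sum_distrib_left[symmetric] cheb_orthogonal[OF assms(1)] lessThan_iff)
    then show "(\<Sum>j<N. y l / real N * (cheb_weight j * cos (real j * cheb_angle N i) * cos (real j * cheb_angle N l))) =
        (if l = i then y l else 0)"
      using N by (cases "l = i") simp_all
  qed
  finally show ?thesis using assms(1) by simp
qed

lemma degree_cheb_interpolant: "degree (cheb_interpolant T (Suc d) y) \<le> d"
  unfolding cheb_interpolant_def
proof (rule degree_sum_le)
  fix j assume "j \<in> {..<Suc d}"
  then have "degree (cheb j) * 1 \<le> d" using degree_cheb[of j] by simp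
  moreover have "degree (pcompose (cheb j) [:1, - 2 / T:]) \<le> degree (cheb j) * 1"
    by (rule order_trans[OF degree_pcompose_le]) simp
  ultimately show "degree (Polynomial.smult (cheb_coeff (Suc d) y j) (pcompose (cheb j) [:1, - 2 / T:])) \<le> d"
    using degree_smult_le[of "cheb_coeff (Suc d) y j" "pcompose (cheb j) [:1, - 2 / T:]"] by linarith
qed simp

text \<open>Each of the \<open>d\<close> nonconstant terms contributes at most \<open>2 B\<close>
  from the coefficient, \<open>d^2\<close> from the Chebyshev derivative and \<open>2 / T\<close>
  from the change of variable.\<close>

lemma cheb_interpolant_deriv:
  assumes T: "0 < T" and y: "\<And>l. l < Suc d \<Longrightarrow> \<bar>y l\<bar> \<le> B"
  shows "\<bar>poly (pderiv (cheb_interpolant T (Suc d) y)) 0\<bar> \<le> 4 * real d ^ 3 / T * B"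
proof -
  let ?N = "Suc d"
  have B: "0 \<le> B" using y[of 0] by simp
  have c: "\<bar>cheb_coeff ?N y j\<bar> \<le> 2 * B" for j
  proof -
    have "\<bar>\<Sum>l<?N. y l * cos (real j * cheb_angle ?N l)\<bar> \<le> (\<Sum>l<?N. \<bar>y l * cos (real j * cheb_angle ?N l)\<bar>)" by (rule sum_abs)
    also have "\<dots> \<le> (\<Sum>l<?N. B * 1)"
      unfolding abs_mult by (intro sum_mono mult_mono) (use y B in auto)
    also have "\<dots> = real ?N * B" by simp
    finally have "cheb_weight j / real ?N * \<bar>\<Sum>l<?N. y l * cos (real j * cheb_angle ?N l)\<bar> \<le> 2 / real ?N * (real ?N * B)"
      using B by (intro mult_mono divide_right_mono) (auto simp: cheb_weight_def)
    then show ?thesis by (simp add: cheb_coeff_def abs_mult abs_divide cheb_weight_def del: of_nat_Suc)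
  qed
  have "poly (pderiv (cheb_interpolant T ?N y)) 0 = (\<Sum>j<?N. cheb_coeff ?N y j * ((real j)\<^sup>2 * (- 2 / T)))"
    unfolding cheb_interpolant_def
    by (simp only: pderiv_sum poly_sum pderiv_smult poly_smult pderiv_pcompose poly_mult poly_pcompose)
       (simp add: pderiv_pCons pderiv_cheb_1)
  also have "\<bar>\<dots>\<bar> \<le> (\<Sum>j<?N. \<bar>cheb_coeff ?N y j * ((real j)\<^sup>2 * (- 2 / T))\<bar>)" by (rule sum_abs)
  also have "\<dots> \<le> (\<Sum>j<?N. if j = 0 then 0 else 2 * B * ((real d)\<^sup>2 * (2 / T)))"
  proof (rule sum_mono)
    fix j assume "j \<in> {..<?N}"
    then have "(real j)\<^sup>2 \<le> (real d)\<^sup>2" by (intro power_mono) auto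
    then show "\<bar>cheb_coeff ?N y j * ((real j)\<^sup>2 * (- 2 / T))\<bar> \<le> (if j = 0 then 0 else 2 * B * ((real d)\<^sup>2 * (2 / T)))"
    proof (cases "j = 0")
      case False
      have "\<bar>cheb_coeff ?N y j * ((real j)\<^sup>2 * (- 2 / T))\<bar> = \<bar>cheb_coeff ?N y j\<bar> * ((real j)\<^sup>2 * (2 / T))"
        using T by (simp add: abs_mult)
      also have "\<dots> \<le> 2 * B * ((real d)\<^sup>2 * (2 / T))"
        using \<open>(real j)\<^sup>2 \<le> (real d)\<^sup>2\<close> T B by (intro mult_mono c mult_right_mono) auto
      finally show ?thesis using False by simp
    qed simp
  qed
  also have "\<dots> = real d * (2 * B * ((real d)\<^sup>2 * (2 / T)))" by (simp add: sum.lessThan_Suc_shift del: sum.lessThan_Suc)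
  also have "\<dots> = 4 * real d ^ 3 / T * B" by (simp add: power2_eq_square power3_eq_cube)
  finally show ?thesis .
qed

section \<open>Uniqueness of the interpolant and the robust fit\<close>

lemma cheb_node_inj: "0 < T \<Longrightarrow> inj_on (cheb_node T N) {..<N}"
proof (rule inj_onI)
  fix i l assume T: "0 < T" and il: "i \<in> {..<N}" "l \<in> {..<N}" "cheb_node T N i = cheb_node T N l"
  then have "cos (cheb_angle N i) = cos (cheb_angle N l)" by (simp add: cheb_node_def)
  moreover have "0 \<le> cheb_angle N i" "cheb_angle N i \<le> pi" if "i < N" for i
    using that by (auto simp: cheb_angle_def divide_le_eq)
  ultimately have "cheb_angle N i = cheb_angle N l" using il(1,2) unfolding lessThan_iff by (metis cos_inj_pi)
  moreover have "0 < real N" using il(1) by auto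
  ultimately have "2 * real i + 1 = 2 * real l + 1"
    unfolding cheb_angle_def by (simp only: divide_cancel_right mult_cancel_left) simp
  then show "i = l" by simp
qed

lemma cheb_interpolant_unique:
  assumes T: "0 < T" and p: "degree p \<le> d" "\<And>i. i < Suc d \<Longrightarrow> poly p (cheb_node T (Suc d) i) = y i"
  shows "p = cheb_interpolant T (Suc d) y"
proof (rule poly_eqI_degree[where A="cheb_node T (Suc d) ` {..<Suc d}"])
  show "poly p x = poly (cheb_interpolant T (Suc d) y) x" if "x \<in> cheb_node T (Suc d) ` {..<Suc d}" for x
    using that p(2) poly_cheb_interpolant T by auto
  have c: "card (cheb_node T (Suc d) ` {..<Suc d}) = Suc d" using card_image[OF cheb_node_inj[OF T, of "Suc d"]] by simp
  show "degree p < card (cheb_node T (Suc d) ` {..<Suc d})" using p(1) unfolding c by simp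
  show "degree (cheb_interpolant T (Suc d) y) < card (cheb_node T (Suc d) ` {..<Suc d})"
    using degree_cheb_interpolant[of T d y] unfolding c by simp
qed

text \<open>With one node per cell every median is a single residual, so the objective is the
  largest residual over \<open>degr g + 1\<close> nodes. The interpolant reaches 0; any minimiser,
  in particular the one selected by \<open>arg_min\<close>, must do so too and then agrees with it
  by uniqueness.\<close>

lemma robust_fit_eq:
  assumes T: "0 < T" and g: "per_cell g = 1" "cells g = Suc (degr g)"
  shows "robust_fit T g y = cheb_interpolant T (Suc (degr g)) y"
proof -
  let ?N = "Suc (degr g)"
  have node: "node T g i = cheb_node T ?N i" for i
    by (simp add: node_def cheb_node_def cheb_angle_def num_times_def g)
  have res: "robust_residual T g y p = Max ((\<lambda>j. \<bar>y j - poly p (cheb_node T ?N j)\<bar>) ` {..<?N})" for p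
    unfolding robust_residual_def g by (simp add: median_def node)
  have pos: "0 \<le> robust_residual T g y p" for p
    unfolding res by (rule order_trans[OF abs_ge_zero, OF Max_ge]) auto
  let ?c = "cheb_interpolant T ?N y"
  have c0: "robust_residual T g y ?c = 0"
  proof -
    have "(\<lambda>j. \<bar>y j - poly ?c (cheb_node T ?N j)\<bar>) ` {..<?N} = (\<lambda>_. 0) ` {..<?N}"
      by (rule image_cong) (use T in \<open>simp_all add: poly_cheb_interpolant\<close>)
    also have "\<dots> = {0}" by (rule image_constant[of 0]) simp
    finally show ?thesis unfolding res by simp
  qed
  have "is_arg_min (robust_residual T g y) (\<lambda>p. degree p \<le> degr g) ?c"
    unfolding is_arg_min_def using pos c0 degree_cheb_interpolant by (auto simp: not_less)
  then have *: "is_arg_min (robust_residual T g y) (\<lambda>p. degree p \<le> degr g) (robust_fit T g y)"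
    unfolding robust_fit_def arg_min_def by (rule someI)
  then have d: "degree (robust_fit T g y) \<le> degr g" and "\<not> robust_residual T g y ?c < robust_residual T g y (robust_fit T g y)"
    using degree_cheb_interpolant unfolding is_arg_min_def by blast+
  then have le: "Max ((\<lambda>j. \<bar>y j - poly (robust_fit T g y) (cheb_node T ?N j)\<bar>) ` {..<?N}) \<le> 0"
    using c0 unfolding res by simp
  show ?thesis
  proof (rule cheb_interpolant_unique[OF T d])
    fix i assume "i < ?N"
    then have "\<bar>y i - poly (robust_fit T g y) (cheb_node T ?N i)\<bar> \<le> 0"
      by (intro order_trans[OF Max_ge le] imageI) simp_all
    then show "poly (robust_fit T g y) (cheb_node T ?N i) = y i" by simp
  qed
qed

lemma node_bounds: "0 \<le> T \<Longrightarrow> 0 \<le> node T g i" "0 \<le> T \<Longrightarrow> node T g i \<le> T"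
proof -
  assume T: "0 \<le> T"
  define c where "c = cos (pi * (2 * real i + 1) / (2 * real (num_times g)))"
  have "0 \<le> T * (1 - c)" using T by (simp add: c_def)
  moreover have "T * (1 - c) \<le> T * 2"
    using T cos_ge_minus_one[of "pi * (2 * real i + 1) / (2 * real (num_times g))"] unfolding c_def[symmetric]
    by (intro mult_left_mono) auto
  ultimately show "0 \<le> node T g i" "node T g i \<le> T" unfolding node_def c_def[symmetric] by simp_all
qed

text \<open>The difference of the fit and the Taylor polynomial is itself an interpolant, namely of
  data errors plus truncation errors, so the derivative bound applies to it directly.\<close>

lemma robust_fit_deriv_error:
  assumes T: "0 < T" and g: "per_cell g = 1" "cells g = Suc (degr g)" "1 \<le> degr g"
    and a: "\<And>m. \<bar>a m\<bar> \<le> fact m * \<kappa> ^ m" and \<kappa>: "0 \<le> \<kappa>" "\<kappa> * T \<le> 1 / 4"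
    and f: "\<And>t. (\<lambda>m. t ^ m / fact m * a m) sums f t"
    and y: "\<And>i. i < Suc (degr g) \<Longrightarrow> \<bar>y i - f (node T g i)\<bar> \<le> \<eta>"
  shows "\<bar>poly (pderiv (robust_fit T g y)) 0 - a 1\<bar> \<le> 4 * real (degr g) ^ 3 / T * (\<eta> + (1 / 4) ^ degr g)"
proof -
  let ?d = "degr g"
  define q where "q = (\<Sum>m\<le>?d. monom (a m / fact m) m)"
  have pq: "poly q t = (\<Sum>m\<le>?d. t ^ m / fact m * a m)" for t
    unfolding q_def poly_sum by (intro sum.cong refl) (simp add: poly_monom)
  have dq: "degree q \<le> ?d" unfolding q_def
    by (rule degree_sum_le) (auto intro: order_trans[OF degree_monom_le])
  have q1: "poly (pderiv q) 0 = a 1"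
  proof -
    have "poly (pderiv q) 0 = coeff q 1" by (simp add: poly_0_coeff_0 coeff_pderiv)
    also have "\<dots> = a 1" unfolding q_def using g(3) by (simp add: coeff_sum)
    finally show ?thesis .
  qed
  \<comment> \<open>The terms decay with ratio \<open>\<kappa> t \<le> 1 / 4\<close>, so the tail is
    at most 4/3 times \<open>(1 / 4) ^ (d + 1)\<close>.\<close>
  have tail: "\<bar>f t - poly q t\<bar> \<le> (1 / 4) ^ ?d" if t: "0 \<le> t" "t \<le> T" for t
  proof -
    have s1: "(\<lambda>m. t ^ (m + Suc ?d) / fact (m + Suc ?d) * a (m + Suc ?d)) sums (f t - poly q t)"
      using sums_split_initial_segment[OF f[of t], of "Suc ?d"] by (simp add: pq lessThan_Suc_atMost del: fact_Suc power_Suc)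
    have s2: "(\<lambda>m. (1 / 4) ^ Suc ?d * (1 / 4) ^ m) sums ((1 / 4) ^ Suc ?d * (1 / (1 - 1 / 4 :: real)))"
      by (intro sums_mult geometric_sums) simp
    have "norm (t ^ m / fact m * a m) \<le> (1 / 4) ^ m" for m
    proof -
      have "norm (t ^ m / fact m * a m) \<le> t ^ m / fact m * (fact m * \<kappa> ^ m)"
      proof -
        have "norm (t ^ m / fact m * a m) = t ^ m / fact m * \<bar>a m\<bar>" using t by (simp add: abs_mult)
        also have "\<dots> \<le> t ^ m / fact m * (fact m * \<kappa> ^ m)" by (intro mult_left_mono a) (use t in simp)
        finally show ?thesis .
      qed
      also have "\<dots> = (\<kappa> * t) ^ m" by (simp add: power_mult_distrib)
      also have "\<dots> \<le> (1 / 4) ^ m"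
        using \<kappa> t mult_left_mono[OF t(2) \<kappa>(1)] by (intro power_mono) auto
      finally show ?thesis .
    qed
    then have "norm (t ^ (m + Suc ?d) / fact (m + Suc ?d) * a (m + Suc ?d)) \<le> (1 / 4) ^ Suc ?d * (1 / 4) ^ m" for m
      by (metis power_add mult.commute)
    from norm_sums_le[OF s1 s2 this] have "norm (f t - poly q t) \<le> (1 / 4) ^ Suc ?d * (1 / (1 - 1 / 4))" .
    also have "\<dots> \<le> (1 / 4) ^ ?d" by simp
    finally show ?thesis by simp
  qed
  let ?p = "robust_fit T g y"
  have node: "node T g i = cheb_node T (Suc ?d) i" for i
    by (simp add: node_def cheb_node_def cheb_angle_def num_times_def g)
  have nr: "0 \<le> node T g i" "node T g i \<le> T" for i
    using node_bounds[of T g i] T by auto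
  have fit: "?p = cheb_interpolant T (Suc ?d) y" by (rule robust_fit_eq[OF T g(1,2)])
  have "?p - q = cheb_interpolant T (Suc ?d) (\<lambda>i. y i - poly q (node T g i))"
  proof (rule cheb_interpolant_unique[OF T])
    show "degree (?p - q) \<le> ?d" unfolding fit by (rule degree_diff_le[OF degree_cheb_interpolant dq])
    fix i assume "i < Suc ?d"
    then show "poly (?p - q) (cheb_node T (Suc ?d) i) = y i - poly q (node T g i)"
      unfolding fit using T by (simp add: poly_cheb_interpolant node)
  qed
  moreover have "\<bar>poly (pderiv (cheb_interpolant T (Suc ?d) (\<lambda>i. y i - poly q (node T g i)))) 0\<bar> \<le>
      4 * real ?d ^ 3 / T * (\<eta> + (1 / 4) ^ ?d)"
  proof (rule cheb_interpolant_deriv[OF T])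
    fix i assume "i < Suc ?d"
    then show "\<bar>y i - poly q (node T g i)\<bar> \<le> \<eta> + (1 / 4) ^ ?d" using y[of i] tail[OF nr, of i] by linarith
  qed
  ultimately show ?thesis by (metis pderiv_diff poly_diff q1)
qed

text \<open>For designs without shots, where all overlap estimates are 0.\<close>

lemma robust_fit_zero_deriv:
  assumes "0 < T" "per_cell g = 1" "cells g = Suc (degr g)" "\<And>i. y i = 0"
  shows "poly (pderiv (robust_fit T g y)) 0 = 0"
  using cheb_interpolant_deriv[OF assms(1), of "degr g" y 0] assms(4) unfolding robust_fit_eq[OF assms(1-3)] by simp

section \<open>Accuracy of the postprocessing\<close>

lemma entrywise_accurate_mono: "entrywise_accurate n k chi G h est a \<Longrightarrow> a \<le> b \<Longrightarrow> entrywise_accurate n k chi G h est b"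
proof -
  assume *: "entrywise_accurate n k chi G h est a" and "a \<le> b"
  obtain X Gh hh where e: "est = (X, Gh, hh)" by (metis surj_pair)
  show ?thesis
    using * unfolding entrywise_accurate_def e prod.case by (meson order_trans[OF _ \<open>a \<le> b\<close>])
qed

lemma index_pairs0_usupp:
  assumes "u \<in> index_pairs0 n k"
  shows "usupp u \<subseteq> {..<n}" "finite (usupp u)" "card (usupp u) \<le> k"
proof -
  show s: "usupp u \<subseteq> {..<n}" using assms by (auto simp: index_pairs0_def index_pairs_def usupp_def pstrs_def)
  show "finite (usupp u)" using s finite_subset by blast
  show "card (usupp u) \<le> k" using assms by (auto simp: index_pairs0_def index_pairs_def)
qed

text \<open>On \<Omega> the recursion bound applies, and \<epsilon>chi absorbs its residual part.
  Elsewhere the estimate 0 errs by at most \<tau> for local pairs and not at all for the others,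
  whose coefficients vanish by locality; the latter matters because \<open>G\<close> and
  \<open>h\<close> are compared at all strings.\<close>

theorem postprocess_accurate:
  assumes kl: "k_local n k lb" and chi: "chi_expansion n (generator n k lb) chi"
    and gks: "gks_expansion n (generator n k lb) (hcoeff lb) G"
    and \<tau>: "0 < \<tau>" and \<Omega>: "\<Omega> \<subseteq> index_pairs0 n k" "\<forall>u\<in>index_pairs0 n k. cmod (chi u) > \<tau> \<longrightarrow> u \<in> \<Omega>"
      "\<tau> + ext_sum n k \<Omega> * ext_residual n chi \<Omega> \<le> \<epsilon>chi"
    and us: "distinct us" "set us = \<Omega>" and \<epsilon>: "0 \<le> \<epsilon>"
    and Lh: "\<forall>u\<in>\<Omega>. \<forall>A\<in>pstrs (usupp u). \<forall>B\<in>pstrs (usupp u). cmod (Lh A B - ptm n (generator n k lb) A B) \<le> \<epsilon>"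
  shows "entrywise_accurate n k chi G (hcoeff lb) (result (postprocess k us Lh)) (\<epsilon>chi + ext_sum n k \<Omega> * \<epsilon>)"
proof -
  let ?\<eta> = "\<epsilon>chi + ext_sum n k \<Omega> * \<epsilon>"
  have D: "0 \<le> ext_sum n k \<Omega>" using ext_sum_ge_1[of n k \<Omega>] by linarith
  have fin: "finite (usupp u)" and card: "card (usupp u) \<le> k" if "u \<in> set us" for u
    using index_pairs0_usupp[of u n k] \<Omega>(1) us(2) that by auto
  have I: "(Id_str, Id_str) \<notin> set us" using \<Omega>(1) us(2) by (auto simp: index_pairs0_def)
  obtain X Gh hh where res: "result (postprocess k us Lh) = (X, Gh, hh)" and X: "X = result (recursive_inversion k us Lh)"
    and Gh: "\<And>P Q. P \<noteq> Id_str \<Longrightarrow> Q \<noteq> Id_str \<Longrightarrow> Gh (P, Q) = X (P, Q)"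
    and hh: "\<And>P. hh P = \<i> / 2 * (X (P, Id_str) - X (Id_str, P))"
    using result_postprocess[OF us(1) fin card I, of Lh] by blast
  have X0: "X u = 0" if "u \<notin> \<Omega>" for u
    using result_recursive_inversion(1)[OF us(1) fin card X] that us(2) by blast
  have XR: "X u = local_value Lh u - (\<Sum>v\<in>{v\<in>\<Omega>. extends v u}. X v)" if "u \<in> \<Omega>" for u
    using result_recursive_inversion(2)[OF us(1) fin card X, of u] that unfolding us(2) by blast
  have \<tau>\<epsilon>: "\<tau> \<le> ?\<eta>"
    using \<Omega>(3) D \<epsilon> mult_nonneg_nonneg[OF D ext_residual_nonneg[of n chi \<Omega>]] mult_nonneg_nonneg[OF D \<epsilon>] by linarith
  have err0: "cmod (X u - chi u) \<le> ?\<eta>" if u: "u \<in> index_pairs0 n k" for u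
  proof (cases "u \<in> \<Omega>")
    case True
    have "cmod (X u - chi u) \<le> (\<epsilon> + ext_residual n chi \<Omega>) * ext_sum n k \<Omega>"
      by (rule recursion_error[OF chi \<Omega>(1) XR _ \<epsilon> True]) (use Lh in auto)
    also have "\<dots> \<le> ?\<eta>" using \<Omega>(3) \<tau> by (simp add: algebra_simps)
    finally show ?thesis .
  next
    case False
    then have "cmod (chi u) \<le> \<tau>" using \<Omega>(2) u by (meson not_less)
    then show ?thesis using X0[OF False] \<tau>\<epsilon> by simp
  qed
  have err: "cmod (X (P, Q) - chi (P, Q)) \<le> ?\<eta>"
    if "P \<in> pstrs {..<n}" "Q \<in> pstrs {..<n}" "(P, Q) \<noteq> (Id_str, Id_str)" for P Q
  proof (cases "(P, Q) \<in> index_pairs n k")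
    case True
    then show ?thesis using err0[of "(P, Q)"] that by (simp add: index_pairs0_def)
  next
    case False
    then have "(P, Q) \<notin> \<Omega>" using \<Omega>(1) by (auto simp: index_pairs0_def)
    moreover have "chi (P, Q) = 0" by (rule chi_generator_local[OF kl chi]) (use that False in auto)
    ultimately show ?thesis using X0[of "(P, Q)"] \<tau>\<epsilon> \<tau> by simp
  qed
  have eh: "cmod (hh P - hcoeff lb P) \<le> ?\<eta>" if P: "P \<in> pstrs {..<n}" for P
  proof (cases "P = Id_str")
    case True
    then show ?thesis using hh[of P] hcoeff_Id[OF kl] \<tau>\<epsilon> \<tau> by simp
  next
    case False
    have h: "hcoeff lb P = \<i> / 2 * (chi (P, Id_str) - chi (Id_str, P))"
      by (rule gks_coefficients(2)[OF chi gks]) (use P False in simp)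
    \<comment> \<open>The factor \<open>\<i> / 2\<close> halves the sum of two errors, so the bound
      for \<open>chi\<close> carries over to \<open>h\<close> unchanged.\<close>
    have "hh P - hcoeff lb P = \<i> / 2 * ((X (P, Id_str) - chi (P, Id_str)) - (X (Id_str, P) - chi (Id_str, P)))"
      unfolding hh h by (simp add: algebra_simps)
    then have "cmod (hh P - hcoeff lb P) = 1 / 2 * cmod ((X (P, Id_str) - chi (P, Id_str)) - (X (Id_str, P) - chi (Id_str, P)))"
      by (simp only: norm_mult) (simp add: norm_divide)
    also have "\<dots> \<le> 1 / 2 * (?\<eta> + ?\<eta>)"
      by (intro mult_left_mono order_trans[OF norm_triangle_ineq4] add_mono err) (use P False in auto)
    also have "\<dots> = ?\<eta>" by simp
    finally show ?thesis .
  qed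
  show ?thesis
    unfolding entrywise_accurate_def res prod.case
    using err0 eh Gh err gks_coefficients(1)[OF chi gks] by (intro conjI ballI) auto
qed

section \<open>Design of the experiment\<close>

text \<open>The generator preserves Hermiticity, so PTM entries are real. The fitted derivative is a
  real number and the moments are real parts; without this they would only approximate the real part
  of an entry.\<close>

lemma cnj_ptm_generator:
  assumes kl: "k_local n k lb" shows "cnj (ptm n (generator n k lb) A B) = ptm n (generator n k lb) A B"
proof -
  interpret lindblad_form "2 ^ n" "gen_index n k lb" "gen_drift n k lb" "gen_jump lb" by (rule gen_form[OF kl])
  let ?X = "generator n k lb (pmat n B)"
  have X: "?X = L (pmat n B)" by (rule generator_lindform[OF kl pmat_carrier])
  have herm: "mat_adjoint ?X = ?X"
  proof -
    let ?N = "2 ^ n" and ?B = "pmat n B" and ?K = "gen_drift n k lb" and ?J = "gen_jump lb"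
    have "mat_adjoint (L ?B) = mat_adjoint (?K * ?B) + mat_adjoint (?B * mat_adjoint ?K) +
        mat_adjoint (msum ?N (gen_index n k lb) (\<lambda>a. ?J a * ?B * mat_adjoint (?J a)))"
      unfolding lindform_def
      by (subst mat_adjoint_add[of _ ?N ?N], (intro sq_intros K)+)+ simp
    also have "mat_adjoint (?K * ?B) = ?B * mat_adjoint ?K"
      using mat_adjoint_mult[OF K pmat_carrier[of n B]] by simp
    also have "mat_adjoint (?B * mat_adjoint ?K) = ?K * ?B"
      using mat_adjoint_mult[OF pmat_carrier[of n B] mat_adjoint_carrier[OF K]] by simp
    also have "mat_adjoint (msum ?N (gen_index n k lb) (\<lambda>a. ?J a * ?B * mat_adjoint (?J a))) =
        msum ?N (gen_index n k lb) (\<lambda>a. mat_adjoint (?J a * ?B * mat_adjoint (?J a)))"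
      by (rule mat_adjoint_msum) (intro sq_intros J)
    also have "\<dots> = msum ?N (gen_index n k lb) (\<lambda>a. ?J a * ?B * mat_adjoint (?J a))"
    proof (rule msum_cong[OF refl])
      fix a assume "a \<in> gen_index n k lb"
      note Ja = J[OF this]
      have "mat_adjoint (?J a * ?B * mat_adjoint (?J a)) = ?J a * (?B * mat_adjoint (?J a))"
        using mat_adjoint_mult[OF sq_mult_carrier[OF Ja pmat_carrier[of n B]] mat_adjoint_carrier[OF Ja]]
          mat_adjoint_mult[OF Ja pmat_carrier[of n B]] by simp
      then show "mat_adjoint (?J a * ?B * mat_adjoint (?J a)) = ?J a * ?B * mat_adjoint (?J a)"
        using assoc_mult_mat[OF Ja pmat_carrier[of n B] mat_adjoint_carrier[OF Ja]] by simp
    qed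
    also have "?B * mat_adjoint ?K + ?K * ?B = ?K * ?B + ?B * mat_adjoint ?K"
      by (rule comm_add_mat[of _ ?N ?N]) (intro sq_intros K)+
    finally show ?thesis unfolding X lindform_def .
  qed
  have "cnj (tr (pmat n A * ?X)) = tr (mat_adjoint (pmat n A * ?X))"
    by (rule tr_adjoint[symmetric, of _ "2 ^ n"]) (intro sq_intros generator_carrier)
  also have "\<dots> = tr (?X * pmat n A)" using mat_adjoint_mult[OF pmat_carrier generator_carrier] by (simp add: herm)
  also have "\<dots> = tr (pmat n A * ?X)" by (rule tr_mult_commute[OF generator_carrier pmat_carrier])
  finally show ?thesis by (simp add: ptm_def)
qed

lemma ptm_eq_moment: "k_local n k lb \<Longrightarrow> ptm n (generator n k lb) A B = complex_of_real (moment n (generator n k lb) A B 1)"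
  using cnj_ptm_generator[of n k lb A B] by (auto simp: complex_eq_iff moment_def ptm_def)

text \<open>Differentiation at \<open>0\<close> amplifies errors by \<open>4 d\<^sup>3 / T = 16 \<kappa> d\<^sup>3\<close>. The degree \<open>d\<close> reduces the contribution
  of the truncation error \<open>4\<^sup>-\<^sup>d\<close> to \<open>\<epsilon> / 2\<close>, and the accuracy of the overlaps leaves the other half.\<close>

definition fit_degree :: "real \<Rightarrow> real \<Rightarrow> nat" where
  "fit_degree \<kappa> \<epsilon> = nat \<lceil>log 2 (128 * \<kappa> / \<epsilon>)\<rceil> + 1"

definition overlap_accuracy :: "real \<Rightarrow> real \<Rightarrow> real" where
  "overlap_accuracy \<kappa> \<epsilon> = \<epsilon> / (32 * \<kappa> * real (fit_degree \<kappa> \<epsilon>) ^ 3)"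

text \<open>The logarithm required by the union bound: 2 tails, \<open>d + 1\<close> nodes, and at
  most \<open>16 ^ k\<close> pairs of strings for each of the \<open>c\<close> given pairs.\<close>

definition log_failure :: "nat \<Rightarrow> real \<Rightarrow> real \<Rightarrow> nat \<Rightarrow> real \<Rightarrow> real" where
  "log_failure k \<kappa> \<epsilon> c \<delta> = ln (2 * real (fit_degree \<kappa> \<epsilon> + 1) * (real c * 16 ^ k) / \<delta>)"

text \<open>PTM entries are bounded by \<open>\<kappa>\<close>, so for \<open>\<kappa> \<le> \<epsilon>\<close> no shots are taken; the estimate is then \<open>0\<close>
  because \<open>0 / 0 = 0\<close>.\<close>

definition shadow_design :: "nat \<Rightarrow> real \<Rightarrow> real \<Rightarrow> nat \<Rightarrow> real \<Rightarrow> design" where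
  "shadow_design k \<kappa> \<epsilon> c \<delta> = \<lparr>degr = fit_degree \<kappa> \<epsilon>, cells = Suc (fit_degree \<kappa> \<epsilon>), per_cell = 1, batches = 1,
     batch_size = (if c = 0 \<or> \<kappa> \<le> \<epsilon> then 0
       else nat \<lceil>2 * 81 ^ k / (overlap_accuracy \<kappa> \<epsilon>)\<^sup>2 * log_failure k \<kappa> \<epsilon> c \<delta>\<rceil>)\<rparr>"

section \<open>Bounds on degree, accuracy and sample size\<close>

lemma logp_ge_1: "1 \<le> logp x" by (simp add: logp_def)

text \<open>\<open>logp\<close> is at least 1, so additive constants and the logarithm of \<kappa>
  can be turned into factors of it; \<open>ln 2 \<ge> 1 / 2\<close> removes the base of the
  logarithm.\<close>

lemma fit_degree_le:
  assumes "0 < \<kappa>" "0 < \<epsilon>"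
  shows "real (fit_degree \<kappa> \<epsilon>) \<le> (2 * \<bar>ln (128 * \<kappa>)\<bar> + 4) * logp (1 / \<epsilon>)"
proof -
  let ?x = "log 2 (128 * \<kappa> / \<epsilon>)" and ?l = "logp (1 / \<epsilon>)" and ?a = "\<bar>ln (128 * \<kappa>)\<bar>"
  have l: "1 \<le> ?l" "ln (1 / \<epsilon>) \<le> ?l" by (auto simp: logp_def)
  have ln2: "1 / 2 \<le> ln (2::real)" using ln2_ge_two_thirds by linarith
  have "ln (128 * \<kappa> / \<epsilon>) = ln (128 * \<kappa>) + ln (1 / \<epsilon>)" using assms by (simp add: ln_div)
  also have "\<dots> \<le> ?a + ?l" using l by linarith
  finally have "?x \<le> (?a + ?l) / ln 2" unfolding log_def by (rule divide_right_mono) simp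
  also have "\<dots> \<le> (?a + ?l) / (1 / 2)" using ln2 l by (intro divide_left_mono) auto
  finally have x: "?x \<le> 2 * ?a + 2 * ?l" by simp
  have "real (nat \<lceil>?x\<rceil>) \<le> 2 * ?a + 2 * ?l + 1"
    using x l by (cases "0 \<le> \<lceil>?x\<rceil>") (auto simp: of_nat_nat, linarith)
  then have "real (fit_degree \<kappa> \<epsilon>) \<le> 2 * ?a + 2 * ?l + 2" by (simp add: fit_degree_def)
  also have "\<dots> \<le> 2 * (?a * ?l) + 2 * ?l + 2 * ?l" using l mult_left_mono[OF l(1), of ?a] by simp
  finally show ?thesis by (simp add: algebra_simps)
qed

text \<open>Lets the cubic amplification of the derivative be paid for by a factor
  \<open>2 ^ d\<close> of the truncation error \<open>(1 / 4) ^ d\<close>. From 4 on,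
  \<open>3 d^2 + 3 d + 1 \<le> d^3\<close>, so the cube at most doubles from one \<open>d\<close> to
  the next.\<close>

lemma cube_le: "real d ^ 3 \<le> 4 * 2 ^ d"
proof -
  have big: "d ^ 3 \<le> 4 * 2 ^ d" if "4 \<le> d" for d :: nat using that
  proof (induction d rule: nat_induct_at_least)
    case (Suc d)
    have "Suc d ^ 3 = d ^ 3 + (3 * d\<^sup>2 + 3 * d + 1)" by (simp add: power2_eq_square power3_eq_cube algebra_simps)
    also have "3 * d\<^sup>2 + 3 * d + 1 \<le> d ^ 3"
    proof -
      have "4 * d\<^sup>2 \<le> d * d\<^sup>2" using Suc(1) by (rule mult_right_mono) simp
      moreover have "3 * d + 1 \<le> d * d" using mult_right_mono[OF Suc(1), of d] Suc(1) by linarith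
      ultimately show ?thesis unfolding power2_eq_square power3_eq_cube mult.assoc by linarith
    qed
    finally show ?case using Suc(2) by simp
  qed simp
  have "d ^ 3 \<le> 4 * 2 ^ d"
  proof (cases "4 \<le> d")
    case False
    then have "d = 0 \<or> d = 1 \<or> d = 2 \<or> d = 3" by auto
    then show ?thesis by auto
  qed (rule big)
  then have "real (d ^ 3) \<le> real (4 * 2 ^ d)" by (rule of_nat_mono)
  then show ?thesis by simp
qed

text \<open>The amplification \<open>4 d^3 / T\<close> is \<open>16 \<kappa> d^3\<close>. With
  \<open>d^3 \<le> 4 * 2 ^ d\<close> the truncation part is at most
  \<open>64 \<kappa> / 2 ^ d\<close>, which \<open>2 ^ d \<ge> 128 \<kappa> / \<epsilon>\<close>
  makes at most \<open>\<epsilon> / 2\<close>; this is the origin of 128. The accuracy of the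
  overlaps makes the other part exactly \<open>\<epsilon> / 2\<close>.\<close>

lemma fit_degree_error:
  assumes \<kappa>: "0 < \<kappa>" and \<epsilon>: "0 < \<epsilon>" and T: "T = 1 / (4 * \<kappa>)"
  shows "4 * real (fit_degree \<kappa> \<epsilon>) ^ 3 / T * (overlap_accuracy \<kappa> \<epsilon> + (1 / 4) ^ fit_degree \<kappa> \<epsilon>) \<le> \<epsilon>"
proof -
  let ?d = "fit_degree \<kappa> \<epsilon>"
  have d: "0 < real ?d" by (simp add: fit_degree_def)
  have "log 2 (128 * \<kappa> / \<epsilon>) \<le> real ?d" unfolding fit_degree_def by linarith
  then have "128 * \<kappa> / \<epsilon> \<le> 2 powr real ?d" using \<kappa> \<epsilon> by (simp add: log_le_iff)
  then have p: "128 * \<kappa> \<le> \<epsilon> * 2 ^ ?d" using \<epsilon> by (simp add: powr_realpow field_simps)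
  have "16 * \<kappa> * real ?d ^ 3 * (1 / 4) ^ ?d \<le> 16 * \<kappa> * (4 * 2 ^ ?d) * (1 / 4) ^ ?d"
    using \<kappa> by (intro mult_right_mono mult_left_mono cube_le) auto
  also have "\<dots> = 64 * \<kappa> * (2 ^ ?d * (1 / 4) ^ ?d)" by simp
  also have "(2::real) ^ ?d * (1 / 4) ^ ?d = 1 / 2 ^ ?d"
    unfolding power_mult_distrib[symmetric] power_one_over[symmetric] by simp
  also have "64 * \<kappa> * (1 / 2 ^ ?d) \<le> \<epsilon> / 2" using p by (simp add: field_simps)
  finally have 1: "16 * \<kappa> * real ?d ^ 3 * (1 / 4) ^ ?d \<le> \<epsilon> / 2" .
  have 2: "16 * \<kappa> * real ?d ^ 3 * overlap_accuracy \<kappa> \<epsilon> = \<epsilon> / 2"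
    using \<kappa> d by (simp add: overlap_accuracy_def field_simps)
  have "4 * real ?d ^ 3 / T = 16 * \<kappa> * real ?d ^ 3" using \<kappa> by (simp add: T)
  then show ?thesis using 1 2 by (simp add: distrib_left)
qed

text \<open>\<open>ln (c / \<delta>)\<close> is nonnegative, so \<open>2 (d + 1) \<ge> 4\<close>
  alone pushes the logarithm above 1; this lower bound later controls the rounding of the batch
  size.\<close>

lemma log_failure_bounds:
  assumes "1 \<le> c" "0 < \<delta>" "\<delta> < 1"
  shows "1 \<le> log_failure k \<kappa> \<epsilon> c \<delta>"
    and "log_failure k \<kappa> \<epsilon> c \<delta> \<le> 4 * real k + 1 + real (fit_degree \<kappa> \<epsilon>) + logp (real c / \<delta>)"
proof -
  let ?d = "fit_degree \<kappa> \<epsilon>"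
  have eq: "log_failure k \<kappa> \<epsilon> c \<delta> = ln 2 + ln (real (?d + 1)) + real k * ln 16 + ln (real c / \<delta>)"
  proof -
    have "ln (2 * D * (C * 16 ^ k) / \<delta>) = ln 2 + ln D + real k * ln 16 + ln (C / \<delta>)" if "0 < D" "0 < C" for D C
      using that assms(2) by (simp add: ln_mult ln_div ln_realpow)
    then show ?thesis unfolding log_failure_def by this (use assms(1) in auto)
  qed
  have cd: "0 \<le> ln (real c / \<delta>)" using assms by (intro ln_ge_zero) (simp add: le_divide_eq)
  have l2: "1 / 2 \<le> ln (2::real)" "ln (2::real) \<le> 1" using ln2_ge_two_thirds ln_2_less_1 by linarith+
  have "ln 2 \<le> ln (real (?d + 1))" by (simp add: fit_degree_def)
  moreover have "0 \<le> real k * ln (16::real)" by simp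
  ultimately show "1 \<le> log_failure k \<kappa> \<epsilon> c \<delta>" unfolding eq using l2 cd by linarith
  have "ln (16::real) = 4 * ln 2" using ln_realpow[of 2 4] by simp
  then have "real k * ln 16 \<le> real k * 4" using l2 by (intro mult_left_mono) auto
  moreover have "ln (real (?d + 1)) \<le> real ?d" using ln_add_one_self_le_self[of "real ?d"] by (simp add: add.commute)
  moreover have "ln (real c / \<delta>) \<le> logp (real c / \<delta>)" by (simp add: logp_def)
  ultimately show "log_failure k \<kappa> \<epsilon> c \<delta> \<le> 4 * real k + 1 + real ?d + logp (real c / \<delta>)"
    unfolding eq using l2 by linarith
qed

text \<open>The batch size grows like \<open>\<kappa>^2 d^6 / \<epsilon>^2\<close> times the failure
  logarithm, and the \<open>d + 1 \<le> 2 d\<close> nodes bring the power to \<open>d^7\<close>. As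
  \<open>d\<close> is at most \<open>C1 * logp (1 / \<epsilon>)\<close> and also occurs in the
  failure logarithm, the exponent is 8. The number 8192 is made of 2 for the nodes, 2 for rounding,
  2 from Hoeffding's exponent and \<open>32^2\<close> from the accuracy.\<close>

lemma num_samples_le:
  assumes \<kappa>: "0 < \<kappa>" and \<epsilon>: "0 < \<epsilon>" and \<delta>: "0 < \<delta>" "\<delta> < 1"
    and C1: "C1 = 2 * \<bar>ln (128 * \<kappa>)\<bar> + 4"
  shows "real (num_samples (shadow_design k \<kappa> \<epsilon> c \<delta>)) \<le>
    (8192 * 81 ^ k * \<kappa>\<^sup>2 * (4 * real k + 2 + C1) * C1 ^ 7) * (1 / \<epsilon>\<^sup>2 * logp (real c / \<delta>)) * logp (1 / \<epsilon>) ^ 8"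
proof -
  let ?g = "shadow_design k \<kappa> \<epsilon> c \<delta>" and ?d = "fit_degree \<kappa> \<epsilon>" and ?\<eta> = "overlap_accuracy \<kappa> \<epsilon>"
    and ?F = "log_failure k \<kappa> \<epsilon> c \<delta>" and ?l = "logp (1 / \<epsilon>)" and ?lc = "logp (real c / \<delta>)"
  have C1p: "0 \<le> C1" by (simp add: C1)
  have l: "1 \<le> ?l" "1 \<le> ?lc" by (rule logp_ge_1)+
  have d: "1 \<le> real ?d" by (simp add: fit_degree_def)
  have dl: "real ?d \<le> C1 * ?l" unfolding C1 by (rule fit_degree_le[OF \<kappa> \<epsilon>])
  have ns: "num_samples ?g = Suc ?d * batch_size ?g" by (simp add: num_samples_def num_times_def shadow_design_def)
  show ?thesis
  proof (cases "c = 0 \<or> \<kappa> \<le> \<epsilon>")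
    case True
    then have "num_samples ?g = 0" unfolding ns by (simp add: shadow_design_def)
    then show ?thesis using l C1p by simp
  next
    case False
    have F: "1 \<le> ?F" "?F \<le> 4 * real k + 1 + real ?d + ?lc"
      using log_failure_bounds[of c \<delta>] False \<delta> by auto
    have \<eta>: "0 < ?\<eta>" using \<kappa> \<epsilon> d by (simp add: overlap_accuracy_def)
    \<comment> \<open>Uses that shots are taken only for \<open>\<epsilon> < \<kappa>\<close>. It
      keeps the batch size at least 1 before rounding, so that rounding up at most doubles
      it.\<close>
    have "?\<eta> \<le> 1"
    proof -
      have "\<epsilon> * 1 \<le> 32 * \<kappa> * real ?d ^ 3" using False \<kappa> d \<epsilon> by (intro mult_mono one_le_power) auto
      then show ?thesis using \<kappa> d by (simp add: overlap_accuracy_def)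
    qed
    then have "?\<eta>\<^sup>2 \<le> 1" using \<eta> by (simp add: power_le_one)
    then have "1 \<le> 1 / ?\<eta>\<^sup>2" using \<eta> by simp
    then have "1 * 1 * 1 \<le> 2 * 81 ^ k * (1 / ?\<eta>\<^sup>2) * ?F"
      using F by (intro mult_mono) (auto intro: order_trans[OF one_le_power[of 81 k]])
    then have A: "1 \<le> 2 * 81 ^ k / ?\<eta>\<^sup>2 * ?F" by simp
    have "real (batch_size ?g) \<le> 2 * 81 ^ k / ?\<eta>\<^sup>2 * ?F + 1"
      using False A by (simp add: shadow_design_def)
    also have "\<dots> \<le> 2 * (2 * 81 ^ k / ?\<eta>\<^sup>2 * ?F)" using A by simp
    also have "\<dots> = 4 * 81 ^ k * (32 * \<kappa> * real ?d ^ 3)\<^sup>2 / \<epsilon>\<^sup>2 * ?F"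
      by (simp add: overlap_accuracy_def power_divide)
    finally have bs: "real (batch_size ?g) \<le> 4096 * 81 ^ k * \<kappa>\<^sup>2 / \<epsilon>\<^sup>2 * real ?d ^ 6 * ?F"
      by (simp add: power_mult_distrib flip: power_mult)
    have Fl: "?F \<le> (4 * real k + 2 + C1) * (?l * ?lc)"
    proof -
      have ll: "1 \<le> ?l * ?lc" using mult_mono[OF l(1) l(2)] l by simp
      have "real ?d \<le> C1 * (?l * ?lc)"
        using dl mult_left_mono[OF l(2), of "C1 * ?l"] C1p l by (simp add: mult.assoc)
      moreover have "?lc \<le> ?l * ?lc" using mult_right_mono[OF l(1), of ?lc] l by simp
      moreover have "4 * real k + 1 \<le> (4 * real k + 1) * (?l * ?lc)" using mult_left_mono[OF ll, of "4 * real k + 1"] by simp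
      ultimately show ?thesis using F(2) by (simp add: algebra_simps)
    qed
    have "real (num_samples ?g) = real (Suc ?d) * real (batch_size ?g)" unfolding ns by (rule of_nat_mult)
    also have "\<dots> \<le> (2 * real ?d) * (4096 * 81 ^ k * \<kappa>\<^sup>2 / \<epsilon>\<^sup>2 * real ?d ^ 6 * ?F)"
      using d bs by (intro mult_mono) auto
    also have "\<dots> = 8192 * 81 ^ k * \<kappa>\<^sup>2 / \<epsilon>\<^sup>2 * real ?d ^ 7 * ?F" by (simp add: power_Suc[symmetric] eval_nat_numeral)
    also have "\<dots> \<le> 8192 * 81 ^ k * \<kappa>\<^sup>2 / \<epsilon>\<^sup>2 * (C1 * ?l) ^ 7 * ((4 * real k + 2 + C1) * (?l * ?lc))"
      using dl d F(1) Fl by (intro mult_mono power_mono mult_left_mono) auto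
    also have "\<dots> = (8192 * 81 ^ k * \<kappa>\<^sup>2 * (4 * real k + 2 + C1) * C1 ^ 7) * (1 / \<epsilon>\<^sup>2 * ?lc) * ?l ^ 8"
      by (simp add: power_mult_distrib eval_nat_numeral)
    finally show ?thesis .
  qed
qed

text \<open>A union bound over nodes and pairs of strings: outside the bad events every overlap is
  accurate at every node, and the regression bound turns this into accurate derivatives.\<close>

theorem shadow_design_success:
  assumes kl: "k_local n k lb" and n: "1 \<le> n" and k: "1 \<le> k" and \<alpha>: "0 < \<alpha>" "interaction_strength n k lb \<le> \<alpha>"
    and \<kappa>: "\<kappa> = real k * \<alpha>" and T: "T = 1 / (4 * \<kappa>)" and \<Omega>: "\<Omega> \<subseteq> index_pairs0 n k"
    and \<epsilon>: "0 < \<epsilon>" and \<delta>: "0 < \<delta>" "\<delta> < 1" and g: "g = shadow_design k \<kappa> \<epsilon> (card \<Omega>) \<delta>"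
  shows "measure_pmf.prob (shadow_data n (generator n k lb) T g)
    {d. \<forall>u\<in>\<Omega>. \<forall>A\<in>pstrs (usupp u). \<forall>B\<in>pstrs (usupp u).
      cmod (ptm_estimate T g d A B - ptm n (generator n k lb) A B) \<le> \<epsilon>} \<ge> 1 - \<delta>"
    (is "measure_pmf.prob ?M ?good \<ge> _")
proof -
  let ?F = "generator n k lb" and ?d = "fit_degree \<kappa> \<epsilon>" and ?\<eta> = "overlap_accuracy \<kappa> \<epsilon>"
  have \<kappa>p: "0 < \<kappa>" using k \<alpha> by (simp add: \<kappa>)
  then have Tp: "0 < T" by (simp add: T)
  have gs: "per_cell g = 1" "cells g = Suc (degr g)" "degr g = ?d" "batches g = 1" "1 \<le> degr g" "num_times g = Suc ?d"
    by (simp_all add: g shadow_design_def fit_degree_def num_times_def)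
  have AB: "A \<in> pstrs {..<n}" "card (supp A) \<le> k" if "u \<in> \<Omega>" "A \<in> pstrs (usupp u)" for u A
  proof -
    note us = index_pairs0_usupp[OF subsetD[OF \<Omega> that(1)]]
    show "A \<in> pstrs {..<n}" using pstrs_mono[OF us(1)] that(2) by blast
    show "card (supp A) \<le> k" using card_mono[OF us(2), of "supp A"] us(3) that(2) by (simp add: pstrs_mem)
  qed
  have mom: "\<bar>moment n ?F A B m\<bar> \<le> fact m * \<kappa> ^ m" if "A \<in> pstrs {..<n}" "card (supp A) \<le> k" "B \<in> pstrs {..<n}" for A B m
    unfolding moment_def \<kappa> by (rule order_trans[OF abs_Re_le_cmod ptm_moment_bound[OF kl n \<alpha>(2) that]])
  have fin\<Omega>: "finite \<Omega>" using \<Omega> finite_index_pairs finite_subset by blast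
  consider "card \<Omega> = 0" | "card \<Omega> \<noteq> 0" "\<kappa> \<le> \<epsilon>" | "card \<Omega> \<noteq> 0" "\<epsilon> < \<kappa>" by linarith
  then show ?thesis
  proof cases
    case 1
    then show ?thesis using fin\<Omega> \<delta> by simp
  next
    case 2
    have "?good = UNIV"
    proof (intro equalityI subset_UNIV subsetI CollectI ballI)
      fix d u A B assume uAB: "u \<in> \<Omega>" "A \<in> pstrs (usupp u)" "B \<in> pstrs (usupp u)"
      have "overlap_estimate g d A B i = 0" for i
        using 2 by (simp add: overlap_estimate_def gs(4) median_def) (simp add: g shadow_design_def)
      then have "ptm_estimate T g d A B = 0"
        unfolding ptm_estimate_def using robust_fit_zero_deriv[OF Tp gs(1,2)] by simp
      then have "cmod (ptm_estimate T g d A B - ptm n ?F A B) = \<bar>moment n ?F A B 1\<bar>"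
        by (simp add: ptm_eq_moment[OF kl])
      also have "\<dots> \<le> \<epsilon>" using mom[of A B 1] AB[OF uAB(1)] uAB 2 by simp
      finally show "cmod (ptm_estimate T g d A B - ptm n ?F A B) \<le> \<epsilon>" .
    qed
    then show ?thesis using \<delta> by simp
  next
    case 3
    \<comment> \<open>The pairs of strings whose PTM entries the inversion reads, collected once for
      all of \<Omega>; all are estimated from the same data.\<close>
    define W where "W = (\<Union>u\<in>\<Omega>. pstrs (usupp u) \<times> pstrs (usupp u))"
    define bad where "bad p = {d. \<bar>overlap_estimate g d (fst (snd p)) (snd (snd p)) (fst p) -
      overlap n ?F (fst (snd p)) (snd (snd p)) (node T g (fst p))\<bar> \<ge> ?\<eta>}" for p
    define q where "q = 2 * exp (- real (batch_size g) * ?\<eta>\<^sup>2 / (2 * 81 ^ k))"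
    have us: "finite (usupp u)" "card (usupp u) \<le> k" if "u \<in> \<Omega>" for u
      using index_pairs0_usupp[OF subsetD[OF \<Omega> that]] by auto
    have finW: "finite W" unfolding W_def using fin\<Omega> us(1) by (auto intro: finite_pstrs)
    have "card W \<le> (\<Sum>u\<in>\<Omega>. card (pstrs (usupp u) \<times> pstrs (usupp u)))"
      unfolding W_def by (rule card_UN_le[OF fin\<Omega>])
    also have "\<dots> \<le> (\<Sum>u\<in>\<Omega>. 16 ^ k)"
    proof (rule sum_mono)
      fix u assume u: "u \<in> \<Omega>"
      have "card (pstrs (usupp u) \<times> pstrs (usupp u)) = 16 ^ card (usupp u)"
        by (simp add: card_cartesian_product card_pstrs[OF us(1)[OF u]] flip: power_mult_distrib)
      then show "card (pstrs (usupp u) \<times> pstrs (usupp u)) \<le> 16 ^ k" using us(2)[OF u] by (simp add: power_increasing)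
    qed
    finally have "card W \<le> card \<Omega> * 16 ^ k" by simp
    then have cW: "real (card W) \<le> real (card \<Omega>) * 16 ^ k" by (metis of_nat_mono of_nat_mult of_nat_numeral of_nat_power)
    have d0: "0 < real ?d" by (simp add: fit_degree_def)
    have \<eta>0: "0 < ?\<eta>" using \<epsilon> \<kappa>p d0 by (simp add: overlap_accuracy_def)
    let ?\<Lambda> = "log_failure k \<kappa> \<epsilon> (card \<Omega>) \<delta>"
    have \<Lambda>: "1 \<le> ?\<Lambda>" using log_failure_bounds(1)[of "card \<Omega>" \<delta>] 3 \<delta> by simp
    have bs: "batch_size g = nat \<lceil>2 * 81 ^ k / ?\<eta>\<^sup>2 * ?\<Lambda>\<rceil>" using 3 by (simp add: g shadow_design_def)
    have pos: "0 < 2 * 81 ^ k / ?\<eta>\<^sup>2 * ?\<Lambda>" using \<eta>0 \<Lambda> by simp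
    then have bs0: "0 < batch_size g" unfolding bs by simp
    have "2 * 81 ^ k / ?\<eta>\<^sup>2 * ?\<Lambda> \<le> real (batch_size g)" unfolding bs by linarith
    then have "?\<Lambda> \<le> real (batch_size g) * ?\<eta>\<^sup>2 / (2 * 81 ^ k)" using \<eta>0 by (simp add: field_simps)
    then have "q \<le> 2 * exp (- ?\<Lambda>)" unfolding q_def by simp
    also have "\<dots> = \<delta> / (real (Suc ?d) * (real (card \<Omega>) * 16 ^ k))"
    proof -
      have "2 * exp (- ln (2 * D * E / \<delta>)) = \<delta> / (D * E)" if "0 < D" "0 < E" for D E
        using that \<delta> by (simp add: exp_minus field_simps)
      then show ?thesis unfolding log_failure_def Suc_eq_plus1 by this (use 3 in auto)
    qed
    finally have "q \<le> \<delta> / (real (Suc ?d) * (real (card \<Omega>) * 16 ^ k))" .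
    moreover have X0: "0 < real (Suc ?d) * (real (card \<Omega>) * 16 ^ k)" using 3 by simp
    ultimately have q: "real (Suc ?d) * (real (card \<Omega>) * 16 ^ k) * q \<le> \<delta>"
      by (simp only: pos_le_divide_eq[OF X0] mult.commute)
    have q0: "0 \<le> q" by (simp add: q_def)
    have "measure_pmf.prob ?M (\<Union>p\<in>{..<Suc ?d} \<times> W. bad p) \<le> (\<Sum>p\<in>{..<Suc ?d} \<times> W. measure_pmf.prob ?M (bad p))"
      by (rule measure_pmf.finite_measure_subadditive_finite) (use finW in auto)
    also have "\<dots> \<le> (\<Sum>p\<in>{..<Suc ?d} \<times> W. q)"
    proof (rule sum_mono)
      fix p assume "p \<in> {..<Suc ?d} \<times> W"
      then obtain i A B u where p: "p = (i, A, B)" "i < Suc ?d" "u \<in> \<Omega>" "A \<in> pstrs (usupp u)" "B \<in> pstrs (usupp u)"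
        by (auto simp: W_def)
      show "measure_pmf.prob ?M (bad p) \<le> q"
        unfolding bad_def q_def p(1) fst_conv snd_conv
        by (rule overlap_estimate_deviation[OF kl AB[OF p(3,4)] AB[OF p(3,5)] _ gs(4) bs0])
           (use p(2) gs(6) \<eta>0 node_bounds(1) Tp in auto)
    qed
    also have "\<dots> = real (Suc ?d) * real (card W) * q" by (simp add: card_cartesian_product algebra_simps)
    also have "\<dots> \<le> real (Suc ?d) * (real (card \<Omega>) * 16 ^ k) * q"
      by (intro mult_right_mono mult_left_mono cW q0) simp
    finally have pb: "measure_pmf.prob ?M (\<Union>p\<in>{..<Suc ?d} \<times> W. bad p) \<le> \<delta>" using q by linarith
    have "- (\<Union>p\<in>{..<Suc ?d} \<times> W. bad p) \<subseteq> ?good"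
    proof (intro subsetI CollectI ballI)
      fix d u A B assume d: "d \<in> - (\<Union>p\<in>{..<Suc ?d} \<times> W. bad p)"
        and uAB: "u \<in> \<Omega>" "A \<in> pstrs (usupp u)" "B \<in> pstrs (usupp u)"
      have good: "\<bar>overlap_estimate g d A B i - overlap n ?F A B (node T g i)\<bar> \<le> ?\<eta>" if "i < Suc (degr g)" for i
      proof -
        have "(i, A, B) \<in> {..<Suc ?d} \<times> W" using that uAB by (auto simp: W_def gs)
        then have "d \<notin> bad (i, A, B)" using d by blast
        then show ?thesis by (simp add: bad_def)
      qed
      have "\<bar>poly (pderiv (robust_fit T g (overlap_estimate g d A B))) 0 - moment n ?F A B 1\<bar> \<le>
          4 * real (degr g) ^ 3 / T * (?\<eta> + (1 / 4) ^ degr g)"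
        by (rule robust_fit_deriv_error[OF Tp gs(1,2,5) mom[OF AB[OF uAB(1,2)] AB(1)[OF uAB(1,3)]] _ _ overlap_sums[OF kl] good])
           (use \<kappa>p in \<open>auto simp: T\<close>)
      also have "\<dots> \<le> \<epsilon>" unfolding gs(3) by (rule fit_degree_error[OF \<kappa>p \<epsilon> T])
      finally show "cmod (ptm_estimate T g d A B - ptm n ?F A B) \<le> \<epsilon>"
        unfolding ptm_estimate_def ptm_eq_moment[OF kl] by (simp flip: of_real_diff)
    qed
    then have "measure_pmf.prob ?M (- (\<Union>p\<in>{..<Suc ?d} \<times> W. bad p)) \<le> measure_pmf.prob ?M ?good"
      by (rule measure_pmf.finite_measure_mono) simp
    moreover have "measure_pmf.prob ?M (- (\<Union>p\<in>{..<Suc ?d} \<times> W. bad p)) = 1 - measure_pmf.prob ?M (\<Union>p\<in>{..<Suc ?d} \<times> W. bad p)"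
      using measure_pmf.prob_compl[of "\<Union>p\<in>{..<Suc ?d} \<times> W. bad p" ?M] by (simp add: Compl_eq_Diff_UNIV)
    ultimately show ?thesis using pb by linarith
  qed
qed

text \<open>The order of quantifiers carries the uniformity: the accuracy constant and the exponent
  are absolute, the cost constant depends on \<open>k\<close> only, and the design is a function of
  accuracy, size of \<Omega> and failure probability that is fixed before the system and its
  generator.\<close>

theorem corollary3p8:
  "\<exists>C0>0. \<exists>c::nat. \<forall>k\<ge>1. \<exists>Ck>0. \<forall>\<alpha>>0. \<exists>C>0. \<exists>dg :: real \<Rightarrow> nat \<Rightarrow> real \<Rightarrow> design.
   \<forall>n lb chi G \<Omega> us \<tau> \<epsilon>chi.
     1 \<le> n \<and> k_local n k lb \<and> interaction_strength n k lb \<le> \<alpha> \<and>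
     chi_expansion n (generator n k lb) chi \<and>
     gks_expansion n (generator n k lb) (hcoeff lb) G \<and>
     0 < \<tau> \<and> 0 < \<epsilon>chi \<and>
     \<Omega> \<subseteq> index_pairs0 n k \<and>
     (\<forall>u\<in>index_pairs0 n k. cmod (chi u) > \<tau> \<longrightarrow> u \<in> \<Omega>) \<and>
     \<tau> + ext_sum n k \<Omega> * ext_residual n chi \<Omega> \<le> \<epsilon>chi \<and>
     distinct us \<and> set us = \<Omega>
     \<longrightarrow>
     (\<forall>Lh. (case result (postprocess k us Lh) of (X, Gh, hh) \<Rightarrow>
              (\<forall>u. u \<notin> \<Omega> \<longrightarrow> X u = 0) \<and>
              (\<forall>P\<in>pstrs {..<n} - {Id_str}. \<forall>Q\<in>pstrs {..<n} - {Id_str}. Gh (P, Q) = X (P, Q)) \<and>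
              (\<forall>P\<in>pstrs {..<n}. hh P = \<i> / 2 * (X (P, Id_str) - X (Id_str, P)))) \<and>
           real (cost (postprocess k us Lh)) \<le> Ck * max 1 (real (card \<Omega>))) \<and>
     (\<forall>\<epsilon>L\<ge>0. \<forall>Lh.
        (\<forall>u\<in>\<Omega>. \<forall>A\<in>pstrs (usupp u). \<forall>B\<in>pstrs (usupp u).
            cmod (Lh A B - ptm n (generator n k lb) A B) \<le> \<epsilon>L)
        \<longrightarrow> entrywise_accurate n k chi G (hcoeff lb) (result (postprocess k us Lh))
              (C0 * (\<epsilon>chi + ext_sum n k \<Omega> * \<epsilon>L))) \<and>
     (\<forall>\<epsilon>L \<delta>. 0 < \<epsilon>L \<and> \<epsilon>L \<le> \<epsilon>chi / ext_sum n k \<Omega> \<and> 0 < \<delta> \<and> \<delta> < 1 \<longrightarrow>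
        (let g = dg \<epsilon>L (card \<Omega>) \<delta>; T = 1 / (4 * \<alpha> * real k) in
           1 \<le> degr g \<and> degr g < cells g \<and> 1 \<le> per_cell g \<and> 1 \<le> batches g \<and>
           real (degr g) \<le> C * logp (1 / \<epsilon>L) \<and>
           real (num_times g) \<le> C * real (degr g) * logp (real (degr g)) \<and>
           measure_pmf.prob (shadow_data n (generator n k lb) T g)
             {d. entrywise_accurate n k chi G (hcoeff lb)
                   (result (postprocess k us (ptm_estimate T g d))) (C0 * \<epsilon>chi)} \<ge> 1 - \<delta> \<and>
           (\<epsilon>L = \<epsilon>chi / ext_sum n k \<Omega> \<longrightarrow>
              real (num_samples g) \<le>
                C * ((ext_sum n k \<Omega>)\<^sup>2 / \<epsilon>chi\<^sup>2 * logp (real (card \<Omega>) / \<delta>)) *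
                (logp (ext_sum n k \<Omega> / \<epsilon>chi) * logp (real (card \<Omega>))) ^ c)))"
\<comment> \<open>The witness 2 comes from
  \<open>\<epsilon>chi + D \<epsilon>L \<le> 2 \<epsilon>chi\<close> for
  \<open>\<epsilon>L \<le> \<epsilon>chi / D\<close>, and 8 is the exponent in
  \<open>num_samples_le\<close>.\<close>
proof (rule exI[of _ 2], rule conjI, simp, rule exI[of _ 8], intro allI impI, goal_cases)
  case (1 k)
  then have k: "1 \<le> k" .
  obtain Ck where Ck: "0 < Ck" "\<And>us Lh. distinct us \<Longrightarrow> \<forall>u\<in>set us. finite (usupp u) \<and> card (usupp u) \<le> k \<Longrightarrow>
      real (cost (postprocess k us Lh)) \<le> Ck * max 1 (real (card (set us)))"
    using cost_postprocess[of k] by blast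
  show ?case
  proof (rule exI[of _ Ck], rule conjI, rule Ck(1), intro allI impI, goal_cases)
    case (1 \<alpha>)
    then have \<alpha>: "0 < \<alpha>" .
    define \<kappa> where "\<kappa> = real k * \<alpha>"
    define C1 where "C1 = 2 * \<bar>ln (128 * \<kappa>)\<bar> + 4"
    define C3 where "C3 = 8192 * 81 ^ k * \<kappa>\<^sup>2 * (4 * real k + 2 + C1) * C1 ^ 7"
    \<comment> \<open>\<open>C1\<close> serves the degree and, being at least 4, the number of times
      \<open>d + 1 \<le> 2 d\<close>; \<open>C3\<close> serves the sample count.\<close>
    define C where "C = C1 + C3"
    have \<kappa>: "0 < \<kappa>" using k \<alpha> by (simp add: \<kappa>_def)
    have C13: "4 \<le> C1" "0 \<le> C3" by (simp_all add: C1_def C3_def)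
    then have C0: "0 < C" by (simp add: C_def)
    show ?case
    proof (rule exI[of _ C], rule conjI, rule C0, rule exI[of _ "shadow_design k \<kappa>"], intro allI impI, goal_cases)
      case (1 n lb chi G \<Omega> us \<tau> \<epsilon>chi)
      then have n: "1 \<le> n" and kl: "k_local n k lb" and str: "interaction_strength n k lb \<le> \<alpha>"
        and chi: "chi_expansion n (generator n k lb) chi" and gks: "gks_expansion n (generator n k lb) (hcoeff lb) G"
        and \<tau>: "0 < \<tau>" and \<epsilon>chi: "0 < \<epsilon>chi" and \<Omega>: "\<Omega> \<subseteq> index_pairs0 n k"
        "\<forall>u\<in>index_pairs0 n k. cmod (chi u) > \<tau> \<longrightarrow> u \<in> \<Omega>" "\<tau> + ext_sum n k \<Omega> * ext_residual n chi \<Omega> \<le> \<epsilon>chi"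
        and us: "distinct us" "set us = \<Omega>"
        by blast+
      let ?D = "ext_sum n k \<Omega>"
      have D: "0 < ?D" using ext_sum_ge_1[of n k \<Omega>] by linarith
      have fin: "finite (usupp u)" and card: "card (usupp u) \<le> k" if "u \<in> set us" for u
        using index_pairs0_usupp[of u n k] \<Omega>(1) us(2) that by auto
      have I: "(Id_str, Id_str) \<notin> set us" using \<Omega>(1) us(2) by (auto simp: index_pairs0_def)
      note acc = postprocess_accurate[OF kl chi gks \<tau> \<Omega> us]
      show ?case
      proof (intro conjI allI impI, goal_cases)
        case (1 Lh)
        obtain X Gh hh where res: "result (postprocess k us Lh) = (X, Gh, hh)" and X: "X = result (recursive_inversion k us Lh)"
          and Gh: "\<And>P Q. P \<noteq> Id_str \<Longrightarrow> Q \<noteq> Id_str \<Longrightarrow> Gh (P, Q) = X (P, Q)"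
          and hh: "\<And>P. hh P = \<i> / 2 * (X (P, Id_str) - X (Id_str, P))"
          using result_postprocess[OF us(1) fin card I, of Lh] by blast
        have "X u = 0" if "u \<notin> \<Omega>" for u
          using result_recursive_inversion(1)[OF us(1) fin card X] that us(2) by blast
        then show ?case unfolding res prod.case using Gh hh by blast
      next
        case (2 Lh)
        then show ?case using Ck(2)[OF us(1), of Lh] fin card us(2) by auto
      next
        case (3 \<epsilon>L Lh)
        have "0 \<le> \<epsilon>chi + ?D * \<epsilon>L" using \<epsilon>chi D 3(1) by simp
        then have "\<epsilon>chi + ?D * \<epsilon>L \<le> 2 * (\<epsilon>chi + ?D * \<epsilon>L)" by (simp only: mult_2 le_add_same_cancel1)
        then show ?case by (rule entrywise_accurate_mono[OF acc[OF 3]])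
      next
        case (4 \<epsilon>L \<delta>)
        then have \<epsilon>L: "0 < \<epsilon>L" "\<epsilon>L \<le> \<epsilon>chi / ?D" and \<delta>: "0 < \<delta>" "\<delta> < 1" by blast+
        define g where "g = shadow_design k \<kappa> \<epsilon>L (card \<Omega>) \<delta>"
        define T where "T = 1 / (4 * \<alpha> * real k)"
        have T: "T = 1 / (4 * \<kappa>)" by (simp add: T_def \<kappa>_def mult_ac)
        have dg: "degr g = fit_degree \<kappa> \<epsilon>L" "1 \<le> degr g" "degr g < cells g" "1 \<le> per_cell g" "1 \<le> batches g"
          "num_times g = Suc (degr g)"
          by (simp_all add: g_def shadow_design_def fit_degree_def num_times_def)
        have D\<epsilon>: "\<epsilon>chi + ?D * \<epsilon>L \<le> 2 * \<epsilon>chi" using \<epsilon>L(2) D by (simp add: field_simps)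
        have deg: "real (degr g) \<le> C * logp (1 / \<epsilon>L)"
        proof -
          have "real (degr g) \<le> C1 * logp (1 / \<epsilon>L)" unfolding dg(1) C1_def by (rule fit_degree_le[OF \<kappa> \<epsilon>L(1)])
          also have "\<dots> \<le> C * logp (1 / \<epsilon>L)"
            by (rule mult_right_mono) (use C13 logp_ge_1[of "1 / \<epsilon>L"] in \<open>simp_all add: C_def\<close>)
          finally show ?thesis .
        qed
        have times: "real (num_times g) \<le> C * real (degr g) * logp (real (degr g))"
        proof -
          have "real (num_times g) \<le> 2 * real (degr g) * 1" using dg(2,6) by simp
          also have "\<dots> \<le> C * real (degr g) * logp (real (degr g))"
            by (intro mult_mono mult_right_mono logp_ge_1) (use C13 in \<open>simp_all add: C_def\<close>)
          finally show ?thesis .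
        qed
        have prob: "1 - \<delta> \<le> measure_pmf.prob (shadow_data n (generator n k lb) T g)
             {d. entrywise_accurate n k chi G (hcoeff lb) (result (postprocess k us (ptm_estimate T g d))) (2 * \<epsilon>chi)}"
        proof (rule order_trans[OF shadow_design_success[OF kl n k \<alpha> str \<kappa>_def T \<Omega>(1) \<epsilon>L(1) \<delta> g_def]])
          show "measure_pmf.prob (shadow_data n (generator n k lb) T g)
            {d. \<forall>u\<in>\<Omega>. \<forall>A\<in>pstrs (usupp u). \<forall>B\<in>pstrs (usupp u).
              cmod (ptm_estimate T g d A B - ptm n (generator n k lb) A B) \<le> \<epsilon>L} \<le>
            measure_pmf.prob (shadow_data n (generator n k lb) T g)
             {d. entrywise_accurate n k chi G (hcoeff lb) (result (postprocess k us (ptm_estimate T g d))) (2 * \<epsilon>chi)}"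
          proof (rule measure_pmf.finite_measure_mono, rule subsetI, rule CollectI)
            fix d assume "d \<in> {d. \<forall>u\<in>\<Omega>. \<forall>A\<in>pstrs (usupp u). \<forall>B\<in>pstrs (usupp u).
              cmod (ptm_estimate T g d A B - ptm n (generator n k lb) A B) \<le> \<epsilon>L}"
            then show "entrywise_accurate n k chi G (hcoeff lb) (result (postprocess k us (ptm_estimate T g d))) (2 * \<epsilon>chi)"
              unfolding mem_Collect_eq by (rule entrywise_accurate_mono[OF acc[OF less_imp_le[OF \<epsilon>L(1)]] D\<epsilon>])
          qed simp
        qed
        have samples: "real (num_samples g) \<le> C * (?D\<^sup>2 / \<epsilon>chi\<^sup>2 * logp (real (card \<Omega>) / \<delta>)) *
                (logp (?D / \<epsilon>chi) * logp (real (card \<Omega>))) ^ 8" if e: "\<epsilon>L = \<epsilon>chi / ?D"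
        proof -
          have l: "1 \<le> logp x" for x by (rule logp_ge_1)
          then have l0: "0 \<le> logp x" for x using order_trans[OF zero_le_one] by blast
          have "real (num_samples g) \<le> C3 * (1 / \<epsilon>L\<^sup>2 * logp (real (card \<Omega>) / \<delta>)) * logp (1 / \<epsilon>L) ^ 8"
            unfolding g_def C3_def by (rule num_samples_le[OF \<kappa> \<epsilon>L(1) \<delta> C1_def])
          also have "\<dots> = C3 * (?D\<^sup>2 / \<epsilon>chi\<^sup>2 * logp (real (card \<Omega>) / \<delta>)) * (logp (?D / \<epsilon>chi) * 1) ^ 8"
            by (simp add: e power_divide)
          also have "\<dots> \<le> C * (?D\<^sup>2 / \<epsilon>chi\<^sup>2 * logp (real (card \<Omega>) / \<delta>)) *
                (logp (?D / \<epsilon>chi) * logp (real (card \<Omega>))) ^ 8"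
            by (intro mult_mono mult_right_mono power_mono mult_left_mono l mult_nonneg_nonneg l0 zero_le_power)
               (use C13 C0 in \<open>simp_all add: C_def l0\<close>)
          finally show ?thesis .
        qed
        show ?case
          unfolding Let_def g_def[symmetric] T_def[symmetric]
          by (intro conjI impI dg(2-5) deg times prob samples)
      qed
    qed
  qed
qed
end
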